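(* Let $L>0$, $t_{\max}>0$, and let $D_o,D_i,D_e,a_o,a_i,a_e,b_o,b_e,b_f$ be positive constants and $v_o,v_i,v_e$ real constants. Let $r\in L^1_{\rm loc}([0,\infty))$ be the kernel described in the context, and for ${\bf T}=(T_o,T_i,T_e)$ write $(r\star T_e)(z,t)=\int_0^t r(t-\tau)T_e(z,\tau)\,d\tau$. Let $$V=\{(\phi_o,\phi_i,\phi_e)\in H^1(0,L)^3:\ \phi_o(L)=0,\ \phi_i(0)=0,\ \phi_i(L)=\phi_e(L)\},$$ with the norm of $H^1(0,L)^3$, let $H=L^2(0,L)^3$, so that $V\subset H\subset V'$ with dense continuous injections, and let $W(V,V')$ be the space of ${\bf T}\in L^2(0,t_{\max};V)$ with ${\bf T}'\in L^2(0,t_{\max};V')$. For ${\bf T}=(T_o,T_i,T_e)$, $\mathbf\Phi=(\phi_o,\phi_i,\phi_e)\in V$ define $$\mathcal A({\bf T},\mathbf\Phi)=\int_0^L\Big(D_o T_o'\phi_o' - a_ov_oT_o'\phi_o + D_iT_i'\phi_i' + a_iv_iT_i'\phi_i + D_eT_e'\phi_e' - a_ev_eT_e'\phi_e\Big)dz + \mathcal B({\bf T},\mathbf\Phi),$$ where $'$ denotes $\partial/\partial z$ and $$\mathcal B({\bf T},\mathbf\Phi)=b_o\int_0^L(T_o-T_i)(\phi_o-\phi_i)\,dz+b_e\int_0^L(T_i-T_e)(\phi_i-\phi_e)\,dz+b_f\int_0^LT_e\phi_e\,dz,$$ and, for time-dependent ${\bf T}$, $\mathcal C({\bf T},\mathbf\Phi)(t)=-b_f\int_0^L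 (r\star T_e)(z,t)\,\phi_e(z)\,dz$. The duality between $V'$ and $V$ is $\langle{\bf F},\mathbf\Phi\rangle=a_o\langle F_o,\phi_o\rangle+a_i\langle F_i,\phi_i\rangle+a_e\langle F_e,\phi_e\rangle$ for ${\bf F}=(F_o,F_i,F_e)$, $F_o,F_i,F_e\in(H^1(0,L))'$. Then for every ${\bf T}^0\in H$ and every ${\bf F}\in L^2(0,t_{\max};V')$ there exists a unique ${\bf T}\in W(V,V')$ such that ${\bf T}(0)={\bf T}^0$ and for a.e. $t\in(0,t_{\max})$ $$\langle {\bf T}'(t),\mathbf\Phi\rangle+\mathcal A({\bf T}(t),\mathbf\Phi)+\mathcal C({\bf T},\mathbf\Phi)(t)=\langle{\bf F}(t),\mathbf\Phi\rangle\quad\forall\,\mathbf\Phi\in V,$$ where ${\bf T}'$ denotes the time derivative.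
   Context: This is the variational formulation of a model of oil-well heating by hot-water circulation, with $T_o,T_i,T_e$ the temperatures of oil, water in the inner annulus and water in the outer annulus. The kernel $r$ arises as follows: let $k_f,\rho_f,c_f,r_f>0$ and let $P(r,t)$ solve $\frac{\rho_fc_f}{k_f}\partial_tP=\frac1r\partial_r(r\partial_rP)$ for $r>r_f$, $t>0$, with $P(r,0)=0$, $P(\infty,t)=0$, $-2\pi k_f\partial_rP(r_f,t)=1$; set $p(t)=P(r_f,t)/(2\pi k_f)$, whose derivative satisfies $p'\in L^1_{\rm loc}([0,\infty))$. Then $r\in L^1_{\rm loc}([0,\infty))$ is the resolvent kernel of the Volterra kernel $k=b_fp'$, i.e. $r+k\star r=k$, so that the solution of $q+k\star q=f$ is $q=f-r\star f$. It is a standard fact that $W(V,V')\subset C([0,t_{\max}];H)$, so ${\bf T}(0)$ makes sense. *)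

theory Defs
  imports "HOL-Analysis.Analysis"
begin

type_synonym triple = "(real \<Rightarrow> real) \<times> (real \<Rightarrow> real) \<times> (real \<Rightarrow> real)"

definition co :: "triple \<Rightarrow> real \<Rightarrow> real" where "co \<Phi> = fst \<Phi>"
definition ci :: "triple \<Rightarrow> real \<Rightarrow> real" where "ci \<Phi> = fst (snd \<Phi>)"
definition ce :: "triple \<Rightarrow> real \<Rightarrow> real" where "ce \<Phi> = snd (snd \<Phi>)"

definition tadd :: "triple \<Rightarrow> triple \<Rightarrow> triple" where
  "tadd \<Phi> \<Psi> = ((\<lambda>z. co \<Phi> z + co \<Psi> z), (\<lambda>z. ci \<Phi> z + ci \<Psi> z), (\<lambda>z. ce \<Phi> z + ce \<Psi> z))"
definition tscale :: "real \<Rightarrow> triple \<Rightarrow> triple" where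
  "tscale c \<Phi> = ((\<lambda>z. c * co \<Phi> z), (\<lambda>z. c * ci \<Phi> z), (\<lambda>z. c * ce \<Phi> z))"

definition C_inf :: "(real \<Rightarrow> real) \<Rightarrow> bool" where
  "C_inf \<psi> \<longleftrightarrow> (\<forall>n x. ((deriv ^^ n) \<psi>) differentiable (at x))"

definition test_fun :: "real \<Rightarrow> real \<Rightarrow> (real \<Rightarrow> real) \<Rightarrow> bool" where
  "test_fun a b \<psi> \<longleftrightarrow> C_inf \<psi> \<and>
     (\<exists>c d. a < c \<and> c \<le> d \<and> d < b \<and> (\<forall>x. x \<notin> {c..d} \<longrightarrow> \<psi> x = 0))"

definition L2_on :: "real \<Rightarrow> real \<Rightarrow> (real \<Rightarrow> real) \<Rightarrow> bool" where
  "L2_on a b u \<longleftrightarrow> set_borel_measurable lebesgue {a<..<b} u \<and>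
     set_integrable lebesgue {a<..<b} (\<lambda>x. (u x)^2)"

definition weak_deriv :: "real \<Rightarrow> real \<Rightarrow> (real \<Rightarrow> real) \<Rightarrow> (real \<Rightarrow> real) \<Rightarrow> bool" where
  "weak_deriv a b u g \<longleftrightarrow> (\<forall>\<psi>. test_fun a b \<psi> \<longrightarrow>
     (LINT x:{a<..<b}|lebesgue. u x * deriv \<psi> x) = - (LINT x:{a<..<b}|lebesgue. g x * \<psi> x))"

text \<open>H^1(0,L), represented by the continuous representative on [0,L]\<close>
definition H1 :: "real \<Rightarrow> (real \<Rightarrow> real) \<Rightarrow> bool" where
  "H1 L u \<longleftrightarrow> continuous_on {0..L} u \<and> L2_on 0 L u \<and> (\<exists>g. L2_on 0 L g \<and> weak_deriv 0 L u g)"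

text \<open>the (a.e. unique) weak space derivative\<close>
definition dz :: "real \<Rightarrow> (real \<Rightarrow> real) \<Rightarrow> real \<Rightarrow> real" where
  "dz L u = (SOME g. L2_on 0 L g \<and> weak_deriv 0 L u g)"

definition H1_norm :: "real \<Rightarrow> (real \<Rightarrow> real) \<Rightarrow> real" where
  "H1_norm L u = sqrt ((LINT x:{0<..<L}|lebesgue. (u x)^2) + (LINT x:{0<..<L}|lebesgue. (dz L u x)^2))"

definition inV :: "real \<Rightarrow> triple \<Rightarrow> bool" where
  "inV L \<Phi> \<longleftrightarrow> H1 L (co \<Phi>) \<and> H1 L (ci \<Phi>) \<and> H1 L (ce \<Phi>) \<and>
     co \<Phi> L = 0 \<and> ci \<Phi> 0 = 0 \<and> ci \<Phi> L = ce \<Phi> L"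

definition V_norm :: "real \<Rightarrow> triple \<Rightarrow> real" where
  "V_norm L \<Phi> = sqrt ((H1_norm L (co \<Phi>))^2 + (H1_norm L (ci \<Phi>))^2 + (H1_norm L (ce \<Phi>))^2)"

definition inH :: "real \<Rightarrow> triple \<Rightarrow> bool" where
  "inH L \<Phi> \<longleftrightarrow> L2_on 0 L (co \<Phi>) \<and> L2_on 0 L (ci \<Phi>) \<and> L2_on 0 L (ce \<Phi>)"

definition H_dist :: "real \<Rightarrow> triple \<Rightarrow> triple \<Rightarrow> real" where
  "H_dist L U W = sqrt ((LINT z:{0<..<L}|lebesgue. (co U z - co W z)^2)
      + (LINT z:{0<..<L}|lebesgue. (ci U z - ci W z)^2)
      + (LINT z:{0<..<L}|lebesgue. (ce U z - ce W z)^2))"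

text \<open>inner product of H compatible with the weighted duality pairing
  (the pairing of V' with V restricted to H is this weighted L^2 product)\<close>
definition H_inner :: "real \<Rightarrow> real \<Rightarrow> real \<Rightarrow> real \<Rightarrow> triple \<Rightarrow> triple \<Rightarrow> real" where
  "H_inner L ao ai ae U \<Phi> = ao * (LINT z:{0<..<L}|lebesgue. co U z * co \<Phi> z)
      + ai * (LINT z:{0<..<L}|lebesgue. ci U z * ci \<Phi> z)
      + ae * (LINT z:{0<..<L}|lebesgue. ce U z * ce \<Phi> z)"

definition ae_eq_H :: "real \<Rightarrow> triple \<Rightarrow> triple \<Rightarrow> bool" where
  "ae_eq_H L U W \<longleftrightarrow> (AE z in lebesgue. z \<in> {0<..<L} \<longrightarrow>
      co U z = co W z \<and> ci U z = ci W z \<and> ce U z = ce W z)"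

text \<open>V': bounded linear functionals on V; f \<Phi> is the duality pairing <f,\<Phi>>\<close>
definition in_Vdual :: "real \<Rightarrow> (triple \<Rightarrow> real) \<Rightarrow> bool" where
  "in_Vdual L f \<longleftrightarrow>
     (\<forall>\<Phi> \<Psi> c. inV L \<Phi> \<and> inV L \<Psi> \<longrightarrow> f (tadd \<Phi> (tscale c \<Psi>)) = f \<Phi> + c * f \<Psi>) \<and>
     (\<exists>M. \<forall>\<Phi>. inV L \<Phi> \<longrightarrow> \<bar>f \<Phi>\<bar> \<le> M * V_norm L \<Phi>)"

definition Vdual_norm :: "real \<Rightarrow> (triple \<Rightarrow> real) \<Rightarrow> real" where
  "Vdual_norm L f = Sup {\<bar>f \<Phi>\<bar> | \<Phi>. inV L \<Phi> \<and> V_norm L \<Phi> \<le> 1}"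

text \<open>L^2(0,tmax;V)  (weak measurability suffices by Pettis, V separable)\<close>
definition L2_V :: "real \<Rightarrow> real \<Rightarrow> (real \<Rightarrow> triple) \<Rightarrow> bool" where
  "L2_V L tmax T \<longleftrightarrow>
     (AE t in lebesgue. t \<in> {0<..<tmax} \<longrightarrow> inV L (T t)) \<and>
     (\<forall>f. in_Vdual L f \<longrightarrow> set_borel_measurable lebesgue {0<..<tmax} (\<lambda>t. f (T t))) \<and>
     set_integrable lebesgue {0<..<tmax} (\<lambda>t. (V_norm L (T t))^2)"

definition L2_Vdual :: "real \<Rightarrow> real \<Rightarrow> (real \<Rightarrow> triple \<Rightarrow> real) \<Rightarrow> bool" where
  "L2_Vdual L tmax F \<longleftrightarrow>
     (AE t in lebesgue. t \<in> {0<..<tmax} \<longrightarrow> in_Vdual L (F t)) \<and>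
     (\<forall>\<Phi>. inV L \<Phi> \<longrightarrow> set_borel_measurable lebesgue {0<..<tmax} (\<lambda>t. F t \<Phi>)) \<and>
     set_borel_measurable lebesgue {0<..<tmax} (\<lambda>t. Vdual_norm L (F t)) \<and>
     set_integrable lebesgue {0<..<tmax} (\<lambda>t. (Vdual_norm L (F t))^2)"

text \<open>G is the (V'-valued, distributional) time derivative of T, using V \<subseteq> H \<subseteq> V'\<close>
definition time_deriv :: "real \<Rightarrow> real \<Rightarrow> real \<Rightarrow> real \<Rightarrow> real \<Rightarrow> (real \<Rightarrow> triple)
    \<Rightarrow> (real \<Rightarrow> triple \<Rightarrow> real) \<Rightarrow> bool" where
  "time_deriv L ao ai ae tmax T G \<longleftrightarrow> (\<forall>\<Phi> \<psi>. inV L \<Phi> \<and> test_fun 0 tmax \<psi> \<longrightarrow>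
     (LINT t:{0<..<tmax}|lebesgue. H_inner L ao ai ae (T t) \<Phi> * deriv \<psi> t)
       = - (LINT t:{0<..<tmax}|lebesgue. G t \<Phi> * \<psi> t))"

definition in_W :: "real \<Rightarrow> real \<Rightarrow> real \<Rightarrow> real \<Rightarrow> real \<Rightarrow> (real \<Rightarrow> triple) \<Rightarrow> bool" where
  "in_W L ao ai ae tmax T \<longleftrightarrow> L2_V L tmax T \<and>
     (\<exists>G. L2_Vdual L tmax G \<and> time_deriv L ao ai ae tmax T G)"

definition H_cont :: "real \<Rightarrow> real \<Rightarrow> (real \<Rightarrow> triple) \<Rightarrow> bool" where
  "H_cont L tmax T \<longleftrightarrow> (\<forall>t\<in>{0..tmax}. inH L (T t)) \<and>
     (\<forall>t\<in>{0..tmax}. ((\<lambda>s. H_dist L (T s) (T t)) \<longlongrightarrow> 0) (at t within {0..tmax}))"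

definition B_form :: "real \<Rightarrow> real \<Rightarrow> real \<Rightarrow> real \<Rightarrow> triple \<Rightarrow> triple \<Rightarrow> real" where
  "B_form L bo be bf T \<Phi> =
     bo * (LINT z:{0<..<L}|lebesgue. (co T z - ci T z) * (co \<Phi> z - ci \<Phi> z))
   + be * (LINT z:{0<..<L}|lebesgue. (ci T z - ce T z) * (ci \<Phi> z - ce \<Phi> z))
   + bf * (LINT z:{0<..<L}|lebesgue. ce T z * ce \<Phi> z)"

definition A_form :: "real \<Rightarrow> real \<Rightarrow> real \<Rightarrow> real \<Rightarrow> real \<Rightarrow> real \<Rightarrow> real \<Rightarrow> real \<Rightarrow> real \<Rightarrow> real
    \<Rightarrow> real \<Rightarrow> real \<Rightarrow> real \<Rightarrow> triple \<Rightarrow> triple \<Rightarrow> real" where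
  "A_form L Do Di De ao ai ae vo vi ve bo be bf T \<Phi> =
     (LINT z:{0<..<L}|lebesgue.
         Do * dz L (co T) z * dz L (co \<Phi>) z - ao * vo * dz L (co T) z * co \<Phi> z
       + Di * dz L (ci T) z * dz L (ci \<Phi>) z + ai * vi * dz L (ci T) z * ci \<Phi> z
       + De * dz L (ce T) z * dz L (ce \<Phi>) z - ae * ve * dz L (ce T) z * ce \<Phi> z)
   + B_form L bo be bf T \<Phi>"

definition C_form :: "real \<Rightarrow> real \<Rightarrow> (real \<Rightarrow> real) \<Rightarrow> (real \<Rightarrow> triple) \<Rightarrow> triple \<Rightarrow> real \<Rightarrow> real" where
  "C_form L bf r T \<Phi> t = - bf * (LINT z:{0<..<L}|lebesgue.
      (LINT \<tau>:{0<..<t}|lebesgue. r (t - \<tau>) * ce (T \<tau>) z) * ce \<Phi> z)"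

definition is_solution :: "real \<Rightarrow> real \<Rightarrow> real \<Rightarrow> real \<Rightarrow> real \<Rightarrow> real \<Rightarrow> real \<Rightarrow> real \<Rightarrow> real
    \<Rightarrow> real \<Rightarrow> real \<Rightarrow> real \<Rightarrow> real \<Rightarrow> real \<Rightarrow> (real \<Rightarrow> real) \<Rightarrow> triple
    \<Rightarrow> (real \<Rightarrow> triple \<Rightarrow> real) \<Rightarrow> (real \<Rightarrow> triple) \<Rightarrow> bool" where
  "is_solution L tmax Do Di De ao ai ae vo vi ve bo be bf r T0 F T \<longleftrightarrow>
     H_cont L tmax T \<and> in_W L ao ai ae tmax T \<and> ae_eq_H L (T 0) T0 \<and>
     (\<exists>G. L2_Vdual L tmax G \<and> time_deriv L ao ai ae tmax T G \<and>
        (AE t in lebesgue. t \<in> {0<..<tmax} \<longrightarrow>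
           (\<forall>\<Phi>. inV L \<Phi> \<longrightarrow>
              G t \<Phi> + A_form L Do Di De ao ai ae vo vi ve bo be bf (T t) \<Phi>
                + C_form L bf r T \<Phi> t = F t \<Phi>)))"

text \<open>r is the resolvent kernel of k = bf p', p(t) = P(rf,t)/(2 pi kf), P the heat-flux solution\<close>
definition heat_resolvent_kernel :: "real \<Rightarrow> real \<Rightarrow> real \<Rightarrow> real \<Rightarrow> real \<Rightarrow> (real \<Rightarrow> real) \<Rightarrow> bool" where
  "heat_resolvent_kernel kf rhof cf rf bf r \<longleftrightarrow>
    (\<exists>(P :: real \<Rightarrow> real \<Rightarrow> real) (Pr :: real \<Rightarrow> real \<Rightarrow> real)
        (Pt :: real \<Rightarrow> real \<Rightarrow> real) (dp :: real \<Rightarrow> real).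
      continuous_on ({rf..} \<times> {0..}) (\<lambda>(x, s). P x s) \<and>
      (\<forall>x t. x > rf \<and> t > 0 \<longrightarrow>
         ((\<lambda>y. P y t) has_real_derivative Pr x t) (at x) \<and>
         (\<lambda>y. y * Pr y t) differentiable (at x) \<and>
         ((\<lambda>s. P x s) has_real_derivative Pt x t) (at t) \<and>
         rhof * cf / kf * Pt x t = (1 / x) * deriv (\<lambda>y. y * Pr y t) x) \<and>
      (\<forall>x\<ge>rf. P x 0 = 0) \<and>
      (\<forall>t>0. ((\<lambda>x. P x t) \<longlongrightarrow> 0) at_top) \<and>
      (\<forall>t>0. ((\<lambda>x. P x t) has_real_derivative Pr rf t) (at rf within {rf..}) \<and>
              - 2 * pi * kf * Pr rf t = 1) \<and>
      (\<forall>t>0. ((\<lambda>s. P rf s / (2 * pi * kf)) has_real_derivative dp t) (at t)) \<and>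
      (\<forall>c\<ge>0. set_integrable lebesgue {0..c} dp) \<and>
      (\<forall>c\<ge>0. set_integrable lebesgue {0..c} r) \<and>
      (AE t in lebesgue. t \<ge> 0 \<longrightarrow>
         r t + (LINT s:{0..t}|lebesgue. bf * dp (t - s) * r s) = bf * dp t))"

end

theory Submission
  imports Defs
begin

text \<open>
The space \<open>V\<close> has an explicit orthogonal basis \<open>eb k\<close>: cosines for the oil component and shifted
sine/cosine pairs for the coupled water components. It is orthonormal for the weighted product of
\<open>H\<close> and diagonalises \<open>a(U, W) = \<Sum> a\<^sub>j \<integral> U\<^sub>j' W\<^sub>j'\<close> with eigenvalues \<open>lam k\<close>, so that membership in
\<open>H\<close>, \<open>V\<close> and \<open>V'\<close> becomes weighted square summability of coefficients \<open>c\<^sub>k\<close>. Fix \<open>\<mu>\<close> larger than every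
\<open>D\<^sub>j / a\<^sub>j\<close> and write the equation as \<open>c\<^sub>k' + \<mu> lam\<^sub>k c\<^sub>k = f\<^sub>k + (\<mu> a - A + S (r \<star> \<cdot>))\<^sub>k\<close>. With
\<open>m\<^sub>k = \<mu> lam\<^sub>k + \<gamma>\<close> and \<open>x\<^sub>k = sqrt m\<^sub>k exp (- \<gamma> t) c\<^sub>k\<close>, Duhamel's formula turns it into
\<open>x = p + K \<star> (Q x + B (r' \<star> x))\<close>, where \<open>K\<^sub>k s = m\<^sub>k exp (- m\<^sub>k s)\<close> has integral 1 and \<open>r'\<close> is the damped
memory kernel. As \<open>0 < min (D\<^sub>j / a\<^sub>j)\<close>, the norm of \<open>Q\<close> tends to a number below 1 and that of \<open>B\<close> to 0 as \<open>\<gamma>\<close>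
grows, so Young's inequality makes the right-hand side a contraction of \<open>L\<^sup>2\<close> with values in square-summable
sequences. Pointwise Duhamel bounds of \<open>c\<^sub>k\<close> give continuity in \<open>H\<close>.
\<close>

section \<open>Square-integrable functions and orthonormal bases\<close>

text \<open>The ratios \<open>Di / ai\<close> and \<open>De / ae\<close> may differ although the two
  water components are tied at \<open>L\<close>, so no explicit eigenbasis of the full form is at
  hand. The comparison form \<open>a\<close> has one, at a price: \<mu> a - A is of the same order
  as \<open>a\<close>, and no weight \<gamma> makes it small. What saves the contraction is that
  each \<mu> - D_j / a_j lies between 0 and \<mu> - dmin, so relative to \<mu> a the leading part
  has norm at most (\<mu> - dmin) / \<mu> < 1; only convection, exchange and memory are left to
  \<gamma>. The factor m_k enters as a square root on either side, which leaves a kernel of unit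
  mass, so that inverting the diagonal part costs nothing. The memory kernel is merely integrable,
  hence the estimates in mean square over time. These say nothing about single times, which is why a
  continuous version of every mode is rebuilt at the end. The definitions use Lebesgue measure and
  functions instead of classes, while convolutions are taken of Borel functions: Borel versions are
  substituted, and equality almost everywhere is tracked throughout.\<close>

lemma geometric_increments_converge:
  fixes a :: "nat \<Rightarrow> 'b::banach"
  assumes d: "\<And>n. norm (a (Suc n) - a n) \<le> B * q ^ n" and q: "0 \<le> q" "q < 1"
  shows "convergent a" and "norm (lim a - a n) \<le> B * q ^ n / (1 - q)"
proof -
  have B: "0 \<le> B" using order_trans[OF norm_ge_zero d[of 0]] by simp
  have sg: "summable (\<lambda>n. B * q ^ n)" using q by (intro summable_mult summable_geometric) auto
  have su: "summable (\<lambda>j. a (Suc j) - a j)"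
    by (rule summable_comparison_test[OF _ sg]) (use d in auto)
  have tel: "(\<Sum>j<k. a (Suc (j + n)) - a (j + n)) = a (k + n) - a n" for k n
    by (induction k) auto
  from su obtain s where "(\<lambda>j. a (Suc j) - a j) sums s" by (auto simp: summable_def)
  then have "(\<lambda>k. a k - a 0) \<longlonglongrightarrow> s" using tel[of 0] by (simp add: sums_def)
  then have lim: "a \<longlonglongrightarrow> s + a 0"
    using tendsto_add[of "\<lambda>k. a k - a 0" s sequentially "\<lambda>_. a 0" "a 0"] by simp
  then show c: "convergent a" by (auto simp: convergent_def)
  have "norm (a (k + n) - a n) \<le> B * q ^ n / (1 - q)" for k
  proof -
    have "norm (a (k + n) - a n) \<le> (\<Sum>j<k. norm (a (Suc (j + n)) - a (j + n)))"
      unfolding tel[symmetric] by (rule norm_sum)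
    also have "\<dots> \<le> (\<Sum>j<k. B * q ^ (j + n))" using d by (intro sum_mono) auto
    also have "\<dots> = B * q ^ n * (\<Sum>j<k. q ^ j)" by (simp add: power_add sum_distrib_left algebra_simps)
    also have "\<dots> \<le> B * q ^ n * (1 / (1 - q))"
      using q B sum_le_suminf[OF summable_geometric, of q "{..<k}"] suminf_geometric[of q]
      by (intro mult_left_mono) auto
    finally show ?thesis by simp
  qed
  moreover have "(\<lambda>k. norm (a (k + n) - a n)) \<longlonglongrightarrow> norm (lim a - a n)"
    using c by (intro tendsto_norm tendsto_diff tendsto_const LIMSEQ_ignore_initial_segment)
      (simp add: convergent_LIMSEQ_iff)
  ultimately show "norm (lim a - a n) \<le> B * q ^ n / (1 - q)"
    by (intro LIMSEQ_le_const2[where X="\<lambda>k. norm (a (k + n) - a n)"]) auto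
qed

lemma L2_geometric_limit:
  fixes f :: "nat \<Rightarrow> 'a \<Rightarrow> 'b::euclidean_space"
  assumes f[measurable]: "\<And>n. f n \<in> borel_measurable M"
    and d: "\<And>n. (\<integral>\<^sup>+x. ennreal ((norm (f (Suc n) x - f n x))\<^sup>2) \<partial>M) \<le> ennreal (C * \<rho> ^ n)"
    and \<rho>: "0 \<le> \<rho>" "\<rho> < 1" and C: "0 \<le> C"
  shows "\<exists>g\<in>borel_measurable M. (AE x in M. (\<lambda>n. f n x) \<longlonglongrightarrow> g x) \<and>
     ((\<lambda>n. \<integral>\<^sup>+x. ennreal ((norm (f n x - g x))\<^sup>2) \<partial>M) \<longlonglongrightarrow> 0)"
proof -
  \<comment> \<open>Any number strictly between \<rho> and 1 would do: \<rho> / s < 1 makes the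
    weighted sum converge, and sqrt s < 1 the pointwise tails.\<close>
  define s where "s = (1 + \<rho>) / 2"
  have s: "\<rho> < s" "s < 1" "0 < s" using \<rho> by (auto simp: s_def)
  define q where "q = sqrt s"
  have q: "0 < q" "q < 1" "q\<^sup>2 = s" using s by (auto simp: q_def)
  define S where "S x = (\<Sum>n. ennreal ((norm (f (Suc n) x - f n x))\<^sup>2 / s ^ n))" for x
  have S[measurable]: "S \<in> borel_measurable M" unfolding S_def by measurable
  have "(\<integral>\<^sup>+x. S x \<partial>M) = (\<Sum>n. \<integral>\<^sup>+x. ennreal ((norm (f (Suc n) x - f n x))\<^sup>2 / s ^ n) \<partial>M)"
    unfolding S_def by (rule nn_integral_suminf) measurable
  also have "\<dots> = (\<Sum>n. ennreal (1 / s ^ n) * (\<integral>\<^sup>+x. ennreal ((norm (f (Suc n) x - f n x))\<^sup>2) \<partial>M))"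
  proof (intro suminf_cong)
    fix n
    have "(\<integral>\<^sup>+x. ennreal ((norm (f (Suc n) x - f n x))\<^sup>2 / s ^ n) \<partial>M)
       = (\<integral>\<^sup>+x. ennreal (1 / s ^ n) * ennreal ((norm (f (Suc n) x - f n x))\<^sup>2) \<partial>M)"
      using s by (intro nn_integral_cong) (simp add: ennreal_mult[symmetric])
    then show "(\<integral>\<^sup>+x. ennreal ((norm (f (Suc n) x - f n x))\<^sup>2 / s ^ n) \<partial>M)
       = ennreal (1 / s ^ n) * (\<integral>\<^sup>+x. ennreal ((norm (f (Suc n) x - f n x))\<^sup>2) \<partial>M)"
      by (simp add: nn_integral_cmult)
  qed
  also have "\<dots> \<le> (\<Sum>n. ennreal (C * (\<rho> / s) ^ n))"
  proof (intro suminf_le)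
    fix n
    have "ennreal (1 / s ^ n) * (\<integral>\<^sup>+x. ennreal ((norm (f (Suc n) x - f n x))\<^sup>2) \<partial>M)
      \<le> ennreal (1 / s ^ n) * ennreal (C * \<rho> ^ n)" using d by (intro mult_left_mono) auto
    also have "\<dots> = ennreal (C * (\<rho> / s) ^ n)" using s by (simp add: ennreal_mult'[symmetric] power_divide)
    finally show "ennreal (1 / s ^ n) * (\<integral>\<^sup>+x. ennreal ((norm (f (Suc n) x - f n x))\<^sup>2) \<partial>M)
      \<le> ennreal (C * (\<rho> / s) ^ n)" .
  qed auto
  also have "\<dots> = ennreal (\<Sum>n. C * (\<rho> / s) ^ n)"
    using \<rho> s C by (intro suminf_ennreal2 summable_mult summable_geometric) auto
  finally have Sfin: "(\<integral>\<^sup>+x. S x \<partial>M) < \<infinity>" by (auto simp: less_top intro: le_less_trans)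
  have AES: "AE x in M. S x \<noteq> \<infinity>"
    by (intro nn_integral_PInf_AE) (use Sfin in auto)
  define g where "g x = lim (\<lambda>n. f n x)" for x
  have g[measurable]: "g \<in> borel_measurable M" unfolding g_def by (rule borel_measurable_lim_metric) measurable
  have pt: "norm (f (Suc n) x - f n x) \<le> sqrt (enn2real (S x)) * q ^ n" if "S x \<noteq> \<infinity>" for x n
  proof -
    have "ennreal ((norm (f (Suc n) x - f n x))\<^sup>2 / s ^ n) \<le> S x"
      unfolding S_def using sum_le_suminf[of "\<lambda>n. ennreal ((norm (f (Suc n) x - f n x))\<^sup>2 / s ^ n)" "{n}"] by simp
    then have "(norm (f (Suc n) x - f n x))\<^sup>2 / s ^ n \<le> enn2real (S x)"
      using that s enn2real_mono[of "ennreal ((norm (f (Suc n) x - f n x))\<^sup>2 / s ^ n)" "S x"]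
      by (simp add: top.not_eq_extremum)
    then have "(norm (f (Suc n) x - f n x))\<^sup>2 \<le> enn2real (S x) * s ^ n" using s by (simp add: divide_simps)
    also have "\<dots> = (sqrt (enn2real (S x)) * q ^ n)\<^sup>2"
      using q by (auto simp: power_mult_distrib mult.commute simp flip: q(3) power_mult)
    finally show ?thesis by (rule power2_le_imp_le) (use q in simp)
  qed
  have conv: "AE x in M. (\<lambda>n. f n x) \<longlonglongrightarrow> g x"
    using AES
  proof eventually_elim
    fix x assume "S x \<noteq> \<infinity>"
    from geometric_increments_converge(1)[of "\<lambda>n. f n x", OF pt[OF this]] q
    show "(\<lambda>n. f n x) \<longlonglongrightarrow> g x" by (simp add: g_def convergent_LIMSEQ_iff)
  qed
  have bd: "(\<integral>\<^sup>+x. ennreal ((norm (f n x - g x))\<^sup>2) \<partial>M) \<le> (\<integral>\<^sup>+x. S x \<partial>M) * ennreal (s ^ n / (1 - q)\<^sup>2)" for n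
  proof -
    have "(\<integral>\<^sup>+x. ennreal ((norm (f n x - g x))\<^sup>2) \<partial>M) \<le> (\<integral>\<^sup>+x. S x * ennreal (s ^ n / (1 - q)\<^sup>2) \<partial>M)"
      using AES
    proof (intro nn_integral_mono_AE, eventually_elim)
      fix x assume x: "S x \<noteq> \<infinity>"
      have "norm (g x - f n x) \<le> sqrt (enn2real (S x)) * q ^ n / (1 - q)"
        unfolding g_def using geometric_increments_converge(2)[of "\<lambda>n. f n x", OF pt[OF x]] q by simp
      then have "(norm (f n x - g x))\<^sup>2 \<le> (sqrt (enn2real (S x)) * q ^ n / (1 - q))\<^sup>2"
        by (intro power_mono) (auto simp: norm_minus_commute)
      also have "\<dots> = enn2real (S x) * (s ^ n / (1 - q)\<^sup>2)"
        using q by (auto simp: power_mult_distrib power_divide mult.commute simp flip: q(3) power_mult)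
      finally have "ennreal ((norm (f n x - g x))\<^sup>2) \<le> ennreal (enn2real (S x) * (s ^ n / (1 - q)\<^sup>2))"
        by (rule ennreal_leI)
      also have "\<dots> = S x * ennreal (s ^ n / (1 - q)\<^sup>2)"
      proof -
        have "ennreal (enn2real (S x)) = S x" using x by (simp add: top.not_eq_extremum)
        then show ?thesis using s by (subst ennreal_mult) auto
      qed
      finally show "ennreal ((norm (f n x - g x))\<^sup>2) \<le> S x * ennreal (s ^ n / (1 - q)\<^sup>2)" .
    qed
    also have "\<dots> = (\<integral>\<^sup>+x. S x \<partial>M) * ennreal (s ^ n / (1 - q)\<^sup>2)"
      by (rule nn_integral_multc[OF S])
    finally show ?thesis .
  qed
  have "(\<lambda>n. ennreal (enn2real (\<integral>\<^sup>+x. S x \<partial>M) * (s ^ n / (1 - q)\<^sup>2))) \<longlonglongrightarrow> ennreal (enn2real (\<integral>\<^sup>+x. S x \<partial>M) * (0 / (1 - q)\<^sup>2))"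
    using s q by (intro tendsto_ennrealI tendsto_mult tendsto_divide tendsto_const LIMSEQ_power_zero) auto
  moreover have "ennreal (enn2real (\<integral>\<^sup>+x. S x \<partial>M) * (s ^ n / (1 - q)\<^sup>2)) = (\<integral>\<^sup>+x. S x \<partial>M) * ennreal (s ^ n / (1 - q)\<^sup>2)" for n
    using Sfin s by (subst ennreal_mult) auto
  ultimately have "(\<lambda>n. (\<integral>\<^sup>+x. S x \<partial>M) * ennreal (s ^ n / (1 - q)\<^sup>2)) \<longlonglongrightarrow> 0" by simp
  then have "(\<lambda>n. \<integral>\<^sup>+x. ennreal ((norm (f n x - g x))\<^sup>2) \<partial>M) \<longlonglongrightarrow> 0"
    by (rule tendsto_sandwich[OF _ _ tendsto_const, rotated 2]) (use bd in auto)
  with conv g show ?thesis by blast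
qed

section \<open>Square-integrable functions with values in a Euclidean space\<close>

definition sqint :: "'a measure \<Rightarrow> ('a \<Rightarrow> 'b::euclidean_space) \<Rightarrow> bool" where
  "sqint M f \<longleftrightarrow> f \<in> borel_measurable M \<and> integrable M (\<lambda>x. (norm (f x))\<^sup>2)"

definition ip :: "'a measure \<Rightarrow> ('a \<Rightarrow> 'b::euclidean_space) \<Rightarrow> ('a \<Rightarrow> 'b) \<Rightarrow> real" where
  "ip M f g = (\<integral>x. f x \<bullet> g x \<partial>M)"

lemma sqint_measurable[measurable_dest]: "sqint M f \<Longrightarrow> f \<in> borel_measurable M"
  by (simp add: sqint_def)

lemma sqint_zero[simp]: "sqint M (\<lambda>x. 0)" by (simp add: sqint_def)

lemma sqint_scaleR: "sqint M f \<Longrightarrow> sqint M (\<lambda>x. c *\<^sub>R f x)"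
  by (auto simp: sqint_def power_mult_distrib)

lemma norm_add_square_le: "(norm (x + y))\<^sup>2 \<le> 2 * (norm x)\<^sup>2 + 2 * (norm (y::'a::real_normed_vector))\<^sup>2"
proof -
  have "(norm (x + y))\<^sup>2 \<le> (norm x + norm y)\<^sup>2" by (intro power_mono norm_triangle_ineq) auto
  moreover have "0 \<le> (norm x - norm y)\<^sup>2" by simp
  ultimately show ?thesis by (simp add: power2_eq_square algebra_simps)
qed

lemma sqint_add: assumes "sqint M f" "sqint M g" shows "sqint M (\<lambda>x. f x + g x)"
  unfolding sqint_def
proof (intro conjI)
  note [measurable] = assms[THEN sqint_measurable]
  show "(\<lambda>x. f x + g x) \<in> borel_measurable M" by measurable
  have "integrable M (\<lambda>x. 2 * (norm (f x))\<^sup>2 + 2 * (norm (g x))\<^sup>2)" using assms by (auto simp: sqint_def)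
  then show "integrable M (\<lambda>x. (norm (f x + g x))\<^sup>2)"
    by (rule Bochner_Integration.integrable_bound) (auto simp: norm_add_square_le)
qed

lemma sqint_diff: "sqint M f \<Longrightarrow> sqint M g \<Longrightarrow> sqint M (\<lambda>x. f x - g x)"
  using sqint_add[of M f "\<lambda>x. (-1) *\<^sub>R g x"] sqint_scaleR[of M g "-1"] by simp

lemma sqint_sum: "(\<And>i. i \<in> I \<Longrightarrow> sqint M (f i)) \<Longrightarrow> sqint M (\<lambda>x. \<Sum>i\<in>I. f i x)"
  by (induction I rule: infinite_finite_induct) (auto intro: sqint_add)

lemma sqint_inner_integrable: assumes "sqint M f" "sqint M g" shows "integrable M (\<lambda>x. f x \<bullet> g x)"
proof -
  note [measurable] = assms[THEN sqint_measurable]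
  have int: "integrable M (\<lambda>x. (norm (f x))\<^sup>2 + (norm (g x))\<^sup>2)" using assms by (auto simp: sqint_def)
  have bd: "\<bar>f x \<bullet> g x\<bar> \<le> (norm (f x))\<^sup>2 + (norm (g x))\<^sup>2" for x
  proof -
    have "\<bar>f x \<bullet> g x\<bar> \<le> norm (f x) * norm (g x)" by (rule Cauchy_Schwarz_ineq2)
    moreover have "0 \<le> (norm (f x) - norm (g x))\<^sup>2" by simp
    moreover have "0 \<le> norm (f x) * norm (g x)" by simp
    ultimately show ?thesis unfolding power2_diff by linarith
  qed
  have me: "(\<lambda>x. f x \<bullet> g x) \<in> borel_measurable M" by measurable
  show ?thesis
  proof (rule Bochner_Integration.integrable_bound[OF int me], rule AE_I2)
    fix x
    show "norm (f x \<bullet> g x) \<le> norm ((norm (f x))\<^sup>2 + (norm (g x))\<^sup>2)"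
      unfolding real_norm_def by (rule order_trans[OF bd abs_ge_self])
  qed
qed

lemma sqint_AE_cong: assumes "AE x in M. f x = g x" "sqint M f" "g \<in> borel_measurable M"
  shows "sqint M g"
  unfolding sqint_def
proof
  note [measurable] = assms(3) sqint_measurable[OF assms(2)]
  show "integrable M (\<lambda>x. (norm (g x))\<^sup>2)"
    by (rule integrable_cong_AE_imp[of _ "\<lambda>x. (norm (f x))\<^sup>2"]) (use assms in \<open>auto simp: sqint_def\<close>)
qed fact

lemma ip_AE_cong: assumes "AE x in M. f x = f' x" "AE x in M. g x = g' x"
   and [measurable]: "f \<in> borel_measurable M" "f' \<in> borel_measurable M" "g \<in> borel_measurable M" "g' \<in> borel_measurable M"
  shows "ip M f g = ip M f' g'"
  unfolding ip_def by (intro integral_cong_AE) (use assms in auto)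

lemma ip_commute: "ip M f g = ip M g f" by (simp add: ip_def inner_commute)
lemma ip_nonneg[simp]: "0 \<le> ip M f f" by (simp add: ip_def)
lemma ip_self: "ip M f f = (\<integral>x. (norm (f x))\<^sup>2 \<partial>M)" by (simp add: ip_def power2_norm_eq_inner)
lemma ip_scaleR_left[simp]: "ip M (\<lambda>x. c *\<^sub>R f x) g = c * ip M f g" by (simp add: ip_def)
lemma ip_scaleR_right[simp]: "ip M f (\<lambda>x. c *\<^sub>R g x) = c * ip M f g" by (simp add: ip_def)
lemma ip_zero[simp]: "ip M (\<lambda>x. 0) g = 0" "ip M g (\<lambda>x. 0) = 0" by (simp_all add: ip_def)

lemma ip_add_left: "sqint M f \<Longrightarrow> sqint M g \<Longrightarrow> sqint M h \<Longrightarrow> ip M (\<lambda>x. f x + g x) h = ip M f h + ip M g h"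
  by (simp add: ip_def inner_add_left sqint_inner_integrable)
lemma ip_diff_left: "sqint M f \<Longrightarrow> sqint M g \<Longrightarrow> sqint M h \<Longrightarrow> ip M (\<lambda>x. f x - g x) h = ip M f h - ip M g h"
  by (simp add: ip_def inner_diff_left sqint_inner_integrable)
lemma ip_add_right: "sqint M f \<Longrightarrow> sqint M g \<Longrightarrow> sqint M h \<Longrightarrow> ip M h (\<lambda>x. f x + g x) = ip M h f + ip M h g"
  by (simp add: ip_def inner_add_right sqint_inner_integrable)
lemma ip_diff_right: "sqint M f \<Longrightarrow> sqint M g \<Longrightarrow> sqint M h \<Longrightarrow> ip M h (\<lambda>x. f x - g x) = ip M h f - ip M h g"
  by (simp add: ip_def inner_diff_right sqint_inner_integrable)
lemma ip_sum_left: "(\<And>i. i \<in> I \<Longrightarrow> sqint M (f i)) \<Longrightarrow> sqint M h \<Longrightarrow> ip M (\<lambda>x. \<Sum>i\<in>I. f i x) h = (\<Sum>i\<in>I. ip M (f i) h)"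
  by (induction I rule: infinite_finite_induct) (auto simp: ip_add_left sqint_sum)
lemma ip_sum_right: "(\<And>i. i \<in> I \<Longrightarrow> sqint M (f i)) \<Longrightarrow> sqint M h \<Longrightarrow> ip M h (\<lambda>x. \<Sum>i\<in>I. f i x) = (\<Sum>i\<in>I. ip M h (f i))"
  using ip_sum_left[of I M f h] by (simp add: ip_commute)

lemma nn_norm_sq: assumes "sqint M f" shows "(\<integral>\<^sup>+x. ennreal ((norm (f x))\<^sup>2) \<partial>M) = ennreal (ip M f f)"
  unfolding ip_self by (rule nn_integral_eq_integral) (use assms in \<open>auto simp: sqint_def\<close>)

lemma ip_Cauchy_Schwarz: assumes "sqint M f" "sqint M g" shows "\<bar>ip M f g\<bar> \<le> sqrt (ip M f f) * sqrt (ip M g g)"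
proof -
  have q: "0 \<le> ip M f f + 2 * t * ip M f g + t\<^sup>2 * ip M g g" for t
  proof -
    let ?h = "\<lambda>x. f x + t *\<^sub>R g x"
    have "ip M ?h ?h = ip M f f + 2 * t * ip M f g + t\<^sup>2 * ip M g g"
      using assms by (simp add: ip_add_left ip_add_right sqint_scaleR sqint_add ip_commute[of M g f] power2_eq_square algebra_simps)
    then show ?thesis using ip_nonneg[of M ?h] by simp
  qed
  have "(ip M f g)\<^sup>2 \<le> ip M f f * ip M g g"
  proof (cases "ip M g g = 0")
    case True
    have "ip M f g = 0"
    proof (rule ccontr)
      assume "ip M f g \<noteq> 0"
      \<comment> \<open>When \<open>g\<close> has norm zero the quadratic is affine in t; this t
        gives it the value -1.\<close>
      with q[of "- (ip M f f + 1) / (2 * ip M f g)"] True show False by (simp add: field_simps)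
    qed
    then show ?thesis by simp
  next
    case False
    then have p: "0 < ip M g g" using ip_nonneg[of M g] by (metis order_le_less)
    have "0 \<le> ip M f f - (ip M f g)\<^sup>2 / ip M g g"
      using q[of "- ip M f g / ip M g g"] p by (simp add: field_simps power2_eq_square)
    then show ?thesis using p by (simp add: field_simps)
  qed
  then have "sqrt ((ip M f g)\<^sup>2) \<le> sqrt (ip M f f * ip M g g)" by (rule real_sqrt_le_mono)
  then show ?thesis by (simp add: real_sqrt_mult)
qed

text \<open>Along a subsequence the squared distances are at most (1/2)^k, so the geometric limit
  applies there; the Cauchy property then carries the limit over to the whole sequence.\<close>

theorem Riesz_Fischer:
  fixes f :: "nat \<Rightarrow> 'a \<Rightarrow> 'b::euclidean_space"
  assumes f: "\<And>n. sqint M (f n)"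
    and C: "\<And>e. e > 0 \<Longrightarrow> \<exists>N. \<forall>m\<ge>N. \<forall>n\<ge>N. ip M (\<lambda>x. f m x - f n x) (\<lambda>x. f m x - f n x) < e"
  shows "\<exists>g. sqint M g \<and> (\<lambda>n. ip M (\<lambda>x. f n x - g x) (\<lambda>x. f n x - g x)) \<longlonglongrightarrow> 0"
proof -
  let ?D = "\<lambda>m n. ip M (\<lambda>x. f m x - f n x) (\<lambda>x. f m x - f n x)"
  define N where "N k = (SOME N. \<forall>m\<ge>N. \<forall>n\<ge>N. ?D m n < (1/2) ^ k)" for k
  have "\<forall>m\<ge>N k. \<forall>n\<ge>N k. ?D m n < (1/2) ^ k" for k
    unfolding N_def by (rule someI_ex, rule C) simp
  then have N: "?D m n < (1/2) ^ k" if "m \<ge> N k" "n \<ge> N k" for k m n using that by blast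
  \<comment> \<open>The sum of all earlier thresholds makes \<sigma> monotone and at least
    \<open>N k\<close>; the summand \<open>k\<close> makes it tend to infinity.\<close>
  define \<sigma> where "\<sigma> k = (\<Sum>i\<le>k. N i) + k" for k
  have \<sigma>N: "N k \<le> \<sigma> k" for k unfolding \<sigma>_def by (induction k) auto
  have \<sigma>S: "\<sigma> k \<le> \<sigma> (Suc k)" for k by (simp add: \<sigma>_def)
  have \<sigma>k: "k \<le> \<sigma> k" for k by (simp add: \<sigma>_def)
  have meas[measurable]: "f n \<in> borel_measurable M" for n using f by (rule sqint_measurable)
  have "\<exists>g\<in>borel_measurable M. (AE x in M. (\<lambda>k. f (\<sigma> k) x) \<longlonglongrightarrow> g x) \<and>
     ((\<lambda>n. \<integral>\<^sup>+x. ennreal ((norm (f (\<sigma> n) x - g x))\<^sup>2) \<partial>M) \<longlonglongrightarrow> 0)"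
  proof (rule L2_geometric_limit[where C=1 and \<rho>="1/2"])
    fix k
    have "?D (\<sigma> (Suc k)) (\<sigma> k) \<le> (1/2) ^ k"
      using N[of k "\<sigma> (Suc k)" "\<sigma> k"] \<sigma>N[of k] \<sigma>S[of k] by (simp add: less_imp_le)
    then show "(\<integral>\<^sup>+x. ennreal ((norm (f (\<sigma> (Suc k)) x - f (\<sigma> k) x))\<^sup>2) \<partial>M) \<le> ennreal (1 * (1/2) ^ k)"
      by (subst nn_norm_sq) (auto intro!: sqint_diff f ennreal_leI)
  qed (auto simp: f)
  then obtain g where g[measurable]: "g \<in> borel_measurable M"
    and lim: "(\<lambda>k. \<integral>\<^sup>+x. ennreal ((norm (f (\<sigma> k) x - g x))\<^sup>2) \<partial>M) \<longlonglongrightarrow> 0" by auto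
  have "eventually (\<lambda>k. (\<integral>\<^sup>+x. ennreal ((norm (f (\<sigma> k) x - g x))\<^sup>2) \<partial>M) < 1) sequentially"
    using lim by (rule order_tendstoD) auto
  then obtain k where "(\<integral>\<^sup>+x. ennreal ((norm (f (\<sigma> k) x - g x))\<^sup>2) \<partial>M) < 1" by (auto simp: eventually_sequentially)
  then have "sqint M (\<lambda>x. f (\<sigma> k) x - g x)"
    unfolding sqint_def integrable_iff_bounded by (auto intro: less_trans)
  then have g2: "sqint M g" using sqint_diff[OF f[of "\<sigma> k"], of "\<lambda>x. f (\<sigma> k) x - g x"] by simp
  have lim': "(\<lambda>k. ip M (\<lambda>x. f (\<sigma> k) x - g x) (\<lambda>x. f (\<sigma> k) x - g x)) \<longlonglongrightarrow> 0"
    using lim unfolding nn_norm_sq[OF sqint_diff[OF f g2]] by (simp add: ennreal_0[symmetric] del: ennreal_0)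
  have "(\<lambda>n. ip M (\<lambda>x. f n x - g x) (\<lambda>x. f n x - g x)) \<longlonglongrightarrow> 0"
  proof (rule LIMSEQ_I)
    fix e :: real assume e: "0 < e"
    from C[of "e/4"] e obtain K where K: "\<And>m n. m \<ge> K \<Longrightarrow> n \<ge> K \<Longrightarrow> ?D m n < e / 4" by auto
    from LIMSEQ_D[OF lim', of "e/4"] e obtain K' where
      K': "\<And>k. k \<ge> K' \<Longrightarrow> ip M (\<lambda>x. f (\<sigma> k) x - g x) (\<lambda>x. f (\<sigma> k) x - g x) < e/4" by (force simp: abs_if)
    define k where "k = max K K'"
    have "norm (ip M (\<lambda>x. f n x - g x) (\<lambda>x. f n x - g x) - 0) < e" if "n \<ge> K" for n
    proof -
      have "ip M (\<lambda>x. f n x - g x) (\<lambda>x. f n x - g x) \<le> 2 * ?D n (\<sigma> k) + 2 * ip M (\<lambda>x. f (\<sigma> k) x - g x) (\<lambda>x. f (\<sigma> k) x - g x)"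
      proof -
        have "(\<integral>x. (norm (f n x - g x))\<^sup>2 \<partial>M) \<le> (\<integral>x. 2 * (norm (f n x - f (\<sigma> k) x))\<^sup>2 + 2 * (norm (f (\<sigma> k) x - g x))\<^sup>2 \<partial>M)"
        proof (intro integral_mono)
          fix x show "(norm (f n x - g x))\<^sup>2 \<le> 2 * (norm (f n x - f (\<sigma> k) x))\<^sup>2 + 2 * (norm (f (\<sigma> k) x - g x))\<^sup>2"
            using norm_add_square_le[of "f n x - f (\<sigma> k) x" "f (\<sigma> k) x - g x"] by simp
        qed (use sqint_diff[OF f g2] sqint_diff[OF f f] in \<open>auto simp: sqint_def\<close>)
        also have "\<dots> = 2 * ?D n (\<sigma> k) + 2 * ip M (\<lambda>x. f (\<sigma> k) x - g x) (\<lambda>x. f (\<sigma> k) x - g x)"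
          unfolding ip_self using sqint_diff[OF f g2] sqint_diff[OF f f]
          by (subst Bochner_Integration.integral_add) (auto simp: sqint_def)
        finally show ?thesis by (simp add: ip_self)
      qed
      moreover have "?D n (\<sigma> k) < e/4" using that \<sigma>k[of k] by (intro K) (auto simp: k_def)
      moreover have "ip M (\<lambda>x. f (\<sigma> k) x - g x) (\<lambda>x. f (\<sigma> k) x - g x) < e/4" by (rule K') (simp add: k_def)
      ultimately show ?thesis by simp
    qed
    then show "\<exists>no. \<forall>n\<ge>no. norm (ip M (\<lambda>x. f n x - g x) (\<lambda>x. f n x - g x) - 0) < e" by auto
  qed
  with g2 show ?thesis by blast
qed

lemma ip_tendsto:
  assumes f: "\<And>n. sqint M (f n)" and g: "sqint M g" and h: "sqint M h"
    and lim: "(\<lambda>n. ip M (\<lambda>x. f n x - g x) (\<lambda>x. f n x - g x)) \<longlonglongrightarrow> 0"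
  shows "(\<lambda>n. ip M (f n) h) \<longlonglongrightarrow> ip M g h"
proof -
  have "(\<lambda>n. sqrt (ip M (\<lambda>x. f n x - g x) (\<lambda>x. f n x - g x)) * sqrt (ip M h h)) \<longlonglongrightarrow> sqrt 0 * sqrt (ip M h h)"
    by (intro tendsto_intros lim)
  then have lim': "(\<lambda>n. sqrt (ip M (\<lambda>x. f n x - g x) (\<lambda>x. f n x - g x)) * sqrt (ip M h h)) \<longlonglongrightarrow> 0" by simp
  have "(\<lambda>n. ip M (\<lambda>x. f n x - g x) h) \<longlonglongrightarrow> 0"
  proof (rule Lim_null_comparison[OF _ lim'], unfold real_norm_def)
    show "\<forall>\<^sub>F n in sequentially. \<bar>ip M (\<lambda>x. f n x - g x) h\<bar>
      \<le> sqrt (ip M (\<lambda>x. f n x - g x) (\<lambda>x. f n x - g x)) * sqrt (ip M h h)"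
      by (intro always_eventually allI ip_Cauchy_Schwarz sqint_diff f g h)
  qed
  then show ?thesis using f g h by (simp add: ip_diff_left LIM_zero_iff)
qed

section \<open>Orthonormal systems and bases\<close>

locale orthonormal_family =
  fixes M :: "'a measure" and b :: "nat \<Rightarrow> 'a \<Rightarrow> 'b::euclidean_space"
  assumes sq: "\<And>k. sqint M (b k)" and on: "\<And>j k. ip M (b j) (b k) = (if j = k then 1 else 0)"
begin

definition psum :: "(nat \<Rightarrow> real) \<Rightarrow> nat \<Rightarrow> 'a \<Rightarrow> 'b" where
  "psum c n x = (\<Sum>k<n. c k *\<^sub>R b k x)"

lemma sqint_psum: "sqint M (psum c n)"
  unfolding psum_def by (intro sqint_sum sqint_scaleR sq)

lemma ip_psum: "ip M (psum c n) (b k) = (if k < n then c k else 0)"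
proof -
  have "ip M (psum c n) (b k) = (\<Sum>i<n. ip M (\<lambda>x. c i *\<^sub>R b i x) (b k))"
    unfolding psum_def by (intro ip_sum_left sqint_scaleR sq)
  then show ?thesis by (simp add: on if_distrib cong: if_cong)
qed

lemma ip_psum2: "sqint M f \<Longrightarrow> ip M f (psum c n) = (\<Sum>k<n. c k * ip M f (b k))"
  unfolding psum_def by (subst ip_sum_right) (auto intro: sqint_scaleR sq)

lemma ip_psum_psum: "n \<le> m \<Longrightarrow> ip M (psum c m) (psum d n) = (\<Sum>k<n. c k * d k)"
  by (simp add: ip_psum2[OF sqint_psum] ip_psum mult.commute)

lemma ip_psum_diff: assumes "n \<le> m"
  shows "ip M (\<lambda>x. psum c m x - psum c n x) (\<lambda>x. psum c m x - psum c n x) = (\<Sum>k<m. (c k)\<^sup>2) - (\<Sum>k<n. (c k)\<^sup>2)"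
proof -
  have "ip M (psum c n) (psum c m) = (\<Sum>k<n. (c k)\<^sup>2)"
    using ip_psum_psum[OF assms, of c c] by (simp add: ip_commute power2_eq_square)
  then show ?thesis
    using ip_psum_psum[OF assms, of c c]
    by (simp add: ip_diff_left ip_diff_right sqint_psum sqint_diff ip_psum_psum power2_eq_square)
qed

text \<open>Pythagoras. Nonnegativity of the left side is Bessel's inequality, and its convergence
  to 0 is Parseval's identity.\<close>

lemma remainder: assumes "sqint M f"
  shows "ip M (\<lambda>x. f x - psum (\<lambda>k. ip M f (b k)) n x) (\<lambda>x. f x - psum (\<lambda>k. ip M f (b k)) n x)
    = ip M f f - (\<Sum>k<n. (ip M f (b k))\<^sup>2)"
proof -
  have "ip M f (psum (\<lambda>k. ip M f (b k)) n) = (\<Sum>k<n. (ip M f (b k))\<^sup>2)"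
    using assms by (simp add: ip_psum2 power2_eq_square)
  moreover from this have "ip M (psum (\<lambda>k. ip M f (b k)) n) f = (\<Sum>k<n. (ip M f (b k))\<^sup>2)"
    by (simp add: ip_commute)
  ultimately show ?thesis
    using assms by (simp add: ip_diff_left ip_diff_right sqint_psum sqint_diff ip_psum_psum power2_eq_square)
qed

lemma Bessel: "sqint M f \<Longrightarrow> (\<Sum>k<n. (ip M f (b k))\<^sup>2) \<le> ip M f f"
  using remainder[of f n] ip_nonneg[of M "\<lambda>x. f x - psum (\<lambda>k. ip M f (b k)) n x"] by simp

lemma Bessel_summable: "sqint M f \<Longrightarrow> summable (\<lambda>k. (ip M f (b k))\<^sup>2)"
  by (rule summableI_nonneg_bounded[where x="ip M f f"]) (auto intro: Bessel)

lemma synthesis: assumes "summable (\<lambda>k. (c k)\<^sup>2)"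
  shows "\<exists>f. sqint M f \<and> (\<forall>k. ip M f (b k) = c k) \<and> (\<lambda>n. ip M (\<lambda>x. psum c n x - f x) (\<lambda>x. psum c n x - f x)) \<longlonglongrightarrow> 0"
proof -
  have "\<exists>g. sqint M g \<and> (\<lambda>n. ip M (\<lambda>x. psum c n x - g x) (\<lambda>x. psum c n x - g x)) \<longlonglongrightarrow> 0"
  proof (rule Riesz_Fischer[OF sqint_psum])
    fix e :: real assume "e > 0"
    have "Cauchy (\<lambda>n. \<Sum>k<n. (c k)\<^sup>2)" using assms by (simp add: summable_iff_convergent Cauchy_convergent_iff)
    from CauchyD[OF this \<open>e > 0\<close>] obtain N where
      N: "\<And>m n. m \<ge> N \<Longrightarrow> n \<ge> N \<Longrightarrow> norm ((\<Sum>k<m. (c k)\<^sup>2) - (\<Sum>k<n. (c k)\<^sup>2)) < e" by auto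
    have "ip M (\<lambda>x. psum c m x - psum c n x) (\<lambda>x. psum c m x - psum c n x) < e" if "m \<ge> N" "n \<ge> N" for m n
    proof (cases "n \<le> m")
      case True then show ?thesis using N[OF that] by (simp add: ip_psum_diff)
    next
      case False
      have "ip M (\<lambda>x. psum c m x - psum c n x) (\<lambda>x. psum c m x - psum c n x) = ip M (\<lambda>x. psum c n x - psum c m x) (\<lambda>x. psum c n x - psum c m x)"
        unfolding ip_self by (simp add: norm_minus_commute)
      then show ?thesis using False N[OF that(2,1)] by (simp add: ip_psum_diff)
    qed
    then show "\<exists>N. \<forall>m\<ge>N. \<forall>n\<ge>N. ip M (\<lambda>x. psum c m x - psum c n x) (\<lambda>x. psum c m x - psum c n x) < e" by blast
  qed
  then obtain g where g: "sqint M g" and lim: "(\<lambda>n. ip M (\<lambda>x. psum c n x - g x) (\<lambda>x. psum c n x - g x)) \<longlonglongrightarrow> 0" by auto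
  have "ip M g (b k) = c k" for k
  proof (rule LIMSEQ_unique[OF ip_tendsto[OF sqint_psum g sq lim]])
    have "eventually (\<lambda>n. ip M (psum c n) (b k) = c k) sequentially"
      unfolding eventually_sequentially by (rule exI[of _ "Suc k"]) (auto simp: ip_psum)
    then show "(\<lambda>n. ip M (psum c n) (b k)) \<longlonglongrightarrow> c k" by (rule tendsto_eventually)
  qed
  with g lim show ?thesis by blast
qed

end

text \<open>Completeness is asked for as "orthogonal to everything implies zero", the form in which
  totality of trigonometric systems is obtained; convergence of expansions then follows from
  Riesz-Fischer.\<close>

locale orthonormal_basis = orthonormal_family +
  assumes total: "\<And>f. sqint M f \<Longrightarrow> (\<And>k. ip M f (b k) = 0) \<Longrightarrow> AE x in M. f x = 0"
begin

lemma expansion: assumes f: "sqint M f"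
  shows "(\<lambda>n. ip M (\<lambda>x. psum (\<lambda>k. ip M f (b k)) n x - f x) (\<lambda>x. psum (\<lambda>k. ip M f (b k)) n x - f x)) \<longlonglongrightarrow> 0"
proof -
  let ?c = "\<lambda>k. ip M f (b k)"
  from synthesis[OF Bessel_summable[OF f]] obtain g where g: "sqint M g" "\<And>k. ip M g (b k) = ?c k"
    and lim: "(\<lambda>n. ip M (\<lambda>x. psum ?c n x - g x) (\<lambda>x. psum ?c n x - g x)) \<longlonglongrightarrow> 0" by blast
  have "AE x in M. g x - f x = 0"
    by (rule total) (use g f in \<open>auto simp: sqint_diff ip_diff_left sq\<close>)
  then have "ip M (\<lambda>x. psum ?c n x - g x) (\<lambda>x. psum ?c n x - g x) = ip M (\<lambda>x. psum ?c n x - f x) (\<lambda>x. psum ?c n x - f x)" for n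
    using sqint_measurable[OF sqint_psum] sqint_measurable[OF f] sqint_measurable[OF g(1)]
    by (intro ip_AE_cong borel_measurable_diff) (auto elim: eventually_mono)
  with lim show ?thesis by simp
qed

lemma Parseval: assumes f: "sqint M f" shows "(\<lambda>k. (ip M f (b k))\<^sup>2) sums ip M f f"
proof -
  have "ip M (\<lambda>x. psum (\<lambda>k. ip M f (b k)) n x - f x) (\<lambda>x. psum (\<lambda>k. ip M f (b k)) n x - f x) = ip M f f - (\<Sum>k<n. (ip M f (b k))\<^sup>2)" for n
    using remainder[OF f, of n] unfolding ip_self by (simp add: norm_minus_commute)
  with expansion[OF f] have "(\<lambda>n. ip M f f - (\<Sum>k<n. (ip M f (b k))\<^sup>2)) \<longlonglongrightarrow> 0" by simp
  from tendsto_diff[OF tendsto_const[of "ip M f f"] this] show ?thesis by (simp add: sums_def)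
qed

lemma ae_eqI: assumes "sqint M f" "sqint M g" "\<And>k. ip M f (b k) = ip M g (b k)" shows "AE x in M. f x = g x"
  using total[of "\<lambda>x. f x - g x"] assms by (simp add: sqint_diff ip_diff_left sq)

end

section \<open>Test functions and weak derivatives\<close>

text \<open>Smoothness by coinduction: a class of differentiable functions closed under
  \<open>deriv\<close> contains only smooth ones, so no formula for the n-th derivative is ever
  needed.\<close>

lemma C_inf_coinduct:
  assumes "f \<in> S" and "\<And>g. g \<in> S \<Longrightarrow> (\<forall>x. g differentiable (at x)) \<and> deriv g \<in> S"
  shows "C_inf f"
proof -
  have "(deriv ^^ n) f \<in> S" for n by (induction n) (use assms in auto)
  then show ?thesis using assms(2) by (auto simp: C_inf_def)
qed

lemma C_inf_differentiable: "C_inf f \<Longrightarrow> f differentiable (at x)"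
  unfolding C_inf_def by (drule spec[of _ 0]) simp

lemma C_inf_deriv: "C_inf f \<Longrightarrow> C_inf (deriv f)"
  unfolding C_inf_def
proof (intro allI)
  fix n x assume "\<forall>n x. ((deriv ^^ n) f) differentiable (at x)"
  then have "((deriv ^^ Suc n) f) differentiable (at x)" by blast
  then show "((deriv ^^ n) (deriv f)) differentiable (at x)" by (simp add: funpow_swap1)
qed

lemma C_inf_DERIV: "C_inf f \<Longrightarrow> (f has_real_derivative deriv f x) (at x)"
  using C_inf_differentiable[of f x] DERIV_deriv_iff_real_differentiable by blast

lemma C_inf_continuous: "C_inf f \<Longrightarrow> continuous_on A f"
  by (meson C_inf_DERIV DERIV_isCont continuous_at_imp_continuous_on)

lemma real_differentiableI: "(f has_real_derivative D) (at x) \<Longrightarrow> f differentiable (at x)"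
  by (auto simp: real_differentiable_def)

lemma C_inf_primitive:
  assumes "C_inf f" "\<And>x. (F has_real_derivative f x) (at x)" shows "C_inf F"
proof (rule C_inf_coinduct[where S="{F} \<union> {g. C_inf g}"])
  have "deriv F = f" using assms(2) by (auto intro: DERIV_imp_deriv)
  then show "(\<forall>x. g differentiable (at x)) \<and> deriv g \<in> {F} \<union> {g. C_inf g}" if "g \<in> {F} \<union> {g. C_inf g}" for g
    using that assms by (auto simp: C_inf_deriv C_inf_differentiable intro: real_differentiableI)
qed simp

text \<open>By the Leibniz rule, finite sums of products of smooth functions are closed under
  differentiation, whereas single products are not. This is the coinduction class for
  products.\<close>

inductive prodsum :: "(real \<Rightarrow> real) \<Rightarrow> bool" where
  prod: "C_inf u \<Longrightarrow> C_inf v \<Longrightarrow> prodsum (\<lambda>x. u x * v x)"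
| sum: "prodsum p \<Longrightarrow> prodsum q \<Longrightarrow> prodsum (\<lambda>x. p x + q x)"

lemma prodsum_deriv: "prodsum p \<Longrightarrow> (\<forall>x. p differentiable (at x)) \<and> prodsum (deriv p)"
proof (induction rule: prodsum.induct)
  case (prod u v)
  have d: "((\<lambda>x. u x * v x) has_real_derivative (deriv u x * v x + u x * deriv v x)) (at x)" for x
    by (rule derivative_eq_intros C_inf_DERIV prod refl | simp)+
  then have "deriv (\<lambda>x. u x * v x) = (\<lambda>x. deriv u x * v x + u x * deriv v x)"
    by (auto intro: DERIV_imp_deriv)
  then show ?case using d prod by (auto intro!: prodsum.intros C_inf_deriv intro: real_differentiableI)
next
  case (sum p q)
  then have d: "((\<lambda>x. p x + q x) has_real_derivative (deriv p x + deriv q x)) (at x)" for x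
    by (intro DERIV_add) (auto simp: DERIV_deriv_iff_real_differentiable)
  then have "deriv (\<lambda>x. p x + q x) = (\<lambda>x. deriv p x + deriv q x)"
    by (auto intro: DERIV_imp_deriv)
  then show ?case using d sum by (auto intro!: prodsum.intros intro: real_differentiableI)
qed

lemma prodsum_C_inf: "prodsum p \<Longrightarrow> C_inf p"
  by (rule C_inf_coinduct[where S="Collect prodsum"]) (auto simp: prodsum_deriv)

lemma C_inf_mult: "C_inf u \<Longrightarrow> C_inf v \<Longrightarrow> C_inf (\<lambda>x. u x * v x)"
  by (rule prodsum_C_inf) (rule prodsum.prod)

lemma C_inf_const: "C_inf (\<lambda>x. c)"
proof (rule C_inf_coinduct[where S="range (\<lambda>c x. c)"])
  show "(\<forall>x. g differentiable (at x)) \<and> deriv g \<in> range (\<lambda>c x. c)" if "g \<in> range (\<lambda>(c::real) (x::real). c)" for g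
    using that by (auto intro!: image_eqI[of _ _ 0])
qed auto

lemma C_inf_add: "C_inf u \<Longrightarrow> C_inf v \<Longrightarrow> C_inf (\<lambda>x. u x + v x)"
  using prodsum_C_inf[OF prodsum.sum[OF prodsum.prod[OF _ C_inf_const[of 1]] prodsum.prod[OF _ C_inf_const[of 1]]], of u v]
  by simp

lemma C_inf_affine: assumes "C_inf f" shows "C_inf (\<lambda>x. f (a * x + b))"
proof (rule C_inf_coinduct[where S="{\<lambda>x. c * g (a * x + b) | c g. C_inf g}"])
  show "(\<lambda>x. f (a * x + b)) \<in> {\<lambda>x. c * g (a * x + b) | c g. C_inf g}"
    using assms by (auto intro!: exI[of _ 1] exI[of _ f])
  fix h assume "h \<in> {\<lambda>x. c * g (a * x + b) | c g. C_inf g}"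
  then obtain c g where h: "h = (\<lambda>x. c * g (a * x + b))" and g: "C_inf g" by auto
  have lin: "((\<lambda>x. a * x + b) has_real_derivative a) (at x)" for x
    by (auto intro!: derivative_eq_intros)
  have d: "(h has_real_derivative (c * a * deriv g (a * x + b))) (at x)" for x
    unfolding h using DERIV_cmult[OF DERIV_chain2[OF C_inf_DERIV[OF g] lin], of c x] by (simp add: mult_ac)
  then have "deriv h = (\<lambda>x. c * a * deriv g (a * x + b))" by (auto intro: DERIV_imp_deriv)
  with d g show "(\<forall>x. h differentiable (at x)) \<and> deriv h \<in> {\<lambda>x. c * g (a * x + b) | c g. C_inf g}"
    by (auto intro!: exI[of _ "c * a"] exI[of _ "deriv g"] C_inf_deriv intro: real_differentiableI)
qed

text \<open>The classical flat function is the case k = 0. Its derivatives are combinations of the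
  \<open>expow k\<close>, so the whole family is treated at once.\<close>

definition expow :: "nat \<Rightarrow> real \<Rightarrow> real" where
  "expow k x = (if x > 0 then (1 / x) ^ k * exp (- (1 / x)) else 0)"

lemma expow_tendsto_0: "((\<lambda>x. expow k x) \<longlongrightarrow> 0) (at 0)"
proof -
  have "((\<lambda>x::real. (inverse x) ^ k / exp (inverse x)) \<longlongrightarrow> 0) (at_right 0)"
    by (rule filterlim_compose[OF tendsto_power_div_exp_0 filterlim_inverse_at_top_right])
  moreover have "\<forall>\<^sub>F x::real in at_right 0. (inverse x) ^ k / exp (inverse x) = expow k x"
    using eventually_at_right_less[of 0]
    by eventually_elim (simp add: expow_def exp_minus field_simps)
  ultimately have r: "((\<lambda>x. expow k x) \<longlongrightarrow> 0) (at_right 0)" by (rule Lim_transform_eventually)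
  have "\<forall>\<^sub>F x::real in at_left 0. 0 = expow k x"
    unfolding eventually_at_filter by (simp add: expow_def)
  then have l: "((\<lambda>x. expow k x) \<longlongrightarrow> 0) (at_left 0)" by (rule Lim_transform_eventually[OF tendsto_const])
  show ?thesis using l r by (simp add: filterlim_split_at)
qed

lemma expow_DERIV: "(expow k has_real_derivative (- real k * expow (Suc k) x + expow (Suc (Suc k)) x)) (at x)"
proof (cases x "0::real" rule: linorder_cases)
  case greater
  have "((\<lambda>x. (1 / x) ^ k * exp (- (1 / x))) has_real_derivative (- real k * expow (Suc k) x + expow (Suc (Suc k)) x)) (at x)"
  proof -
    have "((\<lambda>x. (1 / x) ^ k * exp (- (1 / x))) has_real_derivative
        (real k * (1 / x) ^ (k - 1) * (- (1 / x\<^sup>2)) * exp (- (1 / x)) + (1 / x) ^ k * (exp (- (1 / x)) * (1 / x\<^sup>2)))) (at x)"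
    proof -
      have d1: "((\<lambda>x. 1 / x) has_real_derivative - (1 / x\<^sup>2)) (at x)"
        using greater by (auto intro!: derivative_eq_intros simp: power2_eq_square field_simps)
      show ?thesis
        by (rule DERIV_cong[OF DERIV_mult[OF DERIV_power[OF d1] DERIV_fun_exp[OF DERIV_minus[OF d1]]]])
          (simp add: algebra_simps)
    qed
    moreover have "real k * (1 / x) ^ (k - 1) * (- (1 / x\<^sup>2)) * exp (- (1 / x)) = - real k * expow (Suc k) x"
      using greater by (cases k) (simp_all add: expow_def power2_eq_square algebra_simps add_divide_distrib diff_divide_distrib)
    moreover have "(1 / x) ^ k * (exp (- (1 / x)) * (1 / x\<^sup>2)) = expow (Suc (Suc k)) x"
      using greater by (auto simp: expow_def power2_eq_square)
    ultimately show ?thesis by simp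
  qed
  moreover have "\<forall>\<^sub>F y in nhds x. expow k y = (1 / y) ^ k * exp (- (1 / y))"
    using eventually_nhds_in_open[of "{0<..}" x] greater
    by (auto elim!: eventually_mono simp: expow_def)
  ultimately show ?thesis by (subst DERIV_cong_ev[OF refl _ refl]) auto
next
  case less
  have "((\<lambda>x. 0) has_real_derivative (- real k * expow (Suc k) x + expow (Suc (Suc k)) x)) (at x)"
    using less by (simp add: expow_def)
  moreover have "\<forall>\<^sub>F y in nhds x. expow k y = 0"
    using eventually_nhds_in_open[of "{..<0}" x] less
    by (auto elim!: eventually_mono simp: expow_def)
  ultimately show ?thesis by (subst DERIV_cong_ev[OF refl _ refl]) auto
next
  case equal
  \<comment> \<open>At the origin the difference quotient is itself the next member of the family,
    which tends to 0; the claimed derivative is 0 there too.\<close>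
  have "(\<lambda>h. (expow k (0 + h) - expow k 0) / h) = expow (Suc k)"
    by (auto simp: expow_def fun_eq_iff)
  then show ?thesis using equal expow_tendsto_0[of "Suc k"] unfolding DERIV_def by (simp add: expow_def[of _ 0])
qed

inductive expow_comb :: "(real \<Rightarrow> real) \<Rightarrow> bool" where
  base: "expow_comb (\<lambda>x. c * expow k x)"
| sum: "expow_comb p \<Longrightarrow> expow_comb q \<Longrightarrow> expow_comb (\<lambda>x. p x + q x)"

lemma expow_comb_deriv: "expow_comb p \<Longrightarrow> (\<forall>x. p differentiable (at x)) \<and> expow_comb (deriv p)"
proof (induction rule: expow_comb.induct)
  case (base c k)
  have d: "((\<lambda>x. c * expow k x) has_real_derivative (- (c * real k) * expow (Suc k) x + c * expow (Suc (Suc k)) x)) (at x)" for x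
    using DERIV_cmult[OF expow_DERIV, of c k x] by (simp add: algebra_simps)
  then have "deriv (\<lambda>x. c * expow k x) = (\<lambda>x. - (c * real k) * expow (Suc k) x + c * expow (Suc (Suc k)) x)"
    by (auto intro: DERIV_imp_deriv)
  moreover have "expow_comb (\<lambda>x. - (c * real k) * expow (Suc k) x + c * expow (Suc (Suc k)) x)"
    by (intro expow_comb.intros)
  ultimately show ?case using real_differentiableI[OF d] by simp
next
  case (sum p q)
  then have d: "((\<lambda>x. p x + q x) has_real_derivative (deriv p x + deriv q x)) (at x)" for x
    by (intro DERIV_add) (auto simp: DERIV_deriv_iff_real_differentiable)
  then have "deriv (\<lambda>x. p x + q x) = (\<lambda>x. deriv p x + deriv q x)"
    by (auto intro: DERIV_imp_deriv)
  then show ?case using d sum by (auto intro!: expow_comb.intros intro: real_differentiableI)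
qed

lemma C_inf_expow: "C_inf (expow 0)"
proof (rule C_inf_coinduct[where S="Collect expow_comb"])
  show "expow 0 \<in> Collect expow_comb" using expow_comb.base[of 1 0] by simp
qed (auto simp: expow_comb_deriv)

text \<open>Smooth functions with support in \<open>[c, d]\<close> that increase to the indicator of \<open>(c, d)\<close>.\<close>
definition bump :: "real \<Rightarrow> real \<Rightarrow> nat \<Rightarrow> real \<Rightarrow> real" where
  "bump c d n x = expow 0 (real (Suc n) * (x - c)) * expow 0 (real (Suc n) * (d - x))"

lemma test_fun_bump: assumes "a < c" "c \<le> d" "d < b" shows "test_fun a b (bump c d n)"
proof -
  have "C_inf (\<lambda>x. expow 0 (real (Suc n) * x + - real (Suc n) * c) * expow 0 (- real (Suc n) * x + real (Suc n) * d))"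
    by (intro C_inf_mult C_inf_affine C_inf_expow)
  then have "C_inf (bump c d n)" by (simp add: bump_def[abs_def] algebra_simps)
  moreover have "\<forall>x. x \<notin> {c..d} \<longrightarrow> bump c d n x = 0"
    by (auto simp: bump_def expow_def zero_less_mult_iff)
  ultimately show ?thesis unfolding test_fun_def using assms by blast
qed

lemma expow0_bounds: "0 \<le> expow 0 x" "expow 0 x \<le> 1"
  by (auto simp: expow_def)

lemma bump_bounds: "0 \<le> bump c d n x" "bump c d n x \<le> 1"
  unfolding bump_def using expow0_bounds by (auto intro!: mult_nonneg_nonneg mult_le_one)

lemma bump_tendsto: "(\<lambda>n. bump c d n x) \<longlonglongrightarrow> indicator {c<..<d} x"
proof -
  have e: "(\<lambda>n. expow 0 (real (Suc n) * y)) \<longlonglongrightarrow> (if y > 0 then 1 else 0)" for y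
  proof (cases "y > 0")
    case True
    have "(\<lambda>n. exp (- (inverse (real (Suc n)) * (1 / y)))) \<longlonglongrightarrow> exp (- (0 * (1 / y)))"
      by (intro tendsto_intros LIMSEQ_inverse_real_of_nat)
    moreover have "exp (- (inverse (real (Suc n)) * (1 / y))) = expow 0 (real (Suc n) * y)" for n
      using True by (simp add: expow_def zero_less_mult_iff divide_inverse del: of_nat_Suc)
    ultimately show ?thesis using True by simp
  next
    case False
    then have "expow 0 (real (Suc n) * y) = 0" for n by (simp add: expow_def zero_less_mult_iff)
    then show ?thesis using False by simp
  qed
  have "(\<lambda>n. bump c d n x) \<longlonglongrightarrow> (if x - c > 0 then 1 else 0) * (if d - x > 0 then 1 else 0)"
    unfolding bump_def by (intro tendsto_mult e)
  then show ?thesis by (auto simp: indicator_def split: if_splits)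
qed

lemma test_fun_C_inf: "test_fun a b \<psi> \<Longrightarrow> C_inf \<psi>" by (simp add: test_fun_def)

lemma test_fun_add_scale: assumes "test_fun a b \<phi>" "test_fun a b \<psi>" shows "test_fun a b (\<lambda>x. \<phi> x + k * \<psi> x)"
proof -
  obtain c d c' d' where *: "a < c" "c \<le> d" "d < b" "\<forall>x. x \<notin> {c..d} \<longrightarrow> \<phi> x = 0"
    "a < c'" "c' \<le> d'" "d' < b" "\<forall>x. x \<notin> {c'..d'} \<longrightarrow> \<psi> x = 0"
    using assms unfolding test_fun_def by metis
  have "C_inf (\<lambda>x. \<phi> x + k * \<psi> x)"
    by (intro C_inf_add C_inf_mult C_inf_const test_fun_C_inf[OF assms(1)] test_fun_C_inf[OF assms(2)])
  moreover have "a < min c c'" "min c c' \<le> max d d'" "max d d' < b" using * by auto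
  moreover have "\<forall>x. x \<notin> {min c c'..max d d'} \<longrightarrow> \<phi> x + k * \<psi> x = 0"
  proof (intro allI impI)
    fix x assume "x \<notin> {min c c'..max d d'}"
    then have "x \<notin> {c..d}" "x \<notin> {c'..d'}" by auto
    then show "\<phi> x + k * \<psi> x = 0" using * by simp
  qed
  ultimately show ?thesis unfolding test_fun_def by blast
qed

section \<open>Testing integrable functions against smooth ones\<close>

lemma set_integrable_mult_bounded:
  fixes g h :: "real \<Rightarrow> real"
  assumes g: "set_integrable lebesgue A g" and h: "continuous_on UNIV h" "\<And>x. x \<in> A \<Longrightarrow> \<bar>h x\<bar> \<le> C"
  shows "set_integrable lebesgue A (\<lambda>x. g x * h x)"
  unfolding set_integrable_def
proof (rule Bochner_Integration.integrable_bound)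
  show "integrable lebesgue (\<lambda>x. C * (indicator A x *\<^sub>R g x))"
    using g by (auto simp: set_integrable_def)
  have [measurable]: "h \<in> borel_measurable lebesgue"
    using h(1) by (intro measurable_completion) (simp add: borel_measurable_continuous_onI)
  have [measurable]: "(\<lambda>x. indicator A x *\<^sub>R g x) \<in> borel_measurable lebesgue"
    using g by (auto simp: set_integrable_def)
  have "(\<lambda>x. (indicator A x *\<^sub>R g x) * h x) \<in> borel_measurable lebesgue" by measurable
  then show "(\<lambda>x. indicator A x *\<^sub>R (g x * h x)) \<in> borel_measurable lebesgue" by (simp add: mult.assoc)
  show "AE x in lebesgue. norm (indicator A x *\<^sub>R (g x * h x)) \<le> norm (C * (indicator A x *\<^sub>R g x))"
  proof (rule AE_I2)
    fix x
    have "\<bar>g x\<bar> * \<bar>h x\<bar> \<le> \<bar>g x\<bar> * \<bar>C\<bar>" if "x \<in> A"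
      using h(2)[OF that] by (intro mult_left_mono) auto
    then show "norm (indicator A x *\<^sub>R (g x * h x)) \<le> norm (C * (indicator A x *\<^sub>R g x))"
      by (auto simp: indicator_def abs_mult mult.commute)
  qed
qed

lemma continuous_bounded_interval: fixes h :: "real \<Rightarrow> real"
  assumes "continuous_on UNIV h" obtains C where "C \<ge> 0" "\<And>x. x \<in> {a..b} \<Longrightarrow> \<bar>h x\<bar> \<le> C"
proof -
  have "compact (h ` {a..b})" by (intro compact_continuous_image continuous_on_subset[OF assms]) auto
  then have "bounded (h ` {a..b})" by (rule compact_imp_bounded)
  then obtain C where "\<forall>x\<in>{a..b}. \<bar>h x\<bar> \<le> C" unfolding bounded_iff by auto
  then show ?thesis by (intro that[of "max C 0"]) (auto simp: le_max_iff_disj)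
qed

lemma test_integrable: fixes g h :: "real \<Rightarrow> real"
  assumes "set_integrable lebesgue {a<..<b} g" "continuous_on UNIV h"
  shows "set_integrable lebesgue {a<..<b} (\<lambda>x. g x * h x)"
proof -
  obtain C where "\<And>x. x \<in> {a..b} \<Longrightarrow> \<bar>h x\<bar> \<le> C" using continuous_bounded_interval[OF assms(2)] by metis
  then show ?thesis by (intro set_integrable_mult_bounded[OF assms, of C]) auto
qed

text \<open>The positive and the negative part of \<open>f\<close> define measures that are finite
  and equal on all rays, hence equal; uniqueness of densities then makes the two parts
  agree.\<close>

lemma AE_zero_from_rays:
  fixes f :: "real \<Rightarrow> real"
  assumes f: "integrable lebesgue f" and z: "\<And>x. (LINT y:{x<..}|lebesgue. f y) = 0"
  shows "AE x in lebesgue. f x = 0"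
proof -
  have "f \<in> borel_measurable (completion lborel)" using f by auto
  from completion_ex_borel_measurable_real[OF this] obtain g where g[measurable]: "g \<in> borel_measurable lborel"
    and fg: "AE x in lborel. f x = g x" by auto
  have fg': "AE x in lebesgue. f x = g x" using AE_completion[OF fg] .
  have g': "g \<in> borel_measurable lebesgue" by (rule measurable_completion[OF g])
  have gi: "integrable lborel g"
    using integrable_cong_AE_imp[OF f g'] fg' by (simp add: integrable_completion AE_symmetric)
  have gz: "(LINT y:{x<..}|lborel. g y) = 0" for x
  proof -
    have "(LINT y:{x<..}|lebesgue. f y) = (LINT y:{x<..}|lebesgue. g y)"
      unfolding set_lebesgue_integral_def using fg' f g'
      by (intro integral_cong_AE borel_measurable_scaleR borel_measurable_indicator) auto
    also have "\<dots> = (LINT y:{x<..}|lborel. g y)"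
      unfolding set_lebesgue_integral_def by (rule integral_completion) measurable
    finally show ?thesis using z by simp
  qed
  let ?P = "\<lambda>x. \<integral>\<^sup>+y. ennreal (g y) * indicator {x<..} y \<partial>lborel"
  let ?N = "\<lambda>x. \<integral>\<^sup>+y. ennreal (- g y) * indicator {x<..} y \<partial>lborel"
  have gsi: "integrable lborel (\<lambda>y. indicator {x<..} y *\<^sub>R g y)" for x
    by (rule integrable_mult_indicator[OF _ gi]) auto
  have e1: "ennreal (indicator {x<..} y *\<^sub>R g y) = ennreal (g y) * indicator {x<..} y" for x y
    by (simp split: split_indicator)
  have e2: "ennreal (- (indicator {x<..} y *\<^sub>R g y)) = ennreal (- g y) * indicator {x<..} y" for x y
    by (simp split: split_indicator)
  have fin: "?P x < \<infinity>" "?N x < \<infinity>" for x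
    using gsi[of x] unfolding real_integrable_def e1 e2 by (auto simp: less_top)
  have eq: "?P x = ?N x" for x
  proof -
    have "enn2real (?P x) - enn2real (?N x) = 0"
      using gz[of x] unfolding set_lebesgue_integral_def real_lebesgue_integral_def[OF gsi] e1 e2 .
    then have "ennreal (enn2real (?P x)) = ennreal (enn2real (?N x))" by simp
    moreover have "ennreal (enn2real (?P x)) = ?P x" "ennreal (enn2real (?N x)) = ?N x"
      using fin[of x] by (auto intro!: ennreal_enn2real)
    ultimately show ?thesis by metis
  qed
  have "density lborel (\<lambda>x. ennreal (g x)) = density lborel (\<lambda>x. ennreal (- g x))"
    by (rule measure_eqI_lessThan) (use fin eq in \<open>auto simp: emeasure_density\<close>)
  then have "AE x in lborel. ennreal (g x) = ennreal (- g x)"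
    by (subst (asm) sigma_finite_measure.density_unique_iff[OF sigma_finite_lborel]) auto
  then have "AE x in lborel. g x = 0"
  proof eventually_elim
    \<comment> \<open>Negative reals become 0 in \<open>ennreal\<close>, so the equality says that
      the positive and the negative part coincide, which forces both to vanish.\<close>
    fix x assume "ennreal (g x) = ennreal (- g x)"
    then show "g x = 0"
      by (cases "g x \<ge> 0") (auto simp: ennreal_neg ennreal_eq_0_iff dest: sym)
  qed
  from AE_completion[OF this] fg' show ?thesis by eventually_elim simp
qed

text \<open>Compactly supported test functions only reach intervals strictly inside
  \<open>(a, b)\<close>. Exhausting the part of a ray in \<open>(a, b)\<close> by such intervals
  passes to rays by dominated convergence.\<close>

lemma AE_zero_from_subintervals:
  fixes g :: "real \<Rightarrow> real"
  assumes g: "set_integrable lebesgue {a<..<b} g"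
    and z: "\<And>c d. a < c \<Longrightarrow> c \<le> d \<Longrightarrow> d < b \<Longrightarrow> (LINT y:{c<..<d}|lebesgue. g y) = 0"
  shows "AE x in lebesgue. x \<in> {a<..<b} \<longrightarrow> g x = 0"
proof -
  let ?f = "\<lambda>x. indicator {a<..<b} x *\<^sub>R g x"
  have f: "integrable lebesgue ?f" using g by (simp add: set_integrable_def)
  have "AE x in lebesgue. ?f x = 0"
  proof (rule AE_zero_from_rays[OF f])
    fix x
    define c d where "c n = max x (a + 1 / real (Suc n))" and "d n = b - 1 / real (Suc n)" for n
    have lim0: "(\<lambda>n. 1 / real (Suc n)) \<longlonglongrightarrow> 0" using LIMSEQ_inverse_real_of_nat by (simp add: inverse_eq_divide)
    have cl: "c \<longlonglongrightarrow> max x a" unfolding c_def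
      using tendsto_max[OF tendsto_const tendsto_add[OF tendsto_const lim0], of x a] by simp
    have dl: "d \<longlonglongrightarrow> b" unfolding d_def
      using tendsto_diff[OF tendsto_const lim0, of b] by simp
    have "(\<lambda>n. LINT y|lebesgue. indicator {c n<..<d n} y *\<^sub>R ?f y) \<longlonglongrightarrow> (LINT y|lebesgue. indicator {x<..} y *\<^sub>R ?f y)"
    proof (rule integral_dominated_convergence[where w="\<lambda>y. norm (?f y)"])
      show "AE y in lebesgue. (\<lambda>n. indicator {c n<..<d n} y *\<^sub>R ?f y) \<longlonglongrightarrow> indicator {x<..} y *\<^sub>R ?f y"
      proof (rule AE_I2)
        fix y
        show "(\<lambda>n. indicator {c n<..<d n} y *\<^sub>R ?f y) \<longlonglongrightarrow> indicator {x<..} y *\<^sub>R ?f y"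
        proof (cases "a < y \<and> y < b")
          case False then show ?thesis by auto
        next
          case ab: True
          show ?thesis
          proof (cases "x < y")
            case True
            have "\<forall>\<^sub>F n in sequentially. c n < y" by (rule order_tendstoD(2)[OF cl]) (use ab True in simp)
            moreover have "\<forall>\<^sub>F n in sequentially. y < d n" by (rule order_tendstoD(1)[OF dl]) (use ab in simp)
            ultimately have "\<forall>\<^sub>F n in sequentially. indicator {c n<..<d n} y *\<^sub>R ?f y = indicator {x<..} y *\<^sub>R ?f y"
              by eventually_elim (use True in auto)
            then show ?thesis by (rule tendsto_eventually)
          next
            case False
            then show ?thesis by (auto simp: c_def)
          qed
        qed
      qed
      show "AE y in lebesgue. norm (indicator {c n<..<d n} y *\<^sub>R ?f y) \<le> norm (?f y)" for n
        by (auto simp: indicator_def)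
        show "(\<lambda>y. indicator {x<..} y *\<^sub>R ?f y) \<in> borel_measurable lebesgue"
        by (rule borel_measurable_scaleR[OF borel_measurable_indicator borel_measurable_integrable[OF f]]) simp
      show "(\<lambda>y. indicator {c n<..<d n} y *\<^sub>R ?f y) \<in> borel_measurable lebesgue" for n
        by (rule borel_measurable_scaleR[OF borel_measurable_indicator borel_measurable_integrable[OF f]]) simp
    qed (use f in auto)
    moreover have "(LINT y|lebesgue. indicator {c n<..<d n} y *\<^sub>R ?f y) = 0" for n
    proof (cases "c n \<le> d n")
      case False then show ?thesis by (simp add: greaterThanLessThan_empty)
    next
      case True
      have "a < c n" "d n < b" by (auto simp: c_def d_def less_max_iff_disj)
      then have "(LINT y|lebesgue. indicator {c n<..<d n} y *\<^sub>R ?f y) = (LINT y:{c n<..<d n}|lebesgue. g y)"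
        unfolding set_lebesgue_integral_def by (intro Bochner_Integration.integral_cong) (auto simp: indicator_def)
      then show ?thesis using z \<open>a < c n\<close> \<open>d n < b\<close> True by simp
    qed
    ultimately show "(LINT y:{x<..}|lebesgue. ?f y) = 0"
      unfolding set_lebesgue_integral_def by (simp add: LIMSEQ_const_iff)
  qed
  then show ?thesis by eventually_elim auto
qed

text \<open>The bumps are bounded by 1 and converge to the indicator of a subinterval, so dominated
  convergence reduces the claim to integrals over subintervals.\<close>

lemma fundamental_lemma:
  fixes g :: "real \<Rightarrow> real"
  assumes g: "set_integrable lebesgue {a<..<b} g"
    and z: "\<And>\<psi>. test_fun a b \<psi> \<Longrightarrow> (LINT y:{a<..<b}|lebesgue. g y * \<psi> y) = 0"
  shows "AE x in lebesgue. x \<in> {a<..<b} \<longrightarrow> g x = 0"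
proof (rule AE_zero_from_subintervals[OF g])
  fix c d assume cd: "a < c" "c \<le> d" "d < b"
  let ?f = "\<lambda>x. indicator {a<..<b} x *\<^sub>R g x"
  have f: "integrable lebesgue ?f" using g by (simp add: set_integrable_def)
  have cont: "continuous_on UNIV (bump c d n)" for n
    using test_fun_bump[OF cd] by (auto intro: C_inf_continuous test_fun_C_inf)
  have [measurable]: "bump c d n \<in> borel_measurable lebesgue" for n
    using cont by (intro measurable_completion) (simp add: borel_measurable_continuous_onI)
  have "(\<lambda>n. LINT y|lebesgue. ?f y * bump c d n y) \<longlonglongrightarrow> (LINT y|lebesgue. ?f y * indicator {c<..<d} y)"
  proof (rule integral_dominated_convergence[where w="\<lambda>y. norm (?f y)"])
    show "AE y in lebesgue. (\<lambda>n. ?f y * bump c d n y) \<longlonglongrightarrow> ?f y * indicator {c<..<d} y"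
      by (intro AE_I2 tendsto_mult tendsto_const bump_tendsto)
    show "AE y in lebesgue. norm (?f y * bump c d n y) \<le> norm (?f y)" for n
      using bump_bounds by (intro AE_I2) (auto simp: abs_mult intro!: mult_right_le_one_le)
    show "(\<lambda>y. ?f y * bump c d n y) \<in> borel_measurable lebesgue" for n
      using f by (intro borel_measurable_times) auto
    show "(\<lambda>y. ?f y * indicator {c<..<d} y) \<in> borel_measurable lebesgue"
      using f by (intro borel_measurable_times borel_measurable_indicator) auto
  qed (use f in auto)
  moreover have "(LINT y|lebesgue. ?f y * bump c d n y) = 0" for n
    using z[OF test_fun_bump[OF cd, of n]] unfolding set_lebesgue_integral_def by (simp add: mult.assoc)
  ultimately have "(LINT y|lebesgue. ?f y * indicator {c<..<d} y) = 0"
    by (simp add: LIMSEQ_const_iff)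
  moreover have "(LINT y|lebesgue. ?f y * indicator {c<..<d} y) = (LINT y:{c<..<d}|lebesgue. g y)"
    unfolding set_lebesgue_integral_def using cd by (intro Bochner_Integration.integral_cong) (auto simp: indicator_def)
  ultimately show "(LINT y:{c<..<d}|lebesgue. g y) = 0" by simp
qed


lemma set_integrable_const_interval: "set_integrable lebesgue {a<..<b::real} (\<lambda>x. k::real)"
proof -
  have "emeasure lebesgue {a<..<b} < \<infinity>" by (cases "a \<le> b") (auto simp: emeasure_lborel_Ioo)
  then show ?thesis by (simp add: set_integrable_def)
qed

text \<open>The primitive is constant to the right of the support, with value the full integral.
  Vanishing of that integral is what gives the primitive compact support.\<close>

lemma test_primitive:
  assumes t: "test_fun a b \<eta>" and z: "(LINT x:{a<..<b}|lebesgue. \<eta> x) = 0"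
  shows "\<exists>\<omega>. test_fun a b \<omega> \<and> deriv \<omega> = \<eta>"
proof -
  obtain c d where cd: "a < c" "c \<le> d" "d < b" and sup: "\<And>x. x \<notin> {c..d} \<Longrightarrow> \<eta> x = 0"
    and sm: "C_inf \<eta>" using t by (auto simp: test_fun_def)
  have cont: "continuous_on A \<eta>" for A by (rule C_inf_continuous[OF sm])
  have io: "\<eta> integrable_on {u..v}" for u v by (rule integrable_continuous_real[OF cont])
  define \<omega> where "\<omega> x = integral {a..x} \<eta>" for x
  have zero: "integral {u..v} \<eta> = 0" if "\<And>x. x \<in> {u..v} \<Longrightarrow> x < c \<or> d < x" for u v
  proof -
    have "integral {u..v} \<eta> = integral {u..v} (\<lambda>x. 0)"
      by (intro Henstock_Kurzweil_Integration.integral_cong sup) (use that in fastforce)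
    then show ?thesis by simp
  qed
  have low: "\<omega> x = 0" if "x < c" for x unfolding \<omega>_def by (rule zero) (use that in auto)
  have hi: "\<omega> x = \<omega> d" if "d \<le> x" for x
  proof -
    have "integral {a..d} \<eta> + integral {d..x} \<eta> = integral {a..x} \<eta>"
      by (rule Henstock_Kurzweil_Integration.integral_combine) (use cd that io in auto)
    moreover have "integral {d..x} \<eta> = integral {d<..<x} \<eta>" by (simp add: integral_open_interval_real)
    moreover have "integral {d<..<x} \<eta> = integral {d<..<x} (\<lambda>x. 0)"
      by (intro Henstock_Kurzweil_Integration.integral_cong sup) auto
    ultimately show ?thesis by (simp add: \<omega>_def)
  qed
  have si: "set_integrable lebesgue {a<..<b} \<eta>"
    using test_integrable[OF set_integrable_const_interval[of a b 1] cont] by simp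
  have "\<omega> b = 0"
    using z set_lebesgue_integral_eq_integral(2)[OF si] by (simp add: \<omega>_def integral_open_interval_real)
  then have hi0: "\<omega> x = 0" if "d \<le> x" for x using hi[OF that] hi[of b] cd by simp
  have der: "(\<omega> has_real_derivative \<eta> x) (at x)" for x
  proof (cases "a < x")
    case True
    have "(\<omega> has_real_derivative \<eta> x) (at x within {a..x+1})"
      unfolding \<omega>_def by (rule integral_has_real_derivative[OF cont]) (use True in auto)
    then show ?thesis using True by (simp add: at_within_Icc_at)
  next
    case False
    have "\<forall>\<^sub>F y in nhds x. \<omega> y = 0"
      using eventually_nhds_in_open[of "{..<c}" x] False cd by (auto elim!: eventually_mono simp: low)
    moreover have "((\<lambda>_. 0) has_real_derivative \<eta> x) (at x)" using sup[of x] False cd by simp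
    ultimately show ?thesis by (subst DERIV_cong_ev[OF refl _ refl]) auto
  qed
  have "C_inf \<omega>" by (rule C_inf_primitive[OF sm der])
  moreover have "\<forall>x. x \<notin> {c..d} \<longrightarrow> \<omega> x = 0"
  proof (intro allI impI)
    fix x assume "x \<notin> {c..d}"
    then have "x < c \<or> d \<le> x" by auto
    then show "\<omega> x = 0" using low hi0 by blast
  qed
  ultimately have "test_fun a b \<omega>" unfolding test_fun_def using cd by blast
  moreover have "deriv \<omega> = \<eta>" using der by (auto intro: DERIV_imp_deriv)
  ultimately show ?thesis by blast
qed

lemma LINT_set_add_scale:
  fixes f g :: "real \<Rightarrow> real"
  assumes "set_integrable lebesgue A f" "set_integrable lebesgue A g"
  shows "(LINT x:A|lebesgue. f x + k * g x) = (LINT x:A|lebesgue. f x) + k * (LINT x:A|lebesgue. g x)"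
  using assms by (simp add: set_integral_add)

text \<open>The lemma of du Bois-Reymond. Subtracting a multiple of one fixed \<psi>0 makes any test
  function the derivative of another, and the constant is the mean of \<open>g\<close> with weight
  \<psi>0.\<close>

lemma fundamental_lemma_const:
  fixes g :: "real \<Rightarrow> real"
  assumes ab: "a < b" and g: "set_integrable lebesgue {a<..<b} g"
    and z: "\<And>\<psi>. test_fun a b \<psi> \<Longrightarrow> (LINT y:{a<..<b}|lebesgue. g y * deriv \<psi> y) = 0"
  shows "\<exists>k. AE x in lebesgue. x \<in> {a<..<b} \<longrightarrow> g x = k"
proof -
  let ?I = "\<lambda>f. LINT y:{a<..<b}|lebesgue. f y"
  have one: "set_integrable lebesgue {a<..<b} (\<lambda>_. 1::real)" by (rule set_integrable_const_interval)
  have cont: "continuous_on UNIV \<psi>" if "test_fun a b \<psi>" for \<psi> by (rule C_inf_continuous[OF test_fun_C_inf[OF that]])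
  have ti: "set_integrable lebesgue {a<..<b} \<psi>" if "test_fun a b \<psi>" for \<psi>
    using test_integrable[OF one cont[OF that]] by simp
  \<comment> \<open>If every test function had integral 0, the fundamental lemma applied to the
    constant 1 would make the interval a null set.\<close>
  obtain \<psi>0 where \<psi>0: "test_fun a b \<psi>0" "?I \<psi>0 \<noteq> 0"
  proof (rule ccontr)
    assume "\<not> thesis"
    then have "\<And>\<psi>. test_fun a b \<psi> \<Longrightarrow> ?I (\<lambda>y. 1 * \<psi> y) = 0" using that by auto
    from fundamental_lemma[OF one this] have "AE x in lebesgue. x \<notin> {a<..<b}" by simp
    then have "{a<..<b} \<in> null_sets lebesgue"
      using AE_iff_null_sets[of "{a<..<b}" lebesgue] by simp
    then have "emeasure lebesgue {a<..<b} = 0" by (simp add: null_sets_def)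
    then show False using ab by (simp add: emeasure_lborel_Ioo)
  qed
  define k where "k = ?I (\<lambda>y. g y * \<psi>0 y) / ?I \<psi>0"
  have gk: "set_integrable lebesgue {a<..<b} (\<lambda>x. g x - k)"
    by (intro set_integral_diff g set_integrable_const_interval)
  have "AE x in lebesgue. x \<in> {a<..<b} \<longrightarrow> g x - k = 0"
  proof (rule fundamental_lemma[OF gk])
    fix \<psi> assume \<psi>: "test_fun a b \<psi>"
    define m where "m = - (?I \<psi> / ?I \<psi>0)"
    define \<eta> where "\<eta> x = \<psi> x + m * \<psi>0 x" for x
    have \<eta>: "test_fun a b \<eta>" unfolding \<eta>_def by (rule test_fun_add_scale[OF \<psi> \<psi>0(1)])
    have "?I \<eta> = ?I \<psi> + m * ?I \<psi>0"
      unfolding \<eta>_def by (rule LINT_set_add_scale[OF ti[OF \<psi>] ti[OF \<psi>0(1)]])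
    also have "\<dots> = 0" using \<psi>0(2) by (simp add: m_def)
    finally obtain \<omega> where \<omega>: "test_fun a b \<omega>" "deriv \<omega> = \<eta>" using test_primitive[OF \<eta>] by auto
    have gi: "set_integrable lebesgue {a<..<b} (\<lambda>x. g x * \<phi> x)" if "test_fun a b \<phi>" for \<phi>
      by (rule test_integrable[OF g cont[OF that]])
    have "?I (\<lambda>y. g y * \<eta> y) = 0" using z[OF \<omega>(1)] \<omega>(2) by simp
    moreover have "?I (\<lambda>y. g y * \<eta> y) = ?I (\<lambda>y. g y * \<psi> y + m * (g y * \<psi>0 y))"
      by (simp add: \<eta>_def algebra_simps)
    moreover have "\<dots> = ?I (\<lambda>y. g y * \<psi> y) + m * ?I (\<lambda>y. g y * \<psi>0 y)"
      by (rule LINT_set_add_scale[OF gi[OF \<psi>] gi[OF \<psi>0(1)]])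
    ultimately have e: "?I (\<lambda>y. g y * \<psi> y) = k * ?I \<psi>" by (simp add: k_def m_def)
    have "?I (\<lambda>y. (g y - k) * \<psi> y) = ?I (\<lambda>y. g y * \<psi> y + (- k) * \<psi> y)" by (simp add: algebra_simps)
    also have "\<dots> = ?I (\<lambda>y. g y * \<psi> y) + (- k) * ?I \<psi>"
      by (rule LINT_set_add_scale[OF gi[OF \<psi>] ti[OF \<psi>]])
    finally show "?I (\<lambda>y. (g y - k) * \<psi> y) = 0" using e by simp
  qed
  then show ?thesis by (intro exI[of _ k]) auto
qed

text \<open>Bridge between two settings: the notions to be proved about use Lebesgue measurability,
  while Fubini and Tonelli are applied to Borel functions on \<open>lborel\<close>.\<close>

lemma AE_borel_version:
  fixes f :: "real \<Rightarrow> real"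
  assumes f: "f \<in> borel_measurable lebesgue"
  obtains g where "g \<in> borel_measurable borel" "AE x in lebesgue. f x = g x"
proof -
  from completion_ex_borel_measurable_real[of f lborel] f obtain g where "g \<in> borel_measurable lborel"
    "AE x in lborel. f x = g x" by auto
  then show ?thesis using that[of g] AE_completion by auto
qed

text \<open>Since \<open>g\<close> is only integrable, its primitive is not differentiated. Instead
  Fubini is applied to g(s) \<psi>'(x) on the triangle s < x, and the fundamental theorem is used
  for the smooth factor alone.\<close>

lemma primitive_by_parts:
  fixes g \<psi> \<psi>' :: "real \<Rightarrow> real"
  assumes ab: "a < b" and g: "set_integrable lebesgue {a<..<b} g"
    and der: "\<And>x. (\<psi> has_real_derivative \<psi>' x) (at x)" and cont': "continuous_on UNIV \<psi>'"
  shows "(LINT x:{a<..<b}|lebesgue. (LINT s:{a<..<x}|lebesgue. g s) * \<psi>' x)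
     = (LINT s:{a<..<b}|lebesgue. g s) * \<psi> b - (LINT s:{a<..<b}|lebesgue. g s * \<psi> s)"
proof -
  have cont\<psi>: "continuous_on UNIV \<psi>" using der by (meson DERIV_isCont continuous_at_imp_continuous_on)
  have [measurable]: "\<psi> \<in> borel_measurable borel" "\<psi>' \<in> borel_measurable borel"
    using cont\<psi> cont' by (auto intro: borel_measurable_continuous_onI)
  let ?f0 = "\<lambda>x. indicator {a<..<b} x *\<^sub>R g x"
  have f0: "integrable lebesgue ?f0" using g by (simp add: set_integrable_def)
  obtain g0 where [measurable]: "g0 \<in> borel_measurable borel" and g0: "AE x in lebesgue. ?f0 x = g0 x"
    using AE_borel_version[OF borel_measurable_integrable[OF f0]] by blast
  define f where "f x = indicator {a<..<b} x * g0 x" for x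
  have fm[measurable]: "f \<in> borel_measurable borel" unfolding f_def by measurable
  have fm': "f \<in> borel_measurable lebesgue" by (intro measurable_completion) simp
  have fae: "AE x in lebesgue. ?f0 x = f x" using g0
  proof eventually_elim
    fix x assume "?f0 x = g0 x" then show "?f0 x = f x" by (cases "x \<in> {a<..<b}") (auto simp: f_def)
  qed
  have "integrable lebesgue f" using integrable_cong_AE_imp[OF f0 fm'] fae by (simp add: AE_symmetric)
  then have fi: "integrable lborel f" by (simp add: integrable_completion)
  define h where "h x = indicator {a<..<b} x * \<psi>' x" for x
  have [measurable]: "h \<in> borel_measurable borel" unfolding h_def by measurable
  have "integrable lebesgue h"
    using test_integrable[OF set_integrable_const_interval[of a b 1] cont'] by (simp add: set_integrable_def h_def[abs_def])
  then have hi: "integrable lborel h" by (simp add: integrable_completion)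
  have conv: "(LINT x:A|lebesgue. g x * w x) = (LINT x|lborel. indicator A x * f x * w x)"
    if "A \<subseteq> {a<..<b}" "A \<in> sets borel" "w \<in> borel_measurable borel" for A w
  proof -
    have [measurable]: "A \<in> sets borel" "w \<in> borel_measurable borel" by fact+
    have w: "w \<in> borel_measurable lebesgue" by (intro measurable_completion) simp
    have "(LINT x:A|lebesgue. g x * w x) = (LINT x|lebesgue. (indicator A x * ?f0 x) * w x)"
      unfolding set_lebesgue_integral_def using that by (intro Bochner_Integration.integral_cong) (auto simp: indicator_def)
    also have "\<dots> = (LINT x|lebesgue. (indicator A x * f x) * w x)"
    proof (rule integral_cong_AE)
      show "(\<lambda>x. indicator A x * ?f0 x * w x) \<in> borel_measurable lebesgue"
        using w that borel_measurable_integrable[OF f0]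
        by (intro borel_measurable_times borel_measurable_indicator) auto
      show "(\<lambda>x. indicator A x * f x * w x) \<in> borel_measurable lebesgue"
        using w that fm' by (intro borel_measurable_times borel_measurable_indicator) auto
      show "AE x in lebesgue. indicator A x * ?f0 x * w x = indicator A x * f x * w x"
        using fae by eventually_elim simp
    qed
    also have "\<dots> = (LINT x|lborel. (indicator A x * f x) * w x)"
      by (rule integral_completion) measurable
    finally show ?thesis .
  qed
  \<comment> \<open>The indicator cuts out the triangle; integrating in s produces the primitive of
    \<open>g\<close>, integrating in x produces \<psi>(b) - \<psi>(s).\<close>
  let ?F = "\<lambda>s x. f s * h x * indicator {s<..} x"
  have meas2: "(\<lambda>(s, x). f s * h x) \<in> borel_measurable (lborel \<Otimes>\<^sub>M lborel)" by measurable
  have "integrable (lborel \<Otimes>\<^sub>M lborel) (\<lambda>(s, x). f s * h x)"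
  proof (rule lborel_pair.Fubini_integrable[OF meas2])
    have "(\<lambda>s. LINT x|lborel. norm (case (s, x) of (s, x) \<Rightarrow> f s * h x)) = (\<lambda>s. \<bar>f s\<bar> * (LINT x|lborel. \<bar>h x\<bar>))"
      by (simp add: abs_mult)
    then show "integrable lborel (\<lambda>s. LINT x|lborel. norm (case (s, x) of (s, x) \<Rightarrow> f s * h x))"
      using fi by simp
  qed (use hi in auto)
  moreover have mF: "case_prod ?F \<in> borel_measurable (lborel \<Otimes>\<^sub>M lborel)"
  proof -
    have "(\<lambda>p. f (fst p) * h (snd p) * (if fst p < snd p then 1 else 0)) \<in> borel_measurable (lborel \<Otimes>\<^sub>M lborel)"
      by measurable
    moreover have "case_prod ?F = (\<lambda>p. f (fst p) * h (snd p) * (if fst p < snd p then 1 else 0))"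
      by (auto simp: fun_eq_iff)
    ultimately show ?thesis by simp
  qed
  moreover have "AE p in lborel \<Otimes>\<^sub>M lborel. norm (case_prod ?F p) \<le> norm (case p of (s, x) \<Rightarrow> f s * h x)"
    by (rule AE_I2) (auto simp: indicator_def)
  ultimately have "integrable (lborel \<Otimes>\<^sub>M lborel) (case_prod ?F)"
    by (rule Bochner_Integration.integrable_bound)
  from lborel_pair.Fubini_integral[OF this]
  have fub: "(LINT x|lborel. LINT s|lborel. ?F s x) = (LINT s|lborel. LINT x|lborel. ?F s x)" .
  have inner1: "(LINT s|lborel. ?F s x) = indicator {a<..<b} x * ((LINT s:{a<..<x}|lebesgue. g s) * \<psi>' x)" for x
  proof (cases "x \<in> {a<..<b}")
    case False then show ?thesis by (simp add: h_def)
  next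
    case True
    have "(LINT s:{a<..<x}|lebesgue. g s) = (LINT s|lborel. indicator {a<..<x} s * f s)"
    proof -
      have "{a<..<x} \<subseteq> {a<..<b}" using True by auto
      from conv[OF this, of "\<lambda>_. 1"] show ?thesis by simp
    qed
    moreover have "(LINT s|lborel. ?F s x) = (LINT s|lborel. \<psi>' x * (indicator {a<..<x} s * f s))"
      using True by (intro Bochner_Integration.integral_cong) (auto simp: h_def f_def indicator_def)
    ultimately show ?thesis using True by simp
  qed
  have ftc: "(LINT x|lborel. h x * indicator {s<..} x) = \<psi> b - \<psi> s" if "s \<in> {a<..<b}" for s
  proof -
    have "(LINT x|lborel. indicator {s..b} x *\<^sub>R \<psi>' x) = \<psi> b - \<psi> s"
    proof (rule integral_FTC_atLeastAtMost)
      show "(\<psi> has_vector_derivative \<psi>' x) (at x within {s..b})" for x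
        using der[of x] by (simp add: has_real_derivative_iff_has_vector_derivative has_vector_derivative_at_within)
    qed (use that in \<open>auto intro: continuous_on_subset[OF cont']\<close>)
    moreover have "AE x in lborel. h x * indicator {s<..} x = indicator {s..b} x *\<^sub>R \<psi>' x"
      using AE_lborel_singleton[of s] AE_lborel_singleton[of b]
      by eventually_elim (use that in \<open>auto simp: h_def indicator_def\<close>)
    ultimately show ?thesis by (subst integral_cong_AE[where g="\<lambda>x. indicator {s..b} x *\<^sub>R \<psi>' x"]) auto
  qed
  have inner2: "(LINT x|lborel. ?F s x) = f s * (\<psi> b - \<psi> s)" for s
  proof (cases "s \<in> {a<..<b}")
    case False then show ?thesis by (simp add: f_def)
  next
    case True
    have "(LINT x|lborel. ?F s x) = f s * (LINT x|lborel. h x * indicator {s<..} x)"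
      by (simp add: mult.assoc)
    then show ?thesis using ftc[OF True] by simp
  qed
  have P: "(LINT x:{a<..<b}|lebesgue. (LINT s:{a<..<x}|lebesgue. g s) * \<psi>' x) = (LINT x|lborel. LINT s|lborel. ?F s x)"
  proof -
    have "(\<lambda>x. LINT s|lborel. ?F s x) \<in> borel_measurable lborel"
    proof (rule lborel.borel_measurable_lebesgue_integral)
      have "(\<lambda>p. f (snd p) * h (fst p) * (if snd p < fst p then 1 else 0)) \<in> borel_measurable (lborel \<Otimes>\<^sub>M lborel)"
        by measurable
      moreover have "(\<lambda>p. f (snd p) * h (fst p) * (if snd p < fst p then 1 else 0)) = case_prod (\<lambda>x s. ?F s x)"
        by (auto simp: fun_eq_iff)
      ultimately show "case_prod (\<lambda>x s. ?F s x) \<in> borel_measurable (lborel \<Otimes>\<^sub>M lborel)" by simp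
    qed
    then have "(\<lambda>x. indicator {a<..<b} x * ((LINT s:{a<..<x}|lebesgue. g s) * \<psi>' x)) \<in> borel_measurable lborel"
      unfolding inner1 .
    then show ?thesis unfolding inner1 set_lebesgue_integral_def[of lebesgue "{a<..<b}"]
      by (subst integral_completion) auto
  qed
  have fpsi: "integrable lborel (\<lambda>s. f s * \<psi> s)"
  proof -
    have i1: "integrable lebesgue (\<lambda>s. indicator {a<..<b} s *\<^sub>R (g s * \<psi> s))"
      using test_integrable[OF g cont\<psi>] by (simp add: set_integrable_def)
    have i2: "AE s in lebesgue. indicator {a<..<b} s *\<^sub>R (g s * \<psi> s) = f s * \<psi> s"
      using fae
    proof eventually_elim
      fix s assume "?f0 s = f s"
      then have "indicator {a<..<b} s *\<^sub>R g s * \<psi> s = f s * \<psi> s" by simp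
      then show "indicator {a<..<b} s *\<^sub>R (g s * \<psi> s) = f s * \<psi> s" by simp
    qed
    have i3: "(\<lambda>s. f s * \<psi> s) \<in> borel_measurable lebesgue" by (intro measurable_completion) simp
    have "integrable lebesgue (\<lambda>s. f s * \<psi> s)"
      by (rule integrable_cong_AE_imp[OF i1 i3 i2])
    then show ?thesis by (simp add: integrable_completion)
  qed
  have fe: "indicator {a<..<b} x * f x = f x" for x by (simp add: f_def indicator_def)
  have "(LINT s|lborel. f s * (\<psi> b - \<psi> s)) = (LINT s|lborel. f s * \<psi> b - f s * \<psi> s)" by (simp add: algebra_simps)
  also have "\<dots> = (LINT s|lborel. f s) * \<psi> b - (LINT s|lborel. f s * \<psi> s)"
    using fi fpsi by simp
  also have "\<dots> = (LINT s:{a<..<b}|lebesgue. g s) * \<psi> b - (LINT s:{a<..<b}|lebesgue. g s * \<psi> s)"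
    using conv[of "{a<..<b}" "\<lambda>_. 1"] conv[of "{a<..<b}" \<psi>] by (simp add: fe)
  finally show ?thesis using P fub inner2 by simp
qed


lemma set_integrable_subinterval:
  fixes g :: "real \<Rightarrow> real"
  assumes "set_integrable lebesgue {a<..<b} g" "x \<le> b" shows "set_integrable lebesgue {a<..<x} g"
  by (rule set_integrable_subset[OF assms(1)]) (use assms(2) in auto)

lemma primitive_continuous:
  fixes g :: "real \<Rightarrow> real"
  assumes g: "set_integrable lebesgue {a<..<b} g"
  shows "continuous_on {a..b} (\<lambda>x. LINT s:{a<..<x}|lebesgue. g s)"
proof -
  have "g integrable_on {a..b}"
    using set_lebesgue_integral_eq_integral(1)[OF g] by (simp add: integrable_on_open_interval_real)
  then have "continuous_on {a..b} (\<lambda>x. integral {a..x} g)" by (rule indefinite_integral_continuous_1)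
  moreover have "integral {a..x} g = (LINT s:{a<..<x}|lebesgue. g s)" if "x \<in> {a..b}" for x
    using set_lebesgue_integral_eq_integral(2)[OF set_integrable_subinterval[OF g, of x]] that
    by (simp add: integral_open_interval_real)
  ultimately show ?thesis by (subst (asm) continuous_on_cong[OF refl]) auto
qed

text \<open>The exceptional set inside the interval is open and null, hence empty; continuity adds
  the endpoints. This is the step from almost every point to every point, used in space and in
  time.\<close>

lemma AE_const_imp_const_on_Icc:
  fixes f :: "real \<Rightarrow> real"
  assumes ab: "a < b" and c: "continuous_on {a..b} f" and k: "AE x in lebesgue. x \<in> {a<..<b} \<longrightarrow> f x = k"
    and x: "x \<in> {a..b}"
  shows "f x = k"
proof -
  define U where "U = {x \<in> {a<..<b}. f x \<in> - {k}}"
  have "open U" unfolding U_def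
  proof -
    have "open ({a<..<b} \<inter> f -` (- {k}))"
      by (rule continuous_open_preimage) (use c in \<open>auto intro: continuous_on_subset\<close>)
    moreover have "{a<..<b} \<inter> f -` (- {k}) = {x \<in> {a<..<b}. f x \<in> - {k}}" by auto
    ultimately show "open {x \<in> {a<..<b}. f x \<in> - {k}}" by simp
  qed
  moreover have "negligible U"
  proof -
    have "U \<in> null_sets lebesgue"
    proof -
      have "U \<in> sets lebesgue" using \<open>open U\<close> by (simp add: borel_open)
      moreover have "AE x in lebesgue. x \<notin> U" using k by eventually_elim (auto simp: U_def)
      ultimately show ?thesis using AE_iff_null_sets[of U lebesgue] by simp
    qed
    then show ?thesis by (simp add: negligible_iff_null_sets)
  qed
  ultimately have "U = {}" using open_not_negligible by blast
  then have "\<And>y. y \<in> {a<..<b} \<Longrightarrow> f y = k" by (auto simp: U_def)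
  then show ?thesis
    using continuous_constant_on_closure[of "{a<..<b}" f k x] c x ab by (simp add: closure_greaterThanLessThan)
qed

lemma C_inf_deriv_cont: "C_inf \<psi> \<Longrightarrow> continuous_on A (deriv \<psi>)"
  by (intro C_inf_continuous C_inf_deriv)

lemma test_fun_ends: "test_fun a b \<psi> \<Longrightarrow> \<psi> a = 0 \<and> \<psi> b = 0"
  by (auto simp: test_fun_def)

lemma LINT_deriv_test_fun: assumes "test_fun a b \<psi>" "a < b"
  shows "(LINT x:{a<..<b}|lebesgue. deriv \<psi> x) = 0"
proof -
  have sm: "C_inf \<psi>" using assms by (simp add: test_fun_C_inf)
  have si: "set_integrable lebesgue {a<..<b} (deriv \<psi>)"
    using test_integrable[OF set_integrable_const_interval[of a b 1] C_inf_deriv_cont[OF sm]] by simp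
  have "(deriv \<psi> has_integral (\<psi> b - \<psi> a)) {a..b}"
    using assms by (intro fundamental_theorem_of_calculus)
      (auto simp flip: has_real_derivative_iff_has_vector_derivative intro: has_field_derivative_at_within C_inf_DERIV[OF sm])
  then have "integral {a..b} (deriv \<psi>) = 0" using test_fun_ends[OF assms(1)] by (simp add: integral_unique)
  then show ?thesis using set_lebesgue_integral_eq_integral(2)[OF si] by (metis integral_open_interval_real)
qed

lemma weak_deriv_primitive:
  fixes u g :: "real \<Rightarrow> real"
  assumes ab: "a < b" and g: "set_integrable lebesgue {a<..<b} g"
    and u: "\<And>x. x \<in> {a<..<b} \<Longrightarrow> u x = k + (LINT s:{a<..<x}|lebesgue. g s)"
  shows "weak_deriv a b u g"
  unfolding weak_deriv_def
proof (intro allI impI)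
  fix \<psi> assume \<psi>: "test_fun a b \<psi>"
  have sm: "C_inf \<psi>" using \<psi> by (simp add: test_fun_C_inf)
  let ?P = "\<lambda>x. LINT s:{a<..<x}|lebesgue. g s"
  have sd: "set_integrable lebesgue {a<..<b} (deriv \<psi>)"
    using test_integrable[OF set_integrable_const_interval[of a b 1] C_inf_deriv_cont[OF sm]] by simp
  have "set_integrable lebesgue {a..b} (\<lambda>x. ?P x * deriv \<psi> x)"
    by (rule absolutely_integrable_continuous_real)
      (intro continuous_intros primitive_continuous[OF g] C_inf_deriv_cont[OF sm])
  then have sP: "set_integrable lebesgue {a<..<b} (\<lambda>x. ?P x * deriv \<psi> x)"
    by (rule set_integrable_subset) auto
  have "(LINT x:{a<..<b}|lebesgue. u x * deriv \<psi> x) = (LINT x:{a<..<b}|lebesgue. ?P x * deriv \<psi> x + k * deriv \<psi> x)"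
    by (intro set_lebesgue_integral_cong) (auto simp: u algebra_simps)
  also have "\<dots> = (LINT x:{a<..<b}|lebesgue. ?P x * deriv \<psi> x)"
    by (subst LINT_set_add_scale[OF sP sd]) (simp add: LINT_deriv_test_fun[OF \<psi> ab])
  also have "\<dots> = - (LINT x:{a<..<b}|lebesgue. g x * \<psi> x)"
    using primitive_by_parts[OF ab g C_inf_DERIV[OF sm] C_inf_deriv_cont[OF sm]] test_fun_ends[OF \<psi>] by simp
  finally show "(LINT x:{a<..<b}|lebesgue. u x * deriv \<psi> x) = - (LINT x:{a<..<b}|lebesgue. g x * \<psi> x)" .
qed

text \<open>The function minus the primitive of its weak derivative has weak derivative zero, so it
  is a constant, fixed by the value at \<open>a\<close>. Applied to elements of \<open>H1\<close>
  and, in time, to the modes of a solution.\<close>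

theorem weak_deriv_imp_primitive:
  fixes u g :: "real \<Rightarrow> real"
  assumes ab: "a < b" and u: "continuous_on {a..b} u" and g: "set_integrable lebesgue {a<..<b} g"
    and w: "weak_deriv a b u g" and x: "x \<in> {a..b}"
  shows "u x = u a + (LINT s:{a<..<x}|lebesgue. g s)"
proof -
  let ?P = "\<lambda>x. LINT s:{a<..<x}|lebesgue. g s"
  have cP: "continuous_on {a..b} ?P" by (rule primitive_continuous[OF g])
  have cw: "continuous_on {a..b} (\<lambda>x. u x - ?P x)" by (intro continuous_intros u cP)
  have si: "set_integrable lebesgue {a<..<b} f" if "continuous_on {a..b} f" for f :: "real \<Rightarrow> real"
    by (rule set_integrable_subset[OF absolutely_integrable_continuous_real[OF that]]) auto
  have "\<exists>k. AE x in lebesgue. x \<in> {a<..<b} \<longrightarrow> u x - ?P x = k"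
  proof (rule fundamental_lemma_const[OF ab si[OF cw]])
    fix \<psi> assume \<psi>: "test_fun a b \<psi>"
    have cd: "continuous_on {a..b} (deriv \<psi>)" by (rule C_inf_deriv_cont[OF test_fun_C_inf[OF \<psi>]])
    have "weak_deriv a b ?P g" by (rule weak_deriv_primitive[OF ab g, of _ 0]) simp
    then have "(LINT x:{a<..<b}|lebesgue. ?P x * deriv \<psi> x) = (LINT x:{a<..<b}|lebesgue. u x * deriv \<psi> x)"
      using w \<psi> by (simp add: weak_deriv_def)
    moreover have "(LINT x:{a<..<b}|lebesgue. u x * deriv \<psi> x + (- 1) * (?P x * deriv \<psi> x))
      = (LINT x:{a<..<b}|lebesgue. u x * deriv \<psi> x) + (- 1) * (LINT x:{a<..<b}|lebesgue. ?P x * deriv \<psi> x)"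
      by (intro LINT_set_add_scale si continuous_intros u cP cd)
    ultimately show "(LINT y:{a<..<b}|lebesgue. (u y - ?P y) * deriv \<psi> y) = 0" by (simp add: algebra_simps)
  qed
  then obtain k where "AE x in lebesgue. x \<in> {a<..<b} \<longrightarrow> u x - ?P x = k" ..
  note * = AE_const_imp_const_on_Icc[OF ab cw this]
  have "u x - ?P x = k" by (rule *) fact
  moreover have "u a - ?P a = k" by (rule *) (use ab in simp)
  moreover have "?P a = 0" by (simp add: set_lebesgue_integral_def)
  ultimately show ?thesis by simp
qed

section \<open>Totality of trigonometric systems\<close>

text \<open>Orthogonality to all cosines gives orthogonality to all polynomials in cos(\<pi> x / L).
  As this function maps [0, L] bijectively onto [-1, 1], Weierstrass approximation reaches every
  test function.\<close>

lemma cos_total: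
  fixes h :: "real \<Rightarrow> real"
  assumes L: "L > 0" and h: "set_integrable lebesgue {0<..<L} h"
    and z: "\<And>n::nat. (LINT x:{0<..<L}|lebesgue. h x * cos (real n * (pi / L) * x)) = 0"
  shows "AE x in lebesgue. x \<in> {0<..<L} \<longrightarrow> h x = 0"
proof (rule fundamental_lemma[OF h])
  let ?I = "\<lambda>f. LINT x:{0<..<L}|lebesgue. f x"
  define c where "c x = cos (pi / L * x)" for x
  have cc: "continuous_on UNIV c" unfolding c_def[abs_def] by (intro continuous_intros)
  \<comment> \<open>Integer frequencies k, negative ones included, let the product formula lead from
    k to k - 1 and k + 1 without a boundary case.\<close>
  have P: "?I (\<lambda>x. h x * (c x ^ n * cos (real_of_int k * (pi / L) * x))) = 0" for n and k :: int
  proof (induction n arbitrary: k)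
    case 0
    have "cos (real_of_int k * (pi / L) * x) = cos (real (nat \<bar>k\<bar>) * (pi / L) * x)" for x
      by (cases "k \<ge> 0") (simp_all add: cos_minus flip: cos_minus[of "real_of_int k * (pi / L) * x"])
    then show ?case using z[of "nat \<bar>k\<bar>"] by simp
  next
    case (Suc n)
    let ?f = "\<lambda>k x. h x * (c x ^ n * cos (real_of_int k * (pi / L) * x))"
    have e: "h x * (c x ^ Suc n * cos (real_of_int k * (pi / L) * x)) = (1/2) * ?f (k - 1) x + (1/2) * ?f (k + 1) x" for x
    proof -
      have "cos (real_of_int k * (pi / L) * x) * c x = (cos (real_of_int (k - 1) * (pi / L) * x) + cos (real_of_int (k + 1) * (pi / L) * x)) / 2"
        (is "?C * _ = (?D + ?E) / 2")
        unfolding c_def cos_times_cos by (simp add: algebra_simps)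
      then have "h x * (c x ^ n * (?C * c x)) = h x * (c x ^ n * ((?D + ?E) / 2))" by (simp only:)
      moreover have "h x * (c x ^ Suc n * ?C) = h x * (c x ^ n * (?C * c x))" by (simp only: power_Suc mult_ac)
      ultimately have "h x * (c x ^ Suc n * ?C) = h x * (c x ^ n * ((?D + ?E) / 2))" by (simp only:)
      moreover have "\<dots> = (1/2) * (h x * (c x ^ n * ?D)) + (1/2) * (h x * (c x ^ n * ?E))"
        by (simp only: distrib_left add_divide_distrib times_divide_eq_right times_divide_eq_left mult_1)
      ultimately show ?thesis by (simp only:)
    qed
    have si: "set_integrable lebesgue {0<..<L} (?f k)" for k
      by (intro test_integrable[OF h] continuous_intros cc)
    have si2: "set_integrable lebesgue {0<..<L} (\<lambda>x. (1/2) * ?f k x)" for k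
      using si[of k] by simp
    have "?I (\<lambda>x. (1/2) * ?f (k - 1) x + (1/2) * ?f (k + 1) x) = (1/2) * ?I (?f (k - 1)) + (1/2) * ?I (?f (k + 1))"
      by (subst LINT_set_add_scale[OF si2 si]) simp
    then show ?case unfolding e using Suc.IH[of "k - 1"] Suc.IH[of "k + 1"] by simp
  qed
  have si: "set_integrable lebesgue {0<..<L} (\<lambda>x. h x * f x)" if "continuous_on UNIV f" for f
    by (rule test_integrable[OF h that])
  have Q: "?I (\<lambda>x. h x * (\<Sum>i\<le>n. a i * c x ^ i)) = 0" for a and n :: nat
  proof (induction n)
    case 0
    have "?I (\<lambda>x. h x * (c x ^ 0 * cos (real_of_int 0 * (pi / L) * x))) = 0" by (rule P)
    then show ?case by simp
  next
    case (Suc n)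
    have "?I (\<lambda>x. h x * (c x ^ Suc n * cos (real_of_int 0 * (pi / L) * x))) = 0" by (rule P)
    then have 0: "?I (\<lambda>x. h x * c x ^ Suc n) = 0" by simp
    have "?I (\<lambda>x. h x * (\<Sum>i\<le>Suc n. a i * c x ^ i)) = ?I (\<lambda>x. h x * (\<Sum>i\<le>n. a i * c x ^ i) + a (Suc n) * (h x * c x ^ Suc n))"
      by (simp add: algebra_simps)
    also have "\<dots> = ?I (\<lambda>x. h x * (\<Sum>i\<le>n. a i * c x ^ i)) + a (Suc n) * ?I (\<lambda>x. h x * c x ^ Suc n)"
      by (rule LINT_set_add_scale) (intro si continuous_intros cc)+
    finally show ?case using Suc 0 by simp
  qed
  fix \<psi> assume \<psi>: "test_fun 0 L \<psi>"
  have c\<psi>: "continuous_on A \<psi>" for A by (rule C_inf_continuous[OF test_fun_C_inf[OF \<psi>]])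
  define N where "N = ?I (\<lambda>x. \<bar>h x\<bar>)"
  have N: "0 \<le> N" unfolding N_def set_lebesgue_integral_def by (intro Bochner_Integration.integral_nonneg) auto
  have ah: "set_integrable lebesgue {0<..<L} (\<lambda>x. \<bar>h x\<bar>)" using h by (rule set_integrable_abs)
  have "\<bar>?I (\<lambda>x. h x * \<psi> x)\<bar> \<le> e * N" if e: "e > 0" for e
  proof -
    \<comment> \<open>Writing \<psi> as a function of c = cos(\<pi> x / L) through
      \<open>arccos\<close> turns uniform approximation on [0, L] into polynomial approximation on
      [-1, 1].\<close>
    have "continuous_on {-1..1} (\<psi> \<circ> (\<lambda>y. L / pi * arccos y))"
      by (intro continuous_on_compose continuous_intros c\<psi>) auto
    then obtain g where g: "real_polynomial_function g" "\<And>x. x \<in> {-1..1} \<Longrightarrow> \<bar>(\<psi> \<circ> (\<lambda>y. L / pi * arccos y)) x - g x\<bar> < e"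
      using Stone_Weierstrass_real_polynomial_function[OF _ _ e, of "{-1..1::real}"] by auto
    obtain a n where ga: "g = (\<lambda>x. \<Sum>i\<le>n. a i * x ^ i)" using g(1) real_polynomial_function_iff_sum by blast
    have cg: "continuous_on UNIV (\<lambda>x. g (c x))" unfolding ga by (intro continuous_intros cc)
    have near: "\<bar>\<psi> x - g (c x)\<bar> \<le> e" if "x \<in> {0<..<L}" for x
    proof -
      have "arccos (c x) = pi / L * x" unfolding c_def by (rule arccos_cos) (use that L in \<open>auto simp: field_simps\<close>)
      then have "L / pi * arccos (c x) = x" using L by simp
      then show ?thesis using g(2)[of "c x"] by (simp add: c_def)
    qed
    have "?I (\<lambda>x. h x * \<psi> x) = ?I (\<lambda>x. h x * \<psi> x) - ?I (\<lambda>x. h x * g (c x))" using Q[of a n] by (simp add: ga)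
    also have "\<dots> = ?I (\<lambda>x. h x * \<psi> x - h x * g (c x))"
      by (rule set_integral_diff(2)[symmetric]) (intro si c\<psi> cg)+
    also have "\<bar>\<dots>\<bar> \<le> ?I (\<lambda>x. \<bar>h x * \<psi> x - h x * g (c x)\<bar>)"
    proof -
      have "\<bar>indicator {0<..<L} x *\<^sub>R (h x * \<psi> x - h x * g (c x))\<bar> = indicator {0<..<L} x *\<^sub>R \<bar>h x * \<psi> x - h x * g (c x)\<bar>" for x
        by (simp add: indicator_def)
      then show ?thesis using integral_abs_bound[of lebesgue "\<lambda>x. indicator {0<..<L} x *\<^sub>R (h x * \<psi> x - h x * g (c x))"]
        unfolding set_lebesgue_integral_def by simp
    qed
    also have "\<dots> \<le> ?I (\<lambda>x. e * \<bar>h x\<bar>)"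
    proof (rule set_integral_mono)
      show "set_integrable lebesgue {0<..<L} (\<lambda>x. \<bar>h x * \<psi> x - h x * g (c x)\<bar>)"
        by (intro set_integrable_abs set_integral_diff si c\<psi> cg)
      show "set_integrable lebesgue {0<..<L} (\<lambda>x. e * \<bar>h x\<bar>)" using ah by simp
      fix x assume "x \<in> {0<..<L}"
      then have "\<bar>h x\<bar> * \<bar>\<psi> x - g (c x)\<bar> \<le> \<bar>h x\<bar> * e" by (intro mult_left_mono near) auto
      then show "\<bar>h x * \<psi> x - h x * g (c x)\<bar> \<le> e * \<bar>h x\<bar>"
        by (metis abs_mult mult.commute right_diff_distrib)
    qed
    also have "\<dots> = e * N" by (simp add: N_def)
    finally show ?thesis .
  qed
  note bd = this
  show "?I (\<lambda>x. h x * \<psi> x) = 0"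
  proof (rule ccontr)
    assume "?I (\<lambda>x. h x * \<psi> x) \<noteq> 0"
    then have "\<bar>?I (\<lambda>x. h x * \<psi> x)\<bar> / (2 * (N + 1)) > 0" using N by simp
    define z where "z = \<bar>?I (\<lambda>x. h x * \<psi> x)\<bar>"
    have z: "0 < z" using \<open>?I (\<lambda>x. h x * \<psi> x) \<noteq> 0\<close> by (simp add: z_def)
    have "z \<le> z / (2 * (N + 1)) * N"
      using bd[OF \<open>\<bar>?I (\<lambda>x. h x * \<psi> x)\<bar> / (2 * (N + 1)) > 0\<close>] unfolding z_def .
    then have "z * 1 \<le> z * (N / (2 * (N + 1)))" by simp
    then have "1 \<le> N / (2 * (N + 1))" using z by (simp only: mult_le_cancel_left_pos)
    then have "2 * (N + 1) \<le> N" using N by (simp add: divide_simps)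
    then show False using N by simp
  qed
qed

lemma AE_interval_mult_zero:
  fixes h w :: "real \<Rightarrow> real"
  assumes "AE x in lebesgue. x \<in> {0<..<L} \<longrightarrow> h x * w x = 0" "\<And>x. x \<in> {0<..<L} \<Longrightarrow> w x \<noteq> 0"
  shows "AE x in lebesgue. x \<in> {0<..<L} \<longrightarrow> h x = 0"
  using assms(1) by eventually_elim (use assms(2) in auto)

text \<open>Multiplication by cos(\<pi> x / (2 L)), which is positive on the open interval, turns
  half-integer frequencies into integer ones and so reduces the claim to the full cosine
  system.\<close>

lemma half_cos_total:
  fixes h :: "real \<Rightarrow> real"
  assumes L: "L > 0" and h: "set_integrable lebesgue {0<..<L} h"
    and z: "\<And>n::nat. (LINT x:{0<..<L}|lebesgue. h x * cos ((real n + 1/2) * (pi / L) * x)) = 0"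
  shows "AE x in lebesgue. x \<in> {0<..<L} \<longrightarrow> h x = 0"
proof -
  let ?I = "\<lambda>f. LINT x:{0<..<L}|lebesgue. f x"
  let ?w = "\<lambda>x. cos (1/2 * (pi / L) * x)"
  have si: "set_integrable lebesgue {0<..<L} (\<lambda>x. h x * f x)" if "continuous_on UNIV f" for f
    by (rule test_integrable[OF h that])
  have "AE x in lebesgue. x \<in> {0<..<L} \<longrightarrow> h x * ?w x = 0"
  proof (rule cos_total[OF L])
    show "set_integrable lebesgue {0<..<L} (\<lambda>x. h x * ?w x)" by (intro si continuous_intros)
    fix n :: nat
    show "?I (\<lambda>x. h x * ?w x * cos (real n * (pi / L) * x)) = 0"
    proof (cases n)
      case 0 then show ?thesis using z[of 0] by simp
    next
      case (Suc m)
      have e: "h x * ?w x * cos (real n * (pi / L) * x) = (1/2) * (h x * cos ((real m + 1/2) * (pi / L) * x)) + (1/2) * (h x * cos ((real n + 1/2) * (pi / L) * x))" for x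
      proof -
        have "cos (real n * (pi / L) * x) * ?w x = (cos ((real m + 1/2) * (pi / L) * x) + cos ((real n + 1/2) * (pi / L) * x)) / 2"
          (is "?C * _ = (?D + ?E) / 2")
          unfolding cos_times_cos using Suc by (simp add: algebra_simps)
        then have "h x * (?C * ?w x) = h x * ((?D + ?E) / 2)" by (simp only:)
        moreover have "h x * ?w x * ?C = h x * (?C * ?w x)" by (simp only: mult_ac)
        ultimately have "h x * ?w x * ?C = h x * ((?D + ?E) / 2)" by (simp only:)
        moreover have "\<dots> = (1/2) * (h x * ?D) + (1/2) * (h x * ?E)"
          by (simp only: distrib_left add_divide_distrib times_divide_eq_right times_divide_eq_left mult_1)
        ultimately show ?thesis by (simp only:)
      qed
      have "?I (\<lambda>x. (1/2) * (h x * cos ((real m + 1/2) * (pi / L) * x)) + (1/2) * (h x * cos ((real n + 1/2) * (pi / L) * x)))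
        = ?I (\<lambda>x. (1/2) * (h x * cos ((real m + 1/2) * (pi / L) * x))) + (1/2) * ?I (\<lambda>x. h x * cos ((real n + 1/2) * (pi / L) * x))"
        by (rule LINT_set_add_scale) (intro si continuous_intros set_integrable_mult_right)+
      then show ?thesis unfolding e using z[of m] z[of n] by simp
    qed
  qed
  then show ?thesis
  proof (rule AE_interval_mult_zero)
    fix x assume "x \<in> {0<..<L}"
    then have "0 < 1/2 * (pi / L) * x" "1/2 * (pi / L) * x < pi / 2" using L by (auto simp: field_simps)
    then have "cos (1/2 * (pi / L) * x) > 0" by (intro cos_gt_zero) auto
    then show "?w x \<noteq> 0" by simp
  qed
qed

text \<open>Here the multiplier is sin(\<pi> x / L), again positive inside: its product with a
  cosine is a difference of two sines.\<close>

lemma sin_total: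
  fixes h :: "real \<Rightarrow> real"
  assumes L: "L > 0" and h: "set_integrable lebesgue {0<..<L} h"
    and z: "\<And>n::nat. (LINT x:{0<..<L}|lebesgue. h x * sin (real n * (pi / L) * x)) = 0"
  shows "AE x in lebesgue. x \<in> {0<..<L} \<longrightarrow> h x = 0"
proof -
  let ?I = "\<lambda>f. LINT x:{0<..<L}|lebesgue. f x"
  let ?w = "\<lambda>x. sin ((pi / L) * x)"
  have si: "set_integrable lebesgue {0<..<L} (\<lambda>x. h x * f x)" if "continuous_on UNIV f" for f
    by (rule test_integrable[OF h that])
  have "AE x in lebesgue. x \<in> {0<..<L} \<longrightarrow> h x * ?w x = 0"
  proof (rule cos_total[OF L])
    show "set_integrable lebesgue {0<..<L} (\<lambda>x. h x * ?w x)" by (intro si continuous_intros)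
    fix n :: nat
    show "?I (\<lambda>x. h x * ?w x * cos (real n * (pi / L) * x)) = 0"
    proof (cases n)
      case 0 then show ?thesis using z[of 1] by simp
    next
      case (Suc m)
      have e: "h x * ?w x * cos (real n * (pi / L) * x) = (1/2) * (h x * sin (real (Suc n) * (pi / L) * x)) + (- 1/2) * (h x * sin (real m * (pi / L) * x))" for x
      proof -
        have "?w x * cos (real n * (pi / L) * x) = (sin ((pi / L) * x + real n * (pi / L) * x) + sin ((pi / L) * x - real n * (pi / L) * x)) / 2"
          by (rule sin_times_cos)
        moreover have "(pi / L) * x + real n * (pi / L) * x = real (Suc n) * (pi / L) * x" by (simp add: algebra_simps)
        moreover have "(pi / L) * x - real n * (pi / L) * x = - (real m * (pi / L) * x)" using Suc by (simp add: algebra_simps)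
        ultimately have "?w x * cos (real n * (pi / L) * x) = (sin (real (Suc n) * (pi / L) * x) - sin (real m * (pi / L) * x)) / 2"
          (is "_ * ?C = (?D - ?E) / 2") by simp
        then have "h x * (?w x * ?C) = h x * ((?D - ?E) / 2)" by (simp only:)
        moreover have "h x * ?w x * ?C = h x * (?w x * ?C)" by (simp only: mult_ac)
        ultimately have "h x * ?w x * ?C = h x * ((?D - ?E) / 2)" by (simp only:)
        moreover have "\<dots> = (1/2) * (h x * ?D) + (- 1/2) * (h x * ?E)"
          by (simp add: diff_divide_distrib right_diff_distrib del: of_nat_Suc)
        ultimately show ?thesis by (simp only:)
      qed
      have "?I (\<lambda>x. (1/2) * (h x * sin (real (Suc n) * (pi / L) * x)) + (- 1/2) * (h x * sin (real m * (pi / L) * x)))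
        = ?I (\<lambda>x. (1/2) * (h x * sin (real (Suc n) * (pi / L) * x))) + (- 1/2) * ?I (\<lambda>x. h x * sin (real m * (pi / L) * x))"
        by (rule LINT_set_add_scale) (intro si continuous_intros set_integrable_mult_right)+
      then show ?thesis unfolding e using z[of m] z[of "Suc n"] by simp
    qed
  qed
  then show ?thesis
  proof (rule AE_interval_mult_zero)
    fix x assume "x \<in> {0<..<L}"
    then have "0 < (pi / L) * x" "(pi / L) * x < pi" using L by (auto simp: field_simps)
    then have "sin ((pi / L) * x) > 0" by (intro sin_gt_zero) auto
    then show "?w x \<noteq> 0" by simp
  qed
qed

text \<open>Adding and subtracting the conditions for \<open>n\<close> and \<open>- n\<close> rotates \<open>(p, q)\<close> by the angle
  \<open>\<theta> x / L\<close> and leaves a cosine series for one component and a sine series for the other.\<close>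
lemma shifted_sin_cos_total:
  fixes p q :: "real \<Rightarrow> real"
  assumes L: "L > 0" and p: "set_integrable lebesgue {0<..<L} p" and q: "set_integrable lebesgue {0<..<L} q"
    and z: "\<And>n::int. (LINT x:{0<..<L}|lebesgue. p x * sin ((\<theta> + real_of_int n * pi) / L * x) + q x * cos ((\<theta> + real_of_int n * pi) / L * x)) = 0"
  shows "AE x in lebesgue. x \<in> {0<..<L} \<longrightarrow> p x = 0 \<and> q x = 0"
proof -
  let ?I = "\<lambda>f. LINT x:{0<..<L}|lebesgue. f x"
  define \<alpha> where "\<alpha> x = \<theta> / L * x" for x
  have c\<alpha>: "continuous_on UNIV \<alpha>" unfolding \<alpha>_def[abs_def] by (intro continuous_intros)
  have sp: "set_integrable lebesgue {0<..<L} (\<lambda>x. p x * f x)" if "continuous_on UNIV f" for f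
    by (rule test_integrable[OF p that])
  have sq: "set_integrable lebesgue {0<..<L} (\<lambda>x. q x * f x)" if "continuous_on UNIV f" for f
    by (rule test_integrable[OF q that])
  let ?A = "\<lambda>x. p x * sin (\<alpha> x) + q x * cos (\<alpha> x)"
  let ?B = "\<lambda>x. p x * cos (\<alpha> x) - q x * sin (\<alpha> x)"
  let ?f = "\<lambda>n x. p x * sin ((\<theta> + real_of_int n * pi) / L * x) + q x * cos ((\<theta> + real_of_int n * pi) / L * x)"
  have sf: "set_integrable lebesgue {0<..<L} (?f n)" for n
    by (intro set_integral_add sp sq continuous_intros)
  have ang: "(\<theta> + real_of_int n * pi) / L * x = \<alpha> x + real_of_int n * (pi / L) * x" for n x
    using L by (simp add: \<alpha>_def field_simps)
  have f1: "?f (int n) x = p x * sin (\<alpha> x + real n * (pi / L) * x) + q x * cos (\<alpha> x + real n * (pi / L) * x)" for n x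
    unfolding ang by simp
  have f2: "?f (- int n) x = p x * sin (\<alpha> x - real n * (pi / L) * x) + q x * cos (\<alpha> x - real n * (pi / L) * x)" for n x
    unfolding ang by simp
  have A0: "AE x in lebesgue. x \<in> {0<..<L} \<longrightarrow> ?A x = 0"
  proof (rule cos_total[OF L])
    show "set_integrable lebesgue {0<..<L} ?A" by (intro set_integral_add sp sq continuous_intros c\<alpha>)
    fix n :: nat
    have "?A x * cos (real n * (pi / L) * x) = (1/2) * ?f (int n) x + (1/2) * ?f (- int n) x" for x
      unfolding f1 f2 sin_add cos_add sin_diff cos_diff
      by (simp add: distrib_left distrib_right right_diff_distrib left_diff_distrib mult_ac)
    then have "?I (\<lambda>x. ?A x * cos (real n * (pi / L) * x)) = ?I (\<lambda>x. (1/2) * ?f (int n) x + (1/2) * ?f (- int n) x)" by simp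
    also have "\<dots> = ?I (\<lambda>x. (1/2) * ?f (int n) x) + (1/2) * ?I (?f (- int n))"
      by (rule LINT_set_add_scale) (use sf in \<open>auto intro!: set_integrable_mult_right simp del: of_int_minus of_int_of_nat_eq distrib_left distrib_left_numeral\<close>)
    finally show "?I (\<lambda>x. ?A x * cos (real n * (pi / L) * x)) = 0" using z[of "int n"] z[of "- int n"] by simp
  qed
  have B0: "AE x in lebesgue. x \<in> {0<..<L} \<longrightarrow> ?B x = 0"
  proof (rule sin_total[OF L])
    show "set_integrable lebesgue {0<..<L} ?B" by (intro set_integral_diff sp sq continuous_intros c\<alpha>)
    fix n :: nat
    have "?B x * sin (real n * (pi / L) * x) = (1/2) * ?f (int n) x + (- 1/2) * ?f (- int n) x" for x
      unfolding f1 f2 sin_add cos_add sin_diff cos_diff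
      by (simp add: distrib_left distrib_right right_diff_distrib left_diff_distrib mult_ac)
    then have "?I (\<lambda>x. ?B x * sin (real n * (pi / L) * x)) = ?I (\<lambda>x. (1/2) * ?f (int n) x + (- 1/2) * ?f (- int n) x)" by simp
    also have "\<dots> = ?I (\<lambda>x. (1/2) * ?f (int n) x) + (- 1/2) * ?I (?f (- int n))"
      by (rule LINT_set_add_scale) (use sf in \<open>auto intro!: set_integrable_mult_right simp del: of_int_minus of_int_of_nat_eq distrib_left distrib_left_numeral\<close>)
    finally show "?I (\<lambda>x. ?B x * sin (real n * (pi / L) * x)) = 0" using z[of "int n"] z[of "- int n"] by simp
  qed
  show ?thesis using A0 B0
  proof eventually_elim
    fix x assume A: "x \<in> {0<..<L} \<longrightarrow> ?A x = 0" and B: "x \<in> {0<..<L} \<longrightarrow> ?B x = 0"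
    show "x \<in> {0<..<L} \<longrightarrow> p x = 0 \<and> q x = 0"
    proof
      assume x: "x \<in> {0<..<L}"
      have sc: "sin (\<alpha> x) * sin (\<alpha> x) = 1 - cos (\<alpha> x) * cos (\<alpha> x)"
        using sin_squared_eq[of "\<alpha> x"] by (simp add: power2_eq_square)
      have "?A x * sin (\<alpha> x) + ?B x * cos (\<alpha> x) = p x * (sin (\<alpha> x) * sin (\<alpha> x)) + p x * (cos (\<alpha> x) * cos (\<alpha> x))"
        by (simp add: algebra_simps)
      then have "p x = ?A x * sin (\<alpha> x) + ?B x * cos (\<alpha> x)" unfolding sc by (simp add: algebra_simps)
      moreover have "?A x * cos (\<alpha> x) - ?B x * sin (\<alpha> x) = q x * (sin (\<alpha> x) * sin (\<alpha> x)) + q x * (cos (\<alpha> x) * cos (\<alpha> x))"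
        by (simp add: algebra_simps)
      then have "q x = ?A x * cos (\<alpha> x) - ?B x * sin (\<alpha> x)" unfolding sc by (simp add: algebra_simps)
      ultimately show "p x = 0 \<and> q x = 0" using A B x by auto
    qed
  qed
qed

section \<open>The Sobolev space on an interval\<close>

text \<open>This and the next three lemmas pass from integrals over a subset to the measure
  restricted to it, where the calculus of \<open>sqint\<close> and \<open>ip\<close> is
  available.\<close>

lemma LINT_eq_on: "(LINT x:A|lebesgue. f x) = (\<integral>x. f x \<partial>lebesgue_on A)" if "A \<in> sets lebesgue" for f :: "real \<Rightarrow> real"
  using that by (simp add: set_lebesgue_integral_def integral_restrict_space)

lemma set_integrable_eq_on: "set_integrable lebesgue A f \<longleftrightarrow> integrable (lebesgue_on A) f" if "A \<in> sets lebesgue" for f :: "real \<Rightarrow> real"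
  using that by (simp add: set_integrable_def integrable_restrict_space)

lemma set_borel_measurable_eq_on: "set_borel_measurable lebesgue A f \<longleftrightarrow> f \<in> borel_measurable (lebesgue_on A)" if "A \<in> sets lebesgue" for f :: "real \<Rightarrow> real"
  using that by (simp add: set_borel_measurable_def borel_measurable_restrict_space_iff)

lemma AE_eq_on: "(AE x in lebesgue. x \<in> A \<longrightarrow> P x) \<longleftrightarrow> (AE x in lebesgue_on A. P x)" if "A \<in> sets lebesgue"
  using that by (simp add: AE_restrict_space_iff)

lemma L2_on_iff_sqint: "L2_on a b u \<longleftrightarrow> sqint (lebesgue_on {a<..<b}) u"
  by (simp add: L2_on_def sqint_def set_borel_measurable_eq_on set_integrable_eq_on)

lemma finite_measure_Ioo: "finite_measure (lebesgue_on {a<..<b::real})"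
proof
  have "emeasure lborel {a<..<b} < \<infinity>" by (cases "a \<le> b") (auto simp: emeasure_lborel_Ioo)
  then show "emeasure (lebesgue_on {a<..<b}) (space (lebesgue_on {a<..<b})) \<noteq> \<infinity>"
    by (simp add: emeasure_restrict_space space_restrict_space)
qed

lemma sqint_const: "sqint (lebesgue_on {a<..<b::real}) (\<lambda>_. c)"
proof -
  interpret finite_measure "lebesgue_on {a<..<b}" by (rule finite_measure_Ioo)
  show ?thesis by (simp add: sqint_def)
qed

lemma sqint_integrable: fixes f :: "real \<Rightarrow> real"
  assumes "sqint (lebesgue_on {a<..<b}) f" shows "integrable (lebesgue_on {a<..<b}) f"
  using sqint_inner_integrable[OF assms sqint_const[of a b 1]] by simp

lemma L2_on_integrable: "L2_on a b f \<Longrightarrow> set_integrable lebesgue {a<..<b} f"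
  using sqint_integrable[of a b f] by (simp add: L2_on_iff_sqint set_integrable_eq_on)

lemma continuous_L2_on: assumes "continuous_on {a..b} f" shows "L2_on a b f"
  unfolding L2_on_def
proof
  have "set_integrable lebesgue {a<..<b} f" if "continuous_on {a..b} f" for f :: "real \<Rightarrow> real"
    by (rule set_integrable_subset[OF absolutely_integrable_continuous_real[OF that]]) auto
  note si = this
  show "set_borel_measurable lebesgue {a<..<b} f"
    using si[OF assms] by (simp add: set_borel_measurable_def set_integrable_def borel_measurable_integrable)
  show "set_integrable lebesgue {a<..<b} (\<lambda>x. (f x)\<^sup>2)" by (intro si continuous_intros assms)
qed

definition prim :: "(real \<Rightarrow> real) \<Rightarrow> real \<Rightarrow> real" where
  "prim g x = (LINT s:{0<..<x}|lebesgue. g s)"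

lemma prim_0[simp]: "prim g 0 = 0" by (simp add: prim_def set_lebesgue_integral_def)

text \<open>Cauchy-Schwarz against the indicator of (0, x), whose squared norm is at most
  \<open>L\<close>.\<close>

lemma prim_bound: assumes g: "L2_on 0 L g" and x: "x \<in> {0..L}"
  shows "\<bar>prim g x\<bar> \<le> sqrt L * sqrt (LINT s:{0<..<L}|lebesgue. (g s)\<^sup>2)"
proof -
  let ?M = "lebesgue_on {0<..<L}"
  have g': "sqint ?M g" using g by (simp add: L2_on_iff_sqint)
  have i: "sqint ?M (indicator {0<..<x} :: real \<Rightarrow> real)"
    unfolding sqint_def
  proof
    show m: "indicator {0<..<x} \<in> borel_measurable ?M" by (intro measurable_restrict_space1 borel_measurable_indicator) simp
    show "integrable ?M (\<lambda>y. (norm (indicator {0<..<x} y :: real))\<^sup>2)"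
    proof (rule Bochner_Integration.integrable_bound[of _ "\<lambda>_. 1::real"])
      show "(\<lambda>y. (norm (indicator {0<..<x} y :: real))\<^sup>2) \<in> borel_measurable ?M"
        using m by measurable
    qed (use sqint_integrable[OF sqint_const[of 0 L 1]] in \<open>auto simp: indicator_def\<close>)
  qed
  have "prim g x = ip ?M g (indicator {0<..<x})"
    unfolding prim_def ip_def set_lebesgue_integral_def using x
    by (subst integral_restrict_space) (auto intro!: Bochner_Integration.integral_cong simp: indicator_def)
  moreover have "ip ?M (indicator {0<..<x}) (indicator {0<..<x}::real\<Rightarrow>real) \<le> L"
  proof -
    have "ip ?M (indicator {0<..<x}) (indicator {0<..<x}::real\<Rightarrow>real) \<le> (\<integral>y. 1 \<partial>?M)"
      unfolding ip_self
      by (rule integral_mono) (use i sqint_integrable[OF sqint_const[of 0 L 1]] in \<open>auto simp: sqint_def indicator_def\<close>)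
    also have "\<dots> = L" using x by (simp add: measure_restrict_space space_restrict_space)
    finally show ?thesis .
  qed
  moreover have "ip ?M g g = (LINT s:{0<..<L}|lebesgue. (g s)\<^sup>2)"
    by (simp add: ip_self LINT_eq_on)
  ultimately show ?thesis
    using order_trans[OF ip_Cauchy_Schwarz[OF g' i] mult_left_mono[OF real_sqrt_le_mono[of _ L]]]
    using ip_nonneg[of ?M g] by (simp add: mult.commute)
qed

text \<open>\<open>dz\<close> is an arbitrary choice among weak derivatives. Uniqueness almost
  everywhere is what allows it to be replaced by an explicitly computed one.\<close>

lemma weak_deriv_unique:
  assumes "L2_on a b g" "L2_on a b g'" "weak_deriv a b u g" "weak_deriv a b u g'"
  shows "AE x in lebesgue. x \<in> {a<..<b} \<longrightarrow> g x = g' x"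
proof -
  note si = L2_on_integrable[OF assms(1)] L2_on_integrable[OF assms(2)]
  have "AE x in lebesgue. x \<in> {a<..<b} \<longrightarrow> g x - g' x = 0"
  proof (rule fundamental_lemma)
    show "set_integrable lebesgue {a<..<b} (\<lambda>x. g x - g' x)" by (intro set_integral_diff si)
    fix \<psi> assume \<psi>: "test_fun a b \<psi>"
    have c: "continuous_on UNIV \<psi>" by (rule C_inf_continuous[OF test_fun_C_inf[OF \<psi>]])
    have "(LINT y:{a<..<b}|lebesgue. (g y - g' y) * \<psi> y) = (LINT y:{a<..<b}|lebesgue. g y * \<psi> y) - (LINT y:{a<..<b}|lebesgue. g' y * \<psi> y)"
      using set_integral_diff(2)[OF test_integrable[OF si(1) c] test_integrable[OF si(2) c]] by (simp add: algebra_simps)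
    then show "(LINT y:{a<..<b}|lebesgue. (g y - g' y) * \<psi> y) = 0"
      using assms(3,4) \<psi> by (simp add: weak_deriv_def)
  qed
  then show ?thesis by simp
qed

lemma H1_dz: assumes "H1 L u" shows "L2_on 0 L (dz L u)" "weak_deriv 0 L u (dz L u)"
proof -
  have "\<exists>g. L2_on 0 L g \<and> weak_deriv 0 L u g" using assms by (simp add: H1_def)
  from someI_ex[OF this] show "L2_on 0 L (dz L u)" "weak_deriv 0 L u (dz L u)" by (simp_all add: dz_def)
qed

lemma H1_repr: assumes "L > 0" "H1 L u" "x \<in> {0..L}" shows "u x = u 0 + prim (dz L u) x"
  unfolding prim_def using assms H1_dz[OF assms(2)]
  by (intro weak_deriv_imp_primitive[of 0 L]) (auto simp: H1_def L2_on_integrable)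

lemma prim_continuous: assumes "L2_on 0 L g" shows "continuous_on {0..L} (prim g)"
  unfolding prim_def[abs_def] by (rule primitive_continuous[OF L2_on_integrable[OF assms]])

text \<open>Together with \<open>H1_repr\<close> this identifies the Sobolev space with constants
  plus primitives of square-integrable functions; in this form elements are constructed.\<close>

lemma H1_intro: assumes L: "L > 0" and g: "L2_on 0 L g" and u: "\<And>x. x \<in> {0..L} \<Longrightarrow> u x = k + prim g x"
  shows "H1 L u" "AE x in lebesgue. x \<in> {0<..<L} \<longrightarrow> dz L u x = g x"
proof -
  have "continuous_on {0..L} (\<lambda>x. k + prim g x)" by (intro continuous_intros prim_continuous[OF g])
  then have c: "continuous_on {0..L} u" using u by (subst continuous_on_cong[OF refl]) auto
  have w: "weak_deriv 0 L u g"
    by (rule weak_deriv_primitive[OF L L2_on_integrable[OF g], of _ k]) (use u in \<open>auto simp: prim_def\<close>)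
  show h: "H1 L u" using c w g continuous_L2_on[OF c] by (auto simp: H1_def)
  show "AE x in lebesgue. x \<in> {0<..<L} \<longrightarrow> dz L u x = g x"
    by (rule weak_deriv_unique[OF H1_dz(1)[OF h] g H1_dz(2)[OF h] w])
qed

lemma L2_on_add_scale: "L2_on a b f \<Longrightarrow> L2_on a b g \<Longrightarrow> L2_on a b (\<lambda>x. f x + c * g x)"
  using sqint_add[of _ f "\<lambda>x. c *\<^sub>R g x"] sqint_scaleR[of _ g c] by (simp add: L2_on_iff_sqint)

lemma H1_add_scale: assumes L: "L > 0" and u: "H1 L u" and v: "H1 L v"
  shows "H1 L (\<lambda>x. u x + c * v x)"
    "AE x in lebesgue. x \<in> {0<..<L} \<longrightarrow> dz L (\<lambda>x. u x + c * v x) x = dz L u x + c * dz L v x"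
proof -
  note g = L2_on_add_scale[OF H1_dz(1)[OF u] H1_dz(1)[OF v], of c]
  have e: "u x + c * v x = (u 0 + c * v 0) + prim (\<lambda>x. dz L u x + c * dz L v x) x" if "x \<in> {0..L}" for x
  proof -
    have "prim (\<lambda>x. dz L u x + c * dz L v x) x = prim (dz L u) x + c * prim (dz L v) x"
      unfolding prim_def using that
      by (intro LINT_set_add_scale set_integrable_subinterval[OF L2_on_integrable[OF H1_dz(1)[OF u]]]
           set_integrable_subinterval[OF L2_on_integrable[OF H1_dz(1)[OF v]]]) auto
    then show ?thesis using H1_repr[OF L u that] H1_repr[OF L v that] by (simp add: algebra_simps)
  qed
  show "H1 L (\<lambda>x. u x + c * v x)" by (rule H1_intro(1)[OF L g e])
  show "AE x in lebesgue. x \<in> {0<..<L} \<longrightarrow> dz L (\<lambda>x. u x + c * v x) x = dz L u x + c * dz L v x"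
    by (rule H1_intro(2)[OF L g e])
qed

lemma H1_smooth: assumes L: "L > 0" and d: "\<And>x. (u has_real_derivative u' x) (at x)" and c: "continuous_on UNIV u'"
  shows "H1 L u" "AE x in lebesgue. x \<in> {0<..<L} \<longrightarrow> dz L u x = u' x"
proof -
  have g: "L2_on 0 L u'" by (rule continuous_L2_on) (rule continuous_on_subset[OF c], simp)
  have e: "u x = u 0 + prim u' x" if "x \<in> {0..L}" for x
  proof -
    have "(u' has_integral (u x - u 0)) {0..x}"
      using that d by (intro fundamental_theorem_of_calculus)
        (auto simp flip: has_real_derivative_iff_has_vector_derivative intro: has_field_derivative_at_within)
    then have "integral {0..x} u' = u x - u 0" by (rule integral_unique)
    then have "integral {0<..<x} u' = u x - u 0" by (metis integral_open_interval_real)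
    moreover have si: "set_integrable lebesgue {0<..<x} u'"
      by (rule set_integrable_subinterval[OF L2_on_integrable[OF g]]) (use that in auto)
    ultimately show ?thesis using set_lebesgue_integral_eq_integral(2)[OF si] by (simp add: prim_def)
  qed
  show "H1 L u" by (rule H1_intro(1)[OF L g e])
  show "AE x in lebesgue. x \<in> {0<..<L} \<longrightarrow> dz L u x = u' x" by (rule H1_intro(2)[OF L g e])
qed

lemma H1_by_parts:
  assumes L: "L > 0" and u: "H1 L u" and d: "\<And>x. (\<psi> has_real_derivative \<psi>' x) (at x)" and c: "continuous_on UNIV \<psi>'"
  shows "(LINT x:{0<..<L}|lebesgue. dz L u x * \<psi> x) = u L * \<psi> L - u 0 * \<psi> 0 - (LINT x:{0<..<L}|lebesgue. u x * \<psi>' x)"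
proof -
  let ?I = "\<lambda>f. LINT x:{0<..<L}|lebesgue. f x"
  note g = L2_on_integrable[OF H1_dz(1)[OF u]]
  have cu: "continuous_on {0..L} u" using u by (simp add: H1_def)
  have cp: "continuous_on {0..L} (prim (dz L u))" by (rule prim_continuous[OF H1_dz(1)[OF u]])
  have c': "continuous_on {0..L} \<psi>'" by (rule continuous_on_subset[OF c]) simp
  have si: "set_integrable lebesgue {0<..<L} f" if "continuous_on {0..L} f" for f :: "real \<Rightarrow> real"
    by (rule L2_on_integrable[OF continuous_L2_on[OF that]])
  have 1: "?I (\<lambda>x. prim (dz L u) x * \<psi>' x) = prim (dz L u) L * \<psi> L - ?I (\<lambda>x. dz L u x * \<psi> x)"
    unfolding prim_def by (rule primitive_by_parts[OF L g d c])
  have 2: "?I \<psi>' = \<psi> L - \<psi> 0"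
  proof -
    have "(\<psi>' has_integral (\<psi> L - \<psi> 0)) {0..L}"
      using L d by (intro fundamental_theorem_of_calculus)
        (auto simp flip: has_real_derivative_iff_has_vector_derivative intro: has_field_derivative_at_within)
    then have "integral {0<..<L} \<psi>' = \<psi> L - \<psi> 0" using integral_unique integral_open_interval_real by metis
    then show ?thesis using set_lebesgue_integral_eq_integral(2)[OF si[OF c']] by simp
  qed
  have "?I (\<lambda>x. u x * \<psi>' x) = ?I (\<lambda>x. prim (dz L u) x * \<psi>' x + u 0 * \<psi>' x)"
  proof (rule set_lebesgue_integral_cong)
    have "u x * \<psi>' x = prim (dz L u) x * \<psi>' x + u 0 * \<psi>' x" if "x \<in> {0..L}" for x
      using H1_repr[OF L u that] by (simp add: algebra_simps)
    then show "\<forall>x. x \<in> {0<..<L} \<longrightarrow> u x * \<psi>' x = prim (dz L u) x * \<psi>' x + u 0 * \<psi>' x" by auto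
  qed simp
  also have "\<dots> = ?I (\<lambda>x. prim (dz L u) x * \<psi>' x) + u 0 * ?I \<psi>'"
    by (intro LINT_set_add_scale si continuous_intros cp c')
  finally have "?I (\<lambda>x. u x * \<psi>' x) = prim (dz L u) L * \<psi> L - ?I (\<lambda>x. dz L u x * \<psi> x) + u 0 * (\<psi> L - \<psi> 0)"
    using 1 2 by simp
  moreover have "u L = u 0 + prim (dz L u) L" by (rule H1_repr[OF L u]) (use L in simp)
  then have "prim (dz L u) L = u L - u 0" by simp
  ultimately show ?thesis by (simp add: algebra_simps)
qed

section \<open>Triples as weighted vector-valued functions\<close>

lemma sqint_Pair_iff:
  fixes a :: "'a \<Rightarrow> 'b::euclidean_space" and b :: "'a \<Rightarrow> 'c::euclidean_space"
  shows "sqint M (\<lambda>z. (a z, b z)) \<longleftrightarrow> sqint M a \<and> sqint M b"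
proof -
  have n: "(norm (x, y))\<^sup>2 = (norm x)\<^sup>2 + (norm y)\<^sup>2" for x :: 'b and y :: 'c by (simp add: norm_Pair)
  show ?thesis
  proof
    assume s: "sqint M (\<lambda>z. (a z, b z))"
    then have m: "(\<lambda>z. (a z, b z)) \<in> borel_measurable M" and i: "integrable M (\<lambda>z. (norm (a z))\<^sup>2 + (norm (b z))\<^sup>2)"
      by (auto simp: sqint_def n)
    have "(\<lambda>z. fst (a z, b z)) \<in> borel_measurable M" "(\<lambda>z. snd (a z, b z)) \<in> borel_measurable M"
      by (rule measurable_compose[OF m borel_measurable_continuous_onI], intro continuous_intros)+
    then have [measurable]: "a \<in> borel_measurable M" "b \<in> borel_measurable M" by auto
    have "integrable M (\<lambda>z. (norm (a z))\<^sup>2)" by (rule Bochner_Integration.integrable_bound[OF i]) auto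
    moreover have "integrable M (\<lambda>z. (norm (b z))\<^sup>2)" by (rule Bochner_Integration.integrable_bound[OF i]) auto
    ultimately show "sqint M a \<and> sqint M b" by (simp add: sqint_def)
  next
    assume "sqint M a \<and> sqint M b"
    then show "sqint M (\<lambda>z. (a z, b z))" by (auto simp: sqint_def n borel_measurable_Pair)
  qed
qed

lemma ip_Pair: assumes "sqint M a" "sqint M b" "sqint M a'" "sqint M b'"
  shows "ip M (\<lambda>z. (a z, b z)) (\<lambda>z. (a' z, b' z)) = ip M a a' + ip M b b'"
  using assms by (simp add: ip_def sqint_inner_integrable)

lemma co_mk[simp]: "co (a, b, c) = a" and ci_mk[simp]: "ci (a, b, c) = b" and ce_mk[simp]: "ce (a, b, c) = c"
  by (simp_all add: co_def ci_def ce_def)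

lemma tadd_comp[simp]: "co (tadd U W) = (\<lambda>z. co U z + co W z)" "ci (tadd U W) = (\<lambda>z. ci U z + ci W z)"
   "ce (tadd U W) = (\<lambda>z. ce U z + ce W z)" by (simp_all add: tadd_def)
lemma tscale_comp[simp]: "co (tscale c W) = (\<lambda>z. c * co W z)" "ci (tscale c W) = (\<lambda>z. c * ci W z)"
   "ce (tscale c W) = (\<lambda>z. c * ce W z)" by (simp_all add: tscale_def)

locale wells =
  fixes L ao ai ae :: real
  assumes L: "L > 0" and ao: "ao > 0" and ai: "ai > 0" and ae: "ae > 0"
begin

abbreviation "M \<equiv> lebesgue_on {0<..<L}"

text \<open>The square roots of the weights turn the weighted product \<open>H_inner\<close>, which
  realises the pairing of V' and V on \<open>H\<close>, into an ordinary L2 product of functions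
  into R^3.\<close>

definition lift :: "triple \<Rightarrow> real \<Rightarrow> real \<times> real \<times> real" where
  "lift U z = (sqrt ao * co U z, sqrt ai * ci U z, sqrt ae * ce U z)"

definition Dlift :: "triple \<Rightarrow> real \<Rightarrow> real \<times> real \<times> real" where
  "Dlift U z = (sqrt ao * dz L (co U) z, sqrt ai * dz L (ci U) z, sqrt ae * dz L (ce U) z)"

definition nD :: "triple \<Rightarrow> real" where "nD U = ip M (Dlift U) (Dlift U)"
definition nH :: "triple \<Rightarrow> real" where "nH U = ip M (lift U) (lift U)"

lemma sqint_cmult_iff: "c \<noteq> 0 \<Longrightarrow> sqint M (\<lambda>z. c * f z) \<longleftrightarrow> sqint M f" for f :: "real \<Rightarrow> real"
  using sqint_scaleR[of M f c] sqint_scaleR[of M "\<lambda>z. c * f z" "1/c"] by auto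

lemma sqint_lift: "sqint M (lift U) \<longleftrightarrow> inH L U"
  unfolding lift_def[abs_def] inH_def L2_on_iff_sqint using ao ai ae by (simp add: sqint_Pair_iff sqint_cmult_iff)

lemma inV_inH: "inV L \<Phi> \<Longrightarrow> inH L \<Phi>"
  by (auto simp: inV_def inH_def H1_def)

lemma sqint_lift_V: "inV L \<Phi> \<Longrightarrow> sqint M (lift \<Phi>)"
  by (simp add: sqint_lift inV_inH)

lemma sqint_Dlift: "inV L \<Phi> \<Longrightarrow> sqint M (Dlift \<Phi>)"
  unfolding Dlift_def[abs_def] using ao ai ae
  by (simp add: sqint_Pair_iff sqint_cmult_iff inV_def H1_dz(1)[unfolded L2_on_iff_sqint])

lemma ip_triple:
  fixes a b c a' b' c' :: "real \<Rightarrow> real"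
  assumes "sqint M a" "sqint M b" "sqint M c" "sqint M a'" "sqint M b'" "sqint M c'"
  shows "ip M (\<lambda>z. (a z, b z, c z)) (\<lambda>z. (a' z, b' z, c' z)) = ip M a a' + (ip M b b' + ip M c c')"
  using assms by (simp add: ip_Pair sqint_Pair_iff)

lemma H_inner_ip: assumes "inH L U" "inH L W" shows "H_inner L ao ai ae U W = ip M (lift U) (lift W)"
proof -
  have s: "sqint M (co U)" "sqint M (ci U)" "sqint M (ce U)" "sqint M (co W)" "sqint M (ci W)" "sqint M (ce W)"
    using assms by (auto simp: inH_def L2_on_iff_sqint)
  have sc: "sqint M (\<lambda>z. c * f z)" if "sqint M f" for c and f :: "real \<Rightarrow> real" using sqint_scaleR[OF that, of c] by simp
  have pr: "ip M (\<lambda>z. c * f z) (\<lambda>z. c * g z) = c * c * ip M f g" for c and f g :: "real \<Rightarrow> real"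
    using ip_scaleR_left[of M c f "\<lambda>z. c *\<^sub>R g z"] ip_scaleR_right[of M f c g] by simp
  have "ip M (lift U) (lift W) = ao * ip M (co U) (co W) + (ai * ip M (ci U) (ci W) + ae * ip M (ce U) (ce W))"
    unfolding lift_def[abs_def] using ao ai ae by (subst ip_triple) (auto intro!: sc s simp: pr)
  then show ?thesis by (simp add: H_inner_def ip_def LINT_eq_on)
qed

lemma ae_eq_H_iff: "ae_eq_H L U W \<longleftrightarrow> (AE z in M. lift U z = lift W z)"
proof -
  have "(AE z in lebesgue. z \<in> {0<..<L} \<longrightarrow> co U z = co W z \<and> ci U z = ci W z \<and> ce U z = ce W z)
    \<longleftrightarrow> (AE z in M. co U z = co W z \<and> ci U z = ci W z \<and> ce U z = ce W z)"
    by (rule AE_eq_on) simp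
  then show ?thesis unfolding ae_eq_H_def using ao ai ae by (simp add: lift_def)
qed

lemma AE_M: "(AE x in lebesgue. x \<in> {0<..<L} \<longrightarrow> P x) \<Longrightarrow> (AE x in M. P x)"
  by (subst AE_eq_on[symmetric]) auto

lemma tadd_V: assumes "inV L \<Phi>" "inV L \<Psi>"
  shows "inV L (tadd \<Phi> (tscale c \<Psi>))" "AE z in M. Dlift (tadd \<Phi> (tscale c \<Psi>)) z = Dlift \<Phi> z + c *\<^sub>R Dlift \<Psi> z"
proof -
  show "inV L (tadd \<Phi> (tscale c \<Psi>))" using assms H1_add_scale(1)[OF L] by (auto simp: inV_def)
  have "AE z in M. dz L (\<lambda>x. u x + c * v x) z = dz L u z + c * dz L v z" if "H1 L u" "H1 L v" for u v
    using H1_add_scale(2)[OF L that, of c] by (rule AE_M)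
  from this[of "co \<Phi>" "co \<Psi>"] this[of "ci \<Phi>" "ci \<Psi>"] this[of "ce \<Phi>" "ce \<Psi>"]
  have "AE z in M. dz L (\<lambda>x. co \<Phi> x + c * co \<Psi> x) z = dz L (co \<Phi>) z + c * dz L (co \<Psi>) z"
    "AE z in M. dz L (\<lambda>x. ci \<Phi> x + c * ci \<Psi> x) z = dz L (ci \<Phi>) z + c * dz L (ci \<Psi>) z"
    "AE z in M. dz L (\<lambda>x. ce \<Phi> x + c * ce \<Psi> x) z = dz L (ce \<Phi>) z + c * dz L (ce \<Psi>) z"
    using assms by (auto simp: inV_def)
  then show "AE z in M. Dlift (tadd \<Phi> (tscale c \<Psi>)) z = Dlift \<Phi> z + c *\<^sub>R Dlift \<Psi> z"
    by eventually_elim (simp add: Dlift_def algebra_simps)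
qed

lemma lift_tadd: "lift (tadd \<Phi> (tscale c \<Psi>)) z = lift \<Phi> z + c *\<^sub>R lift \<Psi> z"
  by (simp add: lift_def algebra_simps)

lemma tadd_H: "inH L \<Phi> \<Longrightarrow> inH L \<Psi> \<Longrightarrow> inH L (tadd \<Phi> (tscale c \<Psi>))"
  unfolding sqint_lift[symmetric] lift_tadd[abs_def] by (intro sqint_add sqint_scaleR)

definition tzero :: triple where "tzero = (\<lambda>z. 0, \<lambda>z. 0, \<lambda>z. 0)"

lemma tzero_V: "inV L tzero" "AE z in M. Dlift tzero z = 0" "lift tzero z = 0"
proof -
  have z: "H1 L (\<lambda>_. 0)" by (rule H1_smooth(1)[OF L, of _ "\<lambda>_. 0"]) auto
  have z2: "AE x in lebesgue. x \<in> {0<..<L} \<longrightarrow> dz L (\<lambda>_. 0) x = 0"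
    by (rule H1_smooth(2)[OF L]) auto
  show "inV L tzero" using z by (simp add: tzero_def inV_def)
  have "AE x in M. dz L (\<lambda>x. 0) x = 0" by (rule AE_M[OF z2])
  then show "AE z in M. Dlift tzero z = 0" by eventually_elim (simp add: Dlift_def tzero_def zero_prod_def)
  show "lift tzero z = 0" by (simp add: lift_def tzero_def zero_prod_def)
qed

section \<open>The eigenbasis\<close>

definition \<theta> where "\<theta> = arctan (sqrt (ai / ae))"

lemma \<theta>: "0 < \<theta>" "\<theta> < pi / 2" "sqrt ae * sin \<theta> = sqrt ai * cos \<theta>"
proof -
  show "0 < \<theta>" using ai ae by (simp add: \<theta>_def)
  show "\<theta> < pi / 2" unfolding \<theta>_def by (rule arctan_ubound)
  have "cos \<theta> \<noteq> 0" by (simp add: \<theta>_def)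
  moreover have "tan \<theta> = sqrt ai / sqrt ae" by (simp add: \<theta>_def tan_arctan real_sqrt_divide)
  ultimately show "sqrt ae * sin \<theta> = sqrt ai * cos \<theta>" using ae by (simp add: tan_def field_simps)
qed

text \<open>Even indices enumerate the oil modes, odd ones the modes of the coupled water components; for
  the latter \<open>tan (freq k * L) = sqrt (ai / ae)\<close> is forced by the condition at \<open>L\<close>.\<close>
definition freq :: "nat \<Rightarrow> real" where
  "freq k = (if even k then (real (k div 2) + 1/2) * (pi / L) else (\<theta> + real_of_int (int_decode (k div 2)) * pi) / L)"

definition lam :: "nat \<Rightarrow> real" where "lam k = (freq k)\<^sup>2"

definition eb :: "nat \<Rightarrow> triple" where
  "eb k = (if even k then (\<lambda>z. sqrt (2 / L) / sqrt ao * cos (freq k * z), \<lambda>z. 0, \<lambda>z. 0)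
     else (\<lambda>z. 0, \<lambda>z. 1 / (sqrt ai * sqrt L) * sin (freq k * z), \<lambda>z. 1 / (sqrt ae * sqrt L) * cos (freq k * z)))"

definition deb :: "nat \<Rightarrow> real \<Rightarrow> real \<times> real \<times> real" where
  "deb k z = (if even k then (- (sqrt (2 / L) * freq k) * sin (freq k * z), 0, 0)
     else (0, freq k / sqrt L * cos (freq k * z), - (freq k / sqrt L) * sin (freq k * z)))"

lemma lift_eb: "lift (eb k) z = (if even k then (sqrt (2 / L) * cos (freq k * z), 0, 0)
   else (0, 1 / sqrt L * sin (freq k * z), 1 / sqrt L * cos (freq k * z)))"
  using ao ai ae by (simp add: lift_def eb_def)

text \<open>For n >= 0 the numerator \<theta> + n \<pi> is positive, and for n <= -1 it is at most
  \<theta> - \<pi> < 0. Hence 0 is not an eigenvalue, and the derivatives of the eigenfunctions can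
  be normalised by dividing by \<open>freq\<close>.\<close>

lemma freq_nz: "freq k \<noteq> 0"
proof (cases "even k")
  case True
  have "(real (k div 2) + 1/2) * (pi / L) > 0" using L by (intro mult_pos_pos) auto
  then show ?thesis using True L by (simp add: freq_def)
next
  case False
  define n where "n = int_decode (k div 2)"
  have "\<theta> + real_of_int n * pi \<noteq> 0"
  proof (cases "n \<ge> 0")
    case True
    then have "0 \<le> real_of_int n * pi" by simp
    then show ?thesis using \<theta> by linarith
  next
    case False
    then have "real_of_int n * pi \<le> (- 1) * pi" by (intro mult_right_mono) auto
    then show ?thesis using \<theta> pi_gt_zero by linarith
  qed
  then show ?thesis using False L by (simp add: freq_def n_def)
qed

lemma lam_pos: "lam k > 0" using freq_nz[of k] by (simp add: lam_def)

lemma freq_L_even: "even k \<Longrightarrow> cos (freq k * L) = 0"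
proof -
  assume "even k"
  then have "freq k * L = real (k div 2) * pi + pi / 2" using L by (simp add: freq_def algebra_simps)
  then show ?thesis by (simp add: cos_add)
qed

text \<open>One identity with two uses: after rescaling it is the matching of the two water
  components at \<open>L\<close>, and in the integration by parts it is the flux balance ai ci' + ae
  ce' = 0 at \<open>L\<close> that removes the boundary term.\<close>

lemma freq_L_odd: "odd k \<Longrightarrow> sqrt ae * sin (freq k * L) = sqrt ai * cos (freq k * L)"
proof -
  assume "odd k"
  define n where "n = int_decode (k div 2)"
  have "freq k * L = \<theta> + pi * real_of_int n" using L \<open>odd k\<close> by (simp add: freq_def n_def mult.commute)
  moreover have "sin (pi * real_of_int n) = 0" by (simp add: sin_zero_iff_int2)
  ultimately have "sin (freq k * L) = sin \<theta> * cos (pi * real_of_int n)" "cos (freq k * L) = cos \<theta> * cos (pi * real_of_int n)"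
    by (simp_all add: sin_add cos_add)
  then show ?thesis using \<theta>(3) by (metis mult.assoc)
qed

lemma eb_V: "inV L (eb k)" "AE z in M. Dlift (eb k) z = deb k z"
proof -
  have z: "H1 L (\<lambda>_. 0)" "AE x in M. dz L (\<lambda>_. 0) x = 0"
    using H1_smooth[OF L, of "\<lambda>_. 0" "\<lambda>_. 0"] by (auto intro!: AE_M)
  have c: "H1 L (\<lambda>z. a * cos (freq k * z))" "AE x in M. dz L (\<lambda>z. a * cos (freq k * z)) x = - (a * freq k) * sin (freq k * x)" for a
  proof -
    have "((\<lambda>z. a * cos (freq k * z)) has_real_derivative - (a * freq k) * sin (freq k * x)) (at x)" for x
      by (auto intro!: derivative_eq_intros)
    note * = H1_smooth[OF L this]
    show "H1 L (\<lambda>z. a * cos (freq k * z))" by (rule *(1)) (intro continuous_intros)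
    have "AE x in lebesgue. x \<in> {0<..<L} \<longrightarrow> dz L (\<lambda>z. a * cos (freq k * z)) x = - (a * freq k) * sin (freq k * x)"
      by (rule *(2)) (intro continuous_intros)
    then show "AE x in M. dz L (\<lambda>z. a * cos (freq k * z)) x = - (a * freq k) * sin (freq k * x)" by (rule AE_M)
  qed
  have s: "H1 L (\<lambda>z. a * sin (freq k * z))" "AE x in M. dz L (\<lambda>z. a * sin (freq k * z)) x = (a * freq k) * cos (freq k * x)" for a
  proof -
    have "((\<lambda>z. a * sin (freq k * z)) has_real_derivative (a * freq k) * cos (freq k * x)) (at x)" for x
      by (auto intro!: derivative_eq_intros)
    note * = H1_smooth[OF L this]
    show "H1 L (\<lambda>z. a * sin (freq k * z))" by (rule *(1)) (intro continuous_intros)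
    have "AE x in lebesgue. x \<in> {0<..<L} \<longrightarrow> dz L (\<lambda>z. a * sin (freq k * z)) x = (a * freq k) * cos (freq k * x)"
      by (rule *(2)) (intro continuous_intros)
    then show "AE x in M. dz L (\<lambda>z. a * sin (freq k * z)) x = (a * freq k) * cos (freq k * x)" by (rule AE_M)
  qed
  have bc: "1 / (sqrt ai * sqrt L) * sin (freq k * L) = 1 / (sqrt ae * sqrt L) * cos (freq k * L)" if "odd k"
  proof -
    have "sqrt ae * sin (freq k * L) * (1 / (sqrt ai * sqrt ae * sqrt L)) = sqrt ai * cos (freq k * L) * (1 / (sqrt ai * sqrt ae * sqrt L))"
      using freq_L_odd[OF that] by simp
    then show ?thesis using ai ae L by simp
  qed
  show "inV L (eb k)"
    unfolding inV_def eb_def using z(1) freq_L_even[of k] bc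
      c(1)[of "sqrt (2 / L) / sqrt ao"] c(1)[of "1 / (sqrt ae * sqrt L)"] s(1)[of "1 / (sqrt ai * sqrt L)"]
    by simp
  show "AE z in M. Dlift (eb k) z = deb k z"
  proof (cases "even k")
    case True
    show ?thesis using c(2)[of "sqrt (2 / L) / sqrt ao"] z(2)
      by eventually_elim (use True ao in \<open>simp add: Dlift_def eb_def deb_def\<close>)
  next
    case False
    show ?thesis using c(2)[of "1 / (sqrt ae * sqrt L)"] s(2)[of "1 / (sqrt ai * sqrt L)"] z(2)
      by eventually_elim (use False ai ae in \<open>simp add: Dlift_def eb_def deb_def\<close>)
  qed
qed

lemma Dlift_eb_measurable: "Dlift (eb k) \<in> borel_measurable M" "deb k \<in> borel_measurable M"
proof -
  show "Dlift (eb k) \<in> borel_measurable M" using sqint_Dlift[OF eb_V(1)] by (rule sqint_measurable)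
  have "deb k \<in> borel_measurable borel"
    unfolding deb_def[abs_def] by (cases "even k") (auto intro!: borel_measurable_continuous_onI continuous_intros)
  then have "deb k \<in> borel_measurable lebesgue" by (intro measurable_completion) simp
  then show "deb k \<in> borel_measurable M" by (rule measurable_restrict_space1)
qed

lemma ip_Dlift_deb: assumes "sqint M f" shows "ip M f (Dlift (eb k)) = ip M f (deb k)"
  using eb_V(2) Dlift_eb_measurable sqint_measurable[OF assms] by (intro ip_AE_cong) auto

lemma sqint_trig: "sqint M (\<lambda>z. a * cos (b * z))" "sqint M (\<lambda>z. a * sin (b * z))" for a b :: real
  by (auto simp flip: L2_on_iff_sqint intro!: continuous_L2_on continuous_intros)

text \<open>Integration by parts; both boundary terms vanish because of the conditions defining \<open>V\<close>.\<close>
lemma eigen: assumes "inV L \<Phi>"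
  shows "ip M (Dlift \<Phi>) (Dlift (eb k)) = lam k * ip M (lift \<Phi>) (lift (eb k))"
proof -
  have V: "H1 L (co \<Phi>)" "H1 L (ci \<Phi>)" "H1 L (ce \<Phi>)" "co \<Phi> L = 0" "ci \<Phi> 0 = 0" "ci \<Phi> L = ce \<Phi> L"
    using assms by (auto simp: inV_def)
  let ?\<kappa> = "freq k"
  have sq: "sqint M u" "sqint M (dz L u)" if "H1 L u" for u
    using that H1_dz(1)[OF that] by (auto simp: H1_def simp flip: L2_on_iff_sqint)
  have ps: "ip M (dz L u) (\<lambda>z. sin (?\<kappa> * z)) = u L * sin (?\<kappa> * L) - ?\<kappa> * ip M u (\<lambda>z. cos (?\<kappa> * z))" if "H1 L u" for u
  proof -
    have d: "((\<lambda>z. sin (?\<kappa> * z)) has_real_derivative (?\<kappa> * cos (?\<kappa> * x))) (at x)" for x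
      by (auto intro!: derivative_eq_intros)
    have m: "(\<lambda>x. u x * (?\<kappa> * cos (?\<kappa> * x))) = (\<lambda>x. ?\<kappa> * (u x * cos (?\<kappa> * x)))" by (simp add: fun_eq_iff)
    have "(LINT x:{0<..<L}|lebesgue. dz L u x * sin (?\<kappa> * x)) = u L * sin (?\<kappa> * L) - u 0 * sin (?\<kappa> * 0) - (LINT x:{0<..<L}|lebesgue. u x * (?\<kappa> * cos (?\<kappa> * x)))"
      by (rule H1_by_parts[OF L that d]) (intro continuous_intros)
    moreover have "(LINT x:{0<..<L}|lebesgue. u x * (?\<kappa> * cos (?\<kappa> * x))) = ?\<kappa> * ip M u (\<lambda>z. cos (?\<kappa> * z))"
      unfolding m by (simp add: LINT_eq_on ip_def)
    ultimately show ?thesis by (simp add: LINT_eq_on ip_def)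
  qed
  have pc: "ip M (dz L u) (\<lambda>z. cos (?\<kappa> * z)) = u L * cos (?\<kappa> * L) - u 0 + ?\<kappa> * ip M u (\<lambda>z. sin (?\<kappa> * z))" if "H1 L u" for u
  proof -
    have d: "((\<lambda>z. cos (?\<kappa> * z)) has_real_derivative (- ?\<kappa> * sin (?\<kappa> * x))) (at x)" for x
      by (auto intro!: derivative_eq_intros)
    have m: "(\<lambda>x. u x * (- ?\<kappa> * sin (?\<kappa> * x))) = (\<lambda>x. - ?\<kappa> * (u x * sin (?\<kappa> * x)))" by (simp add: fun_eq_iff)
    have "(LINT x:{0<..<L}|lebesgue. dz L u x * cos (?\<kappa> * x)) = u L * cos (?\<kappa> * L) - u 0 * cos (?\<kappa> * 0) - (LINT x:{0<..<L}|lebesgue. u x * (- ?\<kappa> * sin (?\<kappa> * x)))"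
      by (rule H1_by_parts[OF L that d]) (intro continuous_intros)
    moreover have "(LINT x:{0<..<L}|lebesgue. u x * (- ?\<kappa> * sin (?\<kappa> * x))) = - ?\<kappa> * ip M u (\<lambda>z. sin (?\<kappa> * z))"
      unfolding m by (simp add: LINT_eq_on ip_def)
    ultimately show ?thesis by (simp add: LINT_eq_on ip_def)
  qed
  have ipm: "ip M (\<lambda>z. a * f z) (\<lambda>z. b * g z) = a * b * ip M f g" for a b and f g :: "real \<Rightarrow> real"
    using ip_scaleR_left[of M a f "\<lambda>z. b *\<^sub>R g z"] ip_scaleR_right[of M f b g] by simp
  have sc: "sqint M (\<lambda>z. a * f z)" if "sqint M f" for a and f :: "real \<Rightarrow> real" using sqint_scaleR[OF that, of a] by simp
  have "ip M (Dlift \<Phi>) (deb k) = lam k * ip M (lift \<Phi>) (lift (eb k))"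
  proof (cases "even k")
    case True
    have "ip M (Dlift \<Phi>) (deb k) = sqrt ao * (- (sqrt (2 / L) * ?\<kappa>)) * ip M (dz L (co \<Phi>)) (\<lambda>z. sin (?\<kappa> * z))"
      unfolding Dlift_def[abs_def] deb_def[abs_def] using True
      by (simp only: if_True, subst ip_triple) (rule sqint_trig sqint_zero sc sq(2) V | simp only: ipm ip_zero add_0_right)+
    moreover have "ip M (lift \<Phi>) (lift (eb k)) = sqrt ao * sqrt (2 / L) * ip M (co \<Phi>) (\<lambda>z. cos (?\<kappa> * z))"
      unfolding lift_eb[abs_def] unfolding lift_def[abs_def] using True
      by (simp only: if_True, subst ip_triple) (rule sqint_trig sqint_zero sc sq(1) V | simp only: ipm ip_zero add_0_right)+
    ultimately show ?thesis using V by (simp add: ps lam_def power2_eq_square)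
  next
    case False
    have t: "sqint M (\<lambda>z. sin (?\<kappa> * z))" "sqint M (\<lambda>z. cos (?\<kappa> * z))"
      using sqint_trig[of 1 ?\<kappa>] by simp_all
    have "ip M (Dlift \<Phi>) (deb k) = sqrt ai * (?\<kappa> / sqrt L) * ip M (dz L (ci \<Phi>)) (\<lambda>z. cos (?\<kappa> * z))
        + sqrt ae * (- (?\<kappa> / sqrt L)) * ip M (dz L (ce \<Phi>)) (\<lambda>z. sin (?\<kappa> * z))"
      unfolding Dlift_def[abs_def] deb_def[abs_def] using False
      by (simp only: if_False, subst ip_triple) (rule sqint_trig sqint_zero sc sq(2) V | simp only: ipm ip_zero add_0_left)+
    also have "\<dots> = ?\<kappa> / sqrt L * (ci \<Phi> L * (sqrt ai * cos (?\<kappa> * L) - sqrt ae * sin (?\<kappa> * L)))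
        + ?\<kappa>\<^sup>2 / sqrt L * (sqrt ai * ip M (ci \<Phi>) (\<lambda>z. sin (?\<kappa> * z)) + sqrt ae * ip M (ce \<Phi>) (\<lambda>z. cos (?\<kappa> * z)))"
      unfolding ps[OF V(3)] pc[OF V(2)] V(5,6)
      by (simp add: algebra_simps power2_eq_square add_divide_distrib diff_divide_distrib)
    also have "sqrt ai * cos (?\<kappa> * L) - sqrt ae * sin (?\<kappa> * L) = 0" using freq_L_odd False by simp
    finally have 1: "ip M (Dlift \<Phi>) (deb k) = ?\<kappa>\<^sup>2 / sqrt L * (sqrt ai * ip M (ci \<Phi>) (\<lambda>z. sin (?\<kappa> * z)) + sqrt ae * ip M (ce \<Phi>) (\<lambda>z. cos (?\<kappa> * z)))" by simp
    have "ip M (lift \<Phi>) (lift (eb k)) = sqrt ai * (1 / sqrt L) * ip M (ci \<Phi>) (\<lambda>z. sin (?\<kappa> * z)) + sqrt ae * (1 / sqrt L) * ip M (ce \<Phi>) (\<lambda>z. cos (?\<kappa> * z))"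
      unfolding lift_eb[abs_def] unfolding lift_def[abs_def] using False
      by (simp only: if_False, subst ip_triple) (rule sqint_trig sqint_zero sc sq(1) V | simp only: ipm ip_zero add_0_left)+
    then show ?thesis unfolding 1 lam_def by (simp add: algebra_simps add_divide_distrib)
  qed
  then show ?thesis by (simp add: ip_Dlift_deb sqint_Dlift assms)
qed


text \<open>Oil frequencies are positive, hence determined by their squares. For the water modes the
  other sign would require 2 \<theta> to be an integer multiple of \<pi>, impossible for 0 <
  \<theta> < \<pi> / 2. Simplicity within each family is what orthogonality relies on.\<close>

lemma lam_inj: assumes "even j \<longleftrightarrow> even k" "lam j = lam k" shows "j = k"
proof -
  have f: "freq j = freq k \<or> freq j = - freq k" using assms(2) by (simp add: lam_def power2_eq_iff)
  have "j div 2 = k div 2"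
  proof (cases "even k")
    case True
    have pos: "0 < freq i" if "even i" for i
      using that L by (auto simp: freq_def intro!: divide_pos_pos mult_pos_pos)
    have "freq j = freq k" using f pos[of j] pos[of k] True assms(1) by auto
    then show ?thesis using True assms(1) L by (simp add: freq_def)
  next
    case False
    define n n' where "n = int_decode (j div 2)" and "n' = int_decode (k div 2)"
    have e: "\<theta> + real_of_int n * pi = \<theta> + real_of_int n' * pi \<or> \<theta> + real_of_int n * pi = - (\<theta> + real_of_int n' * pi)"
    proof -
      have fj: "freq j = (\<theta> + real_of_int n * pi) / L" and fk: "freq k = (\<theta> + real_of_int n' * pi) / L"
        using False assms(1) by (auto simp: freq_def n_def n'_def)
      show ?thesis using f L unfolding fj fk minus_divide_left by simp
    qed
    have "\<theta> + real_of_int n * pi \<noteq> - (\<theta> + real_of_int n' * pi)"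
    proof
      assume "\<theta> + real_of_int n * pi = - (\<theta> + real_of_int n' * pi)"
      then have h: "2 * \<theta> = real_of_int (- (n + n')) * pi" by (simp add: algebra_simps)
      define m where "m = - (n + n')"
      have h: "2 * \<theta> = real_of_int m * pi" using h by (simp add: m_def)
      have "0 < real_of_int m * pi" "real_of_int m * pi < 1 * pi"
        unfolding h[symmetric] using \<theta>(1,2) by auto
      then have "0 < real_of_int m" "real_of_int m < 1"
        using pi_gt_zero by (simp_all only: zero_less_mult_iff mult_less_cancel_right_pos) auto
      then show False by simp
    qed
    then have "n = n'" using e by simp
    then show ?thesis unfolding n_def n'_def by (metis int_decode_inverse)
  qed
  then show ?thesis using assms(1) by presburger
qed

text \<open>Only sin^2 + cos^2 = 1 is integrated. For a water mode both terms occur; for an oil mode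
  the eigenvalue identity of \<open>eb k\<close> with itself shows that the two integrals are equal,
  hence L / 2 each.\<close>

lemma ip_eb_eb: "ip M (lift (eb k)) (lift (eb k)) = 1"
proof -
  let ?c = "\<lambda>z. cos (freq k * z)" and ?s = "\<lambda>z. sin (freq k * z)"
  have t: "sqint M ?c" "sqint M ?s" using sqint_trig[of 1 "freq k"] by simp_all
  have sc: "sqint M (\<lambda>z. a * f z)" if "sqint M f" for a and f :: "real \<Rightarrow> real" using sqint_scaleR[OF that, of a] by simp
  have ipm: "ip M (\<lambda>z. a * f z) (\<lambda>z. b * g z) = a * b * ip M f g" for a b and f g :: "real \<Rightarrow> real"
    using ip_scaleR_left[of M a f "\<lambda>z. b *\<^sub>R g z"] ip_scaleR_right[of M f b g] by simp
  have "ip M ?s ?s + ip M ?c ?c = (\<integral>z. 1 \<partial>M)"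
    unfolding ip_def using sqint_inner_integrable[OF t(1) t(1)] sqint_inner_integrable[OF t(2) t(2)]
    by (subst Bochner_Integration.integral_add[symmetric]) (auto simp flip: power2_eq_square)
  then have 1: "ip M ?s ?s + ip M ?c ?c = L" using L by (simp add: measure_restrict_space space_restrict_space)
  show ?thesis
  proof (cases "even k")
    case True
    have a: "ip M (lift (eb k)) (lift (eb k)) = sqrt (2 / L) * sqrt (2 / L) * ip M ?c ?c"
      unfolding lift_eb[abs_def] using True
      by (simp only: if_True, subst ip_triple) (rule sqint_trig sqint_zero | simp only: ipm ip_zero add_0_right)+
    have b: "ip M (deb k) (deb k) = - (sqrt (2 / L) * freq k) * - (sqrt (2 / L) * freq k) * ip M ?s ?s"
      unfolding deb_def[abs_def] using True
      by (simp only: if_True, subst ip_triple) (rule sqint_trig sqint_zero | simp only: ipm ip_zero add_0_right)+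
    have "ip M (deb k) (deb k) = lam k * ip M (lift (eb k)) (lift (eb k))"
    proof -
      have "ip M (Dlift (eb k)) (Dlift (eb k)) = ip M (deb k) (deb k)"
        by (intro ip_AE_cong eb_V(2) Dlift_eb_measurable)
      then show ?thesis using eigen[OF eb_V(1), of k k] by simp
    qed
    then have "freq k * freq k * (2 / L * ip M ?s ?s) = freq k * freq k * (2 / L * ip M ?c ?c)"
      using L unfolding a b lam_def power2_eq_square by (simp add: mult.commute mult.left_commute)
    then have "ip M ?s ?s = ip M ?c ?c" using freq_nz[of k] L by simp
    then show ?thesis using 1 a L by simp
  next
    case False
    have "ip M (lift (eb k)) (lift (eb k)) = 1 / sqrt L * (1 / sqrt L) * ip M ?s ?s + 1 / sqrt L * (1 / sqrt L) * ip M ?c ?c"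
      unfolding lift_eb[abs_def] using False
      by (simp only: if_False, subst ip_triple) (rule sqint_trig sqint_zero | simp only: ipm ip_zero add_0_left)+
    also have "\<dots> = 1 / L * (ip M ?s ?s + ip M ?c ?c)" using L by (simp add: distrib_left)
    finally show ?thesis using 1 L by simp
  qed
qed

text \<open>Within a family, distinct eigenvalues of a symmetric form give orthogonality; modes of
  different families have no common nonzero component.\<close>

lemma ip_eb: "ip M (lift (eb j)) (lift (eb k)) = (if j = k then 1 else 0)"
proof (cases "j = k")
  case True then show ?thesis by (simp add: ip_eb_eb)
next
  case False
  have "ip M (lift (eb j)) (lift (eb k)) = 0"
  proof (cases "even j \<longleftrightarrow> even k")
    case True
    then have ne: "lam j \<noteq> lam k" using lam_inj False by blast
    have "lam k * ip M (lift (eb j)) (lift (eb k)) = lam j * ip M (lift (eb j)) (lift (eb k))"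
      using eigen[OF eb_V(1), of j k] eigen[OF eb_V(1), of k j] by (simp add: ip_commute)
    then show ?thesis using ne by simp
  next
    case False
    then have "lift (eb j) z \<bullet> lift (eb k) z = 0" for z by (auto simp: lift_eb)
    then show ?thesis by (simp add: ip_def)
  qed
  with False show ?thesis by simp
qed

text \<open>The even modes see only the first component and form the half-integer cosine system; the
  odd modes form the shifted sine and cosine system for the other two. The index
  \<open>2 * int_encode n + 1\<close> inverts the enumeration in \<open>freq\<close>.\<close>

lemma eb_total: assumes f: "sqint M f" and z: "\<And>k. ip M f (lift (eb k)) = 0" shows "AE x in M. f x = 0"
proof -
  define f1 f2 f3 where "f1 x = fst (f x)" and "f2 x = fst (snd (f x))" and "f3 x = snd (snd (f x))" for x
  have fe: "f = (\<lambda>x. (f1 x, f2 x, f3 x))" by (simp add: f1_def f2_def f3_def)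
  have s: "sqint M f1" "sqint M f2" "sqint M f3" using f unfolding fe by (simp_all add: sqint_Pair_iff)
  have si: "set_integrable lebesgue {0<..<L} g" if "sqint M g" for g :: "real \<Rightarrow> real"
    using sqint_integrable[OF that] by (simp add: set_integrable_eq_on)
  have ipm: "ip M g (\<lambda>z. b * h z) = b * ip M g h" for b and g h :: "real \<Rightarrow> real"
    using ip_scaleR_right[of M g b h] by simp
  have "AE x in lebesgue. x \<in> {0<..<L} \<longrightarrow> f1 x = 0"
  proof (rule half_cos_total[OF L si[OF s(1)]])
    fix n :: nat
    have "ip M f (lift (eb (2 * n))) = sqrt (2 / L) * ip M f1 (\<lambda>z. cos (freq (2 * n) * z))"
      unfolding lift_eb[abs_def] fe
      by (simp only: dvd_triv_left if_True, subst ip_triple) (rule s sqint_trig sqint_zero | simp only: ipm ip_zero add_0_right)+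
    then have "ip M f1 (\<lambda>z. cos (freq (2 * n) * z)) = 0" using z[of "2 * n"] L by simp
    moreover have "freq (2 * n) = (real n + 1 / 2) * (pi / L)" by (simp add: freq_def)
    ultimately show "(LINT x:{0<..<L}|lebesgue. f1 x * cos ((real n + 1/2) * (pi / L) * x)) = 0"
      by (simp only: LINT_eq_on ip_def inner_real_def) (simp add: LINT_eq_on)
  qed
  moreover have "AE x in lebesgue. x \<in> {0<..<L} \<longrightarrow> f2 x = 0 \<and> f3 x = 0"
  proof (rule shifted_sin_cos_total[OF L si[OF s(2)] si[OF s(3)]])
    fix n :: int
    define k where "k = 2 * int_encode n + 1"
    have k: "odd k" "freq k = (\<theta> + real_of_int n * pi) / L" by (simp_all add: k_def freq_def)
    have t: "sqint M (\<lambda>z. cos (freq k * z))" "sqint M (\<lambda>z. sin (freq k * z))" using sqint_trig[of 1 "freq k"] by simp_all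
    have "ip M f (lift (eb k)) = 1 / sqrt L * ip M f2 (\<lambda>z. sin (freq k * z)) + 1 / sqrt L * ip M f3 (\<lambda>z. cos (freq k * z))"
      unfolding lift_eb[abs_def] fe using k(1)
      by (simp only: if_False, subst ip_triple) (rule s sqint_trig sqint_zero | simp only: ipm ip_zero add_0_left)+
    then have "1 / sqrt L * (ip M f2 (\<lambda>z. sin (freq k * z)) + ip M f3 (\<lambda>z. cos (freq k * z))) = 0"
      using z[of k] by (simp add: distrib_left add_divide_distrib)
    then have "ip M f2 (\<lambda>z. sin (freq k * z)) + ip M f3 (\<lambda>z. cos (freq k * z)) = 0" using L by simp
    then have "(\<integral>x. f2 x * sin (freq k * x) + f3 x * cos (freq k * x) \<partial>M) = 0"
      using sqint_inner_integrable[OF s(2) t(2)] sqint_inner_integrable[OF s(3) t(1)] by (simp add: ip_def)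
    then show "(LINT x:{0<..<L}|lebesgue. f2 x * sin ((\<theta> + real_of_int n * pi) / L * x) + f3 x * cos ((\<theta> + real_of_int n * pi) / L * x)) = 0"
      unfolding k(2) by (simp add: LINT_eq_on)
  qed
  ultimately have "AE x in lebesgue. x \<in> {0<..<L} \<longrightarrow> f x = 0"
    by eventually_elim (simp add: f1_def f2_def f3_def prod_eq_iff)
  then show ?thesis by (rule AE_M)
qed

sublocale H: orthonormal_basis M "\<lambda>k. lift (eb k)"
  by standard (auto simp: sqint_lift_V eb_V ip_eb intro: eb_total)

text \<open>The three conditions in \<open>V\<close> fix the integration constants, so \<open>V\<close> is parametrised by
  arbitrary derivatives.\<close>
lemma V_from_derivative: assumes g: "sqint M g"
  shows "\<exists>\<Phi>. inV L \<Phi> \<and> (AE x in M. Dlift \<Phi> x = g x)"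
proof -
  define g1 g2 g3 where "g1 x = 1 / sqrt ao * fst (g x)" and "g2 x = 1 / sqrt ai * fst (snd (g x))" and "g3 x = 1 / sqrt ae * snd (snd (g x))" for x
  have "g = (\<lambda>x. (sqrt ao * g1 x, sqrt ai * g2 x, sqrt ae * g3 x))" using ao ai ae by (simp add: g1_def g2_def g3_def)
  with g have "sqint M (\<lambda>x. (sqrt ao * g1 x, sqrt ai * g2 x, sqrt ae * g3 x))" by metis
  then have s: "L2_on 0 L g1" "L2_on 0 L g2" "L2_on 0 L g3"
    using ao ai ae by (simp_all add: sqint_Pair_iff sqint_cmult_iff L2_on_iff_sqint)
  define u1 u2 u3 where "u1 x = - prim g1 L + prim g1 x" and "u2 x = 0 + prim g2 x" and "u3 x = (prim g2 L - prim g3 L) + prim g3 x" for x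
  have H: "H1 L u1" "H1 L u2" "H1 L u3"
    by (rule H1_intro(1)[OF L s(1)], simp add: u1_def, rule H1_intro(1)[OF L s(2)], simp add: u2_def,
        rule H1_intro(1)[OF L s(3)], simp add: u3_def)
  have "inV L (u1, u2, u3)" unfolding inV_def using H by (simp add: u1_def u2_def u3_def)
  moreover have "AE x in M. dz L u1 x = g1 x"
    by (rule AE_M, rule H1_intro(2)[OF L s(1)]) (simp add: u1_def)
  moreover have "AE x in M. dz L u2 x = g2 x"
    by (rule AE_M, rule H1_intro(2)[OF L s(2)]) (simp add: u2_def)
  moreover have "AE x in M. dz L u3 x = g3 x"
    by (rule AE_M, rule H1_intro(2)[OF L s(3)]) (simp add: u3_def)
  ultimately have "inV L (u1, u2, u3) \<and> (AE x in M. Dlift (u1, u2, u3) x = g x)"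
    by (auto elim!: eventually_rev_mp simp: Dlift_def g1_def g2_def g3_def ao ai ae less_imp_neq[symmetric] prod_eq_iff ao[THEN less_imp_neq, symmetric] ai[THEN less_imp_neq, symmetric] ae[THEN less_imp_neq, symmetric])
  then show ?thesis by blast
qed

text \<open>Not immediate, as \<open>dz\<close> is chosen: the components vanish on the closed
  interval by continuity, so 0 is a weak derivative, and weak derivatives are unique almost
  everywhere.\<close>

lemma V_zero: assumes \<Phi>: "inV L \<Phi>" and z: "AE x in M. lift \<Phi> x = 0" shows "AE x in M. Dlift \<Phi> x = 0"
proof -
  have "AE x in M. dz L u x = 0" if u: "H1 L u" and z: "AE x in M. u x = 0" for u
  proof (rule AE_M, rule H1_intro(2)[OF L])
    show "L2_on 0 L (\<lambda>_. 0)" by (simp add: L2_on_iff_sqint)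
    fix x assume x: "x \<in> {0..L}"
    have "AE x in lebesgue. x \<in> {0<..<L} \<longrightarrow> u x = 0" using z by (subst AE_eq_on) auto
    then have "u x = 0" using u x L by (intro AE_const_imp_const_on_Icc) (auto simp: H1_def)
    then show "u x = 0 + prim (\<lambda>_. 0) x" by (simp add: prim_def)
  qed
  note d = this
  have "AE x in M. co \<Phi> x = 0 \<and> ci \<Phi> x = 0 \<and> ce \<Phi> x = 0"
    using z by eventually_elim (use ao ai ae in \<open>simp add: lift_def zero_prod_def\<close>)
  then have "AE x in M. co \<Phi> x = 0" "AE x in M. ci \<Phi> x = 0" "AE x in M. ce \<Phi> x = 0" by auto
  moreover have "H1 L (co \<Phi>)" "H1 L (ci \<Phi>)" "H1 L (ce \<Phi>)" using \<Phi> by (auto simp: inV_def)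
  ultimately have "AE x in M. dz L (co \<Phi>) x = 0" "AE x in M. dz L (ci \<Phi>) x = 0" "AE x in M. dz L (ce \<Phi>) x = 0"
    using d by blast+
  then show ?thesis by eventually_elim (simp add: Dlift_def zero_prod_def)
qed

text \<open>By the eigenvalue identity the derivative of \<open>eb k\<close> has squared norm
  \<open>lam k\<close>, so these are the normalised derivatives of the basis.\<close>

definition xb :: "nat \<Rightarrow> real \<Rightarrow> real \<times> real \<times> real" where
  "xb k x = (1 / freq k) *\<^sub>R Dlift (eb k) x"

lemma ip_xb: assumes "inV L \<Phi>" shows "ip M (Dlift \<Phi>) (xb k) = freq k * ip M (lift \<Phi>) (lift (eb k))"
  unfolding xb_def[abs_def] using eigen[OF assms, of k] freq_nz[of k] by (simp add: lam_def power2_eq_square)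

text \<open>Totality: every square-integrable function is the derivative of some \<Phi> in V. If it
  is orthogonal to all \<open>xb k\<close>, then \<Phi> has no coefficients in the eigenbasis, so
  \<Phi> and its derivative vanish.\<close>

sublocale X: orthonormal_basis M xb
proof
  show "sqint M (xb k)" for k unfolding xb_def[abs_def] by (intro sqint_scaleR sqint_Dlift eb_V)
  show "ip M (xb j) (xb k) = (if j = k then 1 else 0)" for j k
  proof -
    have "ip M (xb j) (xb k) = 1 / freq j * ip M (Dlift (eb j)) (xb k)" unfolding xb_def[of j, abs_def] by simp
    then show ?thesis using freq_nz[of k] by (simp add: ip_xb[OF eb_V(1)] ip_eb)
  qed
  fix f assume f: "sqint M f" and z: "\<And>k. ip M f (xb k) = 0"
  from V_from_derivative[OF f] obtain \<Phi> where \<Phi>: "inV L \<Phi>" "AE x in M. Dlift \<Phi> x = f x" by blast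
  have "ip M (Dlift \<Phi>) (xb k) = ip M f (xb k)" for k
    using \<Phi> sqint_measurable[OF f] sqint_measurable[OF sqint_Dlift[OF \<Phi>(1)]] Dlift_eb_measurable(1)[of k]
    by (intro ip_AE_cong) (auto simp: xb_def[abs_def])
  then have "ip M (lift \<Phi>) (lift (eb k)) = 0" for k using z ip_xb[OF \<Phi>(1)] freq_nz by simp
  then have "AE x in M. lift \<Phi> x = 0" by (rule eb_total[OF sqint_lift_V[OF \<Phi>(1)]])
  from V_zero[OF \<Phi>(1) this] \<Phi>(2) show "AE x in M. f x = 0" by eventually_elim simp
qed

end

lemma ip_self_tendsto:
  assumes f: "\<And>n. sqint M (f n)" and g: "sqint M g"
    and lim: "(\<lambda>n. ip M (\<lambda>x. f n x - g x) (\<lambda>x. f n x - g x)) \<longlonglongrightarrow> 0"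
  shows "(\<lambda>n. ip M (f n) (f n)) \<longlonglongrightarrow> ip M g g"
proof -
  have e: "ip M (f n) (f n) = ip M (\<lambda>x. f n x - g x) (\<lambda>x. f n x - g x) + 2 * ip M (f n) g - ip M g g" for n
    using f g by (simp add: ip_diff_left ip_diff_right sqint_diff ip_commute[of M g "f n"])
  have "(\<lambda>n. ip M (\<lambda>x. f n x - g x) (\<lambda>x. f n x - g x) + 2 * ip M (f n) g - ip M g g) \<longlonglongrightarrow> 0 + 2 * ip M g g - ip M g g"
    by (intro tendsto_intros lim ip_tendsto[OF f g g lim])
  then show ?thesis unfolding e by simp
qed

section \<open>Coefficients with respect to the eigenbasis\<close>

context wells
begin

definition cf :: "triple \<Rightarrow> nat \<Rightarrow> real" where "cf U k = H_inner L ao ai ae U (eb k)"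

lemma eb_H: "inH L (eb k)" by (rule inV_inH[OF eb_V(1)])

lemma cf_ip: "inH L U \<Longrightarrow> cf U k = ip M (lift U) (lift (eb k))"
  unfolding cf_def by (rule H_inner_ip[OF _ eb_H])

lemma cf_sums: assumes "inH L U" shows "(\<lambda>k. (cf U k)\<^sup>2) sums nH U"
  using H.Parseval[of "lift U"] assms unfolding nH_def by (simp add: sqint_lift cf_ip)

text \<open>Parseval in the basis \<open>xb\<close>, where the derivative of \<open>U\<close> has
  coefficients \<open>freq k * cf U k\<close>; the square of \<open>freq\<close> is the weight
  \<open>lam\<close>.\<close>

lemma cfV_sums: assumes "inV L U" shows "(\<lambda>k. lam k * (cf U k)\<^sup>2) sums nD U"
  using X.Parseval[OF sqint_Dlift[OF assms]] unfolding nD_def ip_xb[OF assms]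
  by (simp add: cf_ip inV_inH assms power_mult_distrib lam_def)

lemma H_eqI: "inH L U \<Longrightarrow> inH L W \<Longrightarrow> (\<And>k. cf U k = cf W k) \<Longrightarrow> ae_eq_H L U W"
  unfolding ae_eq_H_iff by (rule H.ae_eqI) (simp_all add: sqint_lift cf_ip)

lemma H_synthesis: assumes "summable (\<lambda>k. (c k)\<^sup>2)" shows "\<exists>U. inH L U \<and> (\<forall>k. cf U k = c k)"
proof -
  from H.synthesis[OF assms] obtain f where f: "sqint M f" "\<forall>k. ip M f (lift (eb k)) = c k" by blast
  define U :: triple where "U = (\<lambda>x. fst (f x) / sqrt ao, \<lambda>x. fst (snd (f x)) / sqrt ai, \<lambda>x. snd (snd (f x)) / sqrt ae)"
  have "lift U = f" using ao ai ae by (auto simp: lift_def U_def fun_eq_iff)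
  then show ?thesis using f sqint_lift[of U] by (intro exI[of _ U]) (simp add: cf_ip)
qed

text \<open>The derivative is synthesised and then integrated. This yields a continuous
  representative with exact boundary conditions, which an L2 limit of partial sums would not
  provide.\<close>

lemma V_synthesis: assumes "summable (\<lambda>k. lam k * (c k)\<^sup>2)" shows "\<exists>\<Phi>. inV L \<Phi> \<and> (\<forall>k. cf \<Phi> k = c k)"
proof -
  have "summable (\<lambda>k. (freq k * c k)\<^sup>2)" using assms by (simp add: power_mult_distrib lam_def)
  from X.synthesis[OF this] obtain g where g: "sqint M g" "\<forall>k. ip M g (xb k) = freq k * c k" by blast
  from V_from_derivative[OF g(1)] obtain \<Phi> where \<Phi>: "inV L \<Phi>" "AE x in M. Dlift \<Phi> x = g x" by blast
  have "cf \<Phi> k = c k" for k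
  proof -
    have "ip M (Dlift \<Phi>) (xb k) = ip M g (xb k)"
      using \<Phi> sqint_measurable[OF g(1)] sqint_measurable[OF sqint_Dlift[OF \<Phi>(1)]] sqint_measurable[OF X.sq]
      by (intro ip_AE_cong) auto
    then show ?thesis using g(2) ip_xb[OF \<Phi>(1)] freq_nz[of k] by (simp add: cf_ip inV_inH \<Phi>(1))
  qed
  with \<Phi>(1) show ?thesis by blast
qed

lemma cf_tadd: assumes "inH L U" "inH L W" shows "cf (tadd U (tscale c W)) k = cf U k + c * cf W k"
  using assms unfolding cf_ip[OF tadd_H[OF assms]] lift_tadd[abs_def]
  by (simp add: cf_ip ip_add_left sqint_scaleR sqint_lift eb_H)

text \<open>Finite combinations are built with \<open>tadd\<close> and \<open>tscale\<close> because
  linearity of functionals in \<open>in_Vdual\<close> is stated for exactly this operation.\<close>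

primrec comb :: "(nat \<Rightarrow> real) \<Rightarrow> nat \<Rightarrow> triple" where
  "comb c 0 = tzero"
| "comb c (Suc n) = tadd (comb c n) (tscale (c n) (eb n))"

lemma comb_V: "inV L (comb c n)"
  by (induction n) (auto intro: tzero_V tadd_V eb_V)

lemma cf_tzero: "cf tzero k = 0"
  using cf_ip[OF inV_inH[OF tzero_V(1)]] by (simp add: tzero_V(3)[abs_def])

lemma cf_eb: "cf (eb j) k = (if j = k then 1 else 0)"
  by (simp add: cf_ip eb_H ip_eb)

lemma cf_comb: "cf (comb c n) k = (if k < n then c k else 0)"
proof (induction n)
  case (Suc n)
  have "k < n \<or> k = n \<or> n < k" by auto
  then show ?case using Suc by (auto simp: cf_tadd inV_inH[OF comb_V] eb_H cf_eb)
qed (simp add: cf_tzero)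

lemma nD_comb: "nD (comb c n) = (\<Sum>k<n. lam k * (c k)\<^sup>2)"
proof -
  have "(\<lambda>k. lam k * (cf (comb c n) k)\<^sup>2) = (\<lambda>k. if k \<in> {..<n} then lam k * (c k)\<^sup>2 else 0)"
    by (auto simp: cf_comb)
  then have "(\<lambda>k. if k \<in> {..<n} then lam k * (c k)\<^sup>2 else 0) sums nD (comb c n)"
    using cfV_sums[OF comb_V, of c n] by simp
  then show ?thesis by (rule sums_unique2) (rule sums_If_finite_set, simp)
qed

abbreviation "tdiff U W \<equiv> tadd U (tscale (- 1) W)"

lemma nD_tail: assumes "inV L \<Phi>"
  shows "nD (tdiff \<Phi> (comb (cf \<Phi>) n)) = nD \<Phi> - (\<Sum>k<n. lam k * (cf \<Phi> k)\<^sup>2)"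
proof -
  have "(\<lambda>k. lam k * (cf (tdiff \<Phi> (comb (cf \<Phi>) n)) k)\<^sup>2)
     = (\<lambda>k. lam k * (cf \<Phi> k)\<^sup>2 - (if k \<in> {..<n} then lam k * (cf \<Phi> k)\<^sup>2 else 0))"
    by (auto simp: cf_tadd inV_inH assms comb_V cf_comb)
  moreover have "(\<lambda>k. lam k * (cf \<Phi> k)\<^sup>2 - (if k \<in> {..<n} then lam k * (cf \<Phi> k)\<^sup>2 else 0)) sums (nD \<Phi> - (\<Sum>k<n. lam k * (cf \<Phi> k)\<^sup>2))"
    by (intro sums_diff cfV_sums assms sums_If_finite_set) simp
  ultimately have "(\<lambda>k. lam k * (cf (tdiff \<Phi> (comb (cf \<Phi>) n)) k)\<^sup>2) sums (nD \<Phi> - (\<Sum>k<n. lam k * (cf \<Phi> k)\<^sup>2))"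
    by (simp only:)
  from sums_unique2[OF cfV_sums[OF tadd_V(1)[OF assms comb_V]] this] show ?thesis .
qed

lemma nD_tail_tendsto: assumes "inV L \<Phi>" shows "(\<lambda>n. nD (tdiff \<Phi> (comb (cf \<Phi>) n))) \<longlonglongrightarrow> 0"
  unfolding nD_tail[OF assms] using tendsto_diff[OF tendsto_const[of "nD \<Phi>"] cfV_sums[OF assms, unfolded sums_def]] by simp

lemma nD_nonneg[simp]: "0 \<le> nD \<Phi>" by (simp add: nD_def)
lemma nH_nonneg[simp]: "0 \<le> nH \<Phi>" by (simp add: nH_def)

section \<open>Norms and functionals\<close>

definition wsum where "wsum = 1 / ao + 1 / ai + 1 / ae"

lemma wsum: "wsum > 0" "1 / ao \<le> wsum" "1 / ai \<le> wsum" "1 / ae \<le> wsum"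
  using ao ai ae by (auto simp: wsum_def add_pos_pos)

lemma nD_split: assumes "inV L \<Phi>"
  shows "nD \<Phi> = ao * ip M (dz L (co \<Phi>)) (dz L (co \<Phi>)) + (ai * ip M (dz L (ci \<Phi>)) (dz L (ci \<Phi>)) + ae * ip M (dz L (ce \<Phi>)) (dz L (ce \<Phi>)))"
proof -
  have s: "sqint M (dz L (co \<Phi>))" "sqint M (dz L (ci \<Phi>))" "sqint M (dz L (ce \<Phi>))"
    using assms by (auto simp: inV_def H1_dz(1)[unfolded L2_on_iff_sqint])
  have sc: "sqint M (\<lambda>z. c * f z)" if "sqint M f" for c and f :: "real \<Rightarrow> real" using sqint_scaleR[OF that, of c] by simp
  have pr: "ip M (\<lambda>z. c * f z) (\<lambda>z. c * g z) = c * c * ip M f g" for c and f g :: "real \<Rightarrow> real"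
    using ip_scaleR_left[of M c f "\<lambda>z. c *\<^sub>R g z"] ip_scaleR_right[of M f c g] by simp
  show ?thesis
    unfolding nD_def Dlift_def[abs_def] using ao ai ae by (subst ip_triple) (auto intro!: sc s simp: pr)
qed

lemma nH_split: assumes "inH L \<Phi>"
  shows "nH \<Phi> = ao * ip M (co \<Phi>) (co \<Phi>) + (ai * ip M (ci \<Phi>) (ci \<Phi>) + ae * ip M (ce \<Phi>) (ce \<Phi>))"
  using H_inner_ip[OF assms assms] by (simp add: nH_def H_inner_def ip_def LINT_eq_on)

lemma nD_comp: assumes "inV L \<Phi>"
  shows "ip M (dz L (co \<Phi>)) (dz L (co \<Phi>)) \<le> wsum * nD \<Phi>" "ip M (dz L (ci \<Phi>)) (dz L (ci \<Phi>)) \<le> wsum * nD \<Phi>"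
    "ip M (dz L (ce \<Phi>)) (dz L (ce \<Phi>)) \<le> wsum * nD \<Phi>"
proof -
  have n: "0 \<le> ao * ip M (dz L (co \<Phi>)) (dz L (co \<Phi>))" "0 \<le> ai * ip M (dz L (ci \<Phi>)) (dz L (ci \<Phi>))" "0 \<le> ae * ip M (dz L (ce \<Phi>)) (dz L (ce \<Phi>))"
    using ao ai ae by auto
  have k: "x \<le> wsum * nD \<Phi>" if "0 < a" "1 / a \<le> wsum" "a * x \<le> nD \<Phi>" for a x
  proof -
    have "x \<le> 1 / a * nD \<Phi>" using that by (simp add: field_simps)
    also have "\<dots> \<le> wsum * nD \<Phi>" using that by (intro mult_right_mono) auto
    finally show ?thesis .
  qed
  show "ip M (dz L (co \<Phi>)) (dz L (co \<Phi>)) \<le> wsum * nD \<Phi>" by (rule k[OF ao wsum(2)]) (use nD_split[OF assms] n in linarith)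
  show "ip M (dz L (ci \<Phi>)) (dz L (ci \<Phi>)) \<le> wsum * nD \<Phi>" by (rule k[OF ai wsum(3)]) (use nD_split[OF assms] n in linarith)
  show "ip M (dz L (ce \<Phi>)) (dz L (ce \<Phi>)) \<le> wsum * nD \<Phi>" by (rule k[OF ae wsum(4)]) (use nD_split[OF assms] n in linarith)
qed

text \<open>The component \<open>ce\<close> is the worst case: its value is a sum of three
  primitives, each bounded by sqrt L * sqrt wsum * sqrt nD. The factor 4 leaves room.\<close>

definition KP where "KP = 4 * sqrt L * sqrt wsum"

lemma KP: "KP > 0" using L wsum by (simp add: KP_def)

text \<open>Poincare's inequality in uniform form: \<open>co\<close> is anchored at
  \<open>L\<close>, \<open>ci\<close> at 0, and \<open>ce\<close> through \<open>ci\<close> at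
  \<open>L\<close>. Hence the derivatives alone control an element of V, and point evaluation is
  bounded.\<close>

lemma pointwise_bound: assumes "inV L \<Phi>" and z: "z \<in> {0..L}"
  shows "\<bar>co \<Phi> z\<bar> \<le> KP * sqrt (nD \<Phi>)" "\<bar>ci \<Phi> z\<bar> \<le> KP * sqrt (nD \<Phi>)" "\<bar>ce \<Phi> z\<bar> \<le> KP * sqrt (nD \<Phi>)"
proof -
  define B where "B = sqrt L * sqrt (wsum * nD \<Phi>)"
  have B: "KP * sqrt (nD \<Phi>) = 4 * B" "0 \<le> B" using L wsum by (auto simp: B_def KP_def real_sqrt_mult)
  have V: "H1 L (co \<Phi>)" "H1 L (ci \<Phi>)" "H1 L (ce \<Phi>)" "co \<Phi> L = 0" "ci \<Phi> 0 = 0" "ci \<Phi> L = ce \<Phi> L"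
    using assms by (auto simp: inV_def)
  have p: "\<bar>prim (dz L u) x\<bar> \<le> B" if "H1 L u" "x \<in> {0..L}" "ip M (dz L u) (dz L u) \<le> wsum * nD \<Phi>" for u x
  proof -
    have "(LINT s:{0<..<L}|lebesgue. (dz L u s)\<^sup>2) = ip M (dz L u) (dz L u)" by (simp add: LINT_eq_on ip_self)
    then have "\<bar>prim (dz L u) x\<bar> \<le> sqrt L * sqrt (ip M (dz L u) (dz L u))"
      using prim_bound[OF H1_dz(1)[OF that(1)] that(2)] by simp
    also have "\<dots> \<le> B" unfolding B_def using that(3) L by (intro mult_left_mono real_sqrt_le_mono) auto
    finally show ?thesis .
  qed
  have zL: "L \<in> {0..L}" using L by simp
  have r: "u x = u L - prim (dz L u) L + prim (dz L u) x" if "H1 L u" "x \<in> {0..L}" for u x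
    using H1_repr[OF L that] H1_repr[OF L that(1) zL] by simp
  have o: "\<bar>prim (dz L (co \<Phi>)) x\<bar> \<le> B" if "x \<in> {0..L}" for x by (rule p[OF V(1) that nD_comp(1)[OF assms(1)]])
  have i: "\<bar>prim (dz L (ci \<Phi>)) x\<bar> \<le> B" if "x \<in> {0..L}" for x by (rule p[OF V(2) that nD_comp(2)[OF assms(1)]])
  have e: "\<bar>prim (dz L (ce \<Phi>)) x\<bar> \<le> B" if "x \<in> {0..L}" for x by (rule p[OF V(3) that nD_comp(3)[OF assms(1)]])
  show "\<bar>co \<Phi> z\<bar> \<le> KP * sqrt (nD \<Phi>)" using r[OF V(1) z] V(4) o[OF z] o[OF zL] B by linarith
  have ci: "\<bar>ci \<Phi> x\<bar> \<le> B" if "x \<in> {0..L}" for x using H1_repr[OF L V(2) that] V(5) i[OF that] by simp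
  show "\<bar>ci \<Phi> z\<bar> \<le> KP * sqrt (nD \<Phi>)" using ci[OF z] B by linarith
  show "\<bar>ce \<Phi> z\<bar> \<le> KP * sqrt (nD \<Phi>)" using r[OF V(3) z] V(6) ci[OF zL] e[OF z] e[OF zL] B by linarith
qed

text \<open>The prescribed norm of V as the norm of one L2 function with six unweighted components.
  The dual norm is defined by it, while estimates use the equivalent quantity
  \<open>nD\<close>.\<close>

definition Vl :: "triple \<Rightarrow> real \<Rightarrow> (real \<times> real \<times> real) \<times> (real \<times> real \<times> real)" where
  "Vl \<Phi> z = ((co \<Phi> z, ci \<Phi> z, ce \<Phi> z), (dz L (co \<Phi>) z, dz L (ci \<Phi>) z, dz L (ce \<Phi>) z))"

lemma sqint_V_comps: assumes "inV L \<Phi>"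
  shows "sqint M (co \<Phi>)" "sqint M (ci \<Phi>)" "sqint M (ce \<Phi>)" "sqint M (dz L (co \<Phi>))" "sqint M (dz L (ci \<Phi>))" "sqint M (dz L (ce \<Phi>))"
proof -
  have "sqint M u" "sqint M (dz L u)" if "H1 L u" for u
    using that H1_dz(1)[OF that] by (auto simp: H1_def L2_on_iff_sqint)
  then show "sqint M (co \<Phi>)" "sqint M (ci \<Phi>)" "sqint M (ce \<Phi>)" "sqint M (dz L (co \<Phi>))" "sqint M (dz L (ci \<Phi>))" "sqint M (dz L (ce \<Phi>))"
    using assms by (auto simp: inV_def)
qed

lemma sqint_Vl: "inV L \<Phi> \<Longrightarrow> sqint M (Vl \<Phi>)"
  unfolding Vl_def[abs_def] by (simp add: sqint_Pair_iff sqint_V_comps)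

lemma ip_Vl: assumes "inV L \<Phi>"
  shows "ip M (Vl \<Phi>) (Vl \<Phi>) = (ip M (co \<Phi>) (co \<Phi>) + (ip M (ci \<Phi>) (ci \<Phi>) + ip M (ce \<Phi>) (ce \<Phi>)))
     + (ip M (dz L (co \<Phi>)) (dz L (co \<Phi>)) + (ip M (dz L (ci \<Phi>)) (dz L (ci \<Phi>)) + ip M (dz L (ce \<Phi>)) (dz L (ce \<Phi>))))"
  unfolding Vl_def[abs_def] using sqint_V_comps[OF assms] by (simp add: ip_Pair sqint_Pair_iff)

lemma V_norm_eq: assumes "inV L \<Phi>" shows "V_norm L \<Phi> = sqrt (ip M (Vl \<Phi>) (Vl \<Phi>))"
proof -
  have h: "(H1_norm L u)\<^sup>2 = ip M u u + ip M (dz L u) (dz L u)" for u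
    unfolding H1_norm_def by (simp add: LINT_eq_on ip_self)
  show ?thesis by (simp add: V_norm_def h ip_Vl[OF assms] algebra_simps)
qed

definition KV where "KV = 3 * L * KP\<^sup>2 + 3 * wsum"

lemma KV: "KV > 0" using L KP wsum by (simp add: KV_def add_pos_pos)

lemma Vl_bound: assumes \<Phi>: "inV L \<Phi>" shows "ip M (Vl \<Phi>) (Vl \<Phi>) \<le> KV * nD \<Phi>"
proof -
  have b: "ip M u u \<le> L * KP\<^sup>2 * nD \<Phi>" if "sqint M u" "\<And>z. z \<in> {0..L} \<Longrightarrow> \<bar>u z\<bar> \<le> KP * sqrt (nD \<Phi>)" for u
  proof -
    have "ip M u u \<le> (\<integral>z. KP\<^sup>2 * nD \<Phi> \<partial>M)"
      unfolding ip_self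
    proof (rule integral_mono)
      show "integrable M (\<lambda>z. (norm (u z))\<^sup>2)" using that(1) by (simp add: sqint_def)
      show "integrable M (\<lambda>z. KP\<^sup>2 * nD \<Phi>)" by (rule sqint_integrable[OF sqint_const])
      fix z assume "z \<in> space M"
      then have "z \<in> {0..L}" by (auto simp: space_restrict_space)
      then have "\<bar>u z\<bar>\<^sup>2 \<le> (KP * sqrt (nD \<Phi>))\<^sup>2" using that(2) by (intro power_mono) auto
      then show "(norm (u z))\<^sup>2 \<le> KP\<^sup>2 * nD \<Phi>" by (simp add: power_mult_distrib)
    qed
    then show ?thesis using L by (simp add: measure_restrict_space space_restrict_space mult_ac)
  qed
  have "ip M (Vl \<Phi>) (Vl \<Phi>) \<le> (L * KP\<^sup>2 * nD \<Phi> + (L * KP\<^sup>2 * nD \<Phi> + L * KP\<^sup>2 * nD \<Phi>)) + (wsum * nD \<Phi> + (wsum * nD \<Phi> + wsum * nD \<Phi>))"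
    unfolding ip_Vl[OF \<Phi>] by (intro add_mono b sqint_V_comps[OF \<Phi>] pointwise_bound[OF \<Phi>] nD_comp[OF \<Phi>])
  also have "\<dots> = KV * nD \<Phi>" by (simp add: KV_def algebra_simps)
  finally show ?thesis .
qed

lemma V_norm_le: "inV L \<Phi> \<Longrightarrow> V_norm L \<Phi> \<le> sqrt KV * sqrt (nD \<Phi>)"
  using real_sqrt_le_mono[OF Vl_bound] by (simp add: V_norm_eq real_sqrt_mult)

definition KD where "KD = ao + ai + ae"

lemma nD_le: assumes "inV L \<Phi>" shows "nD \<Phi> \<le> KD * ip M (Vl \<Phi>) (Vl \<Phi>)"
proof -
  let ?S = "ip M (Vl \<Phi>) (Vl \<Phi>)"
  note e = ip_Vl[OF assms]
  have n: "0 \<le> ip M u u" for u :: "real \<Rightarrow> real" by simp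
  have "nD \<Phi> \<le> ao * ?S + (ai * ?S + ae * ?S)"
    unfolding nD_split[OF assms] e using ao ai ae
    by (intro add_mono mult_left_mono) (auto intro!: add_nonneg_nonneg simp: add_increasing add_increasing2)
  then show ?thesis by (simp add: KD_def algebra_simps)
qed

lemma Vdual_bounded: assumes "in_Vdual L f"
  obtains C where "C \<ge> 0" "\<And>\<Phi>. inV L \<Phi> \<Longrightarrow> \<bar>f \<Phi>\<bar> \<le> C * V_norm L \<Phi>"
proof -
  obtain C where C: "\<And>\<Phi>. inV L \<Phi> \<Longrightarrow> \<bar>f \<Phi>\<bar> \<le> C * V_norm L \<Phi>" using assms by (auto simp: in_Vdual_def)
  have "\<bar>f \<Phi>\<bar> \<le> \<bar>C\<bar> * V_norm L \<Phi>" if "inV L \<Phi>" for \<Phi>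
  proof -
    have "C * V_norm L \<Phi> \<le> \<bar>C\<bar> * V_norm L \<Phi>" by (intro mult_right_mono) (auto simp: V_norm_eq that)
    then show ?thesis using C[OF that] by linarith
  qed
  then show ?thesis using that[of "\<bar>C\<bar>"] by simp
qed

lemma Vdual_lin: "in_Vdual L f \<Longrightarrow> inV L \<Phi> \<Longrightarrow> inV L \<Psi> \<Longrightarrow> f (tadd \<Phi> (tscale c \<Psi>)) = f \<Phi> + c * f \<Psi>"
  unfolding in_Vdual_def by blast

lemma Vdual_tzero: assumes "in_Vdual L f" shows "f tzero = 0"
proof -
  have "tadd tzero (tscale 1 tzero) = tzero" by (simp add: tzero_def tadd_def tscale_def)
  then show ?thesis using Vdual_lin[OF assms tzero_V(1) tzero_V(1), of 1] by simp
qed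

lemma Vdual_comb: assumes "in_Vdual L f" shows "f (comb c n) = (\<Sum>k<n. c k * f (eb k))"
  by (induction n) (auto simp: Vdual_tzero[OF assms] Vdual_lin[OF assms] comb_V eb_V)

text \<open>Partial expansions converge in V, and a bounded functional passes to the limit. Thus a
  functional is determined by its values on the basis, and measurability in time reduces to that of
  coefficients.\<close>

lemma Vdual_expand: assumes f: "in_Vdual L f" and \<Phi>: "inV L \<Phi>"
  shows "(\<lambda>n. \<Sum>k<n. cf \<Phi> k * f (eb k)) \<longlonglongrightarrow> f \<Phi>"
proof -
  obtain C where C: "C \<ge> 0" "\<And>\<Phi>. inV L \<Phi> \<Longrightarrow> \<bar>f \<Phi>\<bar> \<le> C * V_norm L \<Phi>" using Vdual_bounded[OF f] by blast
  have b: "\<bar>f \<Phi> - (\<Sum>k<n. cf \<Phi> k * f (eb k))\<bar> \<le> C * (sqrt KV * sqrt (nD (tdiff \<Phi> (comb (cf \<Phi>) n))))" for n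
  proof -
    have v: "inV L (tdiff \<Phi> (comb (cf \<Phi>) n))" by (intro tadd_V \<Phi> comb_V)
    have "f \<Phi> - (\<Sum>k<n. cf \<Phi> k * f (eb k)) = f (tdiff \<Phi> (comb (cf \<Phi>) n))"
      by (simp add: Vdual_lin[OF f \<Phi> comb_V] Vdual_comb[OF f])
    also have "\<bar>\<dots>\<bar> \<le> C * V_norm L (tdiff \<Phi> (comb (cf \<Phi>) n))" by (rule C(2)[OF v])
    also have "\<dots> \<le> C * (sqrt KV * sqrt (nD (tdiff \<Phi> (comb (cf \<Phi>) n))))"
      by (intro mult_left_mono V_norm_le v C)
    finally show ?thesis .
  qed
  have "(\<lambda>n. C * (sqrt KV * sqrt (nD (tdiff \<Phi> (comb (cf \<Phi>) n))))) \<longlonglongrightarrow> C * (sqrt KV * sqrt 0)"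
    by (intro tendsto_intros nD_tail_tendsto[OF \<Phi>])
  then have "(\<lambda>n. C * (sqrt KV * sqrt (nD (tdiff \<Phi> (comb (cf \<Phi>) n))))) \<longlonglongrightarrow> 0" by simp
  then have "(\<lambda>n. f \<Phi> - (\<Sum>k<n. cf \<Phi> k * f (eb k))) \<longlonglongrightarrow> 0"
    by (rule Lim_null_comparison[rotated]) (use b in simp)
  from tendsto_diff[OF tendsto_const[of "f \<Phi>"] this] show ?thesis by simp
qed

text \<open>The dual norm is a supremum of reals, which carries information only when the set is
  bounded.\<close>

lemma Vdual_norm_bdd: assumes "in_Vdual L f"
  shows "bdd_above {\<bar>f \<Phi>\<bar> | \<Phi>. inV L \<Phi> \<and> V_norm L \<Phi> \<le> 1}"
proof -
  obtain C where C: "C \<ge> 0" "\<And>\<Phi>. inV L \<Phi> \<Longrightarrow> \<bar>f \<Phi>\<bar> \<le> C * V_norm L \<Phi>" using Vdual_bounded[OF assms] by blast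
  show ?thesis
  proof (rule bdd_aboveI[of _ C])
    fix x assume "x \<in> {\<bar>f \<Phi>\<bar> | \<Phi>. inV L \<Phi> \<and> V_norm L \<Phi> \<le> 1}"
    then obtain \<Phi> where \<Phi>: "x = \<bar>f \<Phi>\<bar>" "inV L \<Phi>" "V_norm L \<Phi> \<le> 1" by blast
    have "C * V_norm L \<Phi> \<le> C * 1" using \<Phi> C by (intro mult_left_mono) auto
    then show "x \<le> C" using C(2)[OF \<Phi>(2)] \<Phi>(1) by simp
  qed
qed

text \<open>Scaling is expressed through \<open>tadd tzero\<close>, the form to which linearity of a
  functional applies. It is needed to normalise a test element in the dual norm.\<close>

lemma Vl_scale: assumes "inV L \<Phi>"
  shows "inV L (tadd tzero (tscale c \<Phi>))" "V_norm L (tadd tzero (tscale c \<Phi>)) = \<bar>c\<bar> * V_norm L \<Phi>"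
proof -
  show v: "inV L (tadd tzero (tscale c \<Phi>))" by (intro tadd_V tzero_V assms)
  have "AE z in M. dz L (\<lambda>x. 0 + c * u x) z = c * dz L u z" if "H1 L u" for u
  proof -
    have z: "H1 L (\<lambda>_. 0)" using tzero_V(1) by (simp add: inV_def tzero_def)
    have "AE z in M. dz L (\<lambda>_. 0) z = 0"
      using tzero_V(2) by eventually_elim (use ao in \<open>simp add: Dlift_def tzero_def zero_prod_def\<close>)
    moreover have "AE z in M. dz L (\<lambda>x. 0 + c * u x) z = dz L (\<lambda>_. 0) z + c * dz L u z"
      by (rule AE_M, rule H1_add_scale(2)[OF L z that])
    ultimately show ?thesis by eventually_elim simp
  qed
  note d = this
  have "AE z in M. Vl (tadd tzero (tscale c \<Phi>)) z = c *\<^sub>R Vl \<Phi> z"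
    using d[of "co \<Phi>"] d[of "ci \<Phi>"] d[of "ce \<Phi>"] assms unfolding inV_def
    by (auto simp: Vl_def tzero_def elim!: eventually_rev_mp)
  then have "ip M (Vl (tadd tzero (tscale c \<Phi>))) (Vl (tadd tzero (tscale c \<Phi>))) = ip M (\<lambda>z. c *\<^sub>R Vl \<Phi> z) (\<lambda>z. c *\<^sub>R Vl \<Phi> z)"
    using sqint_measurable[OF sqint_Vl[OF v]] sqint_measurable[OF sqint_scaleR[OF sqint_Vl[OF assms]]]
    by (intro ip_AE_cong) auto
  then show "V_norm L (tadd tzero (tscale c \<Phi>)) = \<bar>c\<bar> * V_norm L \<Phi>"
    unfolding V_norm_eq[OF v] V_norm_eq[OF assms] by (simp add: real_sqrt_mult flip: power2_eq_square mult.assoc)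
qed

lemma V_norm_nonneg[simp]: "inV L \<Phi> \<Longrightarrow> 0 \<le> V_norm L \<Phi>" by (simp add: V_norm_eq)

lemma Vdual_norm_ge: assumes f: "in_Vdual L f" and \<Phi>: "inV L \<Phi>"
  shows "\<bar>f \<Phi>\<bar> \<le> Vdual_norm L f * V_norm L \<Phi>"
proof (cases "V_norm L \<Phi> = 0")
  case True
  then show ?thesis using Vdual_bounded[OF f] \<Phi> by (metis mult_zero_right)
next
  case False
  define c where "c = 1 / V_norm L \<Phi>"
  have p: "V_norm L \<Phi> > 0" using False V_norm_nonneg[OF \<Phi>] by simp
  note v = Vl_scale[OF \<Phi>, of c]
  have "\<bar>f (tadd tzero (tscale c \<Phi>))\<bar> \<le> Vdual_norm L f"
  proof -
    have "V_norm L (tadd tzero (tscale c \<Phi>)) \<le> 1" using v p by (simp add: c_def)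
    then show ?thesis
      unfolding Vdual_norm_def using v(1) by (intro cSup_upper Vdual_norm_bdd f) blast
  qed
  then have "c * \<bar>f \<Phi>\<bar> \<le> Vdual_norm L f"
    using p by (simp add: Vdual_lin[OF f tzero_V(1) \<Phi>] Vdual_tzero[OF f] abs_mult c_def)
  then show ?thesis using p by (simp add: c_def field_simps)
qed

lemma Vdual_norm_le: assumes C: "\<And>\<Phi>. inV L \<Phi> \<Longrightarrow> \<bar>f \<Phi>\<bar> \<le> C * V_norm L \<Phi>" "0 \<le> C"
  shows "Vdual_norm L f \<le> C"
  unfolding Vdual_norm_def
proof (rule cSup_least)
  have "V_norm L tzero \<le> 1" using V_norm_le[OF tzero_V(1)] nD_comb[of "\<lambda>_. 0" 0] by simp
  then show "{\<bar>f \<Phi>\<bar> | \<Phi>. inV L \<Phi> \<and> V_norm L \<Phi> \<le> 1} \<noteq> {}" using tzero_V(1) by blast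
  fix x assume "x \<in> {\<bar>f \<Phi>\<bar> | \<Phi>. inV L \<Phi> \<and> V_norm L \<Phi> \<le> 1}"
  then obtain \<Phi> where \<Phi>: "x = \<bar>f \<Phi>\<bar>" "inV L \<Phi>" "V_norm L \<Phi> \<le> 1" by blast
  have "C * V_norm L \<Phi> \<le> C * 1" using \<Phi> C by (intro mult_left_mono) auto
  then show "x \<le> C" using C(1)[OF \<Phi>(2)] \<Phi>(1) by simp
qed

lemma Vdual_norm_nonneg: assumes "in_Vdual L f" shows "0 \<le> Vdual_norm L f"
proof -
  have "V_norm L tzero \<le> 1" using V_norm_le[OF tzero_V(1)] nD_comb[of "\<lambda>_. 0" 0] by simp
  then have "\<bar>f tzero\<bar> \<le> Vdual_norm L f"
    unfolding Vdual_norm_def using tzero_V(1) by (intro cSup_upper Vdual_norm_bdd assms) blast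
  then show ?thesis by linarith
qed

text \<open>Tested with the truncated Riesz representer \<open>w\<close>, whose coefficients are
  \<open>f (eb k) / lam k\<close>: both \<open>f w\<close> and \<open>nD w\<close> equal the sum S
  in question, so S is at most a constant times the norm of \<open>f\<close> times sqrt S.\<close>

lemma Vdual_coeffs: assumes f: "in_Vdual L f"
  shows "(\<Sum>k<n. (f (eb k))\<^sup>2 / lam k) \<le> KV * (Vdual_norm L f)\<^sup>2"
proof -
  define S where "S = (\<Sum>k<n. (f (eb k))\<^sup>2 / lam k)"
  have S: "0 \<le> S" unfolding S_def using lam_pos by (intro sum_nonneg divide_nonneg_pos) auto
  define w where "w = comb (\<lambda>k. f (eb k) / lam k) n"
  have "f w = S" unfolding w_def Vdual_comb[OF f] S_def by (simp add: power2_eq_square)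
  moreover have "nD w = S"
    unfolding w_def nD_comb S_def
    by (intro sum.cong) (auto simp: power_divide power2_eq_square lam_pos[THEN less_imp_neq, symmetric])
  moreover have "\<bar>f w\<bar> \<le> Vdual_norm L f * V_norm L w" by (rule Vdual_norm_ge[OF f]) (simp add: w_def comb_V)
  moreover have "V_norm L w \<le> sqrt KV * sqrt (nD w)" by (rule V_norm_le) (simp add: w_def comb_V)
  ultimately have "S \<le> Vdual_norm L f * V_norm L w" "V_norm L w \<le> sqrt KV * sqrt S" using S by auto
  then have "S \<le> Vdual_norm L f * (sqrt KV * sqrt S)"
    using mult_left_mono[OF _ Vdual_norm_nonneg[OF f]] order_trans by blast
  then have h: "sqrt S * sqrt S \<le> (Vdual_norm L f * sqrt KV) * sqrt S" using S by (simp add: mult_ac)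
  have "sqrt S \<le> Vdual_norm L f * sqrt KV"
  proof (cases "S = 0")
    case True then show ?thesis using Vdual_norm_nonneg[OF f] KV by simp
  next
    case False then show ?thesis using S by (intro mult_right_le_imp_le[OF h]) simp
  qed
  then have "(sqrt S)\<^sup>2 \<le> (Vdual_norm L f * sqrt KV)\<^sup>2" using S by (intro power_mono) auto
  then show ?thesis using S KV by (simp add: S_def power_mult_distrib mult.commute)
qed

end

section \<open>Bounded matrices on square-summable sequences\<close>

text \<open>Boundedness through finite square sections, since on finite combinations of basis
  elements the bilinear forms are finite double sums. Convergence of the infinite rows is a
  consequence.\<close>

definition matbound :: "real \<Rightarrow> (nat \<Rightarrow> nat \<Rightarrow> real) \<Rightarrow> bool" where
  "matbound \<rho> q \<longleftrightarrow> (\<forall>n x y. \<bar>\<Sum>j<n. \<Sum>k<n. q j k * x j * y k\<bar> \<le> \<rho> * sqrt (\<Sum>j<n. (x j)\<^sup>2) * sqrt (\<Sum>k<n. (y k)\<^sup>2))"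

text \<open>The first index is summed: j belongs to the trial function, k to the test function, as
  in \<open>A (eb j) (eb k)\<close>.\<close>

definition matop :: "(nat \<Rightarrow> nat \<Rightarrow> real) \<Rightarrow> (nat \<Rightarrow> real) \<Rightarrow> nat \<Rightarrow> real" where
  "matop q x k = (\<Sum>j. q j k * x j)"

text \<open>The section bound is tested with the output itself, cut off at \<open>N\<close>;
  \<open>N \<le> n\<close> makes this a legal second argument of the n-th section.\<close>

lemma matop_partial:
  assumes q: "matbound \<rho> q" and \<rho>: "0 \<le> \<rho>" and x: "summable (\<lambda>j. (x j)\<^sup>2)" and Nn: "N \<le> n"
  shows "(\<Sum>k<N. (\<Sum>j<n. q j k * x j)\<^sup>2) \<le> \<rho>\<^sup>2 * (\<Sum>j. (x j)\<^sup>2)"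
proof -
  define g where "g k = (\<Sum>j<n. q j k * x j)" for k
  define S where "S = (\<Sum>k<N. (g k)\<^sup>2)"
  define X where "X = (\<Sum>j. (x j)\<^sup>2)"
  have S0: "0 \<le> S" unfolding S_def by (intro sum_nonneg) auto
  have X0: "0 \<le> X" unfolding X_def by (intro suminf_nonneg x) auto
  define y where "y k = (if k < N then g k else 0)" for k
  have ys: "(\<Sum>k<n. f k * y k) = (\<Sum>k<N. f k * g k)" for f
  proof -
    have "(\<Sum>k<N. f k * g k) = (\<Sum>k<N. f k * y k)" by (simp add: y_def)
    also have "\<dots> = (\<Sum>k<n. f k * y k)" by (rule sum.mono_neutral_left) (use Nn in \<open>auto simp: y_def\<close>)
    finally show ?thesis by simp
  qed
  have "(\<Sum>j<n. \<Sum>k<n. q j k * x j * y k) = (\<Sum>k<n. g k * y k)"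
    unfolding g_def by (subst sum.swap) (simp add: sum_distrib_right)
  also have "\<dots> = S" unfolding ys S_def by (simp add: power2_eq_square)
  finally have 1: "(\<Sum>j<n. \<Sum>k<n. q j k * x j * y k) = S" .
  have "(\<Sum>k<n. y k * y k) = (\<Sum>k<N. y k * g k)" by (rule ys)
  also have "\<dots> = S" unfolding S_def by (intro sum.cong) (auto simp: y_def power2_eq_square)
  finally have 2: "(\<Sum>k<n. (y k)\<^sup>2) = S" by (simp add: power2_eq_square)
  have "S \<le> \<rho> * sqrt (\<Sum>j<n. (x j)\<^sup>2) * sqrt S"
    using q[unfolded matbound_def, rule_format, where n=n and x=x and y=y] S0 unfolding 1 2 by linarith
  also have "\<dots> \<le> \<rho> * sqrt X * sqrt S"
    unfolding X_def using \<rho> S0 by (intro mult_right_mono mult_left_mono real_sqrt_le_mono sum_le_suminf x) auto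
  finally have "sqrt S * sqrt S \<le> (\<rho> * sqrt X) * sqrt S" using S0 by simp
  then have "sqrt S \<le> \<rho> * sqrt X"
  proof (cases "S = 0")
    case True then show ?thesis using \<rho> X0 by simp
  next
    case False
    show ?thesis by (rule mult_right_le_imp_le[OF \<open>sqrt S * sqrt S \<le> (\<rho> * sqrt X) * sqrt S\<close>]) (use False S0 in simp)
  qed
  then have "(sqrt S)\<^sup>2 \<le> (\<rho> * sqrt X)\<^sup>2" using S0 by (intro power_mono) auto
  then show ?thesis using S0 X0 by (simp add: S_def X_def g_def power_mult_distrib)
qed

text \<open>Adjusting the signs of \<open>x\<close> to those of the column makes every term
  nonnegative without increasing the norm, so a bound on partial sums becomes absolute
  convergence.\<close>

lemma matop_summable:
  assumes q: "matbound \<rho> q" and \<rho>: "0 \<le> \<rho>" and x: "summable (\<lambda>j. (x j)\<^sup>2)"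
  shows "summable (\<lambda>j. q j k * x j)"
proof (rule summable_rabs_cancel, rule summableI_nonneg_bounded)
  fix N
  define y where "y j = (if j < N then \<bar>x j\<bar> * sgn (q j k) else 0)" for j
  have y2: "(y j)\<^sup>2 \<le> (x j)\<^sup>2" for j by (auto simp: y_def power_mult_distrib sgn_if)
  have sy: "summable (\<lambda>j. (y j)\<^sup>2)" by (rule summable_comparison_test[OF _ x]) (use y2 in auto)
  \<comment> \<open>The section must contain the \<open>N\<close> summed entries and also the index
    \<open>k\<close> of the output.\<close>
  define n where "n = max N (Suc k)"
  have "(\<Sum>j<N. \<bar>q j k * x j\<bar>) = (\<Sum>j<N. q j k * y j)"
    by (intro sum.cong) (auto simp: y_def abs_mult sgn_if)
  also have "\<dots> = (\<Sum>j<n. q j k * y j)"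
    by (rule sum.mono_neutral_left) (auto simp: n_def y_def)
  finally have e: "(\<Sum>j<N. \<bar>q j k * x j\<bar>) = (\<Sum>j<n. q j k * y j)" .
  have "(\<Sum>j<n. q j k * y j)\<^sup>2 \<le> (\<Sum>k<Suc k. (\<Sum>j<n. q j k * y j)\<^sup>2)"
    by (rule member_le_sum[of k "{..<Suc k}" "\<lambda>k. (\<Sum>j<n. q j k * y j)\<^sup>2"]) auto
  also have "\<dots> \<le> \<rho>\<^sup>2 * (\<Sum>j. (y j)\<^sup>2)" by (rule matop_partial[OF q \<rho> sy]) (simp add: n_def)
  also have "\<dots> \<le> \<rho>\<^sup>2 * (\<Sum>j. (x j)\<^sup>2)" by (intro mult_left_mono suminf_le y2 sy x) auto
  finally have "(\<Sum>j<n. q j k * y j) \<le> sqrt (\<rho>\<^sup>2 * (\<Sum>j. (x j)\<^sup>2))" by (rule real_le_rsqrt)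
  then show "(\<Sum>j<N. \<bar>q j k * x j\<bar>) \<le> sqrt (\<rho>\<^sup>2 * (\<Sum>j. (x j)\<^sup>2))" unfolding e .
qed simp

lemma matop_bound:
  assumes q: "matbound \<rho> q" and \<rho>: "0 \<le> \<rho>" and x: "summable (\<lambda>j. (x j)\<^sup>2)"
  shows "(\<Sum>k<N. (matop q x k)\<^sup>2) \<le> \<rho>\<^sup>2 * (\<Sum>j. (x j)\<^sup>2)"
proof (rule LIMSEQ_le_const2)
  show "(\<lambda>n. \<Sum>k<N. (\<Sum>j<n. q j k * x j)\<^sup>2) \<longlonglongrightarrow> (\<Sum>k<N. (matop q x k)\<^sup>2)"
    unfolding matop_def by (intro tendsto_intros summable_LIMSEQ matop_summable[OF q \<rho> x])
  show "\<exists>M. \<forall>n\<ge>M. (\<Sum>k<N. (\<Sum>j<n. q j k * x j)\<^sup>2) \<le> \<rho>\<^sup>2 * (\<Sum>j. (x j)\<^sup>2)"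
    by (intro exI[of _ N]) (auto intro: matop_partial[OF q \<rho> x])
qed

text \<open>Extended values spare every estimate a summability condition; finiteness is extracted
  only where the series itself is used.\<close>

definition sq :: "(nat \<Rightarrow> real) \<Rightarrow> ennreal" where "sq x = (\<Sum>k. ennreal ((x k)\<^sup>2))"

lemma sq_summable: assumes "sq x \<noteq> \<infinity>" shows "summable (\<lambda>k. (x k)\<^sup>2)"
  by (rule summable_suminf_not_top) (use assms in \<open>auto simp: sq_def\<close>)

lemma sq_eq: "summable (\<lambda>k. (x k)\<^sup>2) \<Longrightarrow> sq x = ennreal (\<Sum>k. (x k)\<^sup>2)"
  unfolding sq_def by (rule suminf_ennreal2) auto

lemma sq_le: assumes "\<And>N. (\<Sum>k<N. (x k)\<^sup>2) \<le> C" shows "sq x \<le> ennreal C"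
proof -
  have s: "summable (\<lambda>k. (x k)\<^sup>2)" by (rule summableI_nonneg_bounded[of _ C]) (use assms in auto)
  then show ?thesis unfolding sq_eq[OF s] using assms by (intro ennreal_leI suminf_le_const)
qed

text \<open>For infinite \<open>sq x\<close> the bound holds because a positive factor times
  infinity is infinity; this is where strict positivity of \<rho> enters.\<close>

lemma sq_matop: assumes q: "matbound \<rho> q" and \<rho>: "0 < \<rho>" shows "sq (matop q x) \<le> ennreal (\<rho>\<^sup>2) * sq x"
proof (cases "sq x = \<infinity>")
  case True then show ?thesis using \<rho> by (simp add: ennreal_mult_top)
next
  case False
  note s = sq_summable[OF False]
  have "sq (matop q x) \<le> ennreal (\<rho>\<^sup>2 * (\<Sum>j. (x j)\<^sup>2))"
    by (intro sq_le matop_bound[OF q _ s]) (use \<rho> in simp)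
  also have "\<dots> = ennreal (\<rho>\<^sup>2) * sq x" unfolding sq_eq[OF s] by (intro ennreal_mult) (auto intro!: suminf_nonneg s)
  finally show ?thesis .
qed

lemma matop_diff:
  assumes q: "matbound \<rho> q" and \<rho>: "0 \<le> \<rho>" and "sq x \<noteq> \<infinity>" "sq y \<noteq> \<infinity>"
  shows "matop q (\<lambda>j. x j - y j) k = matop q x k - matop q y k"
  unfolding matop_def using suminf_diff[OF matop_summable[OF q \<rho> sq_summable[OF assms(3)]] matop_summable[OF q \<rho> sq_summable[OF assms(4)]]]
  by (simp add: right_diff_distrib)

text \<open>The free parameter \<eta> replaces the triangle inequality for \<open>Nrm\<close>, which
  is a squared norm: the best \<eta> recovers the square of the sum of two bounds.\<close>

lemma young_square: fixes a b \<eta> :: real assumes "\<eta> > 0"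
  shows "(a + b)\<^sup>2 \<le> (1 + \<eta>) * a\<^sup>2 + (1 + 1 / \<eta>) * b\<^sup>2"
proof -
  have "0 \<le> (sqrt \<eta> * a - b / sqrt \<eta>)\<^sup>2" by simp
  also have "\<dots> = \<eta> * a\<^sup>2 + b\<^sup>2 / \<eta> - 2 * a * b"
    using assms by (simp add: power2_diff power_mult_distrib power_divide)
  finally show ?thesis by (simp add: power2_sum algebra_simps)
qed

lemma sq_add_le: assumes "\<eta> > 0"
  shows "sq (\<lambda>k. x k + y k) \<le> ennreal (1 + \<eta>) * sq x + ennreal (1 + 1 / \<eta>) * sq y"
proof -
  have "sq (\<lambda>k. x k + y k) \<le> (\<Sum>k. ennreal (1 + \<eta>) * ennreal ((x k)\<^sup>2) + ennreal (1 + 1 / \<eta>) * ennreal ((y k)\<^sup>2))"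
    unfolding sq_def
  proof (intro suminf_le allI)
    fix k
    have "ennreal ((x k + y k)\<^sup>2) \<le> ennreal ((1 + \<eta>) * (x k)\<^sup>2 + (1 + 1 / \<eta>) * (y k)\<^sup>2)"
      by (intro ennreal_leI young_square assms)
    also have "\<dots> = ennreal (1 + \<eta>) * ennreal ((x k)\<^sup>2) + ennreal (1 + 1 / \<eta>) * ennreal ((y k)\<^sup>2)"
      using assms by (simp add: ennreal_mult)
    finally show "ennreal ((x k + y k)\<^sup>2) \<le> ennreal (1 + \<eta>) * ennreal ((x k)\<^sup>2) + ennreal (1 + 1 / \<eta>) * ennreal ((y k)\<^sup>2)" .
  qed auto
  also have "\<dots> = ennreal (1 + \<eta>) * sq x + ennreal (1 + 1 / \<eta>) * sq y"
    unfolding sq_def by (subst suminf_add[symmetric]) (auto simp: ennreal_suminf_cmult)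
  finally show ?thesis .
qed

section \<open>Convolutions\<close>

text \<open>An integral over the whole line. Causality is encoded in supports: kernels vanish for
  nonpositive arguments and the functions outside the time interval.\<close>

definition cv :: "(real \<Rightarrow> real) \<Rightarrow> (real \<Rightarrow> real) \<Rightarrow> real \<Rightarrow> real" where
  "cv r x t = (\<integral>s. r (t - s) * x s \<partial>lborel)"

lemma cv_measurable[measurable]: assumes [measurable]: "r \<in> borel_measurable borel" "x \<in> borel_measurable borel"
  shows "cv r x \<in> borel_measurable borel"
  unfolding cv_def[abs_def] by measurable

lemma nn_shift: fixes f :: "real \<Rightarrow> ennreal" assumes [measurable]: "f \<in> borel_measurable borel"
  shows "(\<integral>\<^sup>+s. f (t - s) \<partial>lborel) = (\<integral>\<^sup>+s. f s \<partial>lborel)"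
  using nn_integral_real_affine[of f "-1" t] by simp

lemma nn_shift': fixes f :: "real \<Rightarrow> ennreal" assumes [measurable]: "f \<in> borel_measurable borel"
  shows "(\<integral>\<^sup>+t. f (t - s) \<partial>lborel) = (\<integral>\<^sup>+t. f t \<partial>lborel)"
  using nn_integral_real_affine[of f "1" "- s"] by (simp add: add.commute)

text \<open>Holds with no integrability assumption, since the integral of a non-integrable function
  is 0 by convention.\<close>

lemma cv_abs_le: "ennreal \<bar>cv r x t\<bar> \<le> (\<integral>\<^sup>+s. ennreal \<bar>r (t - s) * x s\<bar> \<partial>lborel)"
proof (cases "integrable lborel (\<lambda>s. r (t - s) * x s)")
  case True
  then show ?thesis unfolding cv_def using integral_norm_bound_ennreal[OF True] by simp
next
  case False then show ?thesis by (simp add: cv_def not_integrable_integral_eq)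
qed

text \<open>Cauchy--Schwarz with \<open>|r| |x| = sqrt |r| * (sqrt |r| * |x|)\<close>.\<close>
lemma cv_square:
  assumes [measurable]: "r \<in> borel_measurable borel" "x \<in> borel_measurable borel"
    and R: "(\<integral>\<^sup>+s. ennreal \<bar>r s\<bar> \<partial>lborel) \<le> ennreal R"
  shows "ennreal ((cv r x t)\<^sup>2) \<le> ennreal R * (\<integral>\<^sup>+s. ennreal \<bar>r (t - s)\<bar> * ennreal ((x s)\<^sup>2) \<partial>lborel)"
proof -
  have "ennreal \<bar>cv r x t\<bar> \<le> (\<integral>\<^sup>+s. ennreal \<bar>r (t - s) * x s\<bar> \<partial>lborel)" by (rule cv_abs_le)
  also have "\<dots> = (\<integral>\<^sup>+s. ennreal (sqrt \<bar>r (t - s)\<bar>) * ennreal (sqrt \<bar>r (t - s)\<bar> * \<bar>x s\<bar>) \<partial>lborel)"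
    by (intro nn_integral_cong) (simp add: abs_mult flip: ennreal_mult mult.assoc)
  finally have "(ennreal \<bar>cv r x t\<bar>)\<^sup>2 \<le> (\<integral>\<^sup>+s. ennreal (sqrt \<bar>r (t - s)\<bar>) * ennreal (sqrt \<bar>r (t - s)\<bar> * \<bar>x s\<bar>) \<partial>lborel)\<^sup>2"
    by (rule power_mono) simp
  also have "\<dots> \<le> (\<integral>\<^sup>+s. (ennreal (sqrt \<bar>r (t - s)\<bar>))\<^sup>2 \<partial>lborel) * (\<integral>\<^sup>+s. (ennreal (sqrt \<bar>r (t - s)\<bar> * \<bar>x s\<bar>))\<^sup>2 \<partial>lborel)"
    by (rule Cauchy_Schwarz_nn_integral) measurable
  also have "(\<integral>\<^sup>+s. (ennreal (sqrt \<bar>r (t - s)\<bar>))\<^sup>2 \<partial>lborel) = (\<integral>\<^sup>+s. ennreal \<bar>r (t - s)\<bar> \<partial>lborel)"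
    by (intro nn_integral_cong) (simp add: ennreal_power)
  also have "\<dots> = (\<integral>\<^sup>+s. ennreal \<bar>r s\<bar> \<partial>lborel)" by (rule nn_shift) measurable
  also have "(\<integral>\<^sup>+s. (ennreal (sqrt \<bar>r (t - s)\<bar> * \<bar>x s\<bar>))\<^sup>2 \<partial>lborel) = (\<integral>\<^sup>+s. ennreal \<bar>r (t - s)\<bar> * ennreal ((x s)\<^sup>2) \<partial>lborel)"
    by (intro nn_integral_cong) (simp add: ennreal_power power_mult_distrib flip: ennreal_mult)
  also have "(\<integral>\<^sup>+s. ennreal \<bar>r s\<bar> \<partial>lborel) * (\<integral>\<^sup>+s. ennreal \<bar>r (t - s)\<bar> * ennreal ((x s)\<^sup>2) \<partial>lborel)
     \<le> ennreal R * (\<integral>\<^sup>+s. ennreal \<bar>r (t - s)\<bar> * ennreal ((x s)\<^sup>2) \<partial>lborel)"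
    by (intro mult_right_mono R) simp
  finally show ?thesis by (simp add: ennreal_power)
qed

lemma tonelli_conv:
  fixes f h :: "real \<Rightarrow> ennreal"
  assumes [measurable]: "f \<in> borel_measurable borel" "h \<in> borel_measurable borel"
  shows "(\<integral>\<^sup>+t. \<integral>\<^sup>+s. f (t - s) * h s \<partial>lborel \<partial>lborel) = (\<integral>\<^sup>+s. f s \<partial>lborel) * (\<integral>\<^sup>+s. h s \<partial>lborel)"
proof -
  have "(\<integral>\<^sup>+t. \<integral>\<^sup>+s. f (t - s) * h s \<partial>lborel \<partial>lborel) = (\<integral>\<^sup>+s. \<integral>\<^sup>+t. f (t - s) * h s \<partial>lborel \<partial>lborel)"
    by (rule lborel_pair.Fubini') measurable
  also have "\<dots> = (\<integral>\<^sup>+s. (\<integral>\<^sup>+t. f t \<partial>lborel) * h s \<partial>lborel)"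
    by (intro nn_integral_cong) (simp add: nn_integral_multc nn_shift')
  also have "\<dots> = (\<integral>\<^sup>+t. f t \<partial>lborel) * (\<integral>\<^sup>+s. h s \<partial>lborel)" by (simp add: nn_integral_cmult)
  finally show ?thesis .
qed

lemma cv_Young:
  assumes [measurable]: "r \<in> borel_measurable borel" "x \<in> borel_measurable borel"
    and R: "(\<integral>\<^sup>+s. ennreal \<bar>r s\<bar> \<partial>lborel) \<le> ennreal R"
  shows "(\<integral>\<^sup>+t. ennreal ((cv r x t)\<^sup>2) \<partial>lborel) \<le> ennreal R * (ennreal R * (\<integral>\<^sup>+t. ennreal ((x t)\<^sup>2) \<partial>lborel))"
proof -
  have "(\<integral>\<^sup>+t. ennreal ((cv r x t)\<^sup>2) \<partial>lborel) \<le> (\<integral>\<^sup>+t. ennreal R * (\<integral>\<^sup>+s. ennreal \<bar>r (t - s)\<bar> * ennreal ((x s)\<^sup>2) \<partial>lborel) \<partial>lborel)"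
    by (intro nn_integral_mono cv_square R) measurable
  also have "\<dots> = ennreal R * ((\<integral>\<^sup>+s. ennreal \<bar>r s\<bar> \<partial>lborel) * (\<integral>\<^sup>+t. ennreal ((x t)\<^sup>2) \<partial>lborel))"
    by (subst nn_integral_cmult, measurable) (subst tonelli_conv[of "\<lambda>s. ennreal \<bar>r s\<bar>" "\<lambda>s. ennreal ((x s)\<^sup>2)"], auto)
  also have "\<dots> \<le> ennreal R * (ennreal R * (\<integral>\<^sup>+t. ennreal ((x t)\<^sup>2) \<partial>lborel))"
    by (intro mult_left_mono mult_right_mono R) auto
  finally show ?thesis .
qed

text \<open>From |x| <= 1 + x^2 the integrand is dominated by the kernel plus the kernel times the
  square; the latter has finite integral for almost every t by Tonelli.\<close>

lemma cv_integrable_AE: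
  fixes r x :: "real \<Rightarrow> real"
  assumes [measurable]: "r \<in> borel_measurable borel" "x \<in> borel_measurable borel"
    and R: "(\<integral>\<^sup>+s. ennreal \<bar>r s\<bar> \<partial>lborel) < \<infinity>" and x: "(\<integral>\<^sup>+s. ennreal ((x s)\<^sup>2) \<partial>lborel) < \<infinity>"
  shows "AE t in lborel. integrable lborel (\<lambda>s. r (t - s) * x s)"
proof -
  have "(\<integral>\<^sup>+t. \<integral>\<^sup>+s. ennreal \<bar>r (t - s)\<bar> * ennreal ((x s)\<^sup>2) \<partial>lborel \<partial>lborel) \<noteq> \<infinity>"
    using tonelli_conv[of "\<lambda>s. ennreal \<bar>r s\<bar>" "\<lambda>s. ennreal ((x s)\<^sup>2)"] R x by (simp add: ennreal_mult_eq_top_iff less_top)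
  then have "AE t in lborel. (\<integral>\<^sup>+s. ennreal \<bar>r (t - s)\<bar> * ennreal ((x s)\<^sup>2) \<partial>lborel) \<noteq> \<infinity>"
    by (intro nn_integral_PInf_AE) auto
  then show ?thesis
  proof eventually_elim
    fix t assume fin: "(\<integral>\<^sup>+s. ennreal \<bar>r (t - s)\<bar> * ennreal ((x s)\<^sup>2) \<partial>lborel) \<noteq> \<infinity>"
    have "(\<integral>\<^sup>+s. ennreal (norm (r (t - s) * x s)) \<partial>lborel) \<le> (\<integral>\<^sup>+s. ennreal \<bar>r (t - s)\<bar> + ennreal \<bar>r (t - s)\<bar> * ennreal ((x s)\<^sup>2) \<partial>lborel)"
    proof (intro nn_integral_mono)
      fix s
      have "\<bar>x s\<bar> \<le> 1 + (x s)\<^sup>2"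
        using zero_le_power2[of "\<bar>x s\<bar> - 1"] by (simp add: power2_diff)
      then have "\<bar>r (t - s)\<bar> * \<bar>x s\<bar> \<le> \<bar>r (t - s)\<bar> * (1 + (x s)\<^sup>2)" by (intro mult_left_mono) auto
      then have "ennreal (norm (r (t - s) * x s)) \<le> ennreal (\<bar>r (t - s)\<bar> + \<bar>r (t - s)\<bar> * (x s)\<^sup>2)"
        by (intro ennreal_leI) (simp add: abs_mult distrib_left)
      then show "ennreal (norm (r (t - s) * x s)) \<le> ennreal \<bar>r (t - s)\<bar> + ennreal \<bar>r (t - s)\<bar> * ennreal ((x s)\<^sup>2)"
        by (simp add: ennreal_mult)
    qed
    also have "\<dots> = (\<integral>\<^sup>+s. ennreal \<bar>r (t - s)\<bar> \<partial>lborel) + (\<integral>\<^sup>+s. ennreal \<bar>r (t - s)\<bar> * ennreal ((x s)\<^sup>2) \<partial>lborel)"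
      by (rule nn_integral_add) measurable
    also have "\<dots> < \<infinity>" using fin R nn_shift[of "\<lambda>s. ennreal \<bar>r s\<bar>" t] by (simp add: less_top)
    finally show "integrable lborel (\<lambda>s. r (t - s) * x s)" by (intro integrableI_bounded) measurable
  qed
qed

lemma cv_diff_AE:
  assumes [measurable]: "r \<in> borel_measurable borel" "x \<in> borel_measurable borel" "y \<in> borel_measurable borel"
    and "(\<integral>\<^sup>+s. ennreal \<bar>r s\<bar> \<partial>lborel) < \<infinity>" "(\<integral>\<^sup>+s. ennreal ((x s)\<^sup>2) \<partial>lborel) < \<infinity>" "(\<integral>\<^sup>+s. ennreal ((y s)\<^sup>2) \<partial>lborel) < \<infinity>"
  shows "AE t in lborel. cv r (\<lambda>s. x s - y s) t = cv r x t - cv r y t"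
  using cv_integrable_AE[OF assms(1,2,4,5)] cv_integrable_AE[OF assms(1,3,4,6)]
  by eventually_elim (simp add: cv_def right_diff_distrib)


section \<open>A Volterra fixed-point problem for sequences\<close>

definition Nrm :: "(nat \<Rightarrow> real \<Rightarrow> real) \<Rightarrow> ennreal" where
  "Nrm x = (\<integral>\<^sup>+t. sq (\<lambda>k. x k t) \<partial>lborel)"

lemma sq_measurable[measurable]: assumes [measurable]: "\<And>k. x k \<in> borel_measurable M"
  shows "(\<lambda>t. sq (\<lambda>k. x k t)) \<in> borel_measurable M"
  unfolding sq_def by measurable

lemma Nrm_eq: assumes [measurable]: "\<And>k. x k \<in> borel_measurable borel"
  shows "Nrm x = (\<Sum>k. \<integral>\<^sup>+t. ennreal ((x k t)\<^sup>2) \<partial>lborel)"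
  unfolding Nrm_def sq_def by (rule nn_integral_suminf) measurable

lemma Nrm_comp: assumes [measurable]: "\<And>k. x k \<in> borel_measurable borel"
  shows "(\<integral>\<^sup>+t. ennreal ((x k t)\<^sup>2) \<partial>lborel) \<le> Nrm x"
  unfolding Nrm_eq[OF assms] using sum_le_suminf[of "\<lambda>k. \<integral>\<^sup>+t. ennreal ((x k t)\<^sup>2) \<partial>lborel" "{k}"] by simp

lemma Nrm_AE: assumes [measurable]: "\<And>k. x k \<in> borel_measurable borel" and "Nrm x < \<infinity>"
  shows "AE t in lborel. sq (\<lambda>k. x k t) \<noteq> \<infinity>"
  using assms(2) unfolding Nrm_def by (intro nn_integral_PInf_AE) auto

lemma Nrm_add_le: assumes [measurable]: "\<And>k. x k \<in> borel_measurable borel" "\<And>k. y k \<in> borel_measurable borel" and "\<eta> > 0"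
  shows "Nrm (\<lambda>k t. x k t + y k t) \<le> ennreal (1 + \<eta>) * Nrm x + ennreal (1 + 1 / \<eta>) * Nrm y"
proof -
  have "Nrm (\<lambda>k t. x k t + y k t) \<le> (\<integral>\<^sup>+t. ennreal (1 + \<eta>) * sq (\<lambda>k. x k t) + ennreal (1 + 1 / \<eta>) * sq (\<lambda>k. y k t) \<partial>lborel)"
    unfolding Nrm_def by (intro nn_integral_mono sq_add_le assms)
  also have "\<dots> = ennreal (1 + \<eta>) * Nrm x + ennreal (1 + 1 / \<eta>) * Nrm y"
    unfolding Nrm_def by (subst nn_integral_add, measurable) (simp add: nn_integral_cmult)
  finally show ?thesis .
qed

lemma Nrm_AE_zero: assumes [measurable]: "\<And>k. x k \<in> borel_measurable borel"
  shows "Nrm x = 0 \<longleftrightarrow> (\<forall>k. AE t in lborel. x k t = 0)"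
proof -
  have "Nrm x = 0 \<longleftrightarrow> (\<forall>k. (\<integral>\<^sup>+t. ennreal ((x k t)\<^sup>2) \<partial>lborel) = 0)"
    unfolding Nrm_eq[OF assms] by (simp add: suminf_eq_zero_iff)
  then show ?thesis by (simp add: nn_integral_0_iff_AE)
qed

lemma Nrm_mono_AE: assumes "\<And>k. AE t in lborel. (x k t)\<^sup>2 \<le> (y k t)\<^sup>2" shows "Nrm x \<le> Nrm y"
  unfolding Nrm_def
proof (rule nn_integral_mono_AE)
  have "AE t in lborel. \<forall>k. (x k t)\<^sup>2 \<le> (y k t)\<^sup>2" using assms by (simp add: AE_all_countable)
  then show "AE t in lborel. sq (\<lambda>k. x k t) \<le> sq (\<lambda>k. y k t)"
    by eventually_elim (auto simp: sq_def intro!: suminf_le ennreal_leI)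
qed

lemma le_cmult_less_top: "a \<le> ennreal c * b \<Longrightarrow> b < \<infinity> \<Longrightarrow> a < \<infinity>"
  by (rule le_less_trans, assumption) (simp add: ennreal_mult_less_top)

text \<open>The kernels \<open>K k\<close> have mass at most 1, so the outer convolution does not
  increase the norm. The contraction constant is therefore the bound of the inner operator, \<rho>1
  + \<rho>2 R.\<close>

locale volterra =
  fixes K :: "nat \<Rightarrow> real \<Rightarrow> real" and r :: "real \<Rightarrow> real" and q b :: "nat \<Rightarrow> nat \<Rightarrow> real" and \<rho>1 \<rho>2 R T :: real
  assumes Km[measurable]: "\<And>k. K k \<in> borel_measurable borel" and K1: "\<And>k. (\<integral>\<^sup>+s. ennreal \<bar>K k s\<bar> \<partial>lborel) \<le> ennreal 1"
    and rm[measurable]: "r \<in> borel_measurable borel" and rR: "(\<integral>\<^sup>+s. ennreal \<bar>r s\<bar> \<partial>lborel) \<le> ennreal R" and R: "R > 0"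
    and q: "matbound \<rho>1 q" and b: "matbound \<rho>2 b" and \<rho>: "\<rho>1 > 0" "\<rho>2 > 0" and small: "\<rho>1 + \<rho>2 * R < 1"
begin

definition FF :: "(nat \<Rightarrow> real \<Rightarrow> real) \<Rightarrow> nat \<Rightarrow> real \<Rightarrow> real" where
  "FF x k s = matop q (\<lambda>j. x j s) k + matop b (\<lambda>j. cv r (x j) s) k"

text \<open>Cutting off to (0, T) keeps all iterates supported there and can only lower the
  norm.\<close>

definition TT :: "(nat \<Rightarrow> real \<Rightarrow> real) \<Rightarrow> nat \<Rightarrow> real \<Rightarrow> real" where
  "TT x k t = indicator {0<..<T} t * cv (K k) (FF x k) t"

abbreviation "bm x \<equiv> (\<forall>k. x k \<in> borel_measurable borel)"

lemma matop_measurable: assumes [measurable]: "\<And>k. x k \<in> borel_measurable borel"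
  shows "(\<lambda>t. matop a (\<lambda>j. x j t) k) \<in> borel_measurable borel"
  unfolding matop_def by measurable

lemma FF_measurable[measurable]: assumes [measurable]: "\<And>k. x k \<in> borel_measurable borel"
  shows "FF x k \<in> borel_measurable borel"
  unfolding FF_def[abs_def] by (intro borel_measurable_add matop_measurable) measurable

lemma TT_measurable[measurable]: assumes [measurable]: "\<And>k. x k \<in> borel_measurable borel"
  shows "TT x k \<in> borel_measurable borel"
  unfolding TT_def[abs_def] by measurable

definition \<rho> where "\<rho> = \<rho>1 + \<rho>2 * R"

lemma \<rho>0: "0 < \<rho>" "\<rho> < 1" using \<rho> R small by (auto simp: \<rho>_def intro!: add_pos_pos mult_pos_pos)

lemma Nrm_cv: assumes [measurable]: "\<And>k. x k \<in> borel_measurable borel"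
  shows "Nrm (\<lambda>k. cv r (x k)) \<le> ennreal (R\<^sup>2) * Nrm x"
proof -
  have "Nrm (\<lambda>k. cv r (x k)) = (\<Sum>k. \<integral>\<^sup>+t. ennreal ((cv r (x k) t)\<^sup>2) \<partial>lborel)"
    by (rule Nrm_eq) measurable
  also have "\<dots> \<le> (\<Sum>k. ennreal (R\<^sup>2) * (\<integral>\<^sup>+t. ennreal ((x k t)\<^sup>2) \<partial>lborel))"
  proof (intro suminf_le allI)
    fix k
    have "ennreal R * (ennreal R * (\<integral>\<^sup>+t. ennreal ((x k t)\<^sup>2) \<partial>lborel)) = ennreal (R\<^sup>2) * (\<integral>\<^sup>+t. ennreal ((x k t)\<^sup>2) \<partial>lborel)"
      using R by (simp add: power2_eq_square ennreal_mult mult.assoc)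
    then show "(\<integral>\<^sup>+t. ennreal ((cv r (x k) t)\<^sup>2) \<partial>lborel) \<le> ennreal (R\<^sup>2) * (\<integral>\<^sup>+t. ennreal ((x k t)\<^sup>2) \<partial>lborel)"
      using cv_Young[of r "x k" R] rR by simp
  qed auto
  also have "\<dots> = ennreal (R\<^sup>2) * Nrm x" unfolding Nrm_eq[OF assms] by simp
  finally show ?thesis .
qed

lemma Nrm_matop: assumes m[measurable]: "\<And>k. x k \<in> borel_measurable borel" and a: "matbound c a" "c > 0"
  shows "Nrm (\<lambda>k t. matop a (\<lambda>j. x j t) k) \<le> ennreal (c\<^sup>2) * Nrm x"
proof -
  have "Nrm (\<lambda>k t. matop a (\<lambda>j. x j t) k) \<le> (\<integral>\<^sup>+t. ennreal (c\<^sup>2) * sq (\<lambda>k. x k t) \<partial>lborel)"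
    unfolding Nrm_def by (intro nn_integral_mono order_trans[OF _ sq_matop[OF a]]) simp
  also have "\<dots> = ennreal (c\<^sup>2) * Nrm x" unfolding Nrm_def by (simp add: nn_integral_cmult)
  finally show ?thesis .
qed

lemma Nrm_FF: assumes m[measurable]: "\<And>k. x k \<in> borel_measurable borel"
  shows "Nrm (FF x) \<le> ennreal (\<rho>\<^sup>2) * Nrm x"
proof -
  \<comment> \<open>The minimising value: it turns the weighted sum of the two squared bounds into
    exactly the square of \<rho>1 + \<rho>2 R.\<close>
  define \<eta> where "\<eta> = \<rho>2 * R / \<rho>1"
  have \<eta>: "\<eta> > 0" using \<rho> R by (simp add: \<eta>_def)
  have "Nrm (FF x) \<le> ennreal (1 + \<eta>) * Nrm (\<lambda>k t. matop q (\<lambda>j. x j t) k) + ennreal (1 + 1 / \<eta>) * Nrm (\<lambda>k t. matop b (\<lambda>j. cv r (x j) t) k)"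
    unfolding FF_def[abs_def] by (rule Nrm_add_le) (auto intro!: matop_measurable cv_measurable rm m \<eta>)
  also have "\<dots> \<le> ennreal (1 + \<eta>) * (ennreal (\<rho>1\<^sup>2) * Nrm x) + ennreal (1 + 1 / \<eta>) * (ennreal (\<rho>2\<^sup>2) * (ennreal (R\<^sup>2) * Nrm x))"
    by (intro add_mono mult_left_mono Nrm_matop[OF m q] order_trans[OF Nrm_matop[OF _ b]] Nrm_cv m \<rho>) auto
  also have "ennreal (1 + \<eta>) * (ennreal (\<rho>1\<^sup>2) * Nrm x) = ennreal ((1 + \<eta>) * \<rho>1\<^sup>2) * Nrm x"
    using \<eta> by (subst ennreal_mult) (auto simp: mult.assoc)
  also have "ennreal (1 + 1 / \<eta>) * (ennreal (\<rho>2\<^sup>2) * (ennreal (R\<^sup>2) * Nrm x)) = ennreal ((1 + 1 / \<eta>) * (\<rho>2\<^sup>2 * R\<^sup>2)) * Nrm x"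
  proof -
    have "ennreal ((1 + 1 / \<eta>) * (\<rho>2\<^sup>2 * R\<^sup>2)) = ennreal (1 + 1 / \<eta>) * (ennreal (\<rho>2\<^sup>2) * ennreal (R\<^sup>2))"
      using \<eta> by (subst ennreal_mult, simp, simp) (subst ennreal_mult, auto)
    then show ?thesis by (simp only: mult.assoc)
  qed
  also have "ennreal ((1 + \<eta>) * \<rho>1\<^sup>2) * Nrm x + ennreal ((1 + 1 / \<eta>) * (\<rho>2\<^sup>2 * R\<^sup>2)) * Nrm x
    = (ennreal ((1 + \<eta>) * \<rho>1\<^sup>2) + ennreal ((1 + 1 / \<eta>) * (\<rho>2\<^sup>2 * R\<^sup>2))) * Nrm x"
    by (rule distrib_right[symmetric])
  also have "ennreal ((1 + \<eta>) * \<rho>1\<^sup>2) + ennreal ((1 + 1 / \<eta>) * (\<rho>2\<^sup>2 * R\<^sup>2)) = ennreal ((1 + \<eta>) * \<rho>1\<^sup>2 + (1 + 1 / \<eta>) * (\<rho>2\<^sup>2 * R\<^sup>2))"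
    using \<eta> by (intro ennreal_plus[symmetric]) auto
  also have "(1 + \<eta>) * \<rho>1\<^sup>2 + (1 + 1 / \<eta>) * (\<rho>2\<^sup>2 * R\<^sup>2) = \<rho>\<^sup>2"
    using \<rho> R by (simp add: \<eta>_def \<rho>_def field_simps power2_eq_square)
  finally show ?thesis .
qed

lemma Nrm_cvK: assumes [measurable]: "\<And>k. y k \<in> borel_measurable borel"
  shows "Nrm (\<lambda>k. cv (K k) (y k)) \<le> Nrm y"
proof -
  have "Nrm (\<lambda>k. cv (K k) (y k)) = (\<Sum>k. \<integral>\<^sup>+t. ennreal ((cv (K k) (y k) t)\<^sup>2) \<partial>lborel)"
    by (rule Nrm_eq) measurable
  also have "\<dots> \<le> (\<Sum>k. \<integral>\<^sup>+t. ennreal ((y k t)\<^sup>2) \<partial>lborel)"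
    by (intro suminf_le allI) (use cv_Young[OF Km assms K1] in auto)
  finally show ?thesis unfolding Nrm_eq[OF assms] .
qed

lemma Nrm_TT: assumes m[measurable]: "\<And>k. x k \<in> borel_measurable borel"
  shows "Nrm (TT x) \<le> ennreal (\<rho>\<^sup>2) * Nrm x"
proof -
  have "Nrm (TT x) \<le> Nrm (\<lambda>k. cv (K k) (FF x k))"
    by (rule Nrm_mono_AE) (auto simp: TT_def indicator_def)
  also have "\<dots> \<le> Nrm (FF x)" by (rule Nrm_cvK) measurable
  finally show ?thesis using Nrm_FF[OF m] by (rule order_trans)
qed

text \<open>Linearity is available only almost everywhere, because both the convolution integrals
  and the matrix series must converge; finite norms guarantee this for almost every time.\<close>

lemma FF_diff_AE: assumes m[measurable]: "\<And>k. x k \<in> borel_measurable borel" "\<And>k. y k \<in> borel_measurable borel"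
  and fin: "Nrm x < \<infinity>" "Nrm y < \<infinity>"
  shows "AE t in lborel. \<forall>k. FF (\<lambda>k t. x k t - y k t) k t = FF x k t - FF y k t"
proof -
  have finc: "(\<integral>\<^sup>+s. ennreal ((x k s)\<^sup>2) \<partial>lborel) < \<infinity>" "(\<integral>\<^sup>+s. ennreal ((y k s)\<^sup>2) \<partial>lborel) < \<infinity>" for k
    using le_less_trans[OF Nrm_comp[of x k, OF m(1)] fin(1)] le_less_trans[OF Nrm_comp[of y k, OF m(2)] fin(2)] by auto
  have rf: "(\<integral>\<^sup>+s. ennreal \<bar>r s\<bar> \<partial>lborel) < \<infinity>" by (rule le_less_trans[OF rR]) simp
  have 1: "AE t in lborel. \<forall>k. cv r (\<lambda>s. x k s - y k s) t = cv r (x k) t - cv r (y k) t"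
    unfolding AE_all_countable by (intro allI cv_diff_AE rf finc) measurable
  have cf: "Nrm (\<lambda>k. cv r (x k)) < \<infinity>" "Nrm (\<lambda>k. cv r (y k)) < \<infinity>"
    by (rule le_cmult_less_top[OF Nrm_cv[OF m(1)] fin(1)], rule le_cmult_less_top[OF Nrm_cv[OF m(2)] fin(2)])
  have 2: "AE t in lborel. sq (\<lambda>k. cv r (x k) t) \<noteq> \<infinity>" by (rule Nrm_AE[OF _ cf(1)]) measurable
  have 3: "AE t in lborel. sq (\<lambda>k. cv r (y k) t) \<noteq> \<infinity>" by (rule Nrm_AE[OF _ cf(2)]) measurable
  show ?thesis using 1 2 3 Nrm_AE[OF m(1) fin(1)] Nrm_AE[OF m(2) fin(2)]
  proof eventually_elim
    fix t
    assume a: "\<forall>k. cv r (\<lambda>s. x k s - y k s) t = cv r (x k) t - cv r (y k) t" "sq (\<lambda>k. cv r (x k) t) \<noteq> \<infinity>" "sq (\<lambda>k. cv r (y k) t) \<noteq> \<infinity>"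
      "sq (\<lambda>k. x k t) \<noteq> \<infinity>" "sq (\<lambda>k. y k t) \<noteq> \<infinity>"
    have "(\<lambda>j. cv r (\<lambda>s. x j s - y j s) t) = (\<lambda>j. cv r (x j) t - cv r (y j) t)" using a(1) by auto
    then show "\<forall>k. FF (\<lambda>k t. x k t - y k t) k t = FF x k t - FF y k t"
      using matop_diff[OF q _ a(4,5)] matop_diff[OF b _ a(2,3)] \<rho> by (simp add: FF_def)
  qed
qed

lemma TT_diff_AE: assumes m[measurable]: "\<And>k. x k \<in> borel_measurable borel" "\<And>k. y k \<in> borel_measurable borel"
  and fin: "Nrm x < \<infinity>" "Nrm y < \<infinity>"
  shows "AE t in lborel. TT (\<lambda>k t. x k t - y k t) k t = TT x k t - TT y k t"
proof -
  have f: "AE t in lborel. FF (\<lambda>k t. x k t - y k t) k t = FF x k t - FF y k t"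
    using FF_diff_AE[OF m fin] by eventually_elim simp
  have e: "cv (K k) (FF (\<lambda>k t. x k t - y k t) k) t = cv (K k) (\<lambda>s. FF x k s - FF y k s) t" for t
    unfolding cv_def by (intro integral_cong_AE) (use f in auto)
  have finF: "Nrm (FF x) < \<infinity>" "Nrm (FF y) < \<infinity>"
    by (rule le_cmult_less_top[OF Nrm_FF[OF m(1)] fin(1)], rule le_cmult_less_top[OF Nrm_FF[OF m(2)] fin(2)])
  have "(\<integral>\<^sup>+s. ennreal ((FF x k s)\<^sup>2) \<partial>lborel) \<le> Nrm (FF x)" "(\<integral>\<^sup>+s. ennreal ((FF y k s)\<^sup>2) \<partial>lborel) \<le> Nrm (FF y)"
    by (rule Nrm_comp, measurable)+
  then have finc: "(\<integral>\<^sup>+s. ennreal ((FF x k s)\<^sup>2) \<partial>lborel) < \<infinity>" "(\<integral>\<^sup>+s. ennreal ((FF y k s)\<^sup>2) \<partial>lborel) < \<infinity>"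
    using finF le_less_trans by blast+
  have "(\<integral>\<^sup>+s. ennreal \<bar>K k s\<bar> \<partial>lborel) < \<infinity>" by (rule le_less_trans[OF K1[of k]]) simp
  then have "AE t in lborel. cv (K k) (\<lambda>s. FF x k s - FF y k s) t = cv (K k) (FF x k) t - cv (K k) (FF y k) t"
    by (intro cv_diff_AE finc) measurable
  then show ?thesis by eventually_elim (simp add: TT_def e right_diff_distrib)
qed

theorem fixed_point_unique:
  assumes m[measurable]: "\<And>k. x k \<in> borel_measurable borel" "\<And>k. y k \<in> borel_measurable borel" "\<And>k. p k \<in> borel_measurable borel"
    and fin: "Nrm x < \<infinity>" "Nrm y < \<infinity>"
    and x: "\<And>k. AE t in lborel. x k t = p k t + TT x k t" and y: "\<And>k. AE t in lborel. y k t = p k t + TT y k t"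
  shows "AE t in lborel. x k t = y k t"
proof -
  let ?d = "\<lambda>k t. x k t - y k t"
  have "AE t in lborel. (?d k t)\<^sup>2 \<le> (TT ?d k t)\<^sup>2" for k
    using x[of k] y[of k] TT_diff_AE[OF m(1,2) fin, of k] by eventually_elim simp
  then have "Nrm ?d \<le> Nrm (TT ?d)" by (rule Nrm_mono_AE)
  also have "\<dots> \<le> ennreal (\<rho>\<^sup>2) * Nrm ?d" by (rule Nrm_TT) measurable
  finally have le: "Nrm ?d \<le> ennreal (\<rho>\<^sup>2) * Nrm ?d" .
  have "Nrm ?d \<le> ennreal (1 + 1) * Nrm x + ennreal (1 + 1 / 1) * Nrm (\<lambda>k t. - y k t)"
    using Nrm_add_le[of x "\<lambda>k t. - y k t" 1] by simp
  also have "Nrm (\<lambda>k t. - y k t) = Nrm y" by (simp add: Nrm_def sq_def)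
  finally have "Nrm ?d < \<infinity>" by (rule le_less_trans) (use fin in \<open>simp add: ennreal_mult_less_top\<close>)
  \<comment> \<open>Finiteness is essential here: the inequality D <= \<rho>^2 D excludes every
    positive real, but not infinity.\<close>
  then obtain D where D: "Nrm ?d = ennreal D" "0 \<le> D" by (cases "Nrm ?d") auto
  have "D \<le> \<rho>\<^sup>2 * D" using le D by (simp flip: ennreal_mult)
  moreover have "\<rho>\<^sup>2 < 1" using \<rho>0 by (simp add: power_less_one_iff)
  ultimately have "D = 0" using D(2) by (metis mult_le_cancel_right1 not_le order_antisym)
  then have "Nrm ?d = 0" using D by simp
  then have "AE t in lborel. ?d k t = 0" by (subst (asm) Nrm_AE_zero) auto
  then show ?thesis by simp
qed

text \<open>Convolution does not see null sets, so equality almost everywhere of the arguments gives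
  equality at every time after the outer convolution.\<close>

lemma FF_AE_cong: assumes m[measurable]: "\<And>k. x k \<in> borel_measurable borel" "\<And>k. y k \<in> borel_measurable borel"
  and e: "\<And>k. AE t in lborel. x k t = y k t"
  shows "cv (K k) (FF x k) t = cv (K k) (FF y k) t"
proof -
  have c: "cv r (x j) s = cv r (y j) s" for j s
    unfolding cv_def by (intro integral_cong_AE) (use e[of j] in auto)
  have "AE s in lborel. \<forall>j. x j s = y j s" using e by (simp add: AE_all_countable)
  then have "AE s in lborel. FF x k s = FF y k s"
    by eventually_elim (simp add: FF_def c)
  then show ?thesis unfolding cv_def by (intro integral_cong_AE) auto
qed

text \<open>Picard iteration from 0. Increments decay geometrically in mean square, and the limit is
  a fixed point almost everywhere; applying the map once more makes the identity hold at every
  time.\<close>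

theorem fixed_point_exists:
  assumes p[measurable]: "\<And>k. p k \<in> borel_measurable borel" and finp: "Nrm p < \<infinity>"
  shows "\<exists>x. (\<forall>k. x k \<in> borel_measurable borel) \<and> Nrm x < \<infinity> \<and> (\<forall>k t. x k t = p k t + TT x k t)"
proof -
  define \<Psi> where "\<Psi> x k t = p k t + TT x k t" for x k t
  have \<Psi>m[measurable]: "\<Psi> x k \<in> borel_measurable borel" if [measurable]: "\<And>k. x k \<in> borel_measurable borel" for x k
    unfolding \<Psi>_def[abs_def] by measurable
  have TTfin: "Nrm (TT x) < \<infinity>" if "\<And>k. x k \<in> borel_measurable borel" "Nrm x < \<infinity>" for x
    by (rule le_cmult_less_top[OF Nrm_TT that(2)]) (rule that(1))
  have addfin: "Nrm (\<lambda>k t. x k t + y k t) < \<infinity>"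
    if [measurable]: "\<And>k. x k \<in> borel_measurable borel" "\<And>k. y k \<in> borel_measurable borel" and "Nrm x < \<infinity>" "Nrm y < \<infinity>" for x y
  proof (rule le_less_trans[OF Nrm_add_le[of x y 1]])
    show "ennreal (1 + 1) * Nrm x + ennreal (1 + 1 / 1) * Nrm y < \<infinity>"
      using that(3,4) by (simp add: ennreal_mult_less_top)
  qed auto
  have \<Psi>fin: "Nrm (\<Psi> x) < \<infinity>" if "\<And>k. x k \<in> borel_measurable borel" "Nrm x < \<infinity>" for x
    unfolding \<Psi>_def[abs_def] by (intro addfin TTfin finp that) (auto intro: TT_measurable that)
  have contr: "Nrm (\<lambda>k t. \<Psi> x k t - \<Psi> y k t) \<le> ennreal (\<rho>\<^sup>2) * Nrm (\<lambda>k t. x k t - y k t)"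
    if m[measurable]: "\<And>k. x k \<in> borel_measurable borel" "\<And>k. y k \<in> borel_measurable borel" and f: "Nrm x < \<infinity>" "Nrm y < \<infinity>" for x y
  proof -
    have "Nrm (\<lambda>k t. \<Psi> x k t - \<Psi> y k t) \<le> Nrm (TT (\<lambda>k t. x k t - y k t))"
    proof (rule Nrm_mono_AE)
      fix k
      show "AE t in lborel. (\<Psi> x k t - \<Psi> y k t)\<^sup>2 \<le> (TT (\<lambda>k t. x k t - y k t) k t)\<^sup>2"
        using TT_diff_AE[OF m f, of k] by eventually_elim (simp add: \<Psi>_def)
    qed
    also have "\<dots> \<le> ennreal (\<rho>\<^sup>2) * Nrm (\<lambda>k t. x k t - y k t)" by (rule Nrm_TT) measurable
    finally show ?thesis .
  qed
  define u where "u n = (\<Psi> ^^ n) (\<lambda>k t. 0)" for n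
  have u0: "u 0 = (\<lambda>k t. 0)" and uS: "u (Suc n) = \<Psi> (u n)" for n by (simp_all add: u_def)
  have um[measurable]: "u n k \<in> borel_measurable borel" for n k
    by (induction n arbitrary: k) (auto simp: u0 uS intro: \<Psi>m)
  have ufin: "Nrm (u n) < \<infinity>" for n
  proof (induction n)
    case 0 show ?case by (simp add: u0 Nrm_def sq_def)
  next
    case (Suc n) then show ?case unfolding uS by (intro \<Psi>fin um)
  qed
  obtain C where C: "Nrm (\<lambda>k t. u 1 k t - u 0 k t) = ennreal C" "0 \<le> C"
    using ufin[of 1] by (cases "Nrm (u 1)") (auto simp: u0)
  have geo: "Nrm (\<lambda>k t. u (Suc n) k t - u n k t) \<le> ennreal (C * (\<rho>\<^sup>2) ^ n)" for n
  proof (induction n)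
    case 0 then show ?case using C by simp
  next
    case (Suc n)
    have "Nrm (\<lambda>k t. u (Suc (Suc n)) k t - u (Suc n) k t) \<le> ennreal (\<rho>\<^sup>2) * Nrm (\<lambda>k t. u (Suc n) k t - u n k t)"
      using contr[of "u (Suc n)" "u n", OF um um ufin ufin] by (simp only: uS)
    also have "\<dots> \<le> ennreal (\<rho>\<^sup>2) * ennreal (C * (\<rho>\<^sup>2) ^ n)" by (intro mult_left_mono Suc) simp
    also have "\<dots> = ennreal (C * (\<rho>\<^sup>2) ^ Suc n)" using C by (simp flip: ennreal_mult' add: mult_ac)
    finally show ?case .
  qed
  \<comment> \<open>A sequence of functions of time is one function of (k, t) on counting measure
    times Lebesgue measure, where \<open>Nrm\<close> is the squared L2 norm.\<close>
  let ?M = "count_space UNIV \<Otimes>\<^sub>M (lborel :: real measure)"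
  have pm: "(\<lambda>(k, t). w k t) \<in> borel_measurable ?M" if "\<And>k. w k \<in> borel_measurable borel" for w :: "nat \<Rightarrow> real \<Rightarrow> real"
    by (rule measurable_pair_measure_countable1) (use that in auto)
  have NM: "(\<integral>\<^sup>+x. ennreal ((norm ((case x of (k, t) \<Rightarrow> w k t) :: real))\<^sup>2) \<partial>?M) = Nrm w" if "\<And>k. w k \<in> borel_measurable borel" for w
  proof -
    have [measurable]: "(\<lambda>(k, t). w k t) \<in> borel_measurable ?M" by (rule pm[OF that])
    have "(\<integral>\<^sup>+x. ennreal ((norm (case x of (k, t) \<Rightarrow> w k t))\<^sup>2) \<partial>?M) = (\<integral>\<^sup>+k. \<integral>\<^sup>+t. ennreal ((w k t)\<^sup>2) \<partial>lborel \<partial>count_space UNIV)"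
      by (subst lborel.nn_integral_fst[symmetric]) auto
    also have "\<dots> = Nrm w" unfolding Nrm_eq[OF that] by (rule nn_integral_count_space_nat)
    finally show ?thesis .
  qed
  have "\<exists>g\<in>borel_measurable ?M. (AE x in ?M. (\<lambda>n. case x of (k, t) \<Rightarrow> u n k t) \<longlonglongrightarrow> g x) \<and>
     ((\<lambda>n. \<integral>\<^sup>+x. ennreal ((norm ((case x of (k, t) \<Rightarrow> u n k t) - g x))\<^sup>2) \<partial>?M) \<longlonglongrightarrow> 0)"
  proof (rule L2_geometric_limit[where C=C and \<rho>="\<rho>\<^sup>2"])
    show "(\<lambda>x. case x of (k, t) \<Rightarrow> u n k t) \<in> borel_measurable ?M" for n by (rule pm) (rule um)
    fix n
    have "(\<lambda>x. (case x of (k, t) \<Rightarrow> u (Suc n) k t) - (case x of (k, t) \<Rightarrow> u n k t)) = (\<lambda>x. case x of (k, t) \<Rightarrow> u (Suc n) k t - u n k t)"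
      by (auto simp: fun_eq_iff)
    then have "(\<integral>\<^sup>+x. ennreal ((norm ((case x of (k, t) \<Rightarrow> u (Suc n) k t) - (case x of (k, t) \<Rightarrow> u n k t)))\<^sup>2) \<partial>?M)
      = (\<integral>\<^sup>+x. ennreal ((norm (case x of (k, t) \<Rightarrow> u (Suc n) k t - u n k t))\<^sup>2) \<partial>?M)" by (metis (no_types, lifting))
    also have "\<dots> = Nrm (\<lambda>k t. u (Suc n) k t - u n k t)" by (rule NM) (intro borel_measurable_diff um)
    finally show "(\<integral>\<^sup>+x. ennreal ((norm ((case x of (k, t) \<Rightarrow> u (Suc n) k t) - (case x of (k, t) \<Rightarrow> u n k t)))\<^sup>2) \<partial>?M) \<le> ennreal (C * (\<rho>\<^sup>2) ^ n)"
      using geo by simp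
  qed (use \<rho>0 C in \<open>auto simp: power_less_one_iff\<close>)
  then obtain G where G: "G \<in> borel_measurable ?M"
    and lim: "(\<lambda>n. \<integral>\<^sup>+x. ennreal ((norm ((case x of (k, t) \<Rightarrow> u n k t) - G x))\<^sup>2) \<partial>?M) \<longlonglongrightarrow> 0" by blast
  define g where "g k t = G (k, t)" for k t
  have gm[measurable]: "g k \<in> borel_measurable borel" for k
    using measurable_Pair2[OF G, of k] by (simp add: g_def[abs_def])
  have lim': "(\<lambda>n. Nrm (\<lambda>k t. u n k t - g k t)) \<longlonglongrightarrow> 0"
  proof -
    have "(\<integral>\<^sup>+x. ennreal ((norm ((case x of (k, t) \<Rightarrow> u n k t) - G x))\<^sup>2) \<partial>?M) = Nrm (\<lambda>k t. u n k t - g k t)" for n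
    proof -
      have "(\<lambda>x. (case x of (k, t) \<Rightarrow> u n k t) - G x) = (\<lambda>x. case x of (k, t) \<Rightarrow> u n k t - g k t)"
        by (auto simp: fun_eq_iff g_def)
      then have "(\<integral>\<^sup>+x. ennreal ((norm ((case x of (k, t) \<Rightarrow> u n k t) - G x))\<^sup>2) \<partial>?M)
        = (\<integral>\<^sup>+x. ennreal ((norm (case x of (k, t) \<Rightarrow> u n k t - g k t))\<^sup>2) \<partial>?M)" by (metis (no_types, lifting))
      also have "\<dots> = Nrm (\<lambda>k t. u n k t - g k t)" by (rule NM) (intro borel_measurable_diff um gm)
      finally show ?thesis .
    qed
    with lim show ?thesis by simp
  qed
  have gfin: "Nrm g < \<infinity>"
  proof -
    have "\<forall>\<^sub>F n in sequentially. Nrm (\<lambda>k t. u n k t - g k t) < 1" using lim' by (rule order_tendstoD) simp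
    then obtain n where "Nrm (\<lambda>k t. u n k t - g k t) < 1" by (auto simp: eventually_sequentially)
    then have f: "Nrm (\<lambda>k t. u n k t - g k t) < \<infinity>" by (rule less_trans) simp
    have "Nrm (\<lambda>k t. g k t - u n k t) = Nrm (\<lambda>k t. u n k t - g k t)" by (simp add: Nrm_def sq_def power2_commute)
    then have "Nrm (\<lambda>k t. u n k t + (g k t - u n k t)) < \<infinity>" by (intro addfin ufin) (use f in auto)
    then show ?thesis by simp
  qed
  have "Nrm (\<lambda>k t. \<Psi> g k t - g k t) \<le> 0"
  proof (rule LIMSEQ_le_const)
    have "(\<lambda>n. ennreal (1 + 1) * (ennreal (\<rho>\<^sup>2) * Nrm (\<lambda>k t. u n k t - g k t)) + ennreal (1 + 1 / 1) * Nrm (\<lambda>k t. u (Suc n) k t - g k t))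
      \<longlonglongrightarrow> ennreal (1 + 1) * (ennreal (\<rho>\<^sup>2) * 0) + ennreal (1 + 1 / 1) * 0"
      by (intro tendsto_add ennreal_tendsto_cmult lim' LIMSEQ_Suc) auto
    then show "(\<lambda>n. ennreal (1 + 1) * (ennreal (\<rho>\<^sup>2) * Nrm (\<lambda>k t. u n k t - g k t)) + ennreal (1 + 1 / 1) * Nrm (\<lambda>k t. u (Suc n) k t - g k t)) \<longlonglongrightarrow> 0" by simp
    have "Nrm (\<lambda>k t. \<Psi> g k t - g k t) \<le> ennreal (1 + 1) * (ennreal (\<rho>\<^sup>2) * Nrm (\<lambda>k t. u n k t - g k t)) + ennreal (1 + 1 / 1) * Nrm (\<lambda>k t. u (Suc n) k t - g k t)" for n
    proof -
      have "Nrm (\<lambda>k t. \<Psi> g k t - g k t) = Nrm (\<lambda>k t. (\<Psi> g k t - u (Suc n) k t) + (u (Suc n) k t - g k t))" by simp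
      also have "\<dots> \<le> ennreal (1 + 1) * Nrm (\<lambda>k t. \<Psi> g k t - u (Suc n) k t) + ennreal (1 + 1 / 1) * Nrm (\<lambda>k t. u (Suc n) k t - g k t)"
        by (rule Nrm_add_le) (auto intro!: borel_measurable_diff \<Psi>m)
      also have "Nrm (\<lambda>k t. \<Psi> g k t - u (Suc n) k t) \<le> ennreal (\<rho>\<^sup>2) * Nrm (\<lambda>k t. g k t - u n k t)"
        unfolding uS by (intro contr gm um gfin ufin)
      also have "Nrm (\<lambda>k t. g k t - u n k t) = Nrm (\<lambda>k t. u n k t - g k t)" by (simp add: Nrm_def sq_def power2_commute)
      finally show ?thesis by (simp add: add_mono mult_left_mono)
    qed
    then show "\<exists>N. \<forall>n\<ge>N. Nrm (\<lambda>k t. \<Psi> g k t - g k t) \<le> ennreal (1 + 1) * (ennreal (\<rho>\<^sup>2) * Nrm (\<lambda>k t. u n k t - g k t)) + ennreal (1 + 1 / 1) * Nrm (\<lambda>k t. u (Suc n) k t - g k t)" by blast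
  qed
  then have "Nrm (\<lambda>k t. \<Psi> g k t - g k t) = 0" by simp
  then have ae: "AE t in lborel. \<Psi> g k t = g k t" for k
    by (subst (asm) Nrm_AE_zero) (auto intro!: borel_measurable_diff \<Psi>m)
  \<comment> \<open>The limit \<open>g\<close> satisfies the equation only almost everywhere. Its
    image under the map has the same convolutions, so it satisfies the equation pointwise and is
    taken instead.\<close>
  have "cv (K k) (FF (\<Psi> g) k) t = cv (K k) (FF g k) t" for k t
    by (rule FF_AE_cong) (auto intro: \<Psi>m gm ae)
  then have "\<Psi> g k t = p k t + TT (\<Psi> g) k t" for k t
    by (simp add: TT_def) (simp add: \<Psi>_def TT_def)
  then show ?thesis using \<Psi>m[of g, OF gm] \<Psi>fin[of g, OF gm gfin] by blast
qed

end

section \<open>The bilinear forms\<close>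

lemma bounded_linear_sqint:
  fixes f :: "'b::euclidean_space \<Rightarrow> 'c::euclidean_space"
  assumes f: "bounded_linear f" and b: "\<And>x. norm (f x) \<le> C * norm x" and g: "sqint M g"
  shows "sqint M (\<lambda>z. f (g z))" "ip M (\<lambda>z. f (g z)) (\<lambda>z. f (g z)) \<le> C\<^sup>2 * ip M g g"
proof -
  have [measurable]: "g \<in> borel_measurable M" using g by (rule sqint_measurable)
  have m: "(\<lambda>z. f (g z)) \<in> borel_measurable M"
    by (rule measurable_compose[OF _ borel_measurable_continuous_onI]) (auto intro: linear_continuous_on f)
  have n: "(norm (f (g z)))\<^sup>2 \<le> C\<^sup>2 * (norm (g z))\<^sup>2" for z
    using power_mono[OF b[of "g z"] norm_ge_zero, of 2] by (simp add: power_mult_distrib)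
  have i: "integrable M (\<lambda>z. C\<^sup>2 * (norm (g z))\<^sup>2)" using g by (simp add: sqint_def)
  have "integrable M (\<lambda>z. (norm (f (g z)))\<^sup>2)"
    by (rule Bochner_Integration.integrable_bound[OF i]) (use m n in auto)
  then show "sqint M (\<lambda>z. f (g z))" using m by (simp add: sqint_def)
  show "ip M (\<lambda>z. f (g z)) (\<lambda>z. f (g z)) \<le> C\<^sup>2 * ip M g g"
    unfolding ip_self integral_mult_right_zero[symmetric] using \<open>integrable M (\<lambda>z. (norm (f (g z)))\<^sup>2)\<close> i n
    by (intro integral_mono) auto
qed

lemma ip_bounded_linear:
  fixes f :: "'b::euclidean_space \<Rightarrow> 'c::euclidean_space"
  assumes f: "bounded_linear f" and b: "\<And>x. norm (f x) \<le> C * norm x" and C: "0 \<le> C" and g: "sqint M g" and h: "sqint M h"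
  shows "\<bar>ip M (\<lambda>z. f (g z)) h\<bar> \<le> C * sqrt (ip M g g) * sqrt (ip M h h)"
proof -
  note s = bounded_linear_sqint[OF f b g]
  have "\<bar>ip M (\<lambda>z. f (g z)) h\<bar> \<le> sqrt (ip M (\<lambda>z. f (g z)) (\<lambda>z. f (g z))) * sqrt (ip M h h)"
    by (rule ip_Cauchy_Schwarz[OF s(1) h])
  also have "\<dots> \<le> sqrt (C\<^sup>2 * ip M g g) * sqrt (ip M h h)" by (intro mult_right_mono real_sqrt_le_mono s(2)) simp
  finally show ?thesis using C by (simp add: real_sqrt_mult)
qed

locale heat_wells = wells +
  fixes Do Di De vo vi ve bo be bf :: real
  assumes Dpos: "Do > 0" "Di > 0" "De > 0" and bf: "bf > 0"
begin

text \<open>\<open>PA\<close>, \<open>CA\<close>, \<open>BA\<close> and \<open>SA\<close> are the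
  matrices of diffusion, convection, exchange and memory in the coordinates of \<open>lift\<close>,
  whose square-root weights produce the divisions by ao, ai and ae.\<close>

definition PA :: "real \<times> real \<times> real \<Rightarrow> real \<times> real \<times> real" where
  "PA x = (Do / ao * fst x, Di / ai * fst (snd x), De / ae * snd (snd x))"
definition CA :: "real \<times> real \<times> real \<Rightarrow> real \<times> real \<times> real" where
  "CA x = (- vo * fst x, vi * fst (snd x), - ve * snd (snd x))"
definition BA :: "real \<times> real \<times> real \<Rightarrow> real \<times> real \<times> real" where
  "BA x = (let p = fst x / sqrt ao; q = fst (snd x) / sqrt ai; s = snd (snd x) / sqrt ae in
     (bo * (p - q) / sqrt ao, (be * (q - s) - bo * (p - q)) / sqrt ai, (bf * s - be * (q - s)) / sqrt ae))"
definition SA :: "real \<times> real \<times> real \<Rightarrow> real \<times> real \<times> real" where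
  "SA x = (0, 0, bf / ae * snd (snd x))"

lemma bounded_linear_maps: "bounded_linear PA" "bounded_linear CA" "bounded_linear BA" "bounded_linear SA"
  unfolding PA_def CA_def BA_def SA_def Let_def
  by (intro linear_conv_bounded_linear[THEN iffD1] linearI;
      simp add: algebra_simps add_divide_distrib diff_divide_distrib)+

definition "KC = onorm CA"
definition "KB = onorm BA"
definition "KS = onorm SA"

lemma KC: "0 \<le> KC" "norm (CA x) \<le> KC * norm x"
  unfolding KC_def using bounded_linear_maps by (auto intro: onorm_pos_le onorm)
lemma KB: "0 \<le> KB" "norm (BA x) \<le> KB * norm x"
  unfolding KB_def using bounded_linear_maps by (auto intro: onorm_pos_le onorm)
lemma KS: "0 \<le> KS" "norm (SA x) \<le> KS * norm x"
  unfolding KS_def using bounded_linear_maps by (auto intro: onorm_pos_le onorm)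

text \<open>A sum of positive ratios exceeds each of them strictly, so \<mu> - dmin > 0, and the
  bound built from it is positive as the fixed-point argument requires.\<close>

definition "\<mu> = Do / ao + Di / ai + De / ae"
definition "dmin = min (Do / ao) (min (Di / ai) (De / ae))"

lemma \<mu>: "0 < dmin" "dmin < \<mu>" "0 < \<mu>"
proof -
  have p: "0 < Do / ao" "0 < Di / ai" "0 < De / ae" using Dpos ao ai ae by auto
  then show "0 < dmin" by (simp add: dmin_def)
  have "dmin \<le> Do / ao" by (simp add: dmin_def)
  then show "dmin < \<mu>" using p unfolding \<mu>_def by linarith
  show "0 < \<mu>" using p by (simp add: \<mu>_def)
qed

text \<open>The source of the contraction: the matrix is diagonal, and its entries \<mu> - D_j / a_j
  lie between 0 and \<mu> - dmin, which is strictly less than \<mu>.\<close>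

lemma PA_contr: "norm (\<mu> *\<^sub>R x - PA x) \<le> (\<mu> - dmin) * norm x"
proof -
  have p: "0 < Do / ao" "0 < Di / ai" "0 < De / ae" using Dpos ao ai ae by auto
  have c: "0 \<le> \<mu> - d" "\<mu> - d \<le> \<mu> - dmin" if "d = Do / ao \<or> d = Di / ai \<or> d = De / ae" for d
    using that p by (auto simp: \<mu>_def dmin_def)
  have s: "((\<mu> - d) * a)\<^sup>2 \<le> (\<mu> - dmin)\<^sup>2 * a\<^sup>2" if "d = Do / ao \<or> d = Di / ai \<or> d = De / ae" for d a
    unfolding power_mult_distrib using c[OF that] by (intro mult_right_mono power_mono) auto
  have "(norm (\<mu> *\<^sub>R x - PA x))\<^sup>2 = ((\<mu> - Do / ao) * fst x)\<^sup>2 + (((\<mu> - Di / ai) * fst (snd x))\<^sup>2 + ((\<mu> - De / ae) * snd (snd x))\<^sup>2)"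
    by (cases x) (simp add: PA_def norm_Pair algebra_simps)
  also have "\<dots> \<le> (\<mu> - dmin)\<^sup>2 * (fst x)\<^sup>2 + ((\<mu> - dmin)\<^sup>2 * (fst (snd x))\<^sup>2 + (\<mu> - dmin)\<^sup>2 * (snd (snd x))\<^sup>2)"
    by (intro add_mono s) auto
  also have "\<dots> = ((\<mu> - dmin) * norm x)\<^sup>2"
    by (cases x) (simp add: norm_Pair power_mult_distrib distrib_left)
  finally show ?thesis by (rule power2_le_imp_le) (use \<mu> in simp)
qed

lemma bounded_linear_PA': "bounded_linear (\<lambda>x. \<mu> *\<^sub>R x - PA x)"
  by (intro bounded_linear_sub bounded_linear_scaleR_right bounded_linear_maps)

abbreviation "A T \<Phi> \<equiv> A_form L Do Di De ao ai ae vo vi ve bo be bf T \<Phi>"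

definition S :: "triple \<Rightarrow> triple \<Rightarrow> real" where "S T \<Phi> = ip M (\<lambda>z. SA (lift T z)) (lift \<Phi>)"

lemma scale_sqrt: "w > 0 \<Longrightarrow> t * (sqrt w * a) * (sqrt w * b) = t * w * a * b"
  by simp

text \<open>Writes the form as L2 products with three pointwise linear maps, so that its linearity
  and bounds follow from general facts about bounded linear maps.\<close>

lemma A_repr: assumes "inV L T" "inV L \<Phi>"
  shows "A T \<Phi> = ip M (\<lambda>z. PA (Dlift T z)) (Dlift \<Phi>) + ip M (\<lambda>z. CA (Dlift T z)) (lift \<Phi>) + ip M (\<lambda>z. BA (lift T z)) (lift \<Phi>)"
proof -
  let ?f1 = "\<lambda>z. Do * dz L (co T) z * dz L (co \<Phi>) z - ao * vo * dz L (co T) z * co \<Phi> z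
       + Di * dz L (ci T) z * dz L (ci \<Phi>) z + ai * vi * dz L (ci T) z * ci \<Phi> z
       + De * dz L (ce T) z * dz L (ce \<Phi>) z - ae * ve * dz L (ce T) z * ce \<Phi> z"
  have i: "integrable M (\<lambda>z. PA (Dlift T z) \<bullet> Dlift \<Phi> z)" "integrable M (\<lambda>z. CA (Dlift T z) \<bullet> lift \<Phi> z)" "integrable M (\<lambda>z. BA (lift T z) \<bullet> lift \<Phi> z)"
    using assms by (auto intro!: sqint_inner_integrable bounded_linear_sqint(1)[OF bounded_linear_maps(1) onorm[OF bounded_linear_maps(1)]]
        bounded_linear_sqint(1)[OF bounded_linear_maps(2) onorm[OF bounded_linear_maps(2)]]
        bounded_linear_sqint(1)[OF bounded_linear_maps(3) onorm[OF bounded_linear_maps(3)]] sqint_Dlift sqint_lift_V)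
  have e1: "?f1 z = PA (Dlift T z) \<bullet> Dlift \<Phi> z + CA (Dlift T z) \<bullet> lift \<Phi> z" for z
    unfolding PA_def CA_def Dlift_def lift_def inner_Pair fst_conv snd_conv inner_real_def
      scale_sqrt[OF ao] scale_sqrt[OF ai] scale_sqrt[OF ae] using ao ai ae by simp
  have s: "sqint M (co T)" "sqint M (ci T)" "sqint M (ce T)" "sqint M (co \<Phi>)" "sqint M (ci \<Phi>)" "sqint M (ce \<Phi>)"
    using sqint_V_comps assms by auto
  have ib: "integrable M (\<lambda>z. (co T z - ci T z) * (co \<Phi> z - ci \<Phi> z))" "integrable M (\<lambda>z. (ci T z - ce T z) * (ci \<Phi> z - ce \<Phi> z))"
    "integrable M (\<lambda>z. ce T z * ce \<Phi> z)"
    using sqint_inner_integrable[OF sqint_diff[OF s(1,2)] sqint_diff[OF s(4,5)]]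
      sqint_inner_integrable[OF sqint_diff[OF s(2,3)] sqint_diff[OF s(5,6)]] sqint_inner_integrable[OF s(3,6)] by simp_all
  have e2: "BA (lift T z) \<bullet> lift \<Phi> z = bo * ((co T z - ci T z) * (co \<Phi> z - ci \<Phi> z)) + be * ((ci T z - ce T z) * (ci \<Phi> z - ce \<Phi> z)) + bf * (ce T z * ce \<Phi> z)" for z
  proof -
    have c: "sqrt ao * a / sqrt ao = a" "sqrt ai * a / sqrt ai = a" "sqrt ae * a / sqrt ae = a"
      "a / sqrt ao * (sqrt ao * b) = a * b" "a / sqrt ai * (sqrt ai * b) = a * b" "a / sqrt ae * (sqrt ae * b) = a * b" for a b
      using ao ai ae by auto
    show ?thesis
      unfolding BA_def lift_def Let_def inner_Pair fst_conv snd_conv inner_real_def c by (simp add: algebra_simps)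
  qed
  have "B_form L bo be bf T \<Phi> = ip M (\<lambda>z. BA (lift T z)) (lift \<Phi>)"
    unfolding B_form_def ip_def e2 using ib by (simp add: LINT_eq_on)
  moreover have "(LINT z:{0<..<L}|lebesgue. ?f1 z) = ip M (\<lambda>z. PA (Dlift T z)) (Dlift \<Phi>) + ip M (\<lambda>z. CA (Dlift T z)) (lift \<Phi>)"
    unfolding e1 using i by (simp add: LINT_eq_on ip_def)
  ultimately show ?thesis by (simp add: A_form_def)
qed

lemma S_eq: assumes "inV L T" "inV L \<Phi>" shows "S T \<Phi> = bf * (LINT z:{0<..<L}|lebesgue. ce T z * ce \<Phi> z)"
proof -
  have "SA (lift T z) \<bullet> lift \<Phi> z = bf * (ce T z * ce \<Phi> z)" for z
    using ae unfolding SA_def lift_def inner_Pair fst_conv snd_conv inner_real_def scale_sqrt[OF ae] by simp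
  then show ?thesis by (simp add: S_def ip_def LINT_eq_on)
qed

lemma nH_le: assumes "inV L \<Phi>" shows "nH \<Phi> \<le> KD * KV * nD \<Phi>"
proof -
  let ?S = "ip M (Vl \<Phi>) (Vl \<Phi>)"
  note e = ip_Vl[OF assms]
  have "nH \<Phi> \<le> ao * ?S + (ai * ?S + ae * ?S)"
    unfolding nH_split[OF inV_inH[OF assms]] e using ao ai ae
    by (intro add_mono mult_left_mono) (auto intro!: add_nonneg_nonneg simp: add_increasing add_increasing2)
  also have "\<dots> = KD * ?S" by (simp add: KD_def algebra_simps)
  also have "\<dots> \<le> KD * (KV * nD \<Phi>)" using ao ai ae by (intro mult_left_mono Vl_bound assms) (simp add: KD_def)
  finally show ?thesis by (simp add: mult.assoc)
qed

lemma KD: "KD > 0" using ao ai ae by (simp add: KD_def)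

lemma lift_comp_lin: assumes "bounded_linear f" shows "f (x + c *\<^sub>R y) = f x + c *\<^sub>R f y"
  using assms by (simp add: linear_simps)

text \<open>The hypothesis on g'' is only almost everywhere because the chosen derivatives
  \<open>dz\<close> add up only almost everywhere.\<close>

lemma form_lin_left:
  fixes f :: "real \<times> real \<times> real \<Rightarrow> real \<times> real \<times> real"
  assumes f: "bounded_linear f" and g: "sqint M g" "sqint M g'" "sqint M h" "g'' \<in> borel_measurable M" and e: "AE z in M. g'' z = g z + c *\<^sub>R g' z"
  shows "ip M (\<lambda>z. f (g'' z)) h = ip M (\<lambda>z. f (g z)) h + c * ip M (\<lambda>z. f (g' z)) h"
proof -
  note bs = bounded_linear_sqint(1)[OF f onorm[OF f]]
  have m: "(\<lambda>z. f (w z)) \<in> borel_measurable M" if "w \<in> borel_measurable M" for w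
    by (rule measurable_compose[OF that borel_measurable_continuous_onI]) (auto intro: linear_continuous_on f)
  have "ip M (\<lambda>z. f (g'' z)) h = ip M (\<lambda>z. f (g z) + c *\<^sub>R f (g' z)) h"
  proof (rule ip_AE_cong)
    show "AE z in M. f (g'' z) = f (g z) + c *\<^sub>R f (g' z)" using e by eventually_elim (simp add: lift_comp_lin[OF f])
    show "(\<lambda>z. f (g z) + c *\<^sub>R f (g' z)) \<in> borel_measurable M"
      using sqint_measurable[OF bs[OF g(1)]] sqint_measurable[OF bs[OF g(2)]] by measurable
  qed (use m g in \<open>auto simp: sqint_measurable\<close>)
  also have "\<dots> = ip M (\<lambda>z. f (g z)) h + ip M (\<lambda>z. c *\<^sub>R f (g' z)) h"
    by (rule ip_add_left[OF bs[OF g(1)] sqint_scaleR[OF bs[OF g(2)]] g(3)])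
  finally show ?thesis by simp
qed

lemma ip_lin_right:
  fixes g :: "real \<Rightarrow> real \<times> real \<times> real"
  assumes g: "sqint M g" "sqint M g'" "sqint M h" "g'' \<in> borel_measurable M" and e: "AE z in M. g'' z = g z + c *\<^sub>R g' z"
  shows "ip M h g'' = ip M h g + c * ip M h g'"
proof -
  have "ip M h g'' = ip M h (\<lambda>z. g z + c *\<^sub>R g' z)"
    by (rule ip_AE_cong) (use e g in \<open>auto intro!: sqint_measurable sqint_add sqint_scaleR\<close>)
  then show ?thesis using g by (simp add: ip_add_right sqint_scaleR)
qed

lemma A_lin_left: assumes "inV L T" "inV L U" "inV L \<Phi>" shows "A (tadd T (tscale c U)) \<Phi> = A T \<Phi> + c * A U \<Phi>"
proof -
  note v = tadd_V[OF assms(1,2), of c]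
  have l: "AE z in M. lift (tadd T (tscale c U)) z = lift T z + c *\<^sub>R lift U z" by (simp add: lift_tadd)
  note s = sqint_Dlift[OF assms(1)] sqint_Dlift[OF assms(2)] sqint_lift_V[OF assms(1)] sqint_lift_V[OF assms(2)]
    sqint_Dlift[OF assms(3)] sqint_lift_V[OF assms(3)] sqint_measurable[OF sqint_Dlift[OF v(1)]] sqint_measurable[OF sqint_lift_V[OF v(1)]]
  show ?thesis
    unfolding A_repr[OF assms(1,3)] A_repr[OF assms(2,3)] A_repr[OF v(1) assms(3)]
      form_lin_left[OF bounded_linear_maps(1) s(1,2,5,7) v(2)] form_lin_left[OF bounded_linear_maps(2) s(1,2,6,7) v(2)]
      form_lin_left[OF bounded_linear_maps(3) s(3,4,6,8) l]
    by (simp add: algebra_simps)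
qed

lemma A_lin_right: assumes "inV L T" "inV L U" "inV L \<Phi>" shows "A \<Phi> (tadd T (tscale c U)) = A \<Phi> T + c * A \<Phi> U"
proof -
  note v = tadd_V[OF assms(1,2), of c]
  have l: "AE z in M. lift (tadd T (tscale c U)) z = lift T z + c *\<^sub>R lift U z" by (simp add: lift_tadd)
  note s = sqint_Dlift[OF assms(1)] sqint_Dlift[OF assms(2)] sqint_lift_V[OF assms(1)] sqint_lift_V[OF assms(2)]
    sqint_Dlift[OF assms(3)] sqint_lift_V[OF assms(3)] sqint_measurable[OF sqint_Dlift[OF v(1)]] sqint_measurable[OF sqint_lift_V[OF v(1)]]
  note b1 = bounded_linear_sqint(1)[OF bounded_linear_maps(1) onorm[OF bounded_linear_maps(1)] s(5)]
  note b2 = bounded_linear_sqint(1)[OF bounded_linear_maps(2) onorm[OF bounded_linear_maps(2)] s(5)]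
  note b3 = bounded_linear_sqint(1)[OF bounded_linear_maps(3) onorm[OF bounded_linear_maps(3)] s(6)]
  show ?thesis
    unfolding A_repr[OF assms(3,1)] A_repr[OF assms(3,2)] A_repr[OF assms(3) v(1)]
      ip_lin_right[OF s(1,2) b1 s(7) v(2)] ip_lin_right[OF s(3,4) b2 s(8) l] ip_lin_right[OF s(3,4) b3 s(8) l]
    by (simp add: algebra_simps)
qed

lemma S_lin_left: assumes "inV L T" "inV L U" "inV L \<Phi>" shows "S (tadd T (tscale c U)) \<Phi> = S T \<Phi> + c * S U \<Phi>"
  unfolding S_def using assms
  by (intro form_lin_left bounded_linear_maps sqint_lift_V sqint_measurable[OF sqint_lift_V] tadd_V) (simp_all add: lift_tadd)

lemma S_lin_right: assumes "inV L T" "inV L U" "inV L \<Phi>" shows "S \<Phi> (tadd T (tscale c U)) = S \<Phi> T + c * S \<Phi> U"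
  unfolding S_def using assms
  by (intro ip_lin_right bounded_linear_sqint(1)[OF bounded_linear_maps(4) onorm[OF bounded_linear_maps(4)]] sqint_lift_V
    sqint_measurable[OF sqint_lift_V] tadd_V) (simp_all add: lift_tadd)

text \<open>\<open>nD\<close> and \<open>nH\<close> are kept apart on purpose: in the weighted
  coordinates each factor sqrt nH gains a power of \<gamma>, while sqrt nD only gains a constant.
  The leading term contains no \<open>nH\<close>.\<close>

lemma A_split_bound: assumes "inV L T" "inV L \<Phi>"
  shows "\<bar>\<mu> * ip M (Dlift T) (Dlift \<Phi>) - A T \<Phi>\<bar> \<le> (\<mu> - dmin) * sqrt (nD T) * sqrt (nD \<Phi>) + KC * sqrt (nD T) * sqrt (nH \<Phi>) + KB * sqrt (nH T) * sqrt (nH \<Phi>)"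
proof -
  note s = sqint_Dlift[OF assms(1)] sqint_Dlift[OF assms(2)] sqint_lift_V[OF assms(1)] sqint_lift_V[OF assms(2)]
  note b1 = bounded_linear_sqint(1)[OF bounded_linear_maps(1) onorm[OF bounded_linear_maps(1)] s(1)]
  have "\<mu> * ip M (Dlift T) (Dlift \<Phi>) - ip M (\<lambda>z. PA (Dlift T z)) (Dlift \<Phi>) = ip M (\<lambda>z. \<mu> *\<^sub>R Dlift T z - PA (Dlift T z)) (Dlift \<Phi>)"
    using s b1 by (simp add: ip_diff_left sqint_scaleR)
  moreover have "\<bar>ip M (\<lambda>z. \<mu> *\<^sub>R Dlift T z - PA (Dlift T z)) (Dlift \<Phi>)\<bar> \<le> (\<mu> - dmin) * sqrt (nD T) * sqrt (nD \<Phi>)"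
    unfolding nD_def by (rule ip_bounded_linear[OF bounded_linear_PA' PA_contr]) (use \<mu> s in auto)
  moreover have "\<bar>ip M (\<lambda>z. CA (Dlift T z)) (lift \<Phi>)\<bar> \<le> KC * sqrt (nD T) * sqrt (nH \<Phi>)"
    unfolding nD_def nH_def by (rule ip_bounded_linear[OF bounded_linear_maps(2) KC(2) KC(1)]) (use s in auto)
  moreover have "\<bar>ip M (\<lambda>z. BA (lift T z)) (lift \<Phi>)\<bar> \<le> KB * sqrt (nH T) * sqrt (nH \<Phi>)"
    unfolding nH_def by (rule ip_bounded_linear[OF bounded_linear_maps(3) KB(2) KB(1)]) (use s in auto)
  ultimately show ?thesis unfolding A_repr[OF assms] by linarith
qed

lemma S_bound: assumes "inV L T" "inV L \<Phi>" shows "\<bar>S T \<Phi>\<bar> \<le> KS * sqrt (nH T) * sqrt (nH \<Phi>)"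
  unfolding S_def nH_def by (rule ip_bounded_linear[OF bounded_linear_maps(4) KS(2) KS(1)]) (use assms in \<open>auto simp: sqint_lift_V\<close>)

definition "K1 = sqrt (KD * KV)"

lemma sqrt_nH: "inV L \<Phi> \<Longrightarrow> sqrt (nH \<Phi>) \<le> K1 * sqrt (nD \<Phi>)" "0 \<le> K1"
  using real_sqrt_le_mono[OF nH_le] KD KV by (auto simp: K1_def real_sqrt_mult)

definition "KA = \<mu> + (\<mu> - dmin) + KC * K1 + KB * K1 * K1"
definition "KS' = KS * K1 * K1"

lemma A_bound: assumes "inV L T" "inV L \<Phi>" shows "\<bar>A T \<Phi>\<bar> \<le> KA * sqrt (nD T) * sqrt (nD \<Phi>)"
proof -
  have "\<bar>\<mu> * ip M (Dlift T) (Dlift \<Phi>)\<bar> \<le> \<mu> * (sqrt (nD T) * sqrt (nD \<Phi>))"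
    unfolding abs_mult nD_def using \<mu> assms by (intro mult_mono ip_Cauchy_Schwarz sqint_Dlift) auto
  moreover have "KC * sqrt (nD T) * sqrt (nH \<Phi>) \<le> KC * sqrt (nD T) * (K1 * sqrt (nD \<Phi>))"
    using KC assms by (intro mult_left_mono sqrt_nH) auto
  moreover have "KB * sqrt (nH T) * sqrt (nH \<Phi>) \<le> KB * (K1 * sqrt (nD T)) * (K1 * sqrt (nD \<Phi>))"
    using KB assms sqrt_nH by (intro mult_mono) auto
  moreover have "KA * sqrt (nD T) * sqrt (nD \<Phi>) = \<mu> * (sqrt (nD T) * sqrt (nD \<Phi>)) + (\<mu> - dmin) * sqrt (nD T) * sqrt (nD \<Phi>)
    + KC * sqrt (nD T) * (K1 * sqrt (nD \<Phi>)) + KB * (K1 * sqrt (nD T)) * (K1 * sqrt (nD \<Phi>))"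
    by (simp add: KA_def algebra_simps)
  ultimately show ?thesis using A_split_bound[OF assms] by linarith
qed

lemma KA: "0 \<le> KA" "0 \<le> KS'" using \<mu> KC KB KS sqrt_nH(2) by (auto simp: KA_def KS'_def intro!: add_nonneg_nonneg mult_nonneg_nonneg)

lemma S_bound': assumes "inV L T" "inV L \<Phi>" shows "\<bar>S T \<Phi>\<bar> \<le> KS' * sqrt (nD T) * sqrt (nD \<Phi>)"
proof -
  have "KS * sqrt (nH T) * sqrt (nH \<Phi>) \<le> KS * (K1 * sqrt (nD T)) * (K1 * sqrt (nD \<Phi>))"
    using KS assms sqrt_nH by (intro mult_mono) auto
  then show ?thesis using S_bound[OF assms] by (simp add: KS'_def mult_ac)
qed

lemma sqrt_nD_le: assumes "inV L \<Phi>" shows "sqrt (nD \<Phi>) \<le> sqrt KD * V_norm L \<Phi>"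
  using real_sqrt_le_mono[OF nD_le[OF assms]] by (simp add: V_norm_eq[OF assms] real_sqrt_mult)

text \<open>It suffices to bound a functional by sqrt nD, since the norm of V dominates it.\<close>

lemma in_VdualI: assumes "\<And>\<Phi> \<Psi> c. inV L \<Phi> \<Longrightarrow> inV L \<Psi> \<Longrightarrow> f (tadd \<Phi> (tscale c \<Psi>)) = f \<Phi> + c * f \<Psi>"
   and "\<And>\<Phi>. inV L \<Phi> \<Longrightarrow> \<bar>f \<Phi>\<bar> \<le> C * sqrt (nD \<Phi>)" "0 \<le> C" shows "in_Vdual L f"
  unfolding in_Vdual_def
proof (intro conjI allI impI exI[of _ "C * sqrt KD"])
  fix \<Phi> assume v: "inV L \<Phi>"
  have "C * sqrt (nD \<Phi>) \<le> C * (sqrt KD * V_norm L \<Phi>)" using assms(3) by (intro mult_left_mono sqrt_nD_le v)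
  then show "\<bar>f \<Phi>\<bar> \<le> C * sqrt KD * V_norm L \<Phi>" using assms(2)[OF v] by (simp add: mult.assoc)
qed (use assms(1) in blast)

lemma A_Vdual: assumes "inV L T" shows "in_Vdual L (A T)" "in_Vdual L (\<lambda>U. A U T)"
proof -
  show "in_Vdual L (A T)"
    by (rule in_VdualI[of _ "KA * sqrt (nD T)"]) (use assms A_lin_right A_bound KA in auto)
  show "in_Vdual L (\<lambda>U. A U T)"
    by (rule in_VdualI[of _ "KA * sqrt (nD T)"]) (use assms A_lin_left A_bound[OF _ assms] KA in \<open>auto simp: mult_ac\<close>)
qed

lemma S_Vdual: assumes "inV L T" shows "in_Vdual L (S T)" "in_Vdual L (\<lambda>U. S U T)"
proof -
  show "in_Vdual L (S T)"
    by (rule in_VdualI[of _ "KS' * sqrt (nD T)"]) (use assms S_lin_right S_bound' KA in auto)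
  show "in_Vdual L (\<lambda>U. S U T)"
    by (rule in_VdualI[of _ "KS' * sqrt (nD T)"]) (use assms S_lin_left S_bound'[OF _ assms] KA in \<open>auto simp: mult_ac\<close>)
qed

text \<open>Evaluation of the outer-annulus component at a point is bounded on V. This links the
  memory integral, which is taken separately at each depth z, with expansions in V.\<close>

lemma point_Vdual: assumes "z \<in> {0..L}" shows "in_Vdual L (\<lambda>\<Phi>. ce \<Phi> z)"
  by (rule in_VdualI[of _ KP]) (use pointwise_bound(3)[OF _ assms] KP in auto)

lemma cf_Vdual: "in_Vdual L (\<lambda>U. cf U k)"
proof (rule in_VdualI[of _ K1])
  fix \<Phi> assume v: "inV L \<Phi>"
  have "\<bar>ip M (lift \<Phi>) (lift (eb k))\<bar> \<le> sqrt (nH \<Phi>) * sqrt 1"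
    using ip_Cauchy_Schwarz[OF sqint_lift_V[OF v] sqint_lift_V[OF eb_V(1)], of k] by (simp add: nH_def ip_eb_eb)
  then show "\<bar>cf \<Phi> k\<bar> \<le> K1 * sqrt (nD \<Phi>)" using sqrt_nH(1)[OF v] by (simp add: cf_ip inV_inH v)
qed (simp_all add: cf_tadd inV_inH sqrt_nH)

end

section \<open>Variation of constants for a scalar equation\<close>

lemma LINT_FTC: fixes u u' :: "real \<Rightarrow> real"
  assumes d: "\<And>x. (u has_real_derivative u' x) (at x)" and c: "continuous_on UNIV u'" and t: "0 \<le> t"
  shows "(LINT x:{0<..<t}|lebesgue. u' x) = u t - u 0"
proof -
  have "(u' has_integral (u t - u 0)) {0..t}"
    using t d by (intro fundamental_theorem_of_calculus)
      (auto simp flip: has_real_derivative_iff_has_vector_derivative intro: has_field_derivative_at_within)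
  then have "integral {0<..<t} u' = u t - u 0" using integral_unique integral_open_interval_real by metis
  moreover have "set_integrable lebesgue {0<..<t} u'"
    by (rule L2_on_integrable[OF continuous_L2_on]) (rule continuous_on_subset[OF c], simp)
  ultimately show ?thesis using set_lebesgue_integral_eq_integral(2) by metis
qed

lemma exp_deriv: "((\<lambda>x. exp (a * x)) has_real_derivative a * exp (a * x)) (at x)" for a x :: real
  by (auto intro!: derivative_eq_intros)

lemma LINT_exp: "0 \<le> t \<Longrightarrow> (LINT x:{0<..<t}|lebesgue. a * exp (a * x)) = exp (a * t) - 1" for a t :: real
  by (subst LINT_FTC[of "\<lambda>x. exp (a * x)" "\<lambda>x. a * exp (a * x)"]) (auto intro!: exp_deriv continuous_intros)

lemma continuous_set_integrable: "continuous_on {a..b} f \<Longrightarrow> set_integrable lebesgue {a<..<b} f" for f :: "real \<Rightarrow> real"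
  by (rule L2_on_integrable[OF continuous_L2_on])

text \<open>The source is only integrable, so the differential equation is read as an integral
  equation. Parts are taken with the weighted primitive against exp(-a x).\<close>

lemma variation_of_constants:
  fixes g c :: "real \<Rightarrow> real"
  assumes g: "set_integrable lebesgue {0<..<T} g" and t: "t \<in> {0..T}"
    and c: "\<And>t. t \<in> {0..T} \<Longrightarrow> c t = exp (- a * t) * (c0 + (LINT s:{0<..<t}|lebesgue. g s * exp (a * s)))"
  shows "c t = c0 + (LINT s:{0<..<t}|lebesgue. g s - a * c s)"
proof (cases "t = 0")
  case True then show ?thesis using c[of 0] t by (simp add: set_lebesgue_integral_def)
next
  case False
  then have t0: "0 < t" using t by simp
  have gt: "set_integrable lebesgue {0<..<t} g" by (rule set_integrable_subinterval[OF g]) (use t in simp)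
  let ?h = "\<lambda>s. g s * exp (a * s)"
  define w where "w x = (LINT s:{0<..<x}|lebesgue. ?h s)" for x
  have ht: "set_integrable lebesgue {0<..<t} ?h" by (rule test_integrable[OF gt]) (intro continuous_intros)
  have cw: "continuous_on {0..t} w" unfolding w_def by (rule primitive_continuous[OF ht])
  have e: "exp (a * s) * exp (- a * s) = 1" for s by (simp flip: exp_add)
  have "(LINT x:{0<..<t}|lebesgue. w x * (- a * exp (- a * x))) = w t * exp (- a * t) - (LINT s:{0<..<t}|lebesgue. ?h s * exp (- a * s))"
    unfolding w_def by (rule primitive_by_parts[OF t0 ht exp_deriv]) (intro continuous_intros)
  also have "(LINT s:{0<..<t}|lebesgue. ?h s * exp (- a * s)) = (LINT s:{0<..<t}|lebesgue. g s)"
    by (simp only: mult.assoc e mult_1_right)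
  finally have 1: "(LINT x:{0<..<t}|lebesgue. w x * (- a * exp (- a * x))) = w t * exp (- a * t) - (LINT s:{0<..<t}|lebesgue. g s)" .
  have "(LINT s:{0<..<t}|lebesgue. g s - a * c s) = (LINT s:{0<..<t}|lebesgue. (g s + 1 * (w s * (- a * exp (- a * s)))) + c0 * (- a * exp (- a * s)))"
  proof (rule set_lebesgue_integral_cong)
    have "g s - a * c s = (g s + 1 * (w s * (- a * exp (- a * s)))) + c0 * (- a * exp (- a * s))" if "s \<in> {0..T}" for s
      unfolding c[OF that] w_def by (simp add: algebra_simps)
    then show "\<forall>s. s \<in> {0<..<t} \<longrightarrow> g s - a * c s = (g s + 1 * (w s * (- a * exp (- a * s)))) + c0 * (- a * exp (- a * s))"
      using t by auto
  qed simp
  also have "\<dots> = (LINT s:{0<..<t}|lebesgue. g s + 1 * (w s * (- a * exp (- a * s)))) + c0 * (LINT s:{0<..<t}|lebesgue. - a * exp (- a * s))"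
    by (intro LINT_set_add_scale set_integral_add gt set_integrable_mult_right continuous_set_integrable continuous_intros cw)
  also have "(LINT s:{0<..<t}|lebesgue. g s + 1 * (w s * (- a * exp (- a * s)))) = (LINT s:{0<..<t}|lebesgue. g s) + 1 * (LINT s:{0<..<t}|lebesgue. w s * (- a * exp (- a * s)))"
    by (intro LINT_set_add_scale gt continuous_set_integrable continuous_intros cw)
  also have "(LINT s:{0<..<t}|lebesgue. - a * exp (- a * s)) = exp (- a * t) - 1" by (rule LINT_exp) (use t in simp)
  finally have "(LINT s:{0<..<t}|lebesgue. g s - a * c s) = w t * exp (- a * t) + c0 * (exp (- a * t) - 1)" using 1 by simp
  then show ?thesis using c[OF t] by (simp add: w_def algebra_simps)
qed

text \<open>The integrating factor exp(a x) enters through parts with the primitive of g - a c,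
  which the assumption identifies with c - c0. Three resulting linear identities combine to the
  formula.\<close>

lemma variation_of_constants_converse:
  fixes g c :: "real \<Rightarrow> real"
  assumes g: "set_integrable lebesgue {0<..<T} g" and t: "t \<in> {0..T}" and cc: "continuous_on {0..T} c"
    and c: "\<And>t. t \<in> {0..T} \<Longrightarrow> c t = c0 + (LINT s:{0<..<t}|lebesgue. g s - a * c s)"
  shows "c t = exp (- a * t) * (c0 + (LINT s:{0<..<t}|lebesgue. g s * exp (a * s)))"
proof (cases "t = 0")
  case True then show ?thesis using c[of 0] t by (simp add: set_lebesgue_integral_def)
next
  case False
  then have t0: "0 < t" using t by simp
  have gt: "set_integrable lebesgue {0<..<t} g" by (rule set_integrable_subinterval[OF g]) (use t in simp)
  have cct: "continuous_on {0..t} c" by (rule continuous_on_subset[OF cc]) (use t in auto)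
  let ?h = "\<lambda>s. g s - a * c s"
  have ht: "set_integrable lebesgue {0<..<t} ?h" by (intro set_integral_diff gt continuous_set_integrable continuous_intros cct)
  have 1: "(LINT x:{0<..<t}|lebesgue. (LINT s:{0<..<x}|lebesgue. ?h s) * (a * exp (a * x))) = (LINT s:{0<..<t}|lebesgue. ?h s) * exp (a * t) - (LINT s:{0<..<t}|lebesgue. ?h s * exp (a * s))"
    by (rule primitive_by_parts[OF t0 ht exp_deriv]) (intro continuous_intros)
  have ge: "set_integrable lebesgue {0<..<t} (\<lambda>s. g s * exp (a * s))" by (rule test_integrable[OF gt]) (intro continuous_intros)
  have ce: "set_integrable lebesgue {0<..<t} (\<lambda>s. c s * exp (a * s))" by (intro continuous_set_integrable continuous_intros cct)
  have ee: "set_integrable lebesgue {0<..<t} (\<lambda>s. a * exp (a * s))" by (intro continuous_set_integrable continuous_intros)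
  have ce': "set_integrable lebesgue {0<..<t} (\<lambda>s. a * (c s * exp (a * s)))" by (intro continuous_set_integrable continuous_intros cct)
  have "(LINT x:{0<..<t}|lebesgue. (LINT s:{0<..<x}|lebesgue. ?h s) * (a * exp (a * x))) = (LINT x:{0<..<t}|lebesgue. a * (c x * exp (a * x)) + (- c0) * (a * exp (a * x)))"
  proof (rule set_lebesgue_integral_cong)
    have "(LINT s:{0<..<x}|lebesgue. ?h s) * (a * exp (a * x)) = a * (c x * exp (a * x)) + (- c0) * (a * exp (a * x))" if "x \<in> {0..T}" for x
    proof -
      have "(LINT s:{0<..<x}|lebesgue. ?h s) = c x - c0" using c[OF that] by simp
      then show ?thesis by (simp only:) (simp add: algebra_simps)
    qed
    then show "\<forall>x. x \<in> {0<..<t} \<longrightarrow> (LINT s:{0<..<x}|lebesgue. ?h s) * (a * exp (a * x)) = a * (c x * exp (a * x)) + (- c0) * (a * exp (a * x))"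
      using t by auto
  qed simp
  also have "\<dots> = (LINT x:{0<..<t}|lebesgue. a * (c x * exp (a * x))) + (- c0) * (LINT x:{0<..<t}|lebesgue. a * exp (a * x))"
    by (rule LINT_set_add_scale[OF ce' ee])
  also have "(LINT x:{0<..<t}|lebesgue. a * exp (a * x)) = exp (a * t) - 1" by (rule LINT_exp) (use t in simp)
  finally have 2: "(LINT x:{0<..<t}|lebesgue. (LINT s:{0<..<x}|lebesgue. ?h s) * (a * exp (a * x))) = (LINT x:{0<..<t}|lebesgue. a * (c x * exp (a * x))) + (- c0) * (exp (a * t) - 1)" .
  have "(LINT s:{0<..<t}|lebesgue. ?h s * exp (a * s)) = (LINT s:{0<..<t}|lebesgue. g s * exp (a * s) + (- 1) * (a * (c s * exp (a * s))))"
    by (simp add: algebra_simps)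
  also have "\<dots> = (LINT s:{0<..<t}|lebesgue. g s * exp (a * s)) + (- 1) * (LINT s:{0<..<t}|lebesgue. a * (c s * exp (a * s)))"
    by (rule LINT_set_add_scale[OF ge ce'])
  finally have 3: "(LINT s:{0<..<t}|lebesgue. ?h s * exp (a * s)) = (LINT s:{0<..<t}|lebesgue. g s * exp (a * s)) + (- 1) * (LINT s:{0<..<t}|lebesgue. a * (c s * exp (a * s)))" .
  have "(LINT s:{0<..<t}|lebesgue. ?h s) = c t - c0" using c[OF t] by simp
  note H = this
  have 1: "(LINT x:{0<..<t}|lebesgue. (LINT s:{0<..<x}|lebesgue. ?h s) * (a * exp (a * x))) = c t * exp (a * t) - c0 * exp (a * t) - (LINT s:{0<..<t}|lebesgue. ?h s * exp (a * s))"
    unfolding 1 H by (simp only: left_diff_distrib)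
  have 2: "(LINT x:{0<..<t}|lebesgue. (LINT s:{0<..<x}|lebesgue. ?h s) * (a * exp (a * x))) = (LINT x:{0<..<t}|lebesgue. a * (c x * exp (a * x))) - c0 * exp (a * t) + c0"
    unfolding 2 by (simp add: right_diff_distrib)
  have "c t * exp (a * t) = c0 + (LINT s:{0<..<t}|lebesgue. g s * exp (a * s))"
    using 1 2 3 by linarith
  moreover have "c t = exp (- a * t) * (c t * exp (a * t))" by (simp flip: exp_add)
  ultimately show ?thesis by simp
qed

section \<open>Matrices of the forms and choice of the exponential weight\<close>

context heat_wells
begin

lemma nH_comb: "nH (comb c n) = (\<Sum>k<n. (c k)\<^sup>2)"
proof -
  have "(\<lambda>k. (cf (comb c n) k)\<^sup>2) = (\<lambda>k. if k \<in> {..<n} then (c k)\<^sup>2 else 0)"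
    by (auto simp: cf_comb)
  then have "(\<lambda>k. if k \<in> {..<n} then (c k)\<^sup>2 else 0) sums nH (comb c n)"
    using cf_sums[OF inV_inH[OF comb_V], of c n] by simp
  then show ?thesis by (rule sums_unique2) (rule sums_If_finite_set, simp)
qed

lemma ip_Dlift_Vdual: assumes "inV L T" shows "in_Vdual L (\<lambda>U. ip M (Dlift T) (Dlift U))"
proof (rule in_VdualI[of _ "sqrt (nD T)"])
  show "ip M (Dlift T) (Dlift (tadd \<Phi> (tscale c \<Psi>))) = ip M (Dlift T) (Dlift \<Phi>) + c * ip M (Dlift T) (Dlift \<Psi>)"
    if "inV L \<Phi>" "inV L \<Psi>" for \<Phi> \<Psi> c
    by (rule ip_lin_right) (use that assms in \<open>auto intro!: sqint_Dlift sqint_measurable tadd_V\<close>)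
  show "\<bar>ip M (Dlift T) (Dlift \<Phi>)\<bar> \<le> sqrt (nD T) * sqrt (nD \<Phi>)" if "inV L \<Phi>" for \<Phi>
    unfolding nD_def by (intro ip_Cauchy_Schwarz sqint_Dlift that assms)
qed simp

lemma ip_Dlift_comb: "ip M (Dlift (comb c n)) (Dlift (comb d n)) = (\<Sum>k<n. lam k * (c k * d k))"
proof -
  have "ip M (Dlift (comb c n)) (Dlift (comb d n)) = (\<Sum>k<n. d k * ip M (Dlift (comb c n)) (Dlift (eb k)))"
    by (rule Vdual_comb[OF ip_Dlift_Vdual[OF comb_V]])
  also have "\<dots> = (\<Sum>k<n. d k * (lam k * cf (comb c n) k))"
    by (simp add: eigen[OF comb_V] cf_ip inV_inH comb_V)
  finally show ?thesis by (simp add: cf_comb mult_ac)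
qed

lemma A_comb: "A (comb c n) (comb d n) = (\<Sum>j<n. \<Sum>k<n. A (eb j) (eb k) * c j * d k)"
proof -
  have "A (comb c n) (comb d n) = (\<Sum>k<n. d k * A (comb c n) (eb k))"
    by (rule Vdual_comb[OF A_Vdual(1)[OF comb_V]])
  also have "\<dots> = (\<Sum>k<n. d k * (\<Sum>j<n. c j * A (eb j) (eb k)))"
    by (simp add: Vdual_comb[OF A_Vdual(2)[OF eb_V(1)]])
  also have "\<dots> = (\<Sum>k<n. \<Sum>j<n. A (eb j) (eb k) * c j * d k)" by (simp add: sum_distrib_left mult_ac)
  finally show ?thesis by (subst sum.swap)
qed

lemma S_comb: "S (comb c n) (comb d n) = (\<Sum>j<n. \<Sum>k<n. S (eb j) (eb k) * c j * d k)"
proof -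
  have "S (comb c n) (comb d n) = (\<Sum>k<n. d k * S (comb c n) (eb k))"
    by (rule Vdual_comb[OF S_Vdual(1)[OF comb_V]])
  also have "\<dots> = (\<Sum>k<n. d k * (\<Sum>j<n. c j * S (eb j) (eb k)))"
    by (simp add: Vdual_comb[OF S_Vdual(2)[OF eb_V(1)]])
  also have "\<dots> = (\<Sum>k<n. \<Sum>j<n. S (eb j) (eb k) * c j * d k)" by (simp add: sum_distrib_left mult_ac)
  finally show ?thesis by (subst sum.swap)
qed

definition mm :: "real \<Rightarrow> nat \<Rightarrow> real" where "mm \<gamma> k = \<mu> * lam k + \<gamma>"

lemma mm: assumes "\<gamma> > 0" shows "mm \<gamma> k > 0" "\<mu> * lam k \<le> mm \<gamma> k" "\<gamma> \<le> mm \<gamma> k"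
  using assms \<mu> lam_pos[of k] by (auto simp: mm_def add_pos_pos)

text \<open>The symmetric scaling makes a section of \<open>qm\<close>, paired with x and y, equal
  to \<mu> a - A on combinations with coefficients x_j / sqrt mm_j and y_k / sqrt mm_k. The same
  scaling is used for the memory matrix \<open>bmx\<close>.\<close>

definition qm :: "real \<Rightarrow> nat \<Rightarrow> nat \<Rightarrow> real" where
  "qm \<gamma> j k = ((if j = k then \<mu> * lam k else 0) - A (eb j) (eb k)) / (sqrt (mm \<gamma> j) * sqrt (mm \<gamma> k))"
definition bmx :: "real \<Rightarrow> nat \<Rightarrow> nat \<Rightarrow> real" where
  "bmx \<gamma> j k = S (eb j) (eb k) / (sqrt (mm \<gamma> j) * sqrt (mm \<gamma> k))"

text \<open>The three terms come from diffusion, convection and exchange. Only the first survives as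
  \<gamma> grows, and it is below 1.\<close>

definition \<rho>q where "\<rho>q \<gamma> = (\<mu> - dmin) / \<mu> + KC / (sqrt \<mu> * sqrt \<gamma>) + KB / \<gamma>"
text \<open>Adding 1 to \<open>KS\<close> keeps the bound strictly positive.\<close>

definition \<rho>b where "\<rho>b \<gamma> = (KS + 1) / \<gamma>"

text \<open>Two lower bounds of the same weight: mm >= \<mu> lam controls the derivatives, and mm >=
  \<gamma> controls the functions. The second is the origin of all powers of \<gamma>.\<close>

lemma comb_scaled_bounds: assumes \<gamma>: "\<gamma> > 0"
  shows "sqrt (nD (comb (\<lambda>j. x j / sqrt (mm \<gamma> j)) n)) \<le> sqrt (\<Sum>j<n. (x j)\<^sup>2) / sqrt \<mu>"
    "sqrt (nH (comb (\<lambda>j. x j / sqrt (mm \<gamma> j)) n)) \<le> sqrt (\<Sum>j<n. (x j)\<^sup>2) / sqrt \<gamma>"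
proof -
  let ?c = "\<lambda>j. x j / sqrt (mm \<gamma> j)"
  have e: "(?c j)\<^sup>2 = (x j)\<^sup>2 / mm \<gamma> j" for j using mm(1)[OF \<gamma>, of j] by (simp add: power_divide)
  have "nD (comb ?c n) \<le> (\<Sum>j<n. (x j)\<^sup>2) / \<mu>"
    unfolding nD_comb e sum_divide_distrib
  proof (rule sum_mono)
    fix j
    have "\<mu> * lam j * (x j)\<^sup>2 \<le> mm \<gamma> j * (x j)\<^sup>2" by (intro mult_right_mono mm \<gamma>) simp
    then show "lam j * ((x j)\<^sup>2 / mm \<gamma> j) \<le> (x j)\<^sup>2 / \<mu>" using mm(1)[OF \<gamma>, of j] \<mu> by (simp add: field_simps)
  qed
  then show "sqrt (nD (comb ?c n)) \<le> sqrt (\<Sum>j<n. (x j)\<^sup>2) / sqrt \<mu>" by (simp flip: real_sqrt_divide)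
  have "nH (comb ?c n) \<le> (\<Sum>j<n. (x j)\<^sup>2) / \<gamma>"
    unfolding nH_comb e sum_divide_distrib
    by (intro sum_mono divide_left_mono mm mult_pos_pos \<gamma>) auto
  then show "sqrt (nH (comb ?c n)) \<le> sqrt (\<Sum>j<n. (x j)\<^sup>2) / sqrt \<gamma>" by (simp flip: real_sqrt_divide)
qed

lemma matbound_qm: assumes \<gamma>: "\<gamma> > 0" shows "matbound (\<rho>q \<gamma>) (qm \<gamma>)"
  unfolding matbound_def
proof (intro allI)
  fix n and x y :: "nat \<Rightarrow> real"
  let ?c = "\<lambda>j. x j / sqrt (mm \<gamma> j)" and ?d = "\<lambda>j. y j / sqrt (mm \<gamma> j)"
  let ?T = "comb ?c n" and ?U = "comb ?d n"
  let ?X = "sqrt (\<Sum>j<n. (x j)\<^sup>2)" and ?Y = "sqrt (\<Sum>j<n. (y j)\<^sup>2)"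
  have "(\<Sum>j<n. \<Sum>k<n. qm \<gamma> j k * x j * y k) = (\<Sum>j<n. \<Sum>k<n. (if j = k then \<mu> * lam k else 0) * ?c j * ?d k - A (eb j) (eb k) * ?c j * ?d k)"
    by (intro sum.cong refl) (simp add: qm_def diff_divide_distrib algebra_simps)
  also have "\<dots> = (\<Sum>j<n. \<Sum>k<n. (if j = k then \<mu> * lam k else 0) * ?c j * ?d k) - A ?T ?U"
    by (simp add: sum_subtractf A_comb)
  also have "(\<Sum>j<n. \<Sum>k<n. (if j = k then \<mu> * lam k else 0) * ?c j * ?d k) = (\<Sum>j<n. \<mu> * lam j * ?c j * ?d j)"
  proof (rule sum.cong[OF refl])
    fix j assume j: "j \<in> {..<n}"
    have "(\<Sum>k<n. (if j = k then \<mu> * lam k else 0) * ?c j * ?d k) = (\<Sum>k<n. if j = k then \<mu> * lam j * ?c j * ?d j else 0)"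
      by (intro sum.cong refl) auto
    also have "\<dots> = \<mu> * lam j * ?c j * ?d j" using j by (subst sum.delta') auto
    finally show "(\<Sum>k<n. (if j = k then \<mu> * lam k else 0) * ?c j * ?d k) = \<mu> * lam j * ?c j * ?d j" .
  qed
  also have "\<dots> = \<mu> * ip M (Dlift ?T) (Dlift ?U)" by (simp add: ip_Dlift_comb sum_distrib_left mult_ac)
  finally have e: "(\<Sum>j<n. \<Sum>k<n. qm \<gamma> j k * x j * y k) = \<mu> * ip M (Dlift ?T) (Dlift ?U) - A ?T ?U" .
  note bT = comb_scaled_bounds[OF \<gamma>, of x n] and bU = comb_scaled_bounds[OF \<gamma>, of y n]
  have nn: "0 \<le> ?X / sqrt \<mu>" "0 \<le> ?X / sqrt \<gamma>" using \<mu> \<gamma> by (auto intro!: divide_nonneg_nonneg sum_nonneg)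
  have "\<bar>\<mu> * ip M (Dlift ?T) (Dlift ?U) - A ?T ?U\<bar> \<le> (\<mu> - dmin) * sqrt (nD ?T) * sqrt (nD ?U) + KC * sqrt (nD ?T) * sqrt (nH ?U) + KB * sqrt (nH ?T) * sqrt (nH ?U)"
    by (rule A_split_bound[OF comb_V comb_V])
  also have "\<dots> \<le> (\<mu> - dmin) * (?X / sqrt \<mu>) * (?Y / sqrt \<mu>) + KC * (?X / sqrt \<mu>) * (?Y / sqrt \<gamma>) + KB * (?X / sqrt \<gamma>) * (?Y / sqrt \<gamma>)"
    using \<mu> KC(1) KB(1) nn by (intro add_mono mult_mono bT bU mult_nonneg_nonneg) auto
  also have "\<dots> = \<rho>q \<gamma> * ?X * ?Y"
  proof -
    have "sqrt \<mu> * sqrt \<mu> = \<mu>" "sqrt \<gamma> * sqrt \<gamma> = \<gamma>" using \<mu> \<gamma> by auto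
    then have "(\<mu> - dmin) * (?X / sqrt \<mu>) * (?Y / sqrt \<mu>) = (\<mu> - dmin) / \<mu> * ?X * ?Y"
      "KB * (?X / sqrt \<gamma>) * (?Y / sqrt \<gamma>) = KB / \<gamma> * ?X * ?Y"
      "KC * (?X / sqrt \<mu>) * (?Y / sqrt \<gamma>) = KC / (sqrt \<mu> * sqrt \<gamma>) * ?X * ?Y" by (simp_all add: times_divide_times_eq)
    then show ?thesis unfolding \<rho>q_def by (simp only: distrib_right)
  qed
  finally show "\<bar>\<Sum>j<n. \<Sum>k<n. qm \<gamma> j k * x j * y k\<bar> \<le> \<rho>q \<gamma> * ?X * ?Y" unfolding e .
qed

lemma matbound_bmx: assumes \<gamma>: "\<gamma> > 0" shows "matbound (\<rho>b \<gamma>) (bmx \<gamma>)"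
  unfolding matbound_def
proof (intro allI)
  fix n and x y :: "nat \<Rightarrow> real"
  let ?c = "\<lambda>j. x j / sqrt (mm \<gamma> j)" and ?d = "\<lambda>j. y j / sqrt (mm \<gamma> j)"
  let ?T = "comb ?c n" and ?U = "comb ?d n"
  let ?X = "sqrt (\<Sum>j<n. (x j)\<^sup>2)" and ?Y = "sqrt (\<Sum>j<n. (y j)\<^sup>2)"
  have e: "(\<Sum>j<n. \<Sum>k<n. bmx \<gamma> j k * x j * y k) = S ?T ?U"
    unfolding S_comb by (intro sum.cong refl) (simp add: bmx_def)
  note bT = comb_scaled_bounds[OF \<gamma>, of x n] and bU = comb_scaled_bounds[OF \<gamma>, of y n]
  have nn: "0 \<le> ?X / sqrt \<gamma>" using \<gamma> by (auto intro!: divide_nonneg_nonneg sum_nonneg)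
  have "\<bar>S ?T ?U\<bar> \<le> KS * sqrt (nH ?T) * sqrt (nH ?U)" by (rule S_bound[OF comb_V comb_V])
  also have "\<dots> \<le> (KS + 1) * (?X / sqrt \<gamma>) * (?Y / sqrt \<gamma>)"
    using KS(1) nn by (intro mult_mono bT bU mult_nonneg_nonneg) auto
  also have "\<dots> = \<rho>b \<gamma> * ?X * ?Y"
    using \<gamma> by (simp add: \<rho>b_def times_divide_times_eq)
  finally show "\<bar>\<Sum>j<n. \<Sum>k<n. bmx \<gamma> j k * x j * y k\<bar> \<le> \<rho>b \<gamma> * ?X * ?Y" unfolding e .
qed

lemma \<rho>_pos: assumes "\<gamma> > 0" shows "\<rho>q \<gamma> > 0" "\<rho>b \<gamma> > 0"
proof -
  have "(\<mu> - dmin) / \<mu> > 0" "KC / (sqrt \<mu> * sqrt \<gamma>) \<ge> 0" "KB / \<gamma> \<ge> 0" using \<mu> KC KB assms by auto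
  then show "\<rho>q \<gamma> > 0" by (simp add: \<rho>q_def)
  show "\<rho>b \<gamma> > 0" using KS assms by (simp add: \<rho>b_def)
qed

text \<open>With \<open>R\<close> fixed, the sum tends to (\<mu> - dmin) / \<mu> = 1 - dmin / \<mu>
  < 1.\<close>

lemma exists_weight: "\<exists>\<gamma>>0. \<rho>q \<gamma> + \<rho>b \<gamma> * R < 1"
proof -
  have s: "filterlim (\<lambda>\<gamma>. sqrt \<mu> * sqrt \<gamma>) at_infinity at_top"
    using \<mu> by (intro filterlim_at_top_imp_at_infinity filterlim_tendsto_pos_mult_at_top[OF tendsto_const] sqrt_at_top) auto
  have i: "filterlim (\<lambda>\<gamma>::real. \<gamma>) at_infinity at_top" by (intro filterlim_at_top_imp_at_infinity filterlim_ident)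
  have "((\<lambda>\<gamma>. (\<mu> - dmin) / \<mu> + KC / (sqrt \<mu> * sqrt \<gamma>) + KB / \<gamma> + (KS + 1) / \<gamma> * R) \<longlongrightarrow> (\<mu> - dmin) / \<mu> + 0 + 0 + 0 * R) at_top"
    by (intro tendsto_add tendsto_mult tendsto_const tendsto_divide_0[OF tendsto_const s] tendsto_divide_0[OF tendsto_const i])
  moreover have "(\<mu> - dmin) / \<mu> + 0 + 0 + 0 * R < 1" using \<mu> by (simp add: field_simps)
  ultimately have "\<forall>\<^sub>F \<gamma> in at_top. \<rho>q \<gamma> + \<rho>b \<gamma> * R < 1"
    unfolding \<rho>q_def \<rho>b_def by (rule order_tendstoD)
  then have "\<forall>\<^sub>F \<gamma> in at_top. 0 < \<gamma> \<and> \<rho>q \<gamma> + \<rho>b \<gamma> * R < 1"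
    by (intro eventually_conj eventually_gt_at_top)
  then show ?thesis using eventually_happens' trivial_limit_at_top_linorder by blast
qed

text \<open>Coefficients of a V-valued function as Borel functions on the whole line, vanishing
  outside the interval, so that convolutions over \<open>lborel\<close> apply. The last clause is
  the L2 bound with values in V.\<close>

definition coefrep :: "real \<Rightarrow> (real \<Rightarrow> triple) \<Rightarrow> (nat \<Rightarrow> real \<Rightarrow> real) \<Rightarrow> bool" where
  "coefrep tmax T y \<longleftrightarrow> (\<forall>k. y k \<in> borel_measurable borel) \<and> (\<forall>k t. t \<notin> {0<..<tmax} \<longrightarrow> y k t = 0) \<and>
     (AE t in lebesgue. t \<in> {0<..<tmax} \<longrightarrow> inV L (T t) \<and> (\<forall>k. cf (T t) k = y k t)) \<and>
     (\<integral>\<^sup>+t. (\<Sum>k. ennreal (lam k * (y k t)\<^sup>2)) \<partial>lborel) < \<infinity>"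

lemma nD_ennreal: assumes "inV L U" shows "(\<Sum>k. ennreal (lam k * (cf U k)\<^sup>2)) = ennreal (nD U)"
  using cfV_sums[OF assms] lam_pos by (intro suminf_ennreal_eq mult_nonneg_nonneg) (auto intro: less_imp_le)

text \<open>Weak measurability, applied to the functionals \<open>cf _ k\<close>, gives Lebesgue
  measurable coefficients. A Borel version is taken for each k, so that one null set serves them
  all.\<close>

lemma L2_V_coefrep: assumes T: "L2_V L tmax T" shows "\<exists>y. coefrep tmax T y"
proof -
  have m: "(\<lambda>t. indicator {0<..<tmax} t *\<^sub>R cf (T t) k) \<in> borel_measurable lebesgue" for k
    using T cf_Vdual[of k] by (auto simp: L2_V_def set_borel_measurable_def)
  have "\<exists>g\<in>borel_measurable borel. AE t in lebesgue. indicator {0<..<tmax} t *\<^sub>R cf (T t) k = g t" for k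
    using AE_borel_version[OF m[of k]] by blast
  then obtain g where gm[measurable]: "\<And>k. g k \<in> borel_measurable borel" and g: "\<And>k. AE t in lebesgue. indicator {0<..<tmax} t *\<^sub>R cf (T t) k = g k t"
    by metis
  define y where "y k t = indicator {0<..<tmax} t * g k t" for k t
  have ym[measurable]: "y k \<in> borel_measurable borel" for k unfolding y_def[abs_def] by measurable
  have y0: "y k t = 0" if "t \<notin> {0<..<tmax}" for k t using that by (simp add: y_def)
  have ga: "AE t in lebesgue. \<forall>k. indicator {0<..<tmax} t *\<^sub>R cf (T t) k = g k t" using g by (simp add: AE_all_countable)
  have V: "AE t in lebesgue. t \<in> {0<..<tmax} \<longrightarrow> inV L (T t)" using T by (simp add: L2_V_def)
  have ae: "AE t in lebesgue. t \<in> {0<..<tmax} \<longrightarrow> inV L (T t) \<and> (\<forall>k. cf (T t) k = y k t)"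
    using ga V
  proof eventually_elim
    fix t assume a: "\<forall>k. indicator {0<..<tmax} t *\<^sub>R cf (T t) k = g k t" and b: "t \<in> {0<..<tmax} \<longrightarrow> inV L (T t)"
    show "t \<in> {0<..<tmax} \<longrightarrow> inV L (T t) \<and> (\<forall>k. cf (T t) k = y k t)"
    proof
      assume t: "t \<in> {0<..<tmax}"
      then have "y k t = g k t" for k by (simp add: y_def)
      then show "inV L (T t) \<and> (\<forall>k. cf (T t) k = y k t)" using a b t by (simp add: a[rule_format, symmetric])
    qed
  qed
  have "(\<integral>\<^sup>+t. (\<Sum>k. ennreal (lam k * (y k t)\<^sup>2)) \<partial>lborel) = (\<integral>\<^sup>+t. (\<Sum>k. ennreal (lam k * (y k t)\<^sup>2)) \<partial>lebesgue)"
    by (rule nn_integral_completion[symmetric]) measurable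
  also have "\<dots> \<le> (\<integral>\<^sup>+t. ennreal (norm (KD * (indicator {0<..<tmax} t *\<^sub>R (V_norm L (T t))\<^sup>2))) \<partial>lebesgue)"
  proof (rule nn_integral_mono_AE)
    show "AE t in lebesgue. (\<Sum>k. ennreal (lam k * (y k t)\<^sup>2)) \<le> ennreal (norm (KD * (indicator {0<..<tmax} t *\<^sub>R (V_norm L (T t))\<^sup>2)))"
      using ae
    proof eventually_elim
      fix t assume a: "t \<in> {0<..<tmax} \<longrightarrow> inV L (T t) \<and> (\<forall>k. cf (T t) k = y k t)"
      show "(\<Sum>k. ennreal (lam k * (y k t)\<^sup>2)) \<le> ennreal (norm (KD * (indicator {0<..<tmax} t *\<^sub>R (V_norm L (T t))\<^sup>2)))"
      proof (cases "t \<in> {0<..<tmax}")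
        case True
        then have v: "inV L (T t)" and c: "\<And>k. y k t = cf (T t) k" using a by auto
        have "nD (T t) \<le> KD * (V_norm L (T t))\<^sup>2" using nD_le[OF v] by (simp add: V_norm_eq[OF v])
        then show ?thesis unfolding c nD_ennreal[OF v] using True KD by (intro ennreal_leI) simp
      qed (simp add: y0)
    qed
  qed
  also have "\<dots> < \<infinity>"
  proof -
    have "integrable lebesgue (\<lambda>t. KD * (indicator {0<..<tmax} t *\<^sub>R (V_norm L (T t))\<^sup>2))"
      using T by (simp add: L2_V_def set_integrable_def)
    then show ?thesis unfolding integrable_iff_bounded by (rule conjunct2)
  qed
  finally have "coefrep tmax T y" using ae y0 ym by (simp add: coefrep_def)
  then show ?thesis by blast
qed

end

text \<open>Reflection maps null sets to null sets, seen on a Borel null superset by invariance of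
  the integral. It moves the null set of the kernel under the convolution.\<close>

lemma AE_lebesgue_reflect: fixes t :: real assumes "AE s in lebesgue. P s" shows "AE s in lebesgue. P (t - s)"
proof -
  have "AE s in lborel. P s" using assms by (simp add: AE_completion_iff)
  then obtain N where N: "N \<in> null_sets lborel" "{s. \<not> P s} \<subseteq> N" by (auto elim!: AE_E simp: null_sets_def)
  have [measurable]: "N \<in> sets borel" using N by auto
  have "(\<integral>\<^sup>+s. indicator N (t - s) \<partial>lborel) = (\<integral>\<^sup>+s. indicator N s \<partial>lborel)" by (rule nn_shift) measurable
  also have "\<dots> = 0" using N by (simp add: null_sets_def)
  finally have "AE s in lborel. indicator N (t - s) = (0::ennreal)" by (subst (asm) nn_integral_0_iff_AE) auto
  then have "AE s in lborel. P (t - s)" by eventually_elim (use N in \<open>auto simp: indicator_def split: if_splits\<close>)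
  then show ?thesis by (rule AE_completion)
qed

section \<open>From solutions to the fixed-point problem\<close>

text \<open>\<open>rb\<close> and \<open>fk k\<close> stand for the kernel and for the load tested
  with \<open>eb k\<close>, replaced by Borel functions that vanish outside the time
  interval.\<close>

locale heat_problem = heat_wells +
  fixes tmax :: real and r rb :: "real \<Rightarrow> real" and R \<gamma> :: real and T0 :: triple
    and F :: "real \<Rightarrow> triple \<Rightarrow> real" and fk :: "nat \<Rightarrow> real \<Rightarrow> real"
  assumes tmax: "tmax > 0"
    and rb[measurable]: "rb \<in> borel_measurable borel" and rb0: "\<And>s. s \<notin> {0<..<tmax} \<Longrightarrow> rb s = 0"
    and rbr: "AE s in lebesgue. s \<in> {0<..<tmax} \<longrightarrow> r s = rb s"
    and rbR: "(\<integral>\<^sup>+s. ennreal \<bar>rb s\<bar> \<partial>lborel) \<le> ennreal R" and R: "R > 0"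
    and \<gamma>: "\<gamma> > 0" and small: "\<rho>q \<gamma> + \<rho>b \<gamma> * R < 1"
    and T0: "inH L T0" and F: "L2_Vdual L tmax F"
    and fk[measurable]: "\<And>k. fk k \<in> borel_measurable borel" and fk0: "\<And>k s. s \<notin> {0<..<tmax} \<Longrightarrow> fk k s = 0"
    and fkF: "\<And>k. AE t in lebesgue. t \<in> {0<..<tmax} \<longrightarrow> F t (eb k) = fk k t"
begin

definition Lam :: "(nat \<Rightarrow> real \<Rightarrow> real) \<Rightarrow> real \<Rightarrow> ennreal" where
  "Lam y s = (\<Sum>k. ennreal (lam k * (y k s)\<^sup>2))"

lemma Lam_measurable[measurable]: assumes [measurable]: "\<And>k. y k \<in> borel_measurable borel" shows "Lam y \<in> borel_measurable borel"
  unfolding Lam_def[abs_def] by measurable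

lemma Lam_partial: assumes "Lam y s \<noteq> \<infinity>" shows "(\<Sum>k<n. lam k * (y k s)\<^sup>2) \<le> enn2real (Lam y s)"
proof -
  have nn: "0 \<le> lam k * (y k s)\<^sup>2" for k using lam_pos[of k] by simp
  have "ennreal (\<Sum>k<n. lam k * (y k s)\<^sup>2) = (\<Sum>k<n. ennreal (lam k * (y k s)\<^sup>2))"
    using nn by (simp add: sum_ennreal)
  also have "\<dots> \<le> Lam y s" unfolding Lam_def by (rule sum_le_suminf) auto
  finally have "enn2real (ennreal (\<Sum>k<n. lam k * (y k s)\<^sup>2)) \<le> enn2real (Lam y s)"
    using assms by (intro enn2real_mono) (auto simp: top.not_eq_extremum)
  then show ?thesis using nn by (simp add: sum_nonneg)
qed

text \<open>The memory integral in \<open>C_form\<close> is a separate scalar integral for each z.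
  For almost every t it is the component of a single element of V whose coefficients are
  convolutions; the exceptional times do not depend on z, because one weighted integral of
  \<open>Lam y\<close> dominates everything.\<close>

lemma memory:
  assumes T: "L2_V L tmax T" and y: "coefrep tmax T y"
  shows "AE t in lebesgue. t \<in> {0<..<tmax} \<longrightarrow> (\<exists>v. inV L v \<and> (\<forall>k. cf v k = cv rb (y k) t) \<and>
    (\<forall>z\<in>{0<..<L}. (LINT \<tau>:{0<..<t}|lebesgue. r (t - \<tau>) * ce (T \<tau>) z) = ce v z))"
proof -
  have ym[measurable]: "y k \<in> borel_measurable borel" and y0: "t \<notin> {0<..<tmax} \<Longrightarrow> y k t = 0" for k t
    using y by (auto simp: coefrep_def)
  have yT: "AE t in lebesgue. t \<in> {0<..<tmax} \<longrightarrow> inV L (T t) \<and> (\<forall>k. cf (T t) k = y k t)"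
    and Lfin: "(\<integral>\<^sup>+t. Lam y t \<partial>lborel) < \<infinity>" using y by (auto simp: coefrep_def Lam_def)
  have "AE s in lborel. Lam y s \<noteq> \<infinity>" by (rule nn_integral_PInf_AE) (use Lfin in auto)
  then have LamAE: "AE s in lebesgue. Lam y s \<noteq> \<infinity>" by (rule AE_completion)
  have rfin: "(\<integral>\<^sup>+s. ennreal \<bar>rb s\<bar> \<partial>lborel) < \<infinity>" by (rule le_less_trans[OF rbR]) simp
  have "(\<integral>\<^sup>+t. \<integral>\<^sup>+s. ennreal \<bar>rb (t - s)\<bar> * Lam y s \<partial>lborel \<partial>lborel) \<noteq> \<infinity>"
    using tonelli_conv[of "\<lambda>s. ennreal \<bar>rb s\<bar>" "Lam y"] rfin Lfin by (simp add: ennreal_mult_eq_top_iff less_top)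
  then have "AE t in lborel. (\<integral>\<^sup>+s. ennreal \<bar>rb (t - s)\<bar> * Lam y s \<partial>lborel) \<noteq> \<infinity>"
    by (intro nn_integral_PInf_AE) auto
  then have fin: "AE t in lebesgue. (\<integral>\<^sup>+s. ennreal \<bar>rb (t - s)\<bar> * Lam y s \<partial>lborel) \<noteq> \<infinity>" by (rule AE_completion)
  show ?thesis using fin
  proof eventually_elim
    fix t assume ft: "(\<integral>\<^sup>+s. ennreal \<bar>rb (t - s)\<bar> * Lam y s \<partial>lborel) \<noteq> \<infinity>"
    show "t \<in> {0<..<tmax} \<longrightarrow> (\<exists>v. inV L v \<and> (\<forall>k. cf v k = cv rb (y k) t) \<and>
      (\<forall>z\<in>{0<..<L}. (LINT \<tau>:{0<..<t}|lebesgue. r (t - \<tau>) * ce (T \<tau>) z) = ce v z))"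
    proof
      assume t: "t \<in> {0<..<tmax}"
      \<comment> \<open>With the factor sqrt lam built in, the plain square bound for convolutions
        yields the weighted summability that membership in V requires.\<close>
      define w where "w k s = sqrt (lam k) * y k s" for k s
      have wm[measurable]: "w k \<in> borel_measurable borel" for k unfolding w_def[abs_def] by measurable
      have cw: "cv rb (w k) t = sqrt (lam k) * cv rb (y k) t" for k
      proof -
        have "(\<lambda>s. rb (t - s) * w k s) = (\<lambda>s. sqrt (lam k) * (rb (t - s) * y k s))" by (simp add: w_def fun_eq_iff)
        then show ?thesis by (simp add: cv_def)
      qed
      have w2: "(w k s)\<^sup>2 = lam k * (y k s)\<^sup>2" for k s using lam_pos[of k] by (simp add: w_def power_mult_distrib)
      have "sq (\<lambda>k. cv rb (w k) t) \<le> (\<Sum>k. ennreal R * (\<integral>\<^sup>+s. ennreal \<bar>rb (t - s)\<bar> * ennreal ((w k s)\<^sup>2) \<partial>lborel))"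
        unfolding sq_def by (intro suminf_le allI cv_square rbR) auto
      also have "\<dots> = ennreal R * (\<Sum>k. \<integral>\<^sup>+s. ennreal \<bar>rb (t - s)\<bar> * ennreal ((w k s)\<^sup>2) \<partial>lborel)" by simp
      also have "(\<Sum>k. \<integral>\<^sup>+s. ennreal \<bar>rb (t - s)\<bar> * ennreal ((w k s)\<^sup>2) \<partial>lborel) = (\<integral>\<^sup>+s. ennreal \<bar>rb (t - s)\<bar> * Lam y s \<partial>lborel)"
        unfolding Lam_def w2 by (subst nn_integral_suminf[symmetric]) auto
      also have "ennreal R * \<dots> < \<infinity>" using ft by (simp add: ennreal_mult_less_top top.not_eq_extremum)
      finally have "summable (\<lambda>k. (cv rb (w k) t)\<^sup>2)" by (intro sq_summable) auto
      then have "summable (\<lambda>k. lam k * (cv rb (y k) t)\<^sup>2)"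
        unfolding cw by (simp add: power_mult_distrib less_imp_le[OF lam_pos])
      from V_synthesis[OF this] obtain v where v: "inV L v" "\<And>k. cf v k = cv rb (y k) t" by blast
      have I1: "integrable lborel (\<lambda>s. \<bar>rb (t - s)\<bar>)"
      proof (rule integrableI_bounded)
        show "(\<integral>\<^sup>+s. ennreal (norm \<bar>rb (t - s)\<bar>) \<partial>lborel) < \<infinity>" using rfin nn_shift[of "\<lambda>s. ennreal \<bar>rb s\<bar>" t] by simp
      qed measurable
      have I2: "integrable lborel (\<lambda>s. \<bar>rb (t - s)\<bar> * enn2real (Lam y s))"
      proof (rule integrableI_bounded)
        have "(\<integral>\<^sup>+s. ennreal (norm (\<bar>rb (t - s)\<bar> * enn2real (Lam y s))) \<partial>lborel) \<le> (\<integral>\<^sup>+s. ennreal \<bar>rb (t - s)\<bar> * Lam y s \<partial>lborel)"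
        proof (rule nn_integral_mono)
          fix s
          have "ennreal (enn2real (Lam y s)) \<le> Lam y s" by (cases "Lam y s") auto
          then show "ennreal (norm (\<bar>rb (t - s)\<bar> * enn2real (Lam y s))) \<le> ennreal \<bar>rb (t - s)\<bar> * Lam y s"
            by (simp add: ennreal_mult mult_left_mono)
        qed
        then show "(\<integral>\<^sup>+s. ennreal (norm (\<bar>rb (t - s)\<bar> * enn2real (Lam y s))) \<partial>lborel) < \<infinity>"
          using ft by (simp add: top.not_eq_extremum le_less_trans)
      qed measurable
      have LamAE': "AE s in lborel. Lam y s \<noteq> \<infinity>" using LamAE by (simp add: AE_completion_iff)
      have I3: "integrable lborel (\<lambda>s. rb (t - s) * y k s)" for k
      proof (rule Bochner_Integration.integrable_bound)
        show "integrable lborel (\<lambda>s. \<bar>rb (t - s)\<bar> + 1 / lam k * (\<bar>rb (t - s)\<bar> * enn2real (Lam y s)))"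
          using I1 I2 by simp
        show "(\<lambda>s. rb (t - s) * y k s) \<in> borel_measurable lborel" by measurable
        show "AE s in lborel. norm (rb (t - s) * y k s) \<le> norm (\<bar>rb (t - s)\<bar> + 1 / lam k * (\<bar>rb (t - s)\<bar> * enn2real (Lam y s)))"
          using LamAE'
        proof eventually_elim
          fix s assume "Lam y s \<noteq> \<infinity>"
          from Lam_partial[OF this, of "Suc k"] have "lam k * (y k s)\<^sup>2 \<le> enn2real (Lam y s)"
            using sum_nonneg[of "{..<k}" "\<lambda>k. lam k * (y k s)\<^sup>2"] lam_pos by (simp add: less_imp_le)
          then have "(y k s)\<^sup>2 \<le> 1 / lam k * enn2real (Lam y s)" using lam_pos[of k] by (simp add: field_simps)
          moreover have "\<bar>y k s\<bar> \<le> 1 + (y k s)\<^sup>2"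
            using zero_le_power2[of "\<bar>y k s\<bar> - 1"] by (simp add: power2_diff)
          ultimately have "\<bar>y k s\<bar> \<le> 1 + 1 / lam k * enn2real (Lam y s)" by linarith
          then have "\<bar>rb (t - s)\<bar> * \<bar>y k s\<bar> \<le> \<bar>rb (t - s)\<bar> * (1 + 1 / lam k * enn2real (Lam y s))" by (intro mult_left_mono) auto
          also have "\<dots> = \<bar>rb (t - s)\<bar> + 1 / lam k * (\<bar>rb (t - s)\<bar> * enn2real (Lam y s))" by (simp add: algebra_simps)
          finally show "norm (rb (t - s) * y k s) \<le> norm (\<bar>rb (t - s)\<bar> + 1 / lam k * (\<bar>rb (t - s)\<bar> * enn2real (Lam y s)))"
            by (simp add: abs_mult)
        qed
      qed
      have "(LINT \<tau>:{0<..<t}|lebesgue. r (t - \<tau>) * ce (T \<tau>) z) = ce v z" if z: "z \<in> {0<..<L}" for z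
      proof -
        have z': "z \<in> {0..L}" using z by auto
        note pz = point_Vdual[OF z']
        define e where "e n s = (\<Sum>k<n. y k s * ce (eb k) z)" for n s
        have em[measurable]: "e n \<in> borel_measurable borel" for n unfolding e_def[abs_def] by measurable
        define G where "G s = indicator {0<..<t} s *\<^sub>R (r (t - s) * ce (T s) z)" for s
        define ez where "ez s = indicator {0<..<tmax} s *\<^sub>R ce (T s) z" for s
        have ezm: "ez \<in> borel_measurable lebesgue"
          using T pz by (auto simp: L2_V_def set_borel_measurable_def ez_def[abs_def])
        have refl: "AE s in lebesgue. t - s \<in> {0<..<tmax} \<longrightarrow> r (t - s) = rb (t - s)"
          by (rule AE_lebesgue_reflect[OF rbr])
        have GE: "AE s in lebesgue. G s = rb (t - s) * ez s"
          using refl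
        proof eventually_elim
          fix s assume rs: "t - s \<in> {0<..<tmax} \<longrightarrow> r (t - s) = rb (t - s)"
          show "G s = rb (t - s) * ez s"
          proof (cases "s \<in> {0<..<t}")
            case True
            then have "t - s \<in> {0<..<tmax}" "s \<in> {0<..<tmax}" using t by auto
            then show ?thesis using True rs by (simp add: G_def ez_def)
          next
            case False
            then have "s \<notin> {0<..<tmax} \<or> t - s \<notin> {0<..<tmax}" by auto
            then show ?thesis using False rb0[of "t - s"] by (auto simp: G_def ez_def)
          qed
        qed
        have rbm: "(\<lambda>s. rb (t - s)) \<in> borel_measurable lebesgue" by (intro measurable_completion) measurable
        \<comment> \<open>Dominated convergence for the expansion of the point value. The partial
          sums are bounded, uniformly in n, by KP * sqrt Lam <= KP * (1 + Lam), which is integrable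
          against the kernel for the chosen t.\<close>
        have lim1: "(\<lambda>n. LINT s|lebesgue. rb (t - s) * e n s) \<longlonglongrightarrow> (LINT s|lebesgue. rb (t - s) * ez s)"
        proof (rule integral_dominated_convergence)
          show "(\<lambda>s. rb (t - s) * ez s) \<in> borel_measurable lebesgue" using rbm ezm by (rule borel_measurable_times)
          show "(\<lambda>s. rb (t - s) * e n s) \<in> borel_measurable lebesgue" for n by (intro measurable_completion) measurable
          have "integrable lborel (\<lambda>s. KP * \<bar>rb (t - s)\<bar> + KP * (\<bar>rb (t - s)\<bar> * enn2real (Lam y s)))" using I1 I2 by simp
          then show "integrable lebesgue (\<lambda>s. KP * \<bar>rb (t - s)\<bar> + KP * (\<bar>rb (t - s)\<bar> * enn2real (Lam y s)))"
            by (subst integrable_completion) auto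
          show "AE s in lebesgue. (\<lambda>n. rb (t - s) * e n s) \<longlonglongrightarrow> rb (t - s) * ez s"
            using yT
          proof eventually_elim
            fix s assume a: "s \<in> {0<..<tmax} \<longrightarrow> inV L (T s) \<and> (\<forall>k. cf (T s) k = y k s)"
            show "(\<lambda>n. rb (t - s) * e n s) \<longlonglongrightarrow> rb (t - s) * ez s"
            proof (cases "s \<in> {0<..<tmax}")
              case True
              then have "inV L (T s)" "\<And>k. y k s = cf (T s) k" using a by auto
              then have "(\<lambda>n. e n s) \<longlonglongrightarrow> ce (T s) z" unfolding e_def using Vdual_expand[OF pz] by simp
              then show ?thesis using True by (intro tendsto_mult tendsto_const) (simp add: ez_def)
            next
              case False then show ?thesis by (simp add: e_def ez_def y0)
            qed
          qed
          fix n
          show "AE s in lebesgue. norm (rb (t - s) * e n s) \<le> KP * \<bar>rb (t - s)\<bar> + KP * (\<bar>rb (t - s)\<bar> * enn2real (Lam y s))"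
            using LamAE
          proof eventually_elim
            fix s assume fi: "Lam y s \<noteq> \<infinity>"
            have "e n s = ce (comb (\<lambda>k. y k s) n) z" unfolding e_def by (rule Vdual_comb[OF pz, symmetric])
            then have "\<bar>e n s\<bar> \<le> KP * sqrt (nD (comb (\<lambda>k. y k s) n))" using pointwise_bound(3)[OF comb_V z'] by simp
            also have "\<dots> \<le> KP * sqrt (enn2real (Lam y s))"
              unfolding nD_comb using KP by (intro mult_left_mono real_sqrt_le_mono Lam_partial fi) auto
            also have "\<dots> \<le> KP * (1 + enn2real (Lam y s))"
            proof (intro mult_left_mono)
              have "x \<le> (1 + x)\<^sup>2" if "0 \<le> x" for x :: real using that by (simp add: power2_eq_square algebra_simps)
              then show "sqrt (enn2real (Lam y s)) \<le> 1 + enn2real (Lam y s)" by (intro real_le_lsqrt) auto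
            qed (use KP in simp)
            finally have "\<bar>rb (t - s)\<bar> * \<bar>e n s\<bar> \<le> \<bar>rb (t - s)\<bar> * (KP * (1 + enn2real (Lam y s)))" by (intro mult_left_mono) auto
            then show "norm (rb (t - s) * e n s) \<le> KP * \<bar>rb (t - s)\<bar> + KP * (\<bar>rb (t - s)\<bar> * enn2real (Lam y s))"
              by (simp add: abs_mult algebra_simps)
          qed
        qed
        have "(LINT s|lebesgue. rb (t - s) * e n s) = (\<Sum>k<n. cf v k * ce (eb k) z)" for n
        proof -
          have "(LINT s|lebesgue. rb (t - s) * e n s) = (LINT s|lborel. rb (t - s) * e n s)" by (rule integral_completion) measurable
          also have "\<dots> = (LINT s|lborel. (\<Sum>k<n. (rb (t - s) * y k s) * ce (eb k) z))"
            by (simp add: e_def sum_distrib_left mult.assoc)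
          also have "\<dots> = (\<Sum>k<n. cv rb (y k) t * ce (eb k) z)"
            using I3 by (subst Bochner_Integration.integral_sum) (auto simp: cv_def)
          finally show ?thesis using v(2) by simp
        qed
        then have "(\<lambda>n. LINT s|lebesgue. rb (t - s) * e n s) \<longlonglongrightarrow> ce v z" using Vdual_expand[OF pz v(1)] by simp
        with lim1 have "(LINT s|lebesgue. rb (t - s) * ez s) = ce v z" by (rule LIMSEQ_unique)
        moreover have "(LINT s|lebesgue. G s) = (LINT s|lebesgue. rb (t - s) * ez s)"
        proof (rule integral_cong_AE[OF _ _ GE])
          show m: "(\<lambda>s. rb (t - s) * ez s) \<in> borel_measurable lebesgue" using rbm ezm by (rule borel_measurable_times)
          show "G \<in> borel_measurable lebesgue"
            by (rule borel_measurable_AE[OF m]) (use GE in \<open>eventually_elim, simp\<close>)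
        qed
        ultimately show ?thesis by (simp add: set_lebesgue_integral_def G_def)
      qed
      with v show "\<exists>v. inV L v \<and> (\<forall>k. cf v k = cv rb (y k) t) \<and>
        (\<forall>z\<in>{0<..<L}. (LINT \<tau>:{0<..<t}|lebesgue. r (t - \<tau>) * ce (T \<tau>) z) = ce v z)" by blast
    qed
  qed
qed


section \<open>Duhamel's formula as a convolution in weighted coordinates\<close>

definition decay :: "nat \<Rightarrow> real \<Rightarrow> real" where
  "decay k s = (if 0 < s then mm \<gamma> k * exp (- mm \<gamma> k * s) else 0)"

definition rt :: "real \<Rightarrow> real" where "rt s = exp (- \<gamma> * s) * rb s"

lemma decay_measurable[measurable]: "decay k \<in> borel_measurable borel"
  unfolding decay_def[abs_def] by measurable

lemma rt_measurable[measurable]: "rt \<in> borel_measurable borel"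
  unfolding rt_def[abs_def] by measurable

lemma nn_exp: assumes "a > 0" "c \<ge> 0"
  shows "(\<integral>\<^sup>+s. ennreal (if 0 < s then c * exp (- a * s) else 0) \<partial>lborel) = ennreal (c / a)"
proof -
  have "(\<integral>\<^sup>+s. ennreal (if 0 < s then c * exp (- a * s) else 0) \<partial>lborel) = (\<integral>\<^sup>+s. ennreal (c * exp (- a * s)) * indicator {0..} s \<partial>lborel)"
  proof (rule nn_integral_cong_AE)
    show "AE s in lborel. ennreal (if 0 < s then c * exp (- a * s) else 0) = ennreal (c * exp (- a * s)) * indicator {0..} s"
      using AE_lborel_singleton[of 0] by eventually_elim (auto simp: indicator_def)
  qed
  also have "\<dots> = ennreal (0 - (- (c / a) * exp (- a * 0)))"
  proof (rule nn_integral_FTC_atLeast)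
    have "((\<lambda>s. exp (- a * s)) \<longlongrightarrow> 0) at_top"
    proof (rule filterlim_compose[OF exp_at_bot])
      have "filterlim (\<lambda>s. a * s) at_top at_top"
        by (rule filterlim_tendsto_pos_mult_at_top[OF tendsto_const assms(1) filterlim_ident])
      then show "LIM s at_top. - a * s :> at_bot" by (simp add: filterlim_uminus_at_bot)
    qed
    then have "((\<lambda>s. - (c / a) * exp (- a * s)) \<longlongrightarrow> - (c / a) * 0) at_top" by (intro tendsto_mult tendsto_const)
    then show "((\<lambda>s. - (c / a) * exp (- a * s)) \<longlongrightarrow> 0) at_top" by simp
    show "((\<lambda>s. - (c / a) * exp (- a * s)) has_real_derivative c * exp (- a * x)) (at x)" for x
      using assms by (auto intro!: derivative_eq_intros)
  qed (use assms in auto)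
  finally show ?thesis by simp
qed

text \<open>The rate in the exponent equals the prefactor, so the mass is 1 for every mode:
  smoothing by the diagonal part is bounded uniformly in k.\<close>

lemma decay_L1: "(\<integral>\<^sup>+s. ennreal \<bar>decay k s\<bar> \<partial>lborel) \<le> ennreal 1"
proof -
  have m: "mm \<gamma> k > 0" using mm(1)[OF \<gamma>] .
  have "(\<integral>\<^sup>+s. ennreal \<bar>decay k s\<bar> \<partial>lborel) = (\<integral>\<^sup>+s. ennreal (if 0 < s then mm \<gamma> k * exp (- mm \<gamma> k * s) else 0) \<partial>lborel)"
    using m by (intro nn_integral_cong) (auto simp: decay_def)
  then show ?thesis using nn_exp[OF m, of "mm \<gamma> k"] m by simp
qed

text \<open>Grows like mm; in the pointwise bound of the modes this growth cancels exactly against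
  the squared scaling factor.\<close>

lemma decay_L2: "(\<integral>\<^sup>+s. ennreal ((decay k s)\<^sup>2) \<partial>lborel) = ennreal (mm \<gamma> k / 2)"
proof -
  have m: "mm \<gamma> k > 0" using mm(1)[OF \<gamma>] .
  have e: "(mm \<gamma> k * exp (- mm \<gamma> k * s))\<^sup>2 = (mm \<gamma> k)\<^sup>2 * exp (- (2 * mm \<gamma> k) * s)" for s
  proof -
    have "(exp (- mm \<gamma> k * s))\<^sup>2 = exp (- (2 * mm \<gamma> k) * s)" unfolding power2_eq_square exp_add[symmetric] by (simp add: algebra_simps)
    then show ?thesis by (simp only: power_mult_distrib)
  qed
  have "(\<integral>\<^sup>+s. ennreal ((decay k s)\<^sup>2) \<partial>lborel) = (\<integral>\<^sup>+s. ennreal (if 0 < s then (mm \<gamma> k)\<^sup>2 * exp (- (2 * mm \<gamma> k) * s) else 0) \<partial>lborel)"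
    using e by (intro nn_integral_cong) (simp add: decay_def)
  also have "\<dots> = ennreal ((mm \<gamma> k)\<^sup>2 / (2 * mm \<gamma> k))" by (rule nn_exp) (use m in auto)
  also have "(mm \<gamma> k)\<^sup>2 / (2 * mm \<gamma> k) = mm \<gamma> k / 2" using m by (simp add: power2_eq_square)
  finally show ?thesis .
qed

lemma rtR: "(\<integral>\<^sup>+s. ennreal \<bar>rt s\<bar> \<partial>lborel) \<le> ennreal R"
proof (rule order_trans[OF nn_integral_mono rbR])
  fix s
  show "ennreal \<bar>rt s\<bar> \<le> ennreal \<bar>rb s\<bar>"
  proof (cases "s \<in> {0<..<tmax}")
    case True
    then have "exp (- \<gamma> * s) \<le> 1" using \<gamma> by simp
    then have "exp (- \<gamma> * s) * \<bar>rb s\<bar> \<le> 1 * \<bar>rb s\<bar>" by (intro mult_right_mono) auto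
    then show ?thesis by (intro ennreal_leI) (simp add: rt_def abs_mult)
  next
    case False then show ?thesis by (simp add: rt_def rb0)
  qed
qed

sublocale volterra decay rt "qm \<gamma>" "bmx \<gamma>" "\<rho>q \<gamma>" "\<rho>b \<gamma>" R tmax
  by standard (rule decay_measurable decay_L1 rt_measurable rtR R matbound_qm[OF \<gamma>] matbound_bmx[OF \<gamma>] \<rho>_pos[OF \<gamma>] small)+

definition scaled :: "(nat \<Rightarrow> real \<Rightarrow> real) \<Rightarrow> nat \<Rightarrow> real \<Rightarrow> real" where
  "scaled y k t = sqrt (mm \<gamma> k) * exp (- \<gamma> * t) * y k t"

text \<open>Coefficients of a functional on V become square summable only after division by sqrt
  lam, which sqrt mm dominates up to a constant.\<close>

definition load :: "nat \<Rightarrow> real \<Rightarrow> real" where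
  "load k s = exp (- \<gamma> * s) / sqrt (mm \<gamma> k) * fk k s"

definition c0 :: "nat \<Rightarrow> real" where "c0 k = cf T0 k"

definition free_part :: "nat \<Rightarrow> real \<Rightarrow> real" where
  "free_part k t = indicator {0<..<tmax} t * (sqrt (mm \<gamma> k) * exp (- mm \<gamma> k * t) * c0 k + cv (decay k) (load k) t)"

lemma load_measurable[measurable]: "load k \<in> borel_measurable borel" unfolding load_def[abs_def] by measurable
lemma free_part_measurable[measurable]: "free_part k \<in> borel_measurable borel" unfolding free_part_def[abs_def] by measurable
lemma scaled_measurable[measurable]: "y k \<in> borel_measurable borel \<Longrightarrow> scaled y k \<in> borel_measurable borel" unfolding scaled_def[abs_def] by measurable

lemma HH0: "s \<notin> {0<..<tmax} \<Longrightarrow> load k s = 0" by (simp add: load_def fk0)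

text \<open>Exponential weights are multiplicative under convolution: exp(-\<gamma> (t - s))
  exp(-\<gamma> s) = exp(-\<gamma> t). Damping the kernel is therefore the same as damping the
  result.\<close>

lemma cv_rt: "cv rt (scaled y j) t = sqrt (mm \<gamma> j) * exp (- \<gamma> * t) * cv rb (y j) t"
proof -
  have "rt (t - s) * scaled y j s = sqrt (mm \<gamma> j) * exp (- \<gamma> * t) * (rb (t - s) * y j s)" for s
  proof -
    have "exp (- \<gamma> * (t - s)) * exp (- \<gamma> * s) = exp (- \<gamma> * t)" by (simp add: algebra_simps flip: exp_add)
    then have "exp (- \<gamma> * (t - s)) * exp (- \<gamma> * s) * (rb (t - s) * (sqrt (mm \<gamma> j) * y j s)) = exp (- \<gamma> * t) * (rb (t - s) * (sqrt (mm \<gamma> j) * y j s))" by (simp only:)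
    then show ?thesis by (simp add: rt_def scaled_def mult_ac)
  qed
  then show ?thesis by (simp add: cv_def)
qed

text \<open>\<open>FF\<close> is what remains on the right of the equation of the \<open>k\<close>-th mode once
  \<open>\<mu> * lam k * y k\<close> has been moved to the left and the weight has been applied.\<close>
lemma FF_scaled:
  assumes U: "inV L U" "\<And>k. cf U k = y k t" and v: "inV L v" "\<And>k. cf v k = cv rb (y k) t"
  shows "FF (scaled y) k t = exp (- \<gamma> * t) / sqrt (mm \<gamma> k) * (\<mu> * lam k * y k t - A U (eb k) + S v (eb k))"
proof -
  have m: "sqrt (mm \<gamma> j) > 0" for j using mm(1)[OF \<gamma>] by simp
  define E where "E = exp (- \<gamma> * t) / sqrt (mm \<gamma> k)"
  have sA: "(\<lambda>j. cf U j * A (eb j) (eb k)) sums A U (eb k)"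
    unfolding sums_def by (rule Vdual_expand[OF A_Vdual(2)[OF eb_V(1)] U(1)])
  have sd: "(\<lambda>j. if j = k then \<mu> * lam k * y k t else 0) sums (\<mu> * lam k * y k t)" by (rule sums_single)
  have "(\<lambda>j. E * ((if j = k then \<mu> * lam k * y k t else 0) - cf U j * A (eb j) (eb k))) sums (E * (\<mu> * lam k * y k t - A U (eb k)))"
    by (intro sums_mult sums_diff sd sA)
  moreover have "E * ((if j = k then \<mu> * lam k * y k t else 0) - cf U j * A (eb j) (eb k)) = qm \<gamma> j k * scaled y j t" for j
    using m[of j] m[of k] unfolding U(2) by (auto simp: E_def qm_def scaled_def field_simps)
  ultimately have 1: "matop (qm \<gamma>) (\<lambda>j. scaled y j t) k = E * (\<mu> * lam k * y k t - A U (eb k))"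
    unfolding matop_def by (simp add: sums_iff)
  have "(\<lambda>j. cf v j * S (eb j) (eb k)) sums S v (eb k)"
    unfolding sums_def by (rule Vdual_expand[OF S_Vdual(2)[OF eb_V(1)] v(1)])
  then have "(\<lambda>j. E * (cf v j * S (eb j) (eb k))) sums (E * S v (eb k))" by (rule sums_mult)
  moreover have "E * (cf v j * S (eb j) (eb k)) = bmx \<gamma> j k * cv rt (scaled y j) t" for j
    using m[of j] m[of k] unfolding v(2) cv_rt by (simp add: E_def bmx_def)
  ultimately have 2: "matop (bmx \<gamma>) (\<lambda>j. cv rt (scaled y j) t) k = E * S v (eb k)"
    unfolding matop_def by (simp add: sums_iff)
  show ?thesis unfolding FF_def 1 2 E_def by (simp add: algebra_simps)
qed

text \<open>Causality: before time 0 neither the function nor its memory contributes. This lets the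
  convolution over the line agree with an integral over (0, t).\<close>

lemma FF_zero: assumes y0: "\<And>k t. t \<notin> {0<..<tmax} \<Longrightarrow> y k t = 0" and s: "s \<le> 0" shows "FF (scaled y) k s = 0"
proof -
  have 1: "scaled y j s = 0" for j using y0[of s j] s by (simp add: scaled_def)
  have z: "rb (s - u) * y j u = 0" for j u
  proof (cases "u \<in> {0<..<tmax}")
    case True then show ?thesis using s rb0[of "s - u"] by simp
  next
    case False then show ?thesis by (simp add: y0)
  qed
  have "cv rb (y j) s = 0" for j unfolding cv_def z by simp
  then have 2: "cv rt (scaled y j) s = 0" for j by (simp add: cv_rt)
  show ?thesis by (simp add: FF_def matop_def 1 2)
qed

text \<open>The weight adds \<gamma> to the decay rate \<mu> lam and makes it \<open>mm\<close>; one
  factor sqrt mm from the scaling and one from the source combine to the prefactor of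
  \<open>decay\<close>.\<close>

lemma Duhamel_cv:
  assumes hm[measurable]: "h \<in> borel_measurable borel" and h0: "\<And>s. s \<le> 0 \<Longrightarrow> h s = 0"
  shows "sqrt (mm \<gamma> k) * exp (- \<gamma> * t) * (exp (- (\<mu> * lam k) * t) * (LINT s:{0<..<t}|lebesgue. (sqrt (mm \<gamma> k) * exp (\<gamma> * s) * h s) * exp (\<mu> * lam k * s))) = cv (decay k) h t"
proof -
  have m: "sqrt (mm \<gamma> k) * sqrt (mm \<gamma> k) = mm \<gamma> k" using mm(1)[OF \<gamma>, of k] by simp
  have "(LINT s:{0<..<t}|lebesgue. (sqrt (mm \<gamma> k) * exp (\<gamma> * s) * h s) * exp (\<mu> * lam k * s))
     = (LINT s|lborel. indicator {0<..<t} s *\<^sub>R ((sqrt (mm \<gamma> k) * exp (\<gamma> * s) * h s) * exp (\<mu> * lam k * s)))"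
    unfolding set_lebesgue_integral_def by (rule integral_completion) measurable
  then have "sqrt (mm \<gamma> k) * exp (- \<gamma> * t) * (exp (- (\<mu> * lam k) * t) * (LINT s:{0<..<t}|lebesgue. (sqrt (mm \<gamma> k) * exp (\<gamma> * s) * h s) * exp (\<mu> * lam k * s)))
    = (LINT s|lborel. sqrt (mm \<gamma> k) * exp (- \<gamma> * t) * exp (- (\<mu> * lam k) * t) * (indicator {0<..<t} s *\<^sub>R ((sqrt (mm \<gamma> k) * exp (\<gamma> * s) * h s) * exp (\<mu> * lam k * s))))"
    by simp
  also have "\<dots> = (LINT s|lborel. decay k (t - s) * h s)"
  proof (rule Bochner_Integration.integral_cong[OF refl])
    fix s
    have ex: "exp (- \<gamma> * t) * exp (- (\<mu> * lam k) * t) * (exp (\<gamma> * s) * exp (\<mu> * lam k * s)) = exp (- mm \<gamma> k * (t - s))"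
      unfolding exp_add[symmetric] by (simp add: mm_def algebra_simps)
    show "sqrt (mm \<gamma> k) * exp (- \<gamma> * t) * exp (- (\<mu> * lam k) * t) * (indicator {0<..<t} s *\<^sub>R ((sqrt (mm \<gamma> k) * exp (\<gamma> * s) * h s) * exp (\<mu> * lam k * s))) = decay k (t - s) * h s"
    proof (cases "s \<in> {0<..<t}")
      case True
      have "sqrt (mm \<gamma> k) * exp (- \<gamma> * t) * exp (- (\<mu> * lam k) * t) * ((sqrt (mm \<gamma> k) * exp (\<gamma> * s) * h s) * exp (\<mu> * lam k * s))
        = (sqrt (mm \<gamma> k) * sqrt (mm \<gamma> k)) * (exp (- \<gamma> * t) * exp (- (\<mu> * lam k) * t) * (exp (\<gamma> * s) * exp (\<mu> * lam k * s))) * h s"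
        by (simp only: mult_ac)
      then show ?thesis unfolding ex m using True by (simp add: decay_def)
    next
      case False
      then show ?thesis using h0[of s] by (auto simp: decay_def not_less)
    qed
  qed
  finally show ?thesis by (simp add: cv_def)
qed

end

lemma set_integrable_AE_eq:
  fixes f g :: "real \<Rightarrow> real"
  assumes f: "set_integrable lebesgue A f" and e: "AE x in lebesgue. x \<in> A \<longrightarrow> f x = g x"
  shows "set_integrable lebesgue A g" "(LINT x:A|lebesgue. g x) = (LINT x:A|lebesgue. f x)"
proof -
  have i: "integrable lebesgue (\<lambda>x. indicator A x *\<^sub>R f x)" using f by (simp add: set_integrable_def)
  have ae: "AE x in lebesgue. indicator A x *\<^sub>R f x = indicator A x *\<^sub>R g x"
    using e by eventually_elim (auto simp: indicator_def)
  have m: "(\<lambda>x. indicator A x *\<^sub>R g x) \<in> borel_measurable lebesgue"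
    by (rule borel_measurable_AE[OF borel_measurable_integrable[OF i] ae])
  show "set_integrable lebesgue A g" unfolding set_integrable_def by (rule integrable_cong_AE_imp[OF i m]) (use ae in \<open>eventually_elim, simp\<close>)
  show "(LINT x:A|lebesgue. g x) = (LINT x:A|lebesgue. f x)" unfolding set_lebesgue_integral_def
    by (rule integral_cong_AE[OF m borel_measurable_integrable[OF i] eventually_mono[OF ae sym]])
qed

section \<open>Modes of a given solution and uniqueness\<close>

context heat_problem
begin

lemma memory_form:
  assumes T: "L2_V L tmax T" and y: "coefrep tmax T y"
  shows "AE t in lebesgue. t \<in> {0<..<tmax} \<longrightarrow> (\<exists>v. inV L v \<and> (\<forall>k. cf v k = cv rb (y k) t) \<and>
    (\<forall>\<Phi>. inV L \<Phi> \<longrightarrow> C_form L bf r T \<Phi> t = - S v \<Phi>))"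
  using memory[OF T y]
proof eventually_elim
  fix t
  assume a: "t \<in> {0<..<tmax} \<longrightarrow> (\<exists>v. inV L v \<and> (\<forall>k. cf v k = cv rb (y k) t) \<and>
    (\<forall>z\<in>{0<..<L}. (LINT \<tau>:{0<..<t}|lebesgue. r (t - \<tau>) * ce (T \<tau>) z) = ce v z))"
  show "t \<in> {0<..<tmax} \<longrightarrow> (\<exists>v. inV L v \<and> (\<forall>k. cf v k = cv rb (y k) t) \<and>
    (\<forall>\<Phi>. inV L \<Phi> \<longrightarrow> C_form L bf r T \<Phi> t = - S v \<Phi>))"
  proof
    assume "t \<in> {0<..<tmax}"
    with a obtain v where v: "inV L v" "\<And>k. cf v k = cv rb (y k) t"
      "\<And>z. z \<in> {0<..<L} \<Longrightarrow> (LINT \<tau>:{0<..<t}|lebesgue. r (t - \<tau>) * ce (T \<tau>) z) = ce v z" by blast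
    have "C_form L bf r T \<Phi> t = - S v \<Phi>" if "inV L \<Phi>" for \<Phi>
    proof -
      have "(LINT z:{0<..<L}|lebesgue. (LINT \<tau>:{0<..<t}|lebesgue. r (t - \<tau>) * ce (T \<tau>) z) * ce \<Phi> z) = (LINT z:{0<..<L}|lebesgue. ce v z * ce \<Phi> z)"
        by (rule set_lebesgue_integral_cong) (use v(3) in auto)
      then show ?thesis unfolding C_form_def S_eq[OF v(1) that] by simp
    qed
    with v show "\<exists>v. inV L v \<and> (\<forall>k. cf v k = cv rb (y k) t) \<and>
      (\<forall>\<Phi>. inV L \<Phi> \<longrightarrow> C_form L bf r T \<Phi> t = - S v \<Phi>)" by blast
  qed
qed

lemma H_dist_eq: assumes "inH L U" "inH L W"
  shows "(H_dist L U W)\<^sup>2 = ip M (co (tdiff U W)) (co (tdiff U W)) + ip M (ci (tdiff U W)) (ci (tdiff U W)) + ip M (ce (tdiff U W)) (ce (tdiff U W))"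
proof -
  have "H_dist L U W = sqrt (ip M (co (tdiff U W)) (co (tdiff U W)) + ip M (ci (tdiff U W)) (ci (tdiff U W)) + ip M (ce (tdiff U W)) (ce (tdiff U W)))"
    by (simp add: H_dist_def ip_self LINT_eq_on)
  then show ?thesis by (simp add: add_nonneg_nonneg)
qed

lemma nH_H_dist: assumes "inH L U" "inH L W"
  shows "nH (tdiff U W) \<le> KD * (H_dist L U W)\<^sup>2" "(H_dist L U W)\<^sup>2 \<le> wsum * nH (tdiff U W)"
proof -
  let ?a = "ip M (co (tdiff U W)) (co (tdiff U W))" and ?b = "ip M (ci (tdiff U W)) (ci (tdiff U W))" and ?c = "ip M (ce (tdiff U W)) (ce (tdiff U W))"
  have n: "0 \<le> ?a" "0 \<le> ?b" "0 \<le> ?c" by simp_all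
  have e: "nH (tdiff U W) = ao * ?a + (ai * ?b + ae * ?c)" by (rule nH_split[OF tadd_H[OF assms]])
  have "ao * ?a + (ai * ?b + ae * ?c) \<le> ao * (?a + ?b + ?c) + (ai * (?a + ?b + ?c) + ae * (?a + ?b + ?c))"
    using n ao ai ae by (intro add_mono mult_left_mono) auto
  then show "nH (tdiff U W) \<le> KD * (H_dist L U W)\<^sup>2"
    unfolding H_dist_eq[OF assms] e by (simp add: KD_def algebra_simps)
  have k: "x \<le> wsum * (a * x)" if "0 \<le> x" "1 / a \<le> wsum" "0 < a" for a x
    using mult_right_mono[OF that(2), of "a * x"] that by simp
  have "?a \<le> wsum * (ao * ?a)" "?b \<le> wsum * (ai * ?b)" "?c \<le> wsum * (ae * ?c)"
    by (rule k[OF n(1) wsum(2) ao], rule k[OF n(2) wsum(3) ai], rule k[OF n(3) wsum(4) ae])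
  then show "(H_dist L U W)\<^sup>2 \<le> wsum * nH (tdiff U W)"
    unfolding H_dist_eq[OF assms] e by (simp only: distrib_left)
qed

lemma H_dist_nonneg: "0 \<le> H_dist L U W"
  unfolding H_dist_def set_lebesgue_integral_def by (intro real_sqrt_ge_zero add_nonneg_nonneg Bochner_Integration.integral_nonneg) auto

lemma cf_H_bound: assumes "inH L U" shows "\<bar>cf U k\<bar> \<le> sqrt (nH U)"
  using ip_Cauchy_Schwarz[of M "lift U" "lift (eb k)"] assms eb_H[of k]
  by (simp add: cf_ip sqint_lift nH_def ip_eb_eb)

lemma cf_continuous: assumes "H_cont L tmax T" shows "continuous_on {0..tmax} (\<lambda>t. cf (T t) k)"
  unfolding continuous_on_def
proof
  fix t assume t: "t \<in> {0..tmax}"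
  have H: "inH L (T s)" if "s \<in> {0..tmax}" for s using assms that by (simp add: H_cont_def)
  have lim: "((\<lambda>s. H_dist L (T s) (T t)) \<longlongrightarrow> 0) (at t within {0..tmax})" using assms t by (simp add: H_cont_def)
  have "((\<lambda>s. sqrt KD * H_dist L (T s) (T t)) \<longlongrightarrow> sqrt KD * 0) (at t within {0..tmax})" by (intro tendsto_intros lim)
  then have lim': "((\<lambda>s. sqrt KD * H_dist L (T s) (T t)) \<longlongrightarrow> 0) (at t within {0..tmax})" by simp
  have "((\<lambda>s. cf (T s) k - cf (T t) k) \<longlongrightarrow> 0) (at t within {0..tmax})"
  proof (rule Lim_null_comparison[OF _ lim'])
    show "\<forall>\<^sub>F s in at t within {0..tmax}. norm (cf (T s) k - cf (T t) k) \<le> sqrt KD * H_dist L (T s) (T t)"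
    proof (unfold eventually_at_filter, rule always_eventually, intro allI impI)
      fix s assume "s \<in> {0..tmax}"
      note h = H[OF this] H[OF t]
      have "norm (cf (T s) k - cf (T t) k) = \<bar>cf (tdiff (T s) (T t)) k\<bar>" by (simp add: cf_tadd h)
      also have "\<dots> \<le> sqrt (nH (tdiff (T s) (T t)))" by (intro cf_H_bound tadd_H h)
      also have "\<dots> \<le> sqrt (KD * (H_dist L (T s) (T t))\<^sup>2)" by (intro real_sqrt_le_mono nH_H_dist h)
      finally show "norm (cf (T s) k - cf (T t) k) \<le> sqrt KD * H_dist L (T s) (T t)"
        by (simp add: real_sqrt_mult H_dist_nonneg)
    qed
  qed
  then show "((\<lambda>s. cf (T s) k) \<longlongrightarrow> cf (T t) k) (at t within {0..tmax})" by (rule LIM_zero_cancel)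
qed

lemma L2_Vdual_comp: assumes G: "L2_Vdual L tmax G" and \<Phi>: "inV L \<Phi>" shows "L2_on 0 tmax (\<lambda>t. G t \<Phi>)"
proof -
  have m: "(\<lambda>t. indicator {0<..<tmax} t *\<^sub>R G t \<Phi>) \<in> borel_measurable lebesgue"
    using G \<Phi> unfolding L2_Vdual_def set_borel_measurable_def by blast
  have i: "integrable lebesgue (\<lambda>t. (V_norm L \<Phi>)\<^sup>2 * (indicator {0<..<tmax} t *\<^sub>R (Vdual_norm L (G t))\<^sup>2))"
    using G by (simp add: L2_Vdual_def set_integrable_def)
  have V: "AE t in lebesgue. t \<in> {0<..<tmax} \<longrightarrow> in_Vdual L (G t)" using G by (simp add: L2_Vdual_def)
  have "integrable lebesgue (\<lambda>t. indicator {0<..<tmax} t *\<^sub>R (G t \<Phi>)\<^sup>2)"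
  proof (rule Bochner_Integration.integrable_bound[OF i])
    have "(\<lambda>t. (indicator {0<..<tmax} t *\<^sub>R G t \<Phi>)\<^sup>2) \<in> borel_measurable lebesgue" using m by (rule borel_measurable_power)
    moreover have "(\<lambda>t. (indicator {0<..<tmax} t *\<^sub>R G t \<Phi>)\<^sup>2) = (\<lambda>t. indicator {0<..<tmax} t *\<^sub>R (G t \<Phi>)\<^sup>2)"
      by (auto simp: indicator_def)
    ultimately show "(\<lambda>t. indicator {0<..<tmax} t *\<^sub>R (G t \<Phi>)\<^sup>2) \<in> borel_measurable lebesgue" by simp
    show "AE t in lebesgue. norm (indicator {0<..<tmax} t *\<^sub>R (G t \<Phi>)\<^sup>2) \<le> norm ((V_norm L \<Phi>)\<^sup>2 * (indicator {0<..<tmax} t *\<^sub>R (Vdual_norm L (G t))\<^sup>2))"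
      using V
    proof eventually_elim
      fix t assume "t \<in> {0<..<tmax} \<longrightarrow> in_Vdual L (G t)"
      then show "norm (indicator {0<..<tmax} t *\<^sub>R (G t \<Phi>)\<^sup>2) \<le> norm ((V_norm L \<Phi>)\<^sup>2 * (indicator {0<..<tmax} t *\<^sub>R (Vdual_norm L (G t))\<^sup>2))"
        using power_mono[OF Vdual_norm_ge[OF _ \<Phi>, of "G t"], of 2]
        by (auto simp: indicator_def power_mult_distrib mult.commute)
    qed
  qed
  then show ?thesis using m by (simp add: L2_on_def set_borel_measurable_def set_integrable_def)
qed

text \<open>The Poincare inequality applied to \<open>eb k\<close>, which has norm 1 in
  \<open>H\<close>. A uniform lower bound of the eigenvalues makes the shift by \<gamma> harmless,
  so mm is at most a multiple of lam.\<close>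

lemma lam_lower: "1 \<le> KD * KV * lam k"
proof -
  have "nH (eb k) \<le> KD * KV * nD (eb k)" by (rule nH_le[OF eb_V(1)])
  moreover have "nH (eb k) = 1" by (simp add: nH_def ip_eb_eb)
  moreover have "nD (eb k) = lam k" using eigen[OF eb_V(1), of k k] by (simp add: nD_def ip_eb_eb)
  ultimately show ?thesis by simp
qed

definition "Cm = \<mu> + \<gamma> * (KD * KV)"

lemma mm_le: "mm \<gamma> k \<le> Cm * lam k"
proof -
  have "\<gamma> * 1 \<le> \<gamma> * (KD * KV * lam k)" using \<gamma> by (intro mult_left_mono lam_lower) simp
  then show ?thesis by (simp add: mm_def Cm_def algebra_simps)
qed

lemma Cm: "Cm > 0" using \<mu> \<gamma> KD KV by (simp add: Cm_def add_pos_pos)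

lemma Nrm_scaled: assumes y: "coefrep tmax T y" shows "Nrm (scaled y) < \<infinity>"
proof -
  have ym[measurable]: "y k \<in> borel_measurable borel" and y0: "t \<notin> {0<..<tmax} \<Longrightarrow> y k t = 0" for k t
    using y by (auto simp: coefrep_def)
  have Lfin: "(\<integral>\<^sup>+t. Lam y t \<partial>lborel) < \<infinity>" using y by (auto simp: coefrep_def Lam_def)
  have "Nrm (scaled y) \<le> (\<integral>\<^sup>+t. ennreal Cm * Lam y t \<partial>lborel)"
    unfolding Nrm_def
  proof (rule nn_integral_mono)
    fix t
    have "sq (\<lambda>k. scaled y k t) \<le> (\<Sum>k. ennreal Cm * ennreal (lam k * (y k t)\<^sup>2))"
      unfolding sq_def
    proof (intro suminf_le allI)
      fix k
      have "(scaled y k t)\<^sup>2 \<le> Cm * (lam k * (y k t)\<^sup>2)"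
      proof (cases "t \<in> {0<..<tmax}")
        case True
        have "exp (- \<gamma> * t) \<le> 1" using True \<gamma> by simp
        then have "(exp (- \<gamma> * t))\<^sup>2 \<le> 1" by (simp add: power_le_one)
        then have "mm \<gamma> k * (exp (- \<gamma> * t))\<^sup>2 * (y k t)\<^sup>2 \<le> (Cm * lam k) * 1 * (y k t)\<^sup>2"
          using mm_le[of k] mm(1)[OF \<gamma>, of k] by (intro mult_right_mono mult_mono) auto
        then show ?thesis using mm(1)[OF \<gamma>, of k] by (simp add: scaled_def power_mult_distrib mult.assoc)
      next
        case False then show ?thesis by (simp add: scaled_def y0)
      qed
      then show "ennreal ((scaled y k t)\<^sup>2) \<le> ennreal Cm * ennreal (lam k * (y k t)\<^sup>2)"
        using Cm by (simp add: ennreal_leI flip: ennreal_mult')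
    qed auto
    then show "sq (\<lambda>k. scaled y k t) \<le> ennreal Cm * Lam y t" unfolding Lam_def by simp
  qed
  also have "\<dots> = ennreal Cm * (\<integral>\<^sup>+t. Lam y t \<partial>lborel)" by (rule nn_integral_cmult) measurable
  also have "\<dots> < \<infinity>" using Lfin by (simp add: ennreal_mult_less_top)
  finally show ?thesis .
qed

lemma F_coeffs: "AE t in lebesgue. t \<in> {0<..<tmax} \<longrightarrow> in_Vdual L (F t) \<and> (\<forall>k. F t (eb k) = fk k t)"
proof -
  have "AE t in lebesgue. \<forall>k. t \<in> {0<..<tmax} \<longrightarrow> F t (eb k) = fk k t" unfolding AE_all_countable using fkF by blast
  moreover have "AE t in lebesgue. t \<in> {0<..<tmax} \<longrightarrow> in_Vdual L (F t)" using F by (simp add: L2_Vdual_def)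
  ultimately show ?thesis by eventually_elim auto
qed

text \<open>The coefficient bound for functionals, together with \<mu> lam <= mm, majorises the load
  at almost every time by the squared dual norm of \<open>F t\<close>.\<close>

lemma Nrm_load: "Nrm load < \<infinity>"
proof -
  have "Nrm load = (\<integral>\<^sup>+t. sq (\<lambda>k. load k t) \<partial>lebesgue)"
    unfolding Nrm_def by (rule nn_integral_completion[symmetric]) measurable
  also have "\<dots> \<le> (\<integral>\<^sup>+t. ennreal (norm (KV / \<mu> * (indicator {0<..<tmax} t *\<^sub>R (Vdual_norm L (F t))\<^sup>2))) \<partial>lebesgue)"
  proof (rule nn_integral_mono_AE)
    show "AE t in lebesgue. sq (\<lambda>k. load k t) \<le> ennreal (norm (KV / \<mu> * (indicator {0<..<tmax} t *\<^sub>R (Vdual_norm L (F t))\<^sup>2)))"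
      using F_coeffs
    proof eventually_elim
      fix t assume a: "t \<in> {0<..<tmax} \<longrightarrow> in_Vdual L (F t) \<and> (\<forall>k. F t (eb k) = fk k t)"
      show "sq (\<lambda>k. load k t) \<le> ennreal (norm (KV / \<mu> * (indicator {0<..<tmax} t *\<^sub>R (Vdual_norm L (F t))\<^sup>2)))"
      proof (cases "t \<in> {0<..<tmax}")
        case True
        then have V: "in_Vdual L (F t)" and fe: "\<And>k. fk k t = F t (eb k)" using a by auto
        have "(load k t)\<^sup>2 \<le> 1 / \<mu> * ((F t (eb k))\<^sup>2 / lam k)" for k
        proof -
          have "exp (- \<gamma> * t) \<le> 1" using True \<gamma> by simp
          then have e: "(exp (- \<gamma> * t))\<^sup>2 \<le> 1" by (simp add: power_le_one)
          have m: "0 < \<mu> * lam k" "\<mu> * lam k \<le> mm \<gamma> k" using \<mu> lam_pos mm(2)[OF \<gamma>] by auto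
          have "(load k t)\<^sup>2 = (exp (- \<gamma> * t))\<^sup>2 * ((F t (eb k))\<^sup>2 / mm \<gamma> k)"
            using mm(1)[OF \<gamma>, of k] by (simp add: load_def fe power_mult_distrib power_divide)
          also have "\<dots> \<le> 1 * ((F t (eb k))\<^sup>2 / (\<mu> * lam k))"
            using e m mm(1)[OF \<gamma>, of k] by (intro mult_mono divide_left_mono) auto
          finally show ?thesis by simp
        qed
        then have "(\<Sum>k<N. (load k t)\<^sup>2) \<le> (\<Sum>k<N. 1 / \<mu> * ((F t (eb k))\<^sup>2 / lam k))" for N by (intro sum_mono)
        also have "(\<Sum>k<N. 1 / \<mu> * ((F t (eb k))\<^sup>2 / lam k)) \<le> 1 / \<mu> * (KV * (Vdual_norm L (F t))\<^sup>2)" for N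
          unfolding sum_distrib_left[symmetric] using \<mu> by (intro mult_left_mono Vdual_coeffs V) auto
        finally have "sq (\<lambda>k. load k t) \<le> ennreal (1 / \<mu> * (KV * (Vdual_norm L (F t))\<^sup>2))" by (rule sq_le)
        then show ?thesis using True KV \<mu> by (simp add: abs_mult)
      next
        case False then show ?thesis by (simp add: HH0 sq_def)
      qed
    qed
  qed
  also have "\<dots> < \<infinity>"
  proof -
    have "integrable lebesgue (\<lambda>t. KV / \<mu> * (indicator {0<..<tmax} t *\<^sub>R (Vdual_norm L (F t))\<^sup>2))"
      using F by (simp add: L2_Vdual_def set_integrable_def)
    then show ?thesis unfolding integrable_iff_bounded by (rule conjunct2)
  qed
  finally show ?thesis .
qed

lemma cvK_add_AE:
  assumes m[measurable]: "\<And>k. x k \<in> borel_measurable borel" "\<And>k. z k \<in> borel_measurable borel" and f: "Nrm x < \<infinity>" "Nrm z < \<infinity>"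
  shows "AE t in lborel. cv (decay k) (\<lambda>s. x k s + z k s) t = cv (decay k) (x k) t + cv (decay k) (z k) t"
proof -
  have fx: "(\<integral>\<^sup>+s. ennreal ((x k s)\<^sup>2) \<partial>lborel) < \<infinity>" "(\<integral>\<^sup>+s. ennreal ((- z k s)\<^sup>2) \<partial>lborel) < \<infinity>"
    using le_less_trans[OF Nrm_comp[of x k, OF m(1)] f(1)] le_less_trans[OF Nrm_comp[of z k, OF m(2)] f(2)] by auto
  have "(\<integral>\<^sup>+s. ennreal \<bar>decay k s\<bar> \<partial>lborel) < \<infinity>" by (rule le_less_trans[OF decay_L1]) simp
  then have "AE t in lborel. cv (decay k) (\<lambda>s. x k s - (- z k s)) t = cv (decay k) (x k) t - cv (decay k) (\<lambda>s. - z k s) t"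
    by (intro cv_diff_AE fx) measurable
  then show ?thesis by eventually_elim (simp add: cv_def)
qed

abbreviation "sol T \<equiv> is_solution L tmax Do Di De ao ai ae vo vi ve bo be bf r T0 F T"

text \<open>The right-hand side g of c' + \<mu> lam c = g in the original, unweighted variables; it
  contains the difference between \<mu> a and the true form.\<close>

definition src :: "(nat \<Rightarrow> real \<Rightarrow> real) \<Rightarrow> nat \<Rightarrow> real \<Rightarrow> real" where
  "src y k s = sqrt (mm \<gamma> k) * exp (\<gamma> * s) * (load k s + FF (scaled y) k s)"

lemma src_eq:
  assumes U: "inV L U" "\<And>k. cf U k = y k t" and v: "inV L v" "\<And>k. cf v k = cv rb (y k) t"
  shows "src y k t = fk k t + \<mu> * lam k * y k t - A U (eb k) + S v (eb k)"
proof -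
  have m: "sqrt (mm \<gamma> k) > 0" using mm(1)[OF \<gamma>] by simp
  have e: "exp (\<gamma> * t) * exp (- \<gamma> * t) = 1" by (simp flip: exp_add)
  have "src y k t = sqrt (mm \<gamma> k) * exp (\<gamma> * t) * (exp (- \<gamma> * t) / sqrt (mm \<gamma> k) * (fk k t + (\<mu> * lam k * y k t - A U (eb k) + S v (eb k))))"
    unfolding src_def load_def FF_scaled[OF assms] by (simp add: distrib_left)
  also have "\<dots> = (exp (\<gamma> * t) * exp (- \<gamma> * t)) * (fk k t + (\<mu> * lam k * y k t - A U (eb k) + S v (eb k)))"
    using m by simp
  finally show ?thesis unfolding e by simp
qed

text \<open>The coefficient is continuous in time and has weak derivative \<open>G t (eb k)\<close>,
  hence is the primitive of it. The equation tested with \<open>eb k\<close> rewrites that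
  derivative as \<open>src\<close> minus \<mu> lam c, and the scalar equation is solved.\<close>

lemma solution_modes:
  assumes s: "sol T" and y: "coefrep tmax T y" and t: "t \<in> {0..tmax}"
  shows "cf (T t) k = exp (- (\<mu> * lam k) * t) * (c0 k + (LINT s:{0<..<t}|lebesgue. src y k s * exp (\<mu> * lam k * s)))"
proof -
  have TV: "L2_V L tmax T" and Hc: "H_cont L tmax T" and i0: "ae_eq_H L (T 0) T0" using s by (auto simp: is_solution_def in_W_def)
  obtain G where G: "L2_Vdual L tmax G" "time_deriv L ao ai ae tmax T G"
    and eq: "AE t in lebesgue. t \<in> {0<..<tmax} \<longrightarrow> (\<forall>\<Phi>. inV L \<Phi> \<longrightarrow> G t \<Phi> + A (T t) \<Phi> + C_form L bf r T \<Phi> t = F t \<Phi>)"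
    using s by (auto simp: is_solution_def)
  define c where "c t = cf (T t) k" for t
  have mode: "continuous_on {0..tmax} c" unfolding c_def by (rule cf_continuous[OF Hc])
  have Gi: "set_integrable lebesgue {0<..<tmax} (\<lambda>t. G t (eb k))"
    by (rule L2_on_integrable[OF L2_Vdual_comp[OF G(1) eb_V(1)]])
  have "weak_deriv 0 tmax c (\<lambda>t. G t (eb k))"
    using G(2) eb_V(1)[of k] unfolding time_deriv_def weak_deriv_def c_def[abs_def] cf_def by blast
  then have cG: "c t = c 0 + (LINT s:{0<..<t}|lebesgue. G s (eb k))" if "t \<in> {0..tmax}" for t
    by (intro weak_deriv_imp_primitive[OF tmax mode Gi _ that])
  have H0: "inH L (T 0)" using Hc tmax by (simp add: H_cont_def)
  have "c 0 = c0 k"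
  proof -
    have ae: "AE z in M. lift (T 0) z = lift T0 z" using i0 by (simp add: ae_eq_H_iff)
    have "ip M (lift (T 0)) (lift (eb k)) = ip M (lift T0) (lift (eb k))"
      by (rule ip_AE_cong[OF ae]) (use H0 T0 eb_H in \<open>auto intro!: sqint_measurable simp: sqint_lift\<close>)
    then show ?thesis by (simp add: c_def c0_def cf_ip H0 T0)
  qed
  have yT: "AE t in lebesgue. t \<in> {0<..<tmax} \<longrightarrow> inV L (T t) \<and> (\<forall>k. cf (T t) k = y k t)" using y by (simp add: coefrep_def)
  have Gs: "AE s in lebesgue. s \<in> {0<..<tmax} \<longrightarrow> G s (eb k) = src y k s - \<mu> * lam k * c s"
    using yT eq memory_form[OF TV y] F_coeffs
  proof eventually_elim
    fix s
    assume a: "s \<in> {0<..<tmax} \<longrightarrow> inV L (T s) \<and> (\<forall>k. cf (T s) k = y k s)"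
      "s \<in> {0<..<tmax} \<longrightarrow> (\<forall>\<Phi>. inV L \<Phi> \<longrightarrow> G s \<Phi> + A (T s) \<Phi> + C_form L bf r T \<Phi> s = F s \<Phi>)"
      "s \<in> {0<..<tmax} \<longrightarrow> (\<exists>v. inV L v \<and> (\<forall>k. cf v k = cv rb (y k) s) \<and> (\<forall>\<Phi>. inV L \<Phi> \<longrightarrow> C_form L bf r T \<Phi> s = - S v \<Phi>))"
      "s \<in> {0<..<tmax} \<longrightarrow> in_Vdual L (F s) \<and> (\<forall>k. F s (eb k) = fk k s)"
    show "s \<in> {0<..<tmax} \<longrightarrow> G s (eb k) = src y k s - \<mu> * lam k * c s"
    proof
      assume s: "s \<in> {0<..<tmax}"
      obtain v where v: "inV L v" "\<And>k. cf v k = cv rb (y k) s" "\<And>\<Phi>. inV L \<Phi> \<Longrightarrow> C_form L bf r T \<Phi> s = - S v \<Phi>"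
        using a(3) s by blast
      have U: "inV L (T s)" "\<And>k. cf (T s) k = y k s" using a(1) s by auto
      have "G s (eb k) + A (T s) (eb k) + C_form L bf r T (eb k) s = F s (eb k)" using a(2) s eb_V(1)[of k] by blast
      then show "G s (eb k) = src y k s - \<mu> * lam k * c s"
        unfolding src_eq[OF U v(1,2)] c_def U(2) using v(3)[OF eb_V(1)[of k]] a(4) s by simp
    qed
  qed
  \<comment> \<open>Integrability of the source is read off from the equation instead of being
    estimated: almost everywhere it equals the derivative plus a continuous function.\<close>
  have gsrc: "set_integrable lebesgue {0<..<tmax} (src y k)"
  proof -
    have "set_integrable lebesgue {0<..<tmax} (\<lambda>s. G s (eb k) + \<mu> * lam k * c s)"
      by (intro set_integral_add Gi continuous_set_integrable continuous_intros mode)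
    then show ?thesis
      by (rule set_integrable_AE_eq(1)) (use Gs in \<open>eventually_elim, auto\<close>)
  qed
  show ?thesis
    unfolding c_def[symmetric]
  proof (rule variation_of_constants_converse[OF gsrc t mode])
    fix t assume t: "t \<in> {0..tmax}"
    have "(LINT s:{0<..<t}|lebesgue. G s (eb k)) = (LINT s:{0<..<t}|lebesgue. src y k s - \<mu> * lam k * c s)"
    proof (rule set_integrable_AE_eq(2)[symmetric])
      show "set_integrable lebesgue {0<..<t} (\<lambda>s. G s (eb k))"
        by (rule set_integrable_subinterval[OF Gi]) (use t in auto)
      show "AE s in lebesgue. s \<in> {0<..<t} \<longrightarrow> G s (eb k) = src y k s - \<mu> * lam k * c s" using Gs by eventually_elim (use t in auto)
    qed
    then show "c t = c0 k + (LINT s:{0<..<t}|lebesgue. src y k s - \<mu> * lam k * c s)" using cG[OF t] \<open>c 0 = c0 k\<close> by simp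
  qed
qed

lemma scaled_modes:
  assumes ym[measurable]: "\<And>k. y k \<in> borel_measurable borel" and y0: "\<And>k t. t \<notin> {0<..<tmax} \<Longrightarrow> y k t = 0"
    and c: "c = exp (- (\<mu> * lam k) * t) * (c0 k + (LINT s:{0<..<t}|lebesgue. src y k s * exp (\<mu> * lam k * s)))"
  shows "sqrt (mm \<gamma> k) * exp (- \<gamma> * t) * c = sqrt (mm \<gamma> k) * exp (- mm \<gamma> k * t) * c0 k + cv (decay k) (\<lambda>s. load k s + FF (scaled y) k s) t"
proof -
  have d: "sqrt (mm \<gamma> k) * exp (- \<gamma> * t) * (exp (- (\<mu> * lam k) * t) * (LINT s:{0<..<t}|lebesgue. src y k s * exp (\<mu> * lam k * s))) = cv (decay k) (\<lambda>s. load k s + FF (scaled y) k s) t"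
    unfolding src_def using FF_zero[OF y0] by (intro Duhamel_cv) (auto simp: HH0)
  have e: "exp (- \<gamma> * t) * exp (- (\<mu> * lam k) * t) = exp (- mm \<gamma> k * t)"
    unfolding exp_add[symmetric] by (simp add: mm_def algebra_simps)
  have "sqrt (mm \<gamma> k) * exp (- \<gamma> * t) * c = sqrt (mm \<gamma> k) * (exp (- \<gamma> * t) * exp (- (\<mu> * lam k) * t)) * c0 k
    + sqrt (mm \<gamma> k) * exp (- \<gamma> * t) * (exp (- (\<mu> * lam k) * t) * (LINT s:{0<..<t}|lebesgue. src y k s * exp (\<mu> * lam k * s)))"
    unfolding c by (simp only: distrib_left mult.assoc)
  then show ?thesis unfolding d e .
qed

lemma solution_fixed_point:
  assumes s: "sol T" and y: "coefrep tmax T y"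
  shows "AE t in lborel. scaled y k t = free_part k t + TT (scaled y) k t"
proof -
  have ym[measurable]: "y k \<in> borel_measurable borel" and y0: "t \<notin> {0<..<tmax} \<Longrightarrow> y k t = 0" for k t
    using y by (auto simp: coefrep_def)
  have "AE t in lebesgue. t \<in> {0<..<tmax} \<longrightarrow> cf (T t) k = y k t"
    using y unfolding coefrep_def by (auto elim: eventually_mono)
  then have yT: "AE t in lborel. t \<in> {0<..<tmax} \<longrightarrow> cf (T t) k = y k t" by (simp add: AE_completion_iff)
  have NF: "Nrm (FF (scaled y)) < \<infinity>" by (rule le_cmult_less_top[OF Nrm_FF Nrm_scaled[OF y]]) measurable
  have "AE t in lborel. cv (decay k) (\<lambda>s. load k s + FF (scaled y) k s) t = cv (decay k) (load k) t + cv (decay k) (FF (scaled y) k) t"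
    by (rule cvK_add_AE[OF _ _ Nrm_load NF]) measurable
  with yT show ?thesis
  proof eventually_elim
    fix t assume a: "t \<in> {0<..<tmax} \<longrightarrow> cf (T t) k = y k t"
      and b: "cv (decay k) (\<lambda>s. load k s + FF (scaled y) k s) t = cv (decay k) (load k) t + cv (decay k) (FF (scaled y) k) t"
    show "scaled y k t = free_part k t + TT (scaled y) k t"
    proof (cases "t \<in> {0<..<tmax}")
      case True
      then have "t \<in> {0..tmax}" by auto
      from scaled_modes[OF ym y0 solution_modes[OF s y this, of k]] a b True
      show ?thesis by (simp add: scaled_def free_part_def TT_def)
    next
      case False then show ?thesis by (simp add: scaled_def free_part_def TT_def y0)
    qed
  qed
qed

text \<open>The coefficients of both solutions, scaled, solve the same fixed-point problem and so
  agree almost everywhere. Continuity in \<open>H\<close> extends this to every time, endpoints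
  included.\<close>

theorem uniqueness: assumes s: "sol T1" "sol T2" and t: "t \<in> {0..tmax}" shows "ae_eq_H L (T1 t) (T2 t)"
proof -
  have TV: "L2_V L tmax T1" "L2_V L tmax T2" and Hc: "H_cont L tmax T1" "H_cont L tmax T2"
    using s by (auto simp: is_solution_def in_W_def)
  obtain y1 y2 where y: "coefrep tmax T1 y1" "coefrep tmax T2 y2" using L2_V_coefrep TV by blast
  have ym[measurable]: "y1 k \<in> borel_measurable borel" "y2 k \<in> borel_measurable borel" for k
    using y by (auto simp: coefrep_def)
  have xe: "AE t in lborel. scaled y1 k t = scaled y2 k t" for k
    by (rule fixed_point_unique[OF _ _ free_part_measurable Nrm_scaled[OF y(1)] Nrm_scaled[OF y(2)] solution_fixed_point[OF s(1) y(1)] solution_fixed_point[OF s(2) y(2)]]) auto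
  have "cf (T1 t) k = cf (T2 t) k" for k
  proof -
    have "AE t in lebesgue. t \<in> {0<..<tmax} \<longrightarrow> cf (T1 t) k = y1 k t" using y(1) unfolding coefrep_def by (auto elim: eventually_mono)
    moreover have "AE t in lebesgue. t \<in> {0<..<tmax} \<longrightarrow> cf (T2 t) k = y2 k t" using y(2) unfolding coefrep_def by (auto elim: eventually_mono)
    ultimately have "AE t in lebesgue. t \<in> {0<..<tmax} \<longrightarrow> cf (T1 t) k - cf (T2 t) k = 0"
      using AE_completion[OF xe[of k]]
      by eventually_elim (use mm(1)[OF \<gamma>, of k] in \<open>auto simp: scaled_def\<close>)
    from AE_const_imp_const_on_Icc[OF tmax _ this t]
    have "cf (T1 t) k - cf (T2 t) k = 0" by (simp add: continuous_on_diff cf_continuous Hc)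
    then show ?thesis by simp
  qed
  moreover have "inH L (T1 t)" "inH L (T2 t)" using Hc t by (auto simp: H_cont_def)
  ultimately show ?thesis by (intro H_eqI) auto
qed

end

section \<open>Measurability of functionals\<close>

context heat_wells
begin

lemma Vl_tadd: assumes "inV L \<Phi>" "inV L \<Psi>"
  shows "AE z in M. Vl (tadd \<Phi> (tscale c \<Psi>)) z = Vl \<Phi> z + c *\<^sub>R Vl \<Psi> z"
proof -
  have d: "AE z in M. dz L (\<lambda>x. u x + c * v x) z = dz L u z + c * dz L v z" if "H1 L u" "H1 L v" for u v
    using H1_add_scale(2)[OF L that, of c] by (rule AE_M)
  have u: "H1 L (co \<Phi>)" "H1 L (ci \<Phi>)" "H1 L (ce \<Phi>)" "H1 L (co \<Psi>)" "H1 L (ci \<Psi>)" "H1 L (ce \<Psi>)"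
    using assms by (auto simp: inV_def)
  show ?thesis using d[OF u(1,4)] d[OF u(2,5)] d[OF u(3,6)]
    by eventually_elim (simp add: Vl_def)
qed

text \<open>The inner product belonging to the norm of V. It makes the squared norm of a finite
  combination a quadratic polynomial in the coefficients, hence continuous in them.\<close>

definition vip :: "triple \<Rightarrow> triple \<Rightarrow> real" where "vip U W = ip M (Vl U) (Vl W)"

lemma vip_commute: "vip U W = vip W U" by (simp add: vip_def ip_commute)

lemma V_norm_vip: "inV L U \<Longrightarrow> V_norm L U = sqrt (vip U U)" by (simp add: vip_def V_norm_eq)

lemma vip_Vdual: assumes W: "inV L W" shows "in_Vdual L (\<lambda>U. vip U W)"
  unfolding in_Vdual_def
proof (intro conjI allI impI exI[of _ "V_norm L W"])
  fix \<Phi> \<Psi> and c :: real assume a: "inV L \<Phi> \<and> inV L \<Psi>"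
  have t: "inV L (tadd \<Phi> (tscale c \<Psi>))" using a by (intro tadd_V(1)) auto
  have "vip (tadd \<Phi> (tscale c \<Psi>)) W = ip M (\<lambda>z. Vl \<Phi> z + c *\<^sub>R Vl \<Psi> z) (Vl W)"
    unfolding vip_def
    by (rule ip_AE_cong[OF Vl_tadd]) (use a t W in \<open>auto intro!: sqint_measurable sqint_Vl sqint_add sqint_scaleR\<close>)
  then show "vip (tadd \<Phi> (tscale c \<Psi>)) W = vip \<Phi> W + c * vip \<Psi> W"
    using a W by (simp add: vip_def ip_add_left ip_scaleR_left sqint_Vl sqint_scaleR)
next
  fix \<Phi> assume "inV L \<Phi>"
  then show "\<bar>vip \<Phi> W\<bar> \<le> V_norm L W * V_norm L \<Phi>"
    using ip_Cauchy_Schwarz[OF sqint_Vl sqint_Vl, of \<Phi> W] W by (simp add: vip_def V_norm_eq mult.commute)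
qed

lemma vip_comb: "vip (comb c n) (comb c n) = (\<Sum>j<n. c j * (\<Sum>k<n. c k * vip (eb k) (eb j)))"
proof -
  have "vip (comb c n) (comb c n) = (\<Sum>j<n. c j * vip (eb j) (comb c n))" by (rule Vdual_comb[OF vip_Vdual[OF comb_V]])
  also have "\<dots> = (\<Sum>j<n. c j * vip (comb c n) (eb j))" by (simp add: vip_commute)
  finally show ?thesis by (simp add: Vdual_comb[OF vip_Vdual[OF eb_V(1)]])
qed

lemma vip_tendsto: assumes \<Phi>: "inV L \<Phi>" shows "(\<lambda>n. vip (comb (cf \<Phi>) n) (comb (cf \<Phi>) n)) \<longlonglongrightarrow> vip \<Phi> \<Phi>"
  unfolding vip_def
proof (rule ip_self_tendsto[OF sqint_Vl[OF comb_V] sqint_Vl[OF \<Phi>]])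
  have b: "ip M (\<lambda>z. Vl (comb (cf \<Phi>) n) z - Vl \<Phi> z) (\<lambda>z. Vl (comb (cf \<Phi>) n) z - Vl \<Phi> z) \<le> KV * nD (tdiff \<Phi> (comb (cf \<Phi>) n))" for n
  proof -
    let ?W = "tdiff \<Phi> (comb (cf \<Phi>) n)"
    have W: "inV L ?W" by (intro tadd_V(1) \<Phi> comb_V)
    have "AE z in M. Vl ?W z = Vl \<Phi> z - Vl (comb (cf \<Phi>) n) z" using Vl_tadd[OF \<Phi> comb_V, of "- 1" "cf \<Phi>" n] by simp
    then have "vip ?W ?W = ip M (\<lambda>z. Vl \<Phi> z - Vl (comb (cf \<Phi>) n) z) (\<lambda>z. Vl \<Phi> z - Vl (comb (cf \<Phi>) n) z)"
      unfolding vip_def by (intro ip_AE_cong) (auto intro!: sqint_measurable sqint_Vl sqint_diff W \<Phi> comb_V)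
    moreover have "vip ?W ?W \<le> KV * nD ?W" unfolding vip_def by (rule Vl_bound[OF W])
    ultimately show ?thesis by (simp add: ip_self norm_minus_commute)
  qed
  have "(\<lambda>n. KV * nD (tdiff \<Phi> (comb (cf \<Phi>) n))) \<longlonglongrightarrow> KV * 0" by (intro tendsto_intros nD_tail_tendsto[OF \<Phi>])
  then have lim: "(\<lambda>n. KV * nD (tdiff \<Phi> (comb (cf \<Phi>) n))) \<longlonglongrightarrow> 0" by simp
  show "(\<lambda>n. ip M (\<lambda>z. Vl (comb (cf \<Phi>) n) z - Vl \<Phi> z) (\<lambda>z. Vl (comb (cf \<Phi>) n) z - Vl \<Phi> z)) \<longlonglongrightarrow> 0"
    by (rule Lim_null_comparison[OF _ lim]) (use b in simp)
qed

text \<open>A countable family dense in V: lists of rationals are finite coefficient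
  vectors.\<close>

definition qc :: "rat list \<Rightarrow> triple" where "qc qs = comb (\<lambda>k. of_rat (qs ! k)) (length qs)"

lemma qc_V: "inV L (qc qs)" unfolding qc_def by (rule comb_V)

text \<open>Two approximations: rational coefficients converge to real ones for a fixed length, and
  finite combinations converge to \<Phi>. Functional and norm are continuous along both.\<close>

lemma qc_dense_bound:
  assumes f: "in_Vdual L f" and b: "\<And>qs. \<bar>f (qc qs)\<bar> \<le> C * V_norm L (qc qs)" and \<Phi>: "inV L \<Phi>"
  shows "\<bar>f \<Phi>\<bar> \<le> C * V_norm L \<Phi>"
proof -
  have comb: "\<bar>f (comb c n)\<bar> \<le> C * V_norm L (comb c n)" for c n
  proof -
    have "\<exists>r. \<bar>of_rat r - c k\<bar> \<le> 1 / real (Suc m)" for k m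
    proof -
      have "c k < c k + 1 / real (Suc m)" by simp
      then obtain r where "c k < of_rat r" "of_rat r < c k + 1 / real (Suc m)" using of_rat_dense by blast
      then show ?thesis by (intro exI[of _ r]) simp
    qed
    note ex = this
    define q where "q m k = (SOME r. \<bar>of_rat r - c k\<bar> \<le> 1 / real (Suc m))" for m k
    have q: "\<bar>of_rat (q m k) - c k\<bar> \<le> 1 / real (Suc m)" for m k unfolding q_def by (rule someI_ex[OF ex])
    have lim: "(\<lambda>m. real_of_rat (q m k)) \<longlonglongrightarrow> c k" for k
    proof -
      have "(\<lambda>m. real_of_rat (q m k) - c k) \<longlonglongrightarrow> 0"
        by (rule Lim_null_comparison[OF _ LIMSEQ_inverse_real_of_nat]) (use q in \<open>simp add: inverse_eq_divide\<close>)
      then show ?thesis by (rule LIM_zero_cancel)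
    qed
    define p where "p m = map (q m) [0..<n]" for m
    have F: "f (qc (p m)) = (\<Sum>k<n. of_rat (q m k) * f (eb k))" for m
      unfolding qc_def Vdual_comb[OF f] by (simp add: p_def)
    have N: "V_norm L (qc (p m)) = sqrt (\<Sum>j<n. of_rat (q m j) * (\<Sum>k<n. of_rat (q m k) * vip (eb k) (eb j)))" for m
      unfolding V_norm_vip[OF qc_V] unfolding qc_def vip_comb by (simp add: p_def)
    have "(\<lambda>m. \<bar>f (qc (p m))\<bar>) \<longlonglongrightarrow> \<bar>f (comb c n)\<bar>"
      unfolding F Vdual_comb[OF f] by (intro tendsto_intros lim)
    moreover have "(\<lambda>m. C * V_norm L (qc (p m))) \<longlonglongrightarrow> C * V_norm L (comb c n)"
      unfolding N V_norm_vip[OF comb_V] vip_comb by (intro tendsto_intros lim)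
    ultimately show ?thesis by (rule LIMSEQ_le) (use b in simp)
  qed
  have "(\<lambda>n. \<bar>f (comb (cf \<Phi>) n)\<bar>) \<longlonglongrightarrow> \<bar>f \<Phi>\<bar>"
    unfolding Vdual_comb[OF f] by (intro tendsto_rabs Vdual_expand f \<Phi>)
  moreover have "(\<lambda>n. C * V_norm L (comb (cf \<Phi>) n)) \<longlonglongrightarrow> C * V_norm L \<Phi>"
    unfolding V_norm_vip[OF comb_V] V_norm_vip[OF \<Phi>] by (intro tendsto_intros vip_tendsto[OF \<Phi>])
  ultimately show ?thesis by (rule LIMSEQ_le) (use comb in simp)
qed

text \<open>A supremum over a countable family is measurable in time. Elements of norm 0 contribute
  0 / 0 = 0, harmless because a bounded functional vanishes on them.\<close>

lemma Vdual_norm_SUP: assumes f: "in_Vdual L f"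
  shows "Vdual_norm L f = enn2real (SUP qs. ennreal (\<bar>f (qc qs)\<bar> / V_norm L (qc qs)))"
proof -
  define N where "N = (SUP qs. ennreal (\<bar>f (qc qs)\<bar> / V_norm L (qc qs)))"
  have le: "N \<le> ennreal (Vdual_norm L f)"
    unfolding N_def
  proof (intro SUP_least ennreal_leI)
    fix qs
    show "\<bar>f (qc qs)\<bar> / V_norm L (qc qs) \<le> Vdual_norm L f"
      using Vdual_norm_ge[OF f qc_V[of qs]] V_norm_nonneg[OF qc_V[of qs]] Vdual_norm_nonneg[OF f]
      by (cases "V_norm L (qc qs) = 0") (auto simp: divide_le_eq)
  qed
  have fin: "ennreal (enn2real N) = N" using le by (simp add: le_less_trans)
  have "Vdual_norm L f \<le> enn2real N"
  proof (rule Vdual_norm_le[OF qc_dense_bound[OF f]])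
    fix qs
    have "ennreal (\<bar>f (qc qs)\<bar> / V_norm L (qc qs)) \<le> N" unfolding N_def by (rule SUP_upper) simp
    then have "ennreal (\<bar>f (qc qs)\<bar> / V_norm L (qc qs)) \<le> ennreal (enn2real N)" by (simp only: fin)
    then have "\<bar>f (qc qs)\<bar> / V_norm L (qc qs) \<le> enn2real N" by (subst (asm) ennreal_le_iff) auto
    then show "\<bar>f (qc qs)\<bar> \<le> enn2real N * V_norm L (qc qs)"
      using Vdual_norm_ge[OF f qc_V[of qs]] V_norm_nonneg[OF qc_V[of qs]]
      by (cases "V_norm L (qc qs) = 0") (auto simp: divide_le_eq)
  qed auto
  moreover have "enn2real N \<le> Vdual_norm L f" using enn2real_mono[OF le] Vdual_norm_nonneg[OF f] by simp
  ultimately show ?thesis by (simp add: N_def)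
qed

lemma Vdual_norm_measurable:
  fixes \<tau> :: real
  assumes V: "AE t in lebesgue. t \<in> {0<..<\<tau>} \<longrightarrow> in_Vdual L (G t)"
    and m: "\<And>k. set_borel_measurable lebesgue {0<..<\<tau>} (\<lambda>t. G t (eb k))"
  shows "set_borel_measurable lebesgue {0<..<\<tau>} (\<lambda>t. Vdual_norm L (G t))"
proof -
  define a where "a k t = indicator {0<..<\<tau>} t *\<^sub>R G t (eb k)" for k t
  have am[measurable]: "a k \<in> borel_measurable lebesgue" for k using m[of k] by (simp add: set_borel_measurable_def a_def[abs_def])
  define h where "h t = enn2real (SUP qs. ennreal (\<bar>\<Sum>k<length qs. of_rat (qs ! k) * a k t\<bar> / V_norm L (qc qs)))" for t
  have hm: "h \<in> borel_measurable lebesgue" unfolding h_def[abs_def] by measurable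
  have "AE t in lebesgue. h t = indicator {0<..<\<tau>} t *\<^sub>R Vdual_norm L (G t)"
    using V
  proof eventually_elim
    fix t assume V: "t \<in> {0<..<\<tau>} \<longrightarrow> in_Vdual L (G t)"
    show "h t = indicator {0<..<\<tau>} t *\<^sub>R Vdual_norm L (G t)"
    proof (cases "t \<in> {0<..<\<tau>}")
      case True
      then have "in_Vdual L (G t)" using V by simp
      then show ?thesis using True by (simp add: Vdual_norm_SUP h_def a_def qc_def Vdual_comb)
    next
      case False then show ?thesis by (simp add: h_def a_def)
    qed
  qed
  from borel_measurable_AE[OF hm this] show ?thesis by (simp add: set_borel_measurable_def)
qed

text \<open>The functional is the limit of finite sums of measurable coefficients times
  constants.\<close>

lemma functional_measurable:
  fixes \<tau> :: real
  assumes zm[measurable]: "\<And>k. z k \<in> borel_measurable borel" and z0: "\<And>k t. t \<notin> {0<..<\<tau>} \<Longrightarrow> z k t = 0"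
    and W: "AE t in lebesgue. t \<in> {0<..<\<tau>} \<longrightarrow> inV L (W t) \<and> (\<forall>k. cf (W t) k = z k t)" and f: "in_Vdual L f"
  shows "set_borel_measurable lebesgue {0<..<\<tau>} (\<lambda>t. f (W t))"
proof -
  define l where "l t = lim (\<lambda>n. \<Sum>k<n. z k t * f (eb k))" for t
  have "l \<in> borel_measurable borel" unfolding l_def[abs_def] by measurable
  then have lm: "l \<in> borel_measurable lebesgue" by (intro measurable_completion) simp
  have "AE t in lebesgue. l t = indicator {0<..<\<tau>} t *\<^sub>R f (W t)"
    using W
  proof eventually_elim
    fix t assume a: "t \<in> {0<..<\<tau>} \<longrightarrow> inV L (W t) \<and> (\<forall>k. cf (W t) k = z k t)"
    show "l t = indicator {0<..<\<tau>} t *\<^sub>R f (W t)"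
    proof (cases "t \<in> {0<..<\<tau>}")
      case True
      then have "inV L (W t)" "\<And>k. z k t = cf (W t) k" using a by auto
      then have "l t = f (W t)" unfolding l_def using limI[OF Vdual_expand[OF f]] by simp
      then show ?thesis using True by simp
    next
      case False then show ?thesis by (simp add: l_def z0)
    qed
  qed
  from borel_measurable_AE[OF lm this] show ?thesis by (simp add: set_borel_measurable_def)
qed

text \<open>Integrating functionals over time, with an integrable bound on their norms, gives a
  functional. An identity between two such integrals then needs to be checked on the basis
  only.\<close>

lemma integral_Vdual:
  fixes \<tau> :: real and G :: "real \<Rightarrow> triple \<Rightarrow> real" and b h :: "real \<Rightarrow> real"
  assumes G: "AE t in lebesgue. t \<in> {0<..<\<tau>} \<longrightarrow> in_Vdual L (G t) \<and> (\<forall>\<Phi>. inV L \<Phi> \<longrightarrow> \<bar>G t \<Phi>\<bar> \<le> b t * V_norm L \<Phi>)"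
    and m: "\<And>\<Phi>. inV L \<Phi> \<Longrightarrow> set_borel_measurable lebesgue {0<..<\<tau>} (\<lambda>t. G t \<Phi>)"
    and b: "set_integrable lebesgue {0<..<\<tau>} b" and h: "continuous_on UNIV h"
  shows "in_Vdual L (\<lambda>\<Phi>. LINT t:{0<..<\<tau>}|lebesgue. G t \<Phi> * h t)"
proof -
  have i: "set_integrable lebesgue {0<..<\<tau>} (\<lambda>t. G t \<Phi> * h t)" if \<Phi>: "inV L \<Phi>" for \<Phi>
  proof (rule test_integrable[OF _ h], rule set_integrable_bound)
    show "set_integrable lebesgue {0<..<\<tau>} (\<lambda>t. b t * V_norm L \<Phi>)" using b by simp
    show "set_borel_measurable lebesgue {0<..<\<tau>} (\<lambda>t. G t \<Phi>)" by (rule m[OF \<Phi>])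
    show "AE t in lebesgue. t \<in> {0<..<\<tau>} \<longrightarrow> norm (G t \<Phi>) \<le> norm (b t * V_norm L \<Phi>)"
      using G
    proof eventually_elim
      fix t assume a: "t \<in> {0<..<\<tau>} \<longrightarrow> in_Vdual L (G t) \<and> (\<forall>\<Phi>. inV L \<Phi> \<longrightarrow> \<bar>G t \<Phi>\<bar> \<le> b t * V_norm L \<Phi>)"
      show "t \<in> {0<..<\<tau>} \<longrightarrow> norm (G t \<Phi>) \<le> norm (b t * V_norm L \<Phi>)"
      proof
        assume "t \<in> {0<..<\<tau>}"
        then have "\<bar>G t \<Phi>\<bar> \<le> b t * V_norm L \<Phi>" using a \<Phi> by blast
        then show "norm (G t \<Phi>) \<le> norm (b t * V_norm L \<Phi>)" by simp
      qed
    qed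
  qed
  have bh: "set_integrable lebesgue {0<..<\<tau>} (\<lambda>t. b t * \<bar>h t\<bar>)"
    by (rule test_integrable[OF b]) (intro continuous_intros h)
  show ?thesis
    unfolding in_Vdual_def
  proof (intro conjI allI impI exI[of _ "LINT t:{0<..<\<tau>}|lebesgue. b t * \<bar>h t\<bar>"])
    fix \<Phi> \<Psi> and c :: real assume a: "inV L \<Phi> \<and> inV L \<Psi>"
    have t: "inV L (tadd \<Phi> (tscale c \<Psi>))" using a by (intro tadd_V(1)) auto
    have "(LINT t:{0<..<\<tau>}|lebesgue. G t \<Phi> * h t + c * (G t \<Psi> * h t)) = (LINT t:{0<..<\<tau>}|lebesgue. G t (tadd \<Phi> (tscale c \<Psi>)) * h t)"
    proof (rule set_integrable_AE_eq(2)[OF i[OF t]])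
      show "AE t in lebesgue. t \<in> {0<..<\<tau>} \<longrightarrow> G t (tadd \<Phi> (tscale c \<Psi>)) * h t = G t \<Phi> * h t + c * (G t \<Psi> * h t)"
        using G by eventually_elim (use a in \<open>simp add: Vdual_lin algebra_simps\<close>)
    qed
    then show "(LINT t:{0<..<\<tau>}|lebesgue. G t (tadd \<Phi> (tscale c \<Psi>)) * h t) = (LINT t:{0<..<\<tau>}|lebesgue. G t \<Phi> * h t) + c * (LINT t:{0<..<\<tau>}|lebesgue. G t \<Psi> * h t)"
      using LINT_set_add_scale[OF i i] a by simp
  next
    fix \<Phi> assume \<Phi>: "inV L \<Phi>"
    have "\<bar>LINT t:{0<..<\<tau>}|lebesgue. G t \<Phi> * h t\<bar> \<le> (LINT t:{0<..<\<tau>}|lebesgue. norm (G t \<Phi> * h t))"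
      using set_integral_norm_bound[OF i[OF \<Phi>]] by simp
    also have "\<dots> \<le> (LINT t:{0<..<\<tau>}|lebesgue. b t * \<bar>h t\<bar> * V_norm L \<Phi>)"
    proof (rule set_integral_mono_AE)
      show "set_integrable lebesgue {0<..<\<tau>} (\<lambda>t. norm (G t \<Phi> * h t))" using set_integrable_norm[OF i[OF \<Phi>]] .
      show "set_integrable lebesgue {0<..<\<tau>} (\<lambda>t. b t * \<bar>h t\<bar> * V_norm L \<Phi>)" using bh by simp
      show "AE t \<in> {0<..<\<tau>} in lebesgue. norm (G t \<Phi> * h t) \<le> b t * \<bar>h t\<bar> * V_norm L \<Phi>"
        using G
      proof eventually_elim
        fix t assume a: "t \<in> {0<..<\<tau>} \<longrightarrow> in_Vdual L (G t) \<and> (\<forall>\<Phi>. inV L \<Phi> \<longrightarrow> \<bar>G t \<Phi>\<bar> \<le> b t * V_norm L \<Phi>)"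
        show "t \<in> {0<..<\<tau>} \<longrightarrow> norm (G t \<Phi> * h t) \<le> b t * \<bar>h t\<bar> * V_norm L \<Phi>"
        proof
          assume "t \<in> {0<..<\<tau>}"
          then have "\<bar>G t \<Phi>\<bar> \<le> b t * V_norm L \<Phi>" using a \<Phi> by blast
          then have "\<bar>G t \<Phi>\<bar> * \<bar>h t\<bar> \<le> b t * V_norm L \<Phi> * \<bar>h t\<bar>" by (rule mult_right_mono) simp
          then show "norm (G t \<Phi> * h t) \<le> b t * \<bar>h t\<bar> * V_norm L \<Phi>" by (simp add: abs_mult mult_ac)
        qed
      qed
    qed
    also have "\<dots> = (LINT t:{0<..<\<tau>}|lebesgue. b t * \<bar>h t\<bar>) * V_norm L \<Phi>" by simp
    finally show "\<bar>LINT t:{0<..<\<tau>}|lebesgue. G t \<Phi> * h t\<bar> \<le> (LINT t:{0<..<\<tau>}|lebesgue. b t * \<bar>h t\<bar>) * V_norm L \<Phi>" .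
  qed
qed

lemma H_inner_Vdual: assumes W: "inH L W"
  shows "in_Vdual L (H_inner L ao ai ae W)" "inV L \<Phi> \<Longrightarrow> \<bar>H_inner L ao ai ae W \<Phi>\<bar> \<le> sqrt (nH W) * (K1 * sqrt KD) * V_norm L \<Phi>"
proof -
  have b: "\<bar>H_inner L ao ai ae W \<Phi>\<bar> \<le> sqrt (nH W) * (K1 * sqrt (nD \<Phi>))" if \<Phi>: "inV L \<Phi>" for \<Phi>
  proof -
    have "\<bar>H_inner L ao ai ae W \<Phi>\<bar> \<le> sqrt (nH W) * sqrt (nH \<Phi>)"
      unfolding H_inner_ip[OF W inV_inH[OF \<Phi>]] nH_def by (intro ip_Cauchy_Schwarz) (simp_all add: sqint_lift W inV_inH \<Phi>)
    also have "\<dots> \<le> sqrt (nH W) * (K1 * sqrt (nD \<Phi>))" by (intro mult_left_mono sqrt_nH \<Phi>) simp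
    finally show ?thesis .
  qed
  show "\<bar>H_inner L ao ai ae W \<Phi>\<bar> \<le> sqrt (nH W) * (K1 * sqrt KD) * V_norm L \<Phi>" if \<Phi>: "inV L \<Phi>" for \<Phi>
  proof -
    have "sqrt (nH W) * (K1 * sqrt (nD \<Phi>)) \<le> sqrt (nH W) * (K1 * (sqrt KD * V_norm L \<Phi>))"
      using sqrt_nH(2) by (intro mult_left_mono sqrt_nD_le \<Phi>) auto
    then show ?thesis using b[OF \<Phi>] by (simp add: mult_ac)
  qed
  show "in_Vdual L (H_inner L ao ai ae W)"
  proof (rule in_VdualI[of _ "sqrt (nH W) * K1"])
    fix \<Phi> \<Psi> c assume a: "inV L \<Phi>" "inV L \<Psi>"
    note h = inV_inH[OF a(1)] inV_inH[OF a(2)]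
    show "H_inner L ao ai ae W (tadd \<Phi> (tscale c \<Psi>)) = H_inner L ao ai ae W \<Phi> + c * H_inner L ao ai ae W \<Psi>"
      unfolding H_inner_ip[OF W tadd_H[OF h]] H_inner_ip[OF W h(1)] H_inner_ip[OF W h(2)] lift_tadd[abs_def]
      using W h by (simp add: ip_add_right ip_scaleR_right sqint_lift sqint_scaleR)
  qed (use b sqrt_nH(2) in \<open>auto simp: mult.assoc\<close>)
qed

lemma H_inner_commute: "H_inner L ao ai ae U W = H_inner L ao ai ae W U"
  by (simp add: H_inner_def mult.commute)

end

section \<open>From the fixed point to a solution\<close>

text \<open>Unlike Young's inequality this bounds the convolution at each single time, at the cost
  of a square-integrable kernel.\<close>

lemma cv_Cauchy_Schwarz:
  assumes [measurable]: "r \<in> borel_measurable borel" "x \<in> borel_measurable borel"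
  shows "ennreal ((cv r x t)\<^sup>2) \<le> (\<integral>\<^sup>+s. ennreal ((r s)\<^sup>2) \<partial>lborel) * (\<integral>\<^sup>+s. ennreal ((x s)\<^sup>2) \<partial>lborel)"
proof -
  have "ennreal \<bar>cv r x t\<bar> \<le> (\<integral>\<^sup>+s. ennreal \<bar>r (t - s) * x s\<bar> \<partial>lborel)" by (rule cv_abs_le)
  also have "\<dots> = (\<integral>\<^sup>+s. ennreal \<bar>r (t - s)\<bar> * ennreal \<bar>x s\<bar> \<partial>lborel)"
    by (intro nn_integral_cong) (simp add: abs_mult flip: ennreal_mult)
  finally have "(ennreal \<bar>cv r x t\<bar>)\<^sup>2 \<le> (\<integral>\<^sup>+s. ennreal \<bar>r (t - s)\<bar> * ennreal \<bar>x s\<bar> \<partial>lborel)\<^sup>2"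
    by (rule power_mono) simp
  also have "\<dots> \<le> (\<integral>\<^sup>+s. (ennreal \<bar>r (t - s)\<bar>)\<^sup>2 \<partial>lborel) * (\<integral>\<^sup>+s. (ennreal \<bar>x s\<bar>)\<^sup>2 \<partial>lborel)"
    by (rule Cauchy_Schwarz_nn_integral) measurable
  also have "(\<integral>\<^sup>+s. (ennreal \<bar>r (t - s)\<bar>)\<^sup>2 \<partial>lborel) = (\<integral>\<^sup>+s. ennreal ((r s)\<^sup>2) \<partial>lborel)"
    by (simp add: ennreal_power nn_shift[of "\<lambda>s. ennreal ((r s)\<^sup>2)"])
  also have "(\<integral>\<^sup>+s. (ennreal \<bar>x s\<bar>)\<^sup>2 \<partial>lborel) = (\<integral>\<^sup>+s. ennreal ((x s)\<^sup>2) \<partial>lborel)"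
    by (simp add: ennreal_power)
  finally show ?thesis by (simp add: ennreal_power)
qed

context heat_problem
begin

text \<open>The square of sqrt m exp(-m t) integrates to 1/2 over the positive half-line whatever m
  is, so initial data in \<open>H\<close> need no further regularity.\<close>

lemma Nrm_free_part: "Nrm free_part < \<infinity>"
proof -
  define a where "a k t = (if 0 < t then sqrt (mm \<gamma> k) * exp (- mm \<gamma> k * t) * c0 k else 0)" for k t
  have am[measurable]: "a k \<in> borel_measurable borel" for k unfolding a_def[abs_def] by measurable
  have m: "mm \<gamma> k > 0" for k using mm(1)[OF \<gamma>] .
  have "(\<integral>\<^sup>+t. ennreal ((a k t)\<^sup>2) \<partial>lborel) = ennreal ((c0 k)\<^sup>2 / 2)" for k
  proof -
    have e: "(sqrt (mm \<gamma> k) * exp (- mm \<gamma> k * t) * c0 k)\<^sup>2 = mm \<gamma> k * (c0 k)\<^sup>2 * exp (- (2 * mm \<gamma> k) * t)" for t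
    proof -
      have "(exp (- mm \<gamma> k * t))\<^sup>2 = exp (- (2 * mm \<gamma> k) * t)" unfolding power2_eq_square exp_add[symmetric] by (simp add: algebra_simps)
      then have "(sqrt (mm \<gamma> k) * exp (- mm \<gamma> k * t) * c0 k)\<^sup>2 = (sqrt (mm \<gamma> k))\<^sup>2 * exp (- (2 * mm \<gamma> k) * t) * (c0 k)\<^sup>2" by (simp only: power_mult_distrib)
      then show ?thesis using m[of k] by simp
    qed
    have "(\<integral>\<^sup>+t. ennreal ((a k t)\<^sup>2) \<partial>lborel) = (\<integral>\<^sup>+t. ennreal (if 0 < t then mm \<gamma> k * (c0 k)\<^sup>2 * exp (- (2 * mm \<gamma> k) * t) else 0) \<partial>lborel)"
      by (intro nn_integral_cong, rename_tac t, case_tac "0 < t") (simp_all only: a_def e if_True if_False power_zero_numeral)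
    also have "\<dots> = ennreal (mm \<gamma> k * (c0 k)\<^sup>2 / (2 * mm \<gamma> k))" by (rule nn_exp) (use m[of k] in auto)
    finally show ?thesis using m[of k] by simp
  qed
  then have "Nrm a = (\<Sum>k. ennreal ((c0 k)\<^sup>2 / 2))" by (simp add: Nrm_eq)
  also have "\<dots> = ennreal (\<Sum>k. (c0 k)\<^sup>2 / 2)"
    using sums_summable[OF cf_sums[OF T0]] by (intro suminf_ennreal2) (auto simp: c0_def intro: summable_divide)
  finally have A: "Nrm a < \<infinity>" by simp
  have B: "Nrm (\<lambda>k. cv (decay k) (load k)) < \<infinity>" by (rule le_less_trans[OF Nrm_cvK Nrm_load]) measurable
  have "Nrm free_part \<le> Nrm (\<lambda>k t. a k t + cv (decay k) (load k) t)"
    by (intro Nrm_mono_AE AE_I2) (auto simp: free_part_def a_def indicator_def)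
  also have "\<dots> \<le> ennreal (1 + 1) * Nrm a + ennreal (1 + 1 / 1) * Nrm (\<lambda>k. cv (decay k) (load k))"
    by (rule Nrm_add_le) (simp_all del: cv_measurable)
  also have "\<dots> < \<infinity>" using A B by (simp add: ennreal_mult_less_top del: ennreal_plus)
  finally show ?thesis .
qed

lemma exists_fixed_point:
  "\<exists>y. (\<forall>k. y k \<in> borel_measurable borel) \<and> (\<forall>k t. t \<notin> {0<..<tmax} \<longrightarrow> y k t = 0) \<and> Nrm (scaled y) < \<infinity> \<and>
    (\<forall>k t. scaled y k t = free_part k t + TT (scaled y) k t)"
proof -
  obtain x where x: "\<And>k. x k \<in> borel_measurable borel" "Nrm x < \<infinity>" "\<And>k t. x k t = free_part k t + TT x k t"
    using fixed_point_exists[OF free_part_measurable Nrm_free_part] by blast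
  define y where "y k t = exp (\<gamma> * t) / sqrt (mm \<gamma> k) * x k t" for k t
  have e: "scaled y = x"
  proof (intro ext)
    fix k t
    have "sqrt (mm \<gamma> k) > 0" using mm(1)[OF \<gamma>, of k] by simp
    moreover have "exp (- \<gamma> * t) * exp (\<gamma> * t) = 1" by (simp flip: exp_add)
    moreover have "scaled y k t = (exp (- \<gamma> * t) * exp (\<gamma> * t)) * (sqrt (mm \<gamma> k) / sqrt (mm \<gamma> k)) * x k t"
      unfolding scaled_def y_def by (simp only: times_divide_eq_left times_divide_eq_right mult_ac)
    ultimately show "scaled y k t = x k t" by simp
  qed
  have "y k t = 0" if "t \<notin> {0<..<tmax}" for k t
    using x(3)[of k t] that by (simp add: y_def free_part_def TT_def)
  moreover have "y k \<in> borel_measurable borel" for k unfolding y_def[abs_def] using x(1) by measurable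
  ultimately show ?thesis using x unfolding e[symmetric] by blast
qed

end

section \<open>Continuous modes and the function built from them\<close>

locale heat_fixed_point = heat_problem +
  fixes y :: "nat \<Rightarrow> real \<Rightarrow> real"
  assumes ym[measurable]: "\<And>k. y k \<in> borel_measurable borel" and y0: "\<And>k t. t \<notin> {0<..<tmax} \<Longrightarrow> y k t = 0"
    and yN: "Nrm (scaled y) < \<infinity>" and yfp: "\<And>k t. scaled y k t = free_part k t + TT (scaled y) k t"
begin

definition rhs :: "nat \<Rightarrow> real \<Rightarrow> real" where "rhs k s = load k s + FF (scaled y) k s"

lemma rhs_measurable[measurable]: "rhs k \<in> borel_measurable borel" unfolding rhs_def[abs_def] by measurable

lemma Nrm_F: "Nrm (FF (scaled y)) < \<infinity>" by (rule le_cmult_less_top[OF Nrm_FF yN]) measurable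

lemma Nrm_rhs: "Nrm rhs < \<infinity>"
proof -
  have "Nrm rhs = Nrm (\<lambda>k t. load k t + FF (scaled y) k t)" by (simp add: rhs_def[abs_def])
  also have "\<dots> \<le> ennreal (1 + 1) * Nrm load + ennreal (1 + 1 / 1) * Nrm (FF (scaled y))"
    by (intro Nrm_add_le load_measurable FF_measurable scaled_measurable ym) simp
  also have "\<dots> < \<infinity>" using Nrm_load Nrm_F by (simp add: ennreal_mult_less_top del: ennreal_plus)
  finally show ?thesis .
qed

definition Nk :: "nat \<Rightarrow> real" where "Nk k = enn2real (\<integral>\<^sup>+s. ennreal ((rhs k s)\<^sup>2) \<partial>lborel)"

lemma Nk_eq: "(\<integral>\<^sup>+s. ennreal ((rhs k s)\<^sup>2) \<partial>lborel) = ennreal (Nk k)"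
  using le_less_trans[OF Nrm_comp[of rhs k, OF rhs_measurable] Nrm_rhs] by (simp add: Nk_def)

lemma Nk_nonneg: "0 \<le> Nk k" by (simp add: Nk_def)

lemma Nk_summable: "summable Nk"
proof -
  have "(\<Sum>k. ennreal (Nk k)) \<noteq> \<infinity>" using Nrm_rhs by (simp add: Nrm_eq Nk_eq)
  then show ?thesis using Nk_nonneg by (intro summable_suminf_not_top) auto
qed

lemma src_rhs: "src y k s = rhs k s * (sqrt (mm \<gamma> k) * exp (\<gamma> * s))"
  by (simp add: src_def rhs_def mult_ac)

lemma rhs_integrable: "set_integrable lebesgue {0<..<tmax} (rhs k)"
proof (rule L2_on_integrable)
  have "integrable lborel (\<lambda>s. (rhs k s)\<^sup>2)"
    by (rule integrableI_bounded) (simp_all add: Nk_eq)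
  then have "integrable lebesgue (\<lambda>s. (rhs k s)\<^sup>2)" by (subst integrable_completion) auto
  then have "set_integrable lebesgue {0<..<tmax} (\<lambda>s. (rhs k s)\<^sup>2)"
    unfolding set_integrable_def by (intro integrable_mult_indicator) auto
  moreover have "set_borel_measurable lebesgue {0<..<tmax} (rhs k)"
    unfolding set_borel_measurable_def by (intro measurable_completion) measurable
  ultimately show "L2_on 0 tmax (rhs k)" by (simp add: L2_on_def)
qed

lemma src_integrable: "set_integrable lebesgue {0<..<tmax} (src y k)"
  unfolding src_rhs[abs_def] by (rule test_integrable[OF rhs_integrable]) (intro continuous_intros)

text \<open>The continuous version of \<open>y k\<close>. The fixed point settles values only for
  almost every time and is 0 at both ends, whereas Duhamel's formula is meaningful on the closed
  interval and has the right initial value.\<close>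

definition mode :: "nat \<Rightarrow> real \<Rightarrow> real" where
  "mode k t = exp (- (\<mu> * lam k) * t) * (c0 k + (LINT s:{0<..<t}|lebesgue. src y k s * exp (\<mu> * lam k * s)))"

lemma mode_continuous: "continuous_on {0..tmax} (mode k)"
  unfolding mode_def[abs_def]
  by (intro continuous_intros primitive_continuous test_integrable src_integrable)

lemma mode_0: "mode k 0 = c0 k" by (simp add: mode_def set_lebesgue_integral_def)

lemma mode_scaled: "sqrt (mm \<gamma> k) * exp (- \<gamma> * t) * mode k t = sqrt (mm \<gamma> k) * exp (- mm \<gamma> k * t) * c0 k + cv (decay k) (rhs k) t"
  using scaled_modes[OF ym y0 mode_def] unfolding rhs_def[abs_def] .

text \<open>A majorant independent of time: the two terms come from the initial value and the
  source, and the exponential undoes the damping on the whole interval.\<close>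

definition Bk :: "nat \<Rightarrow> real" where "Bk k = exp (2 * \<gamma> * tmax) * (2 * (c0 k)\<^sup>2 + Nk k)"

lemma Bk_summable: "summable Bk"
  unfolding Bk_def[abs_def] using sums_summable[OF cf_sums[OF T0]] Nk_summable
  by (intro summable_mult summable_add) (auto simp: c0_def)

text \<open>Cauchy-Schwarz bounds the squared convolution by mm / 2 times \<open>Nk\<close>, while
  the scaled mode carries a factor mm on the left. The factor cancels and leaves a bound summable in
  k.\<close>

lemma mode_bound: assumes t: "t \<in> {0..tmax}" shows "(mode k t)\<^sup>2 \<le> Bk k"
proof -
  have m: "mm \<gamma> k > 0" using mm(1)[OF \<gamma>] .
  define v where "v = cv (decay k) (rhs k) t"
  have "ennreal (v\<^sup>2) \<le> ennreal (mm \<gamma> k / 2) * ennreal (Nk k)"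
    unfolding v_def using cv_Cauchy_Schwarz[of "decay k" "rhs k" t] by (simp add: decay_L2 Nk_eq)
  also have "\<dots> = ennreal (mm \<gamma> k / 2 * Nk k)" using m Nk_nonneg[of k] by (subst ennreal_mult[symmetric]) auto
  finally have v: "v\<^sup>2 \<le> mm \<gamma> k / 2 * Nk k" using m Nk_nonneg[of k] by (subst (asm) ennreal_le_iff) auto
  define E where "E = exp (- mm \<gamma> k * t)"
  have E: "0 \<le> E" "E \<le> 1" using m t by (auto simp: E_def)
  have "(sqrt (mm \<gamma> k) * (exp (- \<gamma> * t) * mode k t))\<^sup>2 = (sqrt (mm \<gamma> k) * (E * c0 k) + v)\<^sup>2"
    using mode_scaled[of k t] by (simp add: E_def v_def mult.assoc)
  also have "\<dots> \<le> 2 * (sqrt (mm \<gamma> k) * (E * c0 k))\<^sup>2 + 2 * v\<^sup>2"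
    using young_square[of 1 "sqrt (mm \<gamma> k) * (E * c0 k)" v] by simp
  also have "\<dots> \<le> 2 * (mm \<gamma> k * (c0 k)\<^sup>2) + mm \<gamma> k * Nk k"
  proof -
    have "E\<^sup>2 * (c0 k)\<^sup>2 \<le> 1 * (c0 k)\<^sup>2" using E by (intro mult_right_mono power_le_one) auto
    then have "mm \<gamma> k * (E\<^sup>2 * (c0 k)\<^sup>2) \<le> mm \<gamma> k * (c0 k)\<^sup>2" using m by simp
    moreover have "(sqrt (mm \<gamma> k) * (E * c0 k))\<^sup>2 = mm \<gamma> k * (E\<^sup>2 * (c0 k)\<^sup>2)" using m by (simp add: power_mult_distrib)
    ultimately show ?thesis using v by linarith
  qed
  finally have "mm \<gamma> k * (exp (- \<gamma> * t) * mode k t)\<^sup>2 \<le> mm \<gamma> k * (2 * (c0 k)\<^sup>2 + Nk k)"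
    using m by (simp add: power_mult_distrib algebra_simps)
  then have z: "(exp (- \<gamma> * t) * mode k t)\<^sup>2 \<le> 2 * (c0 k)\<^sup>2 + Nk k" using m by simp
  have "exp (2 * \<gamma> * t) * (exp (- \<gamma> * t))\<^sup>2 = 1" unfolding power2_eq_square exp_add[symmetric] by simp
  then have "(mode k t)\<^sup>2 = (exp (2 * \<gamma> * t) * (exp (- \<gamma> * t))\<^sup>2) * (mode k t)\<^sup>2" by simp
  also have "\<dots> = exp (2 * \<gamma> * t) * (exp (- \<gamma> * t) * mode k t)\<^sup>2" by (simp only: power_mult_distrib mult.assoc)
  also have "\<dots> \<le> exp (2 * \<gamma> * tmax) * (2 * (c0 k)\<^sup>2 + Nk k)" using z t \<gamma> by (intro mult_mono) auto
  finally show ?thesis by (simp add: Bk_def)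
qed

lemma mode_summable: assumes "t \<in> {0..tmax}" shows "summable (\<lambda>k. (mode k t)\<^sup>2)"
  by (rule summable_comparison_test'[OF Bk_summable, of 0]) (use mode_bound[OF assms] in simp)

lemma y_mode: "AE t in lebesgue. \<forall>k. t \<in> {0<..<tmax} \<longrightarrow> y k t = mode k t"
  unfolding AE_all_countable
proof
  fix k
  have "AE t in lborel. cv (decay k) (\<lambda>s. load k s + FF (scaled y) k s) t = cv (decay k) (load k) t + cv (decay k) (FF (scaled y) k) t"
    by (rule cvK_add_AE[OF _ _ Nrm_load Nrm_F]) measurable
  then have "AE t in lborel. t \<in> {0<..<tmax} \<longrightarrow> y k t = mode k t"
  proof eventually_elim
    fix t assume a: "cv (decay k) (\<lambda>s. load k s + FF (scaled y) k s) t = cv (decay k) (load k) t + cv (decay k) (FF (scaled y) k) t"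
    show "t \<in> {0<..<tmax} \<longrightarrow> y k t = mode k t"
    proof
      assume "t \<in> {0<..<tmax}"
      then have "scaled y k t = sqrt (mm \<gamma> k) * exp (- \<gamma> * t) * mode k t"
        using yfp[of k t] a unfolding mode_scaled rhs_def[abs_def] free_part_def TT_def by simp
      then show "y k t = mode k t" using mm(1)[OF \<gamma>, of k] by (simp add: scaled_def)
    qed
  qed
  then show "AE t in lebesgue. t \<in> {0<..<tmax} \<longrightarrow> y k t = mode k t" by (rule AE_completion)
qed

text \<open>The norm of the fixed point already contains the weight mm >= \<mu> lam, so finiteness
  of \<open>Nrm (scaled y)\<close> is the L2 bound with values in V.\<close>

lemma Lam_y: "(\<integral>\<^sup>+t. Lam y t \<partial>lborel) < \<infinity>"
proof -
  have "(\<integral>\<^sup>+t. Lam y t \<partial>lborel) \<le> (\<integral>\<^sup>+t. ennreal (exp (2 * \<gamma> * tmax) / \<mu>) * sq (\<lambda>k. scaled y k t) \<partial>lborel)"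
  proof (rule nn_integral_mono)
    fix t
    have "Lam y t \<le> (\<Sum>k. ennreal (exp (2 * \<gamma> * tmax) / \<mu>) * ennreal ((scaled y k t)\<^sup>2))"
      unfolding Lam_def
    proof (intro suminf_le allI)
      fix k
      have "lam k * (y k t)\<^sup>2 \<le> exp (2 * \<gamma> * tmax) / \<mu> * (scaled y k t)\<^sup>2"
      proof (cases "t \<in> {0<..<tmax}")
        case True
        have l: "lam k \<le> mm \<gamma> k / \<mu>" using mm(2)[OF \<gamma>, of k] \<mu> by (simp add: field_simps)
        have "exp (2 * \<gamma> * t) * (exp (- \<gamma> * t))\<^sup>2 = 1" unfolding power2_eq_square exp_add[symmetric] by simp
        then have "lam k * (y k t)\<^sup>2 = lam k * ((exp (2 * \<gamma> * t) * (exp (- \<gamma> * t))\<^sup>2) * (y k t)\<^sup>2)" by simp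
        also have "\<dots> = lam k * (exp (2 * \<gamma> * t) * ((exp (- \<gamma> * t))\<^sup>2 * (y k t)\<^sup>2))" by (simp only: mult.assoc)
        also have "\<dots> \<le> mm \<gamma> k / \<mu> * (exp (2 * \<gamma> * tmax) * ((exp (- \<gamma> * t))\<^sup>2 * (y k t)\<^sup>2))"
          using l True \<gamma> lam_pos[of k] mm(1)[OF \<gamma>, of k] \<mu> by (intro mult_mono) auto
        also have "\<dots> = exp (2 * \<gamma> * tmax) / \<mu> * (scaled y k t)\<^sup>2"
          using mm(1)[OF \<gamma>, of k] by (simp add: scaled_def power_mult_distrib)
        finally show ?thesis .
      next
        case False then show ?thesis by (simp add: y0 scaled_def)
      qed
      then show "ennreal (lam k * (y k t)\<^sup>2) \<le> ennreal (exp (2 * \<gamma> * tmax) / \<mu>) * ennreal ((scaled y k t)\<^sup>2)"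
        using \<mu> by (simp add: ennreal_leI flip: ennreal_mult')
    qed auto
    then show "Lam y t \<le> ennreal (exp (2 * \<gamma> * tmax) / \<mu>) * sq (\<lambda>k. scaled y k t)" by (simp add: sq_def)
  qed
  also have "\<dots> = ennreal (exp (2 * \<gamma> * tmax) / \<mu>) * Nrm (scaled y)" unfolding Nrm_def by (rule nn_integral_cmult) measurable
  also have "\<dots> < \<infinity>" using yN by (simp add: ennreal_mult_less_top)
  finally show ?thesis .
qed

lemma Lam_summable: assumes "Lam y t \<noteq> \<infinity>" shows "summable (\<lambda>k. lam k * (y k t)\<^sup>2)"
proof (rule summable_suminf_not_top)
  show "0 \<le> lam k * (y k t)\<^sup>2" for k using lam_pos[of k] by simp
qed (use assms in \<open>simp add: Lam_def\<close>)

text \<open>At every time the value must lie in \<open>H\<close>, but in V whenever the coefficients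
  permit. The two syntheses give different representatives, so the choice prefers the continuous
  one.\<close>

definition soln :: "real \<Rightarrow> triple" where
  "soln t = (SOME U. inH L U \<and> (\<forall>k. cf U k = mode k t) \<and> (summable (\<lambda>k. lam k * (mode k t)\<^sup>2) \<longrightarrow> inV L U))"

lemma soln: assumes t: "t \<in> {0..tmax}"
  shows "inH L (soln t)" "cf (soln t) k = mode k t" "summable (\<lambda>k. lam k * (mode k t)\<^sup>2) \<Longrightarrow> inV L (soln t)"
proof -
  have "\<exists>U. inH L U \<and> (\<forall>k. cf U k = mode k t) \<and> (summable (\<lambda>k. lam k * (mode k t)\<^sup>2) \<longrightarrow> inV L U)"
  proof (cases "summable (\<lambda>k. lam k * (mode k t)\<^sup>2)")
    case True
    from V_synthesis[OF this] show ?thesis using inV_inH by blast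
  next
    case False
    with H_synthesis[OF mode_summable[OF t]] show ?thesis by blast
  qed
  from someI_ex[OF this, folded soln_def]
  show "inH L (soln t)" "cf (soln t) k = mode k t" "summable (\<lambda>k. lam k * (mode k t)\<^sup>2) \<Longrightarrow> inV L (soln t)" by auto
qed

lemma soln_AE: "AE t in lebesgue. t \<in> {0<..<tmax} \<longrightarrow> inV L (soln t) \<and> (\<forall>k. cf (soln t) k = y k t) \<and> (\<forall>k. mode k t = y k t)"
proof -
  have "AE t in lborel. Lam y t \<noteq> \<infinity>" by (rule nn_integral_PInf_AE) (use Lam_y in auto)
  then have "AE t in lebesgue. Lam y t \<noteq> \<infinity>" by (rule AE_completion)
  with y_mode show ?thesis
  proof eventually_elim
    fix t assume a: "\<forall>k. t \<in> {0<..<tmax} \<longrightarrow> y k t = mode k t" "Lam y t \<noteq> \<infinity>"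
    show "t \<in> {0<..<tmax} \<longrightarrow> inV L (soln t) \<and> (\<forall>k. cf (soln t) k = y k t) \<and> (\<forall>k. mode k t = y k t)"
    proof
      assume t: "t \<in> {0<..<tmax}"
      then have t': "t \<in> {0..tmax}" and e: "\<And>k. mode k t = y k t" using a(1) by auto
      then show "inV L (soln t) \<and> (\<forall>k. cf (soln t) k = y k t) \<and> (\<forall>k. mode k t = y k t)"
        using soln[OF t'] Lam_summable[OF a(2)] by simp
    qed
  qed
qed

lemma soln_coefrep: "coefrep tmax soln y"
proof -
  have "AE t in lebesgue. t \<in> {0<..<tmax} \<longrightarrow> inV L (soln t) \<and> (\<forall>k. cf (soln t) k = y k t)" using soln_AE by eventually_elim blast
  then show ?thesis using ym y0 Lam_y by (simp add: coefrep_def Lam_def[abs_def])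
qed

lemma soln_meas: assumes "in_Vdual L f" shows "set_borel_measurable lebesgue {0<..<tmax} (\<lambda>t. f (soln t))"
proof (rule functional_measurable[OF ym y0 _ assms])
  show "AE t in lebesgue. t \<in> {0<..<tmax} \<longrightarrow> inV L (soln t) \<and> (\<forall>k. cf (soln t) k = y k t)" using soln_AE by eventually_elim blast
qed auto

lemma nD_Lam: assumes "inV L U" "\<And>k. cf U k = z k t" shows "ennreal (nD U) = Lam z t"
  using nD_ennreal[OF assms(1)] by (simp add: assms(2) Lam_def)

lemma square_integrable_majorant:
  fixes N :: "real \<Rightarrow> real" and \<Theta> :: "real \<Rightarrow> ennreal"
  assumes m: "set_borel_measurable lebesgue {0<..<tmax} (\<lambda>t. (N t)\<^sup>2)"
    and \<Theta>: "\<Theta> \<in> borel_measurable borel" "(\<integral>\<^sup>+t. \<Theta> t \<partial>lborel) < \<infinity>"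
    and b: "AE t in lebesgue. t \<in> {0<..<tmax} \<longrightarrow> ennreal ((N t)\<^sup>2) \<le> ennreal C * \<Theta> t"
  shows "set_integrable lebesgue {0<..<tmax} (\<lambda>t. (N t)\<^sup>2)"
  unfolding set_integrable_def
proof (rule integrableI_bounded)
  show "(\<lambda>t. indicator {0<..<tmax} t *\<^sub>R (N t)\<^sup>2) \<in> borel_measurable lebesgue" using m by (simp add: set_borel_measurable_def)
  have "(\<integral>\<^sup>+t. ennreal (norm (indicator {0<..<tmax} t *\<^sub>R (N t)\<^sup>2)) \<partial>lebesgue) \<le> (\<integral>\<^sup>+t. ennreal C * \<Theta> t \<partial>lebesgue)"
    by (rule nn_integral_mono_AE) (use b in \<open>eventually_elim, simp add: indicator_def\<close>)
  also have "\<dots> = (\<integral>\<^sup>+t. ennreal C * \<Theta> t \<partial>lborel)" using \<Theta>(1) by (intro nn_integral_completion) measurable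
  also have "\<dots> = ennreal C * (\<integral>\<^sup>+t. \<Theta> t \<partial>lborel)" using \<Theta>(1) by (intro nn_integral_cmult) simp
  also have "\<dots> < \<infinity>" using \<Theta>(2) by (simp add: ennreal_mult_less_top)
  finally show "(\<integral>\<^sup>+t. ennreal (norm (indicator {0<..<tmax} t *\<^sub>R (N t)\<^sup>2)) \<partial>lebesgue) < \<infinity>" .
qed

lemma soln_L2_V: "L2_V L tmax soln"
proof -
  have V: "AE t in lebesgue. t \<in> {0<..<tmax} \<longrightarrow> inV L (soln t)" using soln_AE by eventually_elim blast
  \<comment> \<open>The norm is not linear in its argument; its square, however, is the limit of
    sums of products of the coefficients with \<open>vip (soln t) (eb k)\<close>, each of which is a
    functional of the solution.\<close>
  define l where "l t = lim (\<lambda>n. \<Sum>k<n. (indicator {0<..<tmax} t *\<^sub>R cf (soln t) k) * (indicator {0<..<tmax} t *\<^sub>R vip (soln t) (eb k)))" for t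
  have [measurable]: "(\<lambda>t. indicator {0<..<tmax} t *\<^sub>R cf (soln t) k) \<in> borel_measurable lebesgue"
    "(\<lambda>t. indicator {0<..<tmax} t *\<^sub>R vip (soln t) (eb k)) \<in> borel_measurable lebesgue" for k
    using soln_meas[OF cf_Vdual[of k]] soln_meas[OF vip_Vdual[OF eb_V(1)[of k]]] by (auto simp: set_borel_measurable_def)
  have lm: "l \<in> borel_measurable lebesgue" unfolding l_def[abs_def] by measurable
  have "AE t in lebesgue. l t = indicator {0<..<tmax} t *\<^sub>R (V_norm L (soln t))\<^sup>2"
    using V
  proof eventually_elim
    fix t assume a: "t \<in> {0<..<tmax} \<longrightarrow> inV L (soln t)"
    show "l t = indicator {0<..<tmax} t *\<^sub>R (V_norm L (soln t))\<^sup>2"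
    proof (cases "t \<in> {0<..<tmax}")
      case True
      then have v: "inV L (soln t)" using a by simp
      have "(V_norm L (soln t))\<^sup>2 = vip (soln t) (soln t)" using v by (simp add: V_norm_eq vip_def)
      moreover have "(\<lambda>n. \<Sum>k<n. cf (soln t) k * vip (soln t) (eb k)) \<longlonglongrightarrow> vip (soln t) (soln t)"
        using Vdual_expand[OF vip_Vdual[OF v] v] unfolding vip_commute[of "eb _"] .
      ultimately show ?thesis using True limI by (simp add: l_def)
    next
      case False then show ?thesis by (simp add: l_def)
    qed
  qed
  from borel_measurable_AE[OF lm this]
  have m: "set_borel_measurable lebesgue {0<..<tmax} (\<lambda>t. (V_norm L (soln t))\<^sup>2)" by (simp add: set_borel_measurable_def)
  have "set_integrable lebesgue {0<..<tmax} (\<lambda>t. (V_norm L (soln t))\<^sup>2)"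
  proof (rule square_integrable_majorant[OF m _ Lam_y])
    show "AE t in lebesgue. t \<in> {0<..<tmax} \<longrightarrow> ennreal ((V_norm L (soln t))\<^sup>2) \<le> ennreal KV * Lam y t"
      using soln_AE
    proof eventually_elim
      fix t assume a: "t \<in> {0<..<tmax} \<longrightarrow> inV L (soln t) \<and> (\<forall>k. cf (soln t) k = y k t) \<and> (\<forall>k. mode k t = y k t)"
      show "t \<in> {0<..<tmax} \<longrightarrow> ennreal ((V_norm L (soln t))\<^sup>2) \<le> ennreal KV * Lam y t"
      proof
        assume "t \<in> {0<..<tmax}"
        then have v: "inV L (soln t)" "\<And>k. cf (soln t) k = y k t" using a by auto
        have "(V_norm L (soln t))\<^sup>2 \<le> KV * nD (soln t)" using Vl_bound[OF v(1)] by (simp add: V_norm_eq[OF v(1)])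
        then have "ennreal ((V_norm L (soln t))\<^sup>2) \<le> ennreal KV * ennreal (nD (soln t))" using KV by (simp add: ennreal_leI flip: ennreal_mult)
        then show "ennreal ((V_norm L (soln t))\<^sup>2) \<le> ennreal KV * Lam y t" by (simp only: nD_Lam[of "soln t" y t, OF v])
      qed
    qed
  qed measurable
  then show ?thesis using V soln_meas by (simp add: L2_V_def)
qed

text \<open>The squared distance is the series of squared differences of continuous modes. It
  converges uniformly by the Weierstrass test with majorant \<open>4 * Bk\<close>, so it is
  continuous and vanishes at s = t.\<close>

lemma soln_H_cont: "H_cont L tmax soln"
  unfolding H_cont_def
proof (intro conjI ballI)
  fix t assume t: "t \<in> {0..tmax}"
  show "inH L (soln t)" by (rule soln(1)[OF t])
  define g where "g s = (\<Sum>k. (mode k s - mode k t)\<^sup>2)" for s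
  have "uniform_limit {0..tmax} (\<lambda>n s. \<Sum>k<n. (mode k s - mode k t)\<^sup>2) (\<lambda>s. \<Sum>k. (mode k s - mode k t)\<^sup>2) sequentially"
  proof (rule Weierstrass_m_test)
    fix k s assume s: "s \<in> {0..tmax}"
    have "(mode k s - mode k t)\<^sup>2 \<le> 2 * (mode k s)\<^sup>2 + 2 * (mode k t)\<^sup>2" using young_square[of 1 "mode k s" "- mode k t"] by simp
    also have "\<dots> \<le> 4 * Bk k" using mode_bound[OF s, of k] mode_bound[OF t, of k] by simp
    finally show "norm ((mode k s - mode k t)\<^sup>2) \<le> 4 * Bk k" by simp
  qed (intro summable_mult Bk_summable)
  then have gc: "continuous_on {0..tmax} g" unfolding g_def[abs_def]
    by (rule uniform_limit_theorem[rotated]) (auto intro!: always_eventually continuous_intros mode_continuous)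
  have "((\<lambda>s. sqrt (wsum * g s)) \<longlongrightarrow> sqrt (wsum * g t)) (at t within {0..tmax})"
    using gc t by (intro tendsto_intros) (auto simp: continuous_on_def)
  then have lim: "((\<lambda>s. sqrt (wsum * g s)) \<longlongrightarrow> 0) (at t within {0..tmax})" by (simp add: g_def)
  show "((\<lambda>s. H_dist L (soln s) (soln t)) \<longlongrightarrow> 0) (at t within {0..tmax})"
  proof (rule Lim_null_comparison[OF _ lim])
    show "\<forall>\<^sub>F s in at t within {0..tmax}. norm (H_dist L (soln s) (soln t)) \<le> sqrt (wsum * g s)"
    proof (unfold eventually_at_filter, rule always_eventually, intro allI impI)
      fix s assume s: "s \<in> {0..tmax}"
      note h = soln(1)[OF s] soln(1)[OF t]
      have "(\<lambda>k. (mode k s - mode k t)\<^sup>2) sums nH (tdiff (soln s) (soln t))"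
        using cf_sums[OF tadd_H[OF h], of "- 1"] by (simp add: cf_tadd h soln(2)[OF s] soln(2)[OF t])
      then have "g s = nH (tdiff (soln s) (soln t))" by (simp add: g_def sums_iff)
      then have "(H_dist L (soln s) (soln t))\<^sup>2 \<le> wsum * g s" using nH_H_dist(2)[OF h] by simp
      then show "norm (H_dist L (soln s) (soln t)) \<le> sqrt (wsum * g s)" by (simp add: real_le_rsqrt H_dist_nonneg)
    qed
  qed
qed

lemma soln_initial: "ae_eq_H L (soln 0) T0"
proof (rule H_eqI[OF _ T0])
  have "(0::real) \<in> {0..tmax}" using tmax by simp
  from soln[OF this] show "inH L (soln 0)" "cf (soln 0) k = cf T0 k" for k by (auto simp: mode_0 c0_def)
qed

end

section \<open>The time derivative of the constructed solution\<close>

context heat_fixed_point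
begin

definition mem :: "real \<Rightarrow> triple" where
  "mem t = (SOME v. inV L v \<and> (\<forall>k. cf v k = cv rb (y k) t) \<and> (\<forall>\<Phi>. inV L \<Phi> \<longrightarrow> C_form L bf r soln \<Phi> t = - S v \<Phi>))"

definition mem_coef :: "nat \<Rightarrow> real \<Rightarrow> real" where "mem_coef k t = indicator {0<..<tmax} t * cv rb (y k) t"

lemma mem_coef_measurable[measurable]: "mem_coef k \<in> borel_measurable borel" unfolding mem_coef_def[abs_def] by measurable

text \<open>Collects everything known for almost every time, so that later arguments exclude a
  single null set.\<close>

definition good :: "real \<Rightarrow> bool" where
  "good t \<longleftrightarrow> inV L (soln t) \<and> (\<forall>k. cf (soln t) k = y k t) \<and> (\<forall>k. mode k t = y k t) \<and>
    inV L (mem t) \<and> (\<forall>k. cf (mem t) k = cv rb (y k) t) \<and> (\<forall>\<Phi>. inV L \<Phi> \<longrightarrow> C_form L bf r soln \<Phi> t = - S (mem t) \<Phi>) \<and>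
    in_Vdual L (F t) \<and> (\<forall>k. F t (eb k) = fk k t) \<and> Lam y t \<noteq> \<infinity> \<and> Lam mem_coef t \<noteq> \<infinity>"

text \<open>Young's inequality for each mode, summed with the weights lam: the memory element
  inherits the L2 bound with values in V from \<open>y\<close>.\<close>

lemma Lam_mem_coef: "(\<integral>\<^sup>+t. Lam mem_coef t \<partial>lborel) < \<infinity>"
proof -
  have l: "0 \<le> lam k" for k using lam_pos[of k] by simp
  have e: "(\<integral>\<^sup>+t. Lam z t \<partial>lborel) = (\<Sum>k. ennreal (lam k) * (\<integral>\<^sup>+t. ennreal ((z k t)\<^sup>2) \<partial>lborel))"
    if [measurable]: "\<And>k. z k \<in> borel_measurable borel" for z
    unfolding Lam_def by (simp add: nn_integral_suminf ennreal_mult' l nn_integral_cmult)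
  have "(\<integral>\<^sup>+t. Lam mem_coef t \<partial>lborel) \<le> (\<integral>\<^sup>+t. Lam (\<lambda>k. cv rb (y k)) t \<partial>lborel)"
    unfolding Lam_def using l
    by (intro nn_integral_mono suminf_le allI ennreal_leI mult_left_mono) (auto simp: mem_coef_def indicator_def)
  also have "\<dots> = (\<Sum>k. ennreal (lam k) * (\<integral>\<^sup>+t. ennreal ((cv rb (y k) t)\<^sup>2) \<partial>lborel))" by (rule e) measurable
  also have "\<dots> \<le> (\<Sum>k. ennreal (lam k) * (ennreal R * (ennreal R * (\<integral>\<^sup>+t. ennreal ((y k t)\<^sup>2) \<partial>lborel))))"
    by (intro suminf_le allI mult_left_mono cv_Young rbR) auto
  also have "\<dots> = (\<Sum>k. ennreal R * (ennreal R * (ennreal (lam k) * (\<integral>\<^sup>+t. ennreal ((y k t)\<^sup>2) \<partial>lborel))))"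
    by (simp only: mult.left_commute)
  also have "\<dots> = ennreal R * (ennreal R * (\<integral>\<^sup>+t. Lam y t \<partial>lborel))"
    by (simp only: ennreal_suminf_cmult e[OF ym])
  also have "\<dots> < \<infinity>" using Lam_y by (simp add: ennreal_mult_less_top)
  finally show ?thesis .
qed

lemma good_AE: "AE t in lebesgue. t \<in> {0<..<tmax} \<longrightarrow> good t"
proof -
  have "AE t in lborel. Lam y t \<noteq> \<infinity>" by (rule nn_integral_PInf_AE) (use Lam_y in auto)
  moreover have "AE t in lborel. Lam mem_coef t \<noteq> \<infinity>" by (rule nn_integral_PInf_AE) (use Lam_mem_coef in auto)
  ultimately have "AE t in lebesgue. Lam y t \<noteq> \<infinity>" "AE t in lebesgue. Lam mem_coef t \<noteq> \<infinity>" by (auto intro: AE_completion)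
  with soln_AE memory_form[OF soln_L2_V soln_coefrep] F_coeffs show ?thesis
  proof eventually_elim
    fix t
    assume a: "t \<in> {0<..<tmax} \<longrightarrow> inV L (soln t) \<and> (\<forall>k. cf (soln t) k = y k t) \<and> (\<forall>k. mode k t = y k t)"
      and b: "t \<in> {0<..<tmax} \<longrightarrow> (\<exists>v. inV L v \<and> (\<forall>k. cf v k = cv rb (y k) t) \<and> (\<forall>\<Phi>. inV L \<Phi> \<longrightarrow> C_form L bf r soln \<Phi> t = - S v \<Phi>))"
      and c: "t \<in> {0<..<tmax} \<longrightarrow> in_Vdual L (F t) \<and> (\<forall>k. F t (eb k) = fk k t)" and d: "Lam y t \<noteq> \<infinity>" "Lam mem_coef t \<noteq> \<infinity>"
    show "t \<in> {0<..<tmax} \<longrightarrow> good t"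
    proof
      assume t: "t \<in> {0<..<tmax}"
      note v = someI_ex[OF mp[OF b t], folded mem_def]
      show "good t" unfolding good_def using mp[OF a t] mp[OF c t] v d by - (elim conjE, intro conjI; assumption)
    qed
  qed
qed

lemma goodD: assumes "good t"
  shows "inV L (soln t)" "\<And>k. cf (soln t) k = y k t" "\<And>k. mode k t = y k t"
    "inV L (mem t)" "\<And>k. cf (mem t) k = cv rb (y k) t" "\<And>\<Phi>. inV L \<Phi> \<Longrightarrow> C_form L bf r soln \<Phi> t = - S (mem t) \<Phi>"
    "in_Vdual L (F t)" "\<And>k. F t (eb k) = fk k t" "Lam y t \<noteq> \<infinity>" "Lam mem_coef t \<noteq> \<infinity>"
  using assms unfolding good_def by blast+

text \<open>Defined by the equation, which therefore holds automatically; what remains is that it is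
  square integrable in V' and that it is the weak time derivative.\<close>

definition soln_dt :: "real \<Rightarrow> triple \<Rightarrow> real" where "soln_dt t \<Phi> = F t \<Phi> - A (soln t) \<Phi> - C_form L bf r soln \<Phi> t"

lemma soln_dt_eq: "good t \<Longrightarrow> inV L \<Phi> \<Longrightarrow> soln_dt t \<Phi> = F t \<Phi> - A (soln t) \<Phi> + S (mem t) \<Phi>"
  by (simp add: soln_dt_def goodD(6))

lemma soln_dt_bound: assumes g: "good t" and \<Phi>: "inV L \<Phi>"
  shows "\<bar>soln_dt t \<Phi>\<bar> \<le> (Vdual_norm L (F t) + KA * sqrt KD * sqrt (nD (soln t)) + KS' * sqrt KD * sqrt (nD (mem t))) * V_norm L \<Phi>"
proof -
  note G = goodD[OF g]
  have "\<bar>F t \<Phi>\<bar> \<le> Vdual_norm L (F t) * V_norm L \<Phi>" by (rule Vdual_norm_ge[OF G(7) \<Phi>])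
  moreover have "\<bar>A (soln t) \<Phi>\<bar> \<le> KA * sqrt (nD (soln t)) * (sqrt KD * V_norm L \<Phi>)"
    by (rule order_trans[OF A_bound[OF G(1) \<Phi>]]) (intro mult_left_mono sqrt_nD_le \<Phi> mult_nonneg_nonneg KA, simp)
  moreover have "\<bar>S (mem t) \<Phi>\<bar> \<le> KS' * sqrt (nD (mem t)) * (sqrt KD * V_norm L \<Phi>)"
    by (rule order_trans[OF S_bound'[OF G(4) \<Phi>]]) (intro mult_left_mono sqrt_nD_le \<Phi> mult_nonneg_nonneg KA, simp)
  ultimately have "\<bar>F t \<Phi> - A (soln t) \<Phi> + S (mem t) \<Phi>\<bar> \<le> Vdual_norm L (F t) * V_norm L \<Phi> + KA * sqrt (nD (soln t)) * (sqrt KD * V_norm L \<Phi>)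
      + KS' * sqrt (nD (mem t)) * (sqrt KD * V_norm L \<Phi>)" by linarith
  then show ?thesis unfolding soln_dt_eq[OF g \<Phi>] by (simp add: algebra_simps)
qed

lemma soln_dt_Vdual: assumes g: "good t" shows "in_Vdual L (soln_dt t)"
  unfolding in_Vdual_def
proof (intro conjI allI impI exI)
  note G = goodD[OF g]
  fix \<Phi> \<Psi> and c :: real assume a: "inV L \<Phi> \<and> inV L \<Psi>"
  then have i: "inV L \<Phi>" "inV L \<Psi>" "inV L (tadd \<Phi> (tscale c \<Psi>))" by (auto intro: tadd_V(1))
  show "soln_dt t (tadd \<Phi> (tscale c \<Psi>)) = soln_dt t \<Phi> + c * soln_dt t \<Psi>"
    unfolding soln_dt_eq[OF g i(1)] soln_dt_eq[OF g i(2)] soln_dt_eq[OF g i(3)] Vdual_lin[OF G(7) i(1,2)]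
      Vdual_lin[OF A_Vdual(1)[OF G(1)] i(1,2)] Vdual_lin[OF S_Vdual(1)[OF G(4)] i(1,2)] by (simp add: algebra_simps)
next
  fix \<Phi> assume "inV L \<Phi>"
  then show "\<bar>soln_dt t \<Phi>\<bar> \<le> (Vdual_norm L (F t) + KA * sqrt KD * sqrt (nD (soln t)) + KS' * sqrt KD * sqrt (nD (mem t))) * V_norm L \<Phi>"
    by (rule soln_dt_bound[OF g])
qed

lemma soln_dt_measurable: assumes \<Phi>: "inV L \<Phi>" shows "set_borel_measurable lebesgue {0<..<tmax} (\<lambda>t. soln_dt t \<Phi>)"
proof -
  let ?i = "indicator {0<..<tmax} :: real \<Rightarrow> real"
  have 1: "(\<lambda>t. ?i t *\<^sub>R F t \<Phi>) \<in> borel_measurable lebesgue"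
    using F \<Phi> unfolding L2_Vdual_def set_borel_measurable_def by blast
  have 2: "(\<lambda>t. ?i t *\<^sub>R A (soln t) \<Phi>) \<in> borel_measurable lebesgue"
    using soln_meas[OF A_Vdual(2)[OF \<Phi>]] by (simp add: set_borel_measurable_def)
  have "AE t in lebesgue. t \<in> {0<..<tmax} \<longrightarrow> inV L (mem t) \<and> (\<forall>k. cf (mem t) k = mem_coef k t)"
    using good_AE by eventually_elim (auto simp: goodD mem_coef_def)
  from functional_measurable[OF _ _ this S_Vdual(2)[OF \<Phi>]]
  have 3: "(\<lambda>t. ?i t *\<^sub>R S (mem t) \<Phi>) \<in> borel_measurable lebesgue" by (simp add: set_borel_measurable_def mem_coef_def)
  have m: "(\<lambda>t. ?i t *\<^sub>R F t \<Phi> - ?i t *\<^sub>R A (soln t) \<Phi> + ?i t *\<^sub>R S (mem t) \<Phi>) \<in> borel_measurable lebesgue"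
    by (intro borel_measurable_add borel_measurable_diff 1 2 3)
  have "AE t in lebesgue. ?i t *\<^sub>R F t \<Phi> - ?i t *\<^sub>R A (soln t) \<Phi> + ?i t *\<^sub>R S (mem t) \<Phi> = ?i t *\<^sub>R soln_dt t \<Phi>"
    using good_AE by eventually_elim (use \<Phi> in \<open>auto simp: soln_dt_eq indicator_def\<close>)
  from borel_measurable_AE[OF m this] show ?thesis by (simp add: set_borel_measurable_def)
qed

lemma Lam_integrable: assumes [measurable]: "\<And>k. z k \<in> borel_measurable borel" and f: "(\<integral>\<^sup>+t. Lam z t \<partial>lborel) < \<infinity>"
  shows "set_integrable lebesgue {0<..<tmax} (\<lambda>t. enn2real (Lam z t))"
proof -
  have "integrable lborel (\<lambda>t. enn2real (Lam z t))"
  proof (rule integrableI_bounded)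
    have "(\<integral>\<^sup>+t. ennreal (norm (enn2real (Lam z t))) \<partial>lborel) \<le> (\<integral>\<^sup>+t. Lam z t \<partial>lborel)"
    proof (rule nn_integral_mono)
      show "ennreal (norm (enn2real (Lam z t))) \<le> Lam z t" for t by (cases "Lam z t") auto
    qed
    then show "(\<integral>\<^sup>+t. ennreal (norm (enn2real (Lam z t))) \<partial>lborel) < \<infinity>" using f by (rule le_less_trans)
  qed measurable
  then have "integrable lebesgue (\<lambda>t. enn2real (Lam z t))" by (subst integrable_completion) auto
  then show ?thesis unfolding set_integrable_def by (intro integrable_mult_indicator) auto
qed

lemma soln_dt_L2: "L2_Vdual L tmax soln_dt"
proof -
  have V: "AE t in lebesgue. t \<in> {0<..<tmax} \<longrightarrow> in_Vdual L (soln_dt t)"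
    using good_AE by eventually_elim (auto intro: soln_dt_Vdual)
  have m: "set_borel_measurable lebesgue {0<..<tmax} (\<lambda>t. Vdual_norm L (soln_dt t))"
    by (rule Vdual_norm_measurable[OF V soln_dt_measurable[OF eb_V(1)]])
  have "(\<lambda>t. (indicator {0<..<tmax} t *\<^sub>R Vdual_norm L (soln_dt t))\<^sup>2) \<in> borel_measurable lebesgue"
    using m unfolding set_borel_measurable_def by (rule borel_measurable_power)
  moreover have "(\<lambda>t. (indicator {0<..<tmax} t *\<^sub>R Vdual_norm L (soln_dt t))\<^sup>2) = (\<lambda>t. indicator {0<..<tmax} t *\<^sub>R (Vdual_norm L (soln_dt t))\<^sup>2)"
    by (auto simp: indicator_def)
  ultimately have m2: "set_borel_measurable lebesgue {0<..<tmax} (\<lambda>t. (Vdual_norm L (soln_dt t))\<^sup>2)"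
    by (simp add: set_borel_measurable_def)
  define ka where "ka = (KA * sqrt KD)\<^sup>2"
  define ks where "ks = (KS' * sqrt KD)\<^sup>2"
  \<comment> \<open>The factor 3 is from (p + q + s)^2 <= 3 (p^2 + q^2 + s^2) for the contributions
    of the load, of \<open>A\<close> and of the memory term.\<close>
  let ?b = "\<lambda>t. 3 * ((Vdual_norm L (F t))\<^sup>2 + (ka * enn2real (Lam y t) + ks * enn2real (Lam mem_coef t)))"
  have bi: "set_integrable lebesgue {0<..<tmax} ?b"
    using F Lam_integrable[OF ym Lam_y] Lam_integrable[OF mem_coef_measurable Lam_mem_coef]
    by (intro set_integrable_mult_right set_integral_add) (simp_all add: L2_Vdual_def)
  have "set_integrable lebesgue {0<..<tmax} (\<lambda>t. (Vdual_norm L (soln_dt t))\<^sup>2)"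
  proof (rule set_integrable_bound[OF bi m2])
    show "AE t in lebesgue. t \<in> {0<..<tmax} \<longrightarrow> norm ((Vdual_norm L (soln_dt t))\<^sup>2) \<le> norm (?b t)"
      using good_AE
    proof eventually_elim
      fix t assume a: "t \<in> {0<..<tmax} \<longrightarrow> good t"
      show "t \<in> {0<..<tmax} \<longrightarrow> norm ((Vdual_norm L (soln_dt t))\<^sup>2) \<le> norm (?b t)"
      proof
        assume t: "t \<in> {0<..<tmax}"
        then have g: "good t" using a by simp
        note G = goodD[OF g]
        have n1: "nD (soln t) = enn2real (Lam y t)" unfolding nD_Lam[of "soln t" y t, OF G(1,2), symmetric] by simp
        have mem_coef: "cf (mem t) k = mem_coef k t" for k using t by (simp add: G(5) mem_coef_def)
        have n2: "nD (mem t) = enn2real (Lam mem_coef t)" unfolding nD_Lam[of "mem t" mem_coef t, OF G(4) mem_coef, symmetric] by simp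
        define p q s where "p = Vdual_norm L (F t)" and "q = KA * sqrt KD * sqrt (nD (soln t))" and "s = KS' * sqrt KD * sqrt (nD (mem t))"
        have nn: "0 \<le> p" "0 \<le> q" "0 \<le> s"
          using Vdual_norm_nonneg[OF G(7)] KA KD by (auto simp: p_def q_def s_def)
        have "Vdual_norm L (soln_dt t) \<le> p + q + s"
        proof (rule Vdual_norm_le)
          show "\<bar>soln_dt t \<Phi>\<bar> \<le> (p + q + s) * V_norm L \<Phi>" if "inV L \<Phi>" for \<Phi>
            using soln_dt_bound[OF g that] by (simp add: p_def q_def s_def)
        qed (use nn in simp)
        then have "(Vdual_norm L (soln_dt t))\<^sup>2 \<le> (p + q + s)\<^sup>2" by (intro power_mono Vdual_norm_nonneg soln_dt_Vdual g)
        also have "\<dots> \<le> 3 * (p\<^sup>2 + (q\<^sup>2 + s\<^sup>2))"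
        proof -
          have "3 * (p\<^sup>2 + (q\<^sup>2 + s\<^sup>2)) - (p + q + s)\<^sup>2 = (p - q)\<^sup>2 + (q - s)\<^sup>2 + (p - s)\<^sup>2"
            by (simp add: power2_eq_square algebra_simps)
          then show ?thesis using zero_le_power2[of "p - q"] zero_le_power2[of "q - s"] zero_le_power2[of "p - s"] by linarith
        qed
        also have "\<dots> = ?b t"
          by (simp add: p_def q_def s_def power_mult_distrib ka_def ks_def n1 n2)
        finally show "norm ((Vdual_norm L (soln_dt t))\<^sup>2) \<le> norm (?b t)" by simp
      qed
    qed
  qed
  then show ?thesis using V m soln_dt_measurable by (simp add: L2_Vdual_def)
qed

lemma soln_dt_modes: "AE s in lebesgue. s \<in> {0<..<tmax} \<longrightarrow> src y k s - \<mu> * lam k * mode k s = soln_dt s (eb k)"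
  using good_AE
proof eventually_elim
  fix s assume a: "s \<in> {0<..<tmax} \<longrightarrow> good s"
  show "s \<in> {0<..<tmax} \<longrightarrow> src y k s - \<mu> * lam k * mode k s = soln_dt s (eb k)"
  proof
    assume "s \<in> {0<..<tmax}"
    then have g: "good s" using a by simp
    note G = goodD[OF g]
    show "src y k s - \<mu> * lam k * mode k s = soln_dt s (eb k)"
      unfolding src_eq[of "soln s" y s "mem s", OF G(1,2,4,5)] soln_dt_eq[OF g eb_V(1)] G(3) G(8) by simp
  qed
qed

text \<open>Variation of constants presents the mode as a primitive of \<open>src\<close> minus
  \<mu> lam times the mode, and at almost every time this is the functional tested with
  \<open>eb k\<close>.\<close>

lemma modes_weak_deriv: "weak_deriv 0 tmax (mode k) (\<lambda>t. soln_dt t (eb k))"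
proof (rule weak_deriv_primitive[OF tmax])
  have i: "set_integrable lebesgue {0<..<tmax} (\<lambda>s. src y k s - \<mu> * lam k * mode k s)"
    by (intro set_integral_diff src_integrable continuous_set_integrable continuous_intros mode_continuous)
  show "set_integrable lebesgue {0<..<tmax} (\<lambda>t. soln_dt t (eb k))" by (rule set_integrable_AE_eq(1)[OF i soln_dt_modes])
  fix t assume t: "t \<in> {0<..<tmax}"
  then have t': "t \<in> {0..tmax}" by auto
  have "mode k t = c0 k + (LINT s:{0<..<t}|lebesgue. src y k s - \<mu> * lam k * mode k s)"
    by (rule variation_of_constants[OF src_integrable t']) (simp add: mode_def)
  also have "(LINT s:{0<..<t}|lebesgue. src y k s - \<mu> * lam k * mode k s) = (LINT s:{0<..<t}|lebesgue. soln_dt s (eb k))"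
  proof (rule set_integrable_AE_eq(2)[symmetric])
    show "set_integrable lebesgue {0<..<t} (\<lambda>s. src y k s - \<mu> * lam k * mode k s)"
      by (rule set_integrable_subinterval[OF i]) (use t in simp)
    show "AE s in lebesgue. s \<in> {0<..<t} \<longrightarrow> src y k s - \<mu> * lam k * mode k s = soln_dt s (eb k)"
      using soln_dt_modes[of k] by eventually_elim (use t in auto)
  qed
  finally show "mode k t = c0 k + (LINT s:{0<..<t}|lebesgue. soln_dt s (eb k))" .
qed

text \<open>Both sides of the weak equation are bounded functionals of the test element, so it suffices to test with the eigenbasis.\<close>
lemma soln_dt_time_deriv: "time_deriv L ao ai ae tmax soln soln_dt"
  unfolding time_deriv_def
proof (intro allI impI)
  fix \<Phi> and \<psi> :: "real \<Rightarrow> real" assume a: "inV L \<Phi> \<and> test_fun 0 tmax \<psi>"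
  then have \<Phi>: "inV L \<Phi>" and \<psi>: "test_fun 0 tmax \<psi>" by auto
  have sm: "C_inf \<psi>" by (rule test_fun_C_inf[OF \<psi>])
  let ?f = "\<lambda>\<Phi>. LINT t:{0<..<tmax}|lebesgue. H_inner L ao ai ae (soln t) \<Phi> * deriv \<psi> t"
  let ?g = "\<lambda>\<Phi>. LINT t:{0<..<tmax}|lebesgue. soln_dt t \<Phi> * \<psi> t"
  have f: "in_Vdual L ?f"
  proof (rule integral_Vdual[OF _ _ set_integrable_const_interval C_inf_deriv_cont[OF sm]])
    show "AE t in lebesgue. t \<in> {0<..<tmax} \<longrightarrow> in_Vdual L (H_inner L ao ai ae (soln t)) \<and>
      (\<forall>\<Phi>. inV L \<Phi> \<longrightarrow> \<bar>H_inner L ao ai ae (soln t) \<Phi>\<bar> \<le> sqrt (suminf Bk) * (K1 * sqrt KD) * V_norm L \<Phi>)"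
    proof (rule AE_I2, intro impI conjI allI)
      fix t assume "t \<in> {0<..<tmax}"
      then have t: "t \<in> {0..tmax}" by auto
      show "in_Vdual L (H_inner L ao ai ae (soln t))" by (rule H_inner_Vdual(1)[OF soln(1)[OF t]])
      fix \<Phi> assume \<Phi>: "inV L \<Phi>"
      have "(\<lambda>k. (mode k t)\<^sup>2) sums nH (soln t)" using cf_sums[OF soln(1)[OF t]] by (simp add: soln(2)[OF t])
      then have "nH (soln t) \<le> suminf Bk"
        using suminf_le[OF mode_bound[OF t] mode_summable[OF t] Bk_summable] by (simp add: sums_iff)
      then have "sqrt (nH (soln t)) * (K1 * sqrt KD) * V_norm L \<Phi> \<le> sqrt (suminf Bk) * (K1 * sqrt KD) * V_norm L \<Phi>"
        using sqrt_nH(2) KD V_norm_nonneg[OF \<Phi>] by (intro mult_right_mono) auto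
      then show "\<bar>H_inner L ao ai ae (soln t) \<Phi>\<bar> \<le> sqrt (suminf Bk) * (K1 * sqrt KD) * V_norm L \<Phi>"
        using H_inner_Vdual(2)[OF soln(1)[OF t] \<Phi>] by linarith
    qed
    \<comment> \<open>Symmetry of the product turns the solution into the argument of a fixed
      functional, to which measurability applies.\<close>
    show "set_borel_measurable lebesgue {0<..<tmax} (\<lambda>t. H_inner L ao ai ae (soln t) \<Phi>)" if "inV L \<Phi>" for \<Phi>
      unfolding H_inner_commute[of _ \<Phi>] by (rule soln_meas[OF H_inner_Vdual(1)[OF inV_inH[OF that]]])
  qed
  have g: "in_Vdual L ?g"
  proof (rule integral_Vdual[OF _ soln_dt_measurable _ C_inf_continuous[OF sm]])
    show "AE t in lebesgue. t \<in> {0<..<tmax} \<longrightarrow> in_Vdual L (soln_dt t) \<and> (\<forall>\<Phi>. inV L \<Phi> \<longrightarrow> \<bar>soln_dt t \<Phi>\<bar> \<le> Vdual_norm L (soln_dt t) * V_norm L \<Phi>)"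
      using good_AE by eventually_elim (blast intro: soln_dt_Vdual Vdual_norm_ge)
    show "set_integrable lebesgue {0<..<tmax} (\<lambda>t. Vdual_norm L (soln_dt t))"
      by (rule L2_on_integrable) (use soln_dt_L2 in \<open>simp add: L2_Vdual_def L2_on_def\<close>)
  qed
  have e: "?f (eb k) = - ?g (eb k)" for k
  proof -
    have "?f (eb k) = (LINT t:{0<..<tmax}|lebesgue. mode k t * deriv \<psi> t)"
    proof (rule set_lebesgue_integral_cong)
      show "\<forall>t. t \<in> {0<..<tmax} \<longrightarrow> H_inner L ao ai ae (soln t) (eb k) * deriv \<psi> t = mode k t * deriv \<psi> t"
        using soln(2)[of _ k] by (auto simp: cf_def)
    qed simp
    also have "\<dots> = - ?g (eb k)" using modes_weak_deriv[of k] \<psi> unfolding weak_deriv_def by blast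
    finally show ?thesis .
  qed
  have "(\<lambda>n. \<Sum>k<n. cf \<Phi> k * ?f (eb k)) \<longlonglongrightarrow> ?f \<Phi>" by (rule Vdual_expand[OF f \<Phi>])
  moreover have "(\<lambda>n. - (\<Sum>k<n. cf \<Phi> k * ?g (eb k))) \<longlonglongrightarrow> - ?g \<Phi>" by (intro tendsto_minus Vdual_expand[OF g \<Phi>])
  moreover have "(\<lambda>n. \<Sum>k<n. cf \<Phi> k * ?f (eb k)) = (\<lambda>n. - (\<Sum>k<n. cf \<Phi> k * ?g (eb k)))"
    by (simp add: e sum_negf)
  ultimately show "?f \<Phi> = - ?g \<Phi>" by (simp add: LIMSEQ_unique)
qed

theorem existence: "sol soln"
  unfolding is_solution_def in_W_def
proof (intro conjI exI)
  show "AE t in lebesgue. t \<in> {0<..<tmax} \<longrightarrow> (\<forall>\<Phi>. inV L \<Phi> \<longrightarrow> soln_dt t \<Phi> + A (soln t) \<Phi> + C_form L bf r soln \<Phi> t = F t \<Phi>)"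
    by (simp add: soln_dt_def)
qed (rule soln_H_cont soln_L2_V soln_dt_L2 soln_dt_time_deriv soln_initial)+

end

theorem theorem1:
  fixes L tmax Do Di De ao ai ae bo be bf vo vi ve kf rhof cf rf :: real
    and r :: "real \<Rightarrow> real"
    and T0 :: triple
    and F :: "real \<Rightarrow> triple \<Rightarrow> real"
  assumes "L > 0" and "tmax > 0"
    and "Do > 0" and "Di > 0" and "De > 0"
    and "ao > 0" and "ai > 0" and "ae > 0"
    and "bo > 0" and "be > 0" and "bf > 0"
    and "kf > 0" and "rhof > 0" and "cf > 0" and "rf > 0"
    and "heat_resolvent_kernel kf rhof cf rf bf r"
    and "inH L T0"
    and "L2_Vdual L tmax F"
  shows "(\<exists>T. is_solution L tmax Do Di De ao ai ae vo vi ve bo be bf r T0 F T) \<and>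
         (\<forall>T1 T2. is_solution L tmax Do Di De ao ai ae vo vi ve bo be bf r T0 F T1 \<and>
                  is_solution L tmax Do Di De ao ai ae vo vi ve bo be bf r T0 F T2 \<longrightarrow>
                  (\<forall>t\<in>{0..tmax}. ae_eq_H L (T1 t) (T2 t)))"
proof -
  interpret W: heat_wells L ao ai ae Do Di De vo vi ve bo be bf
    by standard (use assms in auto)
  have "set_integrable lebesgue {0..tmax} r"
    using assms(2,16) unfolding heat_resolvent_kernel_def by (elim exE conjE) simp
  then have "set_integrable lebesgue {0<..<tmax} r" by (rule set_integrable_subset) auto
  then have ri: "integrable lebesgue (\<lambda>s. indicator {0<..<tmax} s *\<^sub>R r s)" by (simp add: set_integrable_def)
  obtain g where gm[measurable]: "g \<in> borel_measurable borel" and g: "AE s in lebesgue. indicator {0<..<tmax} s *\<^sub>R r s = g s"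
    using AE_borel_version[OF borel_measurable_integrable[OF ri]] by blast
  define rb where "rb s = indicator {0<..<tmax} s * g s" for s
  have rbm[measurable]: "rb \<in> borel_measurable borel" unfolding rb_def[abs_def] by measurable
  have rbr: "AE s in lebesgue. s \<in> {0<..<tmax} \<longrightarrow> r s = rb s"
    using g by eventually_elim (auto simp: rb_def)
  have "(\<integral>\<^sup>+s. ennreal \<bar>rb s\<bar> \<partial>lborel) = (\<integral>\<^sup>+s. ennreal \<bar>rb s\<bar> \<partial>lebesgue)"
    by (rule nn_integral_completion[symmetric]) measurable
  also have "\<dots> = (\<integral>\<^sup>+s. ennreal (norm (indicator {0<..<tmax} s *\<^sub>R r s)) \<partial>lebesgue)"
    by (rule nn_integral_cong_AE) (use rbr in \<open>eventually_elim, auto simp: rb_def indicator_def\<close>)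
  also have "\<dots> < \<infinity>" using ri unfolding integrable_iff_bounded by (rule conjunct2)
  finally have fin: "(\<integral>\<^sup>+s. ennreal \<bar>rb s\<bar> \<partial>lborel) < \<infinity>" .
  \<comment> \<open>The summand 1 makes the bound strictly positive even when the kernel vanishes
    almost everywhere.\<close>
  define R where "R = enn2real (\<integral>\<^sup>+s. ennreal \<bar>rb s\<bar> \<partial>lborel) + 1"
  have R: "R > 0" by (simp add: R_def add_nonneg_pos)
  have rbR: "(\<integral>\<^sup>+s. ennreal \<bar>rb s\<bar> \<partial>lborel) \<le> ennreal R"
  proof -
    have "(\<integral>\<^sup>+s. ennreal \<bar>rb s\<bar> \<partial>lborel) = ennreal (enn2real (\<integral>\<^sup>+s. ennreal \<bar>rb s\<bar> \<partial>lborel))" using fin by simp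
    also have "\<dots> \<le> ennreal R" by (intro ennreal_leI) (simp add: R_def)
    finally show ?thesis .
  qed
  \<comment> \<open>There is no circularity: \<open>R\<close> bounds the undamped kernel and damping
    only lowers it, so \<gamma> may be chosen after \<open>R\<close>.\<close>
  obtain \<gamma> where \<gamma>: "\<gamma> > 0" "W.\<rho>q \<gamma> + W.\<rho>b \<gamma> * R < 1" using W.exists_weight by blast
  have fm: "(\<lambda>t. indicator {0<..<tmax} t *\<^sub>R F t (W.eb k)) \<in> borel_measurable lebesgue" for k
    using assms(18) W.eb_V(1)[of k] unfolding L2_Vdual_def set_borel_measurable_def by blast
  have "\<exists>h\<in>borel_measurable borel. AE t in lebesgue. indicator {0<..<tmax} t *\<^sub>R F t (W.eb k) = h t" for k
    using AE_borel_version[OF fm[of k]] by blast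
  then obtain h where hm[measurable]: "\<And>k. h k \<in> borel_measurable borel"
    and h: "\<And>k. AE t in lebesgue. indicator {0<..<tmax} t *\<^sub>R F t (W.eb k) = h k t" by metis
  define fk where "fk k t = indicator {0<..<tmax} t * h k t" for k t
  interpret P: heat_problem L ao ai ae Do Di De vo vi ve bo be bf tmax r rb R \<gamma> T0 F fk
  proof
    show "fk k \<in> borel_measurable borel" for k unfolding fk_def[abs_def] by measurable
    show "AE t in lebesgue. t \<in> {0<..<tmax} \<longrightarrow> F t (W.eb k) = fk k t" for k
      using h[of k] by eventually_elim (auto simp: fk_def)
  qed (use assms rbr rbR R \<gamma> in \<open>auto simp: rb_def fk_def\<close>)
  obtain y where y: "\<And>k. y k \<in> borel_measurable borel" "\<And>k t. t \<notin> {0<..<tmax} \<Longrightarrow> y k t = 0" "Nrm (P.scaled y) < \<infinity>"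
      "\<And>k t. P.scaled y k t = P.free_part k t + P.TT (P.scaled y) k t"
    using P.exists_fixed_point by blast
  interpret Q: heat_fixed_point L ao ai ae Do Di De vo vi ve bo be bf tmax r rb R \<gamma> T0 F fk y
    by standard (use y in auto)
  show ?thesis using Q.existence P.uniqueness by blast
qed

end
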